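(* Let $l>0$, $\Omega=(0,\pi)\times(-l,l)$, $\sigma\in(0,1)$, $0<\alpha<1<\beta$, and let $\psi_-,\psi_+\in C^0(\overline\Omega)$ with $\psi_-\le0\le\psi_+$, $\psi_-\not\equiv0$, $\psi_+\not\equiv0$. Let $D\subset\Omega$ be any open set and $p\in(1,+\infty]$. Then: (a) for the energy $\mathbb{E}_1$, the supremum of $\mathcal{A}^\infty_{f,D}$ over $f\in\mathcal{F}:=\{f\in(C^0(\overline\Omega))': \|f\|_{(C^0(\overline\Omega))'}\le1\}$ is attained; (b) for each of the energies $\mathbb{E}_1$ and $\mathbb{E}_2$, the supremum of $\mathcal{A}^\infty_{f,D}$ over $f\in\mathcal{F}:=\{f\in L^p(\Omega):\|f\|_{L^p(\Omega)}\le1\}$ is attained. Moreover, in each of these cases, if $-\psi_-\equiv\psi_+$ and $f$ is a maximizer, then $-f$ is also a maximizer.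
   Context: $H^2_*(\Omega):=\{v\in H^2(\Omega): v=0\text{ on }\{0,\pi\}\times(-l,l)\}$, identified with continuous functions on $\overline\Omega$. For an open $E\subset\Omega$ set $(u,v)_E:=\int_E\big(\Delta u\,\Delta v+(1-\sigma)(2u_{xy}v_{xy}-u_{xx}v_{yy}-u_{yy}v_{xx})\big)\,dx\,dy$, and $(u,v)_{H^2_*(\Omega)}:=(u,v)_\Omega$ (a scalar product on $H^2_*(\Omega)$ with norm equivalent to the $H^2$ norm). $(C^0(\overline\Omega))'$ is the dual of $C^0(\overline\Omega)$ (finite Radon measures) with the dual norm and pairing $\langle f,u\rangle$; for $f\in L^1$, $\langle f,u\rangle=\int_\Omega fu$. Let $K:=\{v\in H^2_*(\Omega):\psi_-\le v\le\psi_+\text{ in }\overline\Omega\}$ and $D^c=\Omega\setminus D$. For energy $\mathbb{E}_1(u)=\int_\Omega(\beta\chi_D+\alpha\chi_{D^c})\big(\tfrac12(\Delta u)^2+(1-\sigma)(u_{xy}^2-u_{xx}u_{yy})\big)-\langle f,u\rangle$, $u_{f,D}$ denotes its unique minimizer over $K$, i.e. the unique $u\in K$ with $\alpha(u,\varphi-u)_{H^2_*(\Omega)}+(\beta-\alpha)(u,\varphi-u)_D\ge\langle f,\varphi-u\rangle$ for all $\varphi\in K$. For energy $\mathbb{E}_2(u)=\int_\Omega\big(\tfrac12(\Delta u)^2+(1-\sigma)(u_{xy}^2-u_{xx}u_{yy})-(\beta\chi_D+\alpha\chi_{D^c})fu\big)$ (for $f\in L^p$), $u_{f,D}$ denotes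 the unique $u\in K$ with $(u,\varphi-u)_{H^2_*(\Omega)}\ge\int_\Omega(\beta\chi_D+\alpha\chi_{D^c})f(\varphi-u)$ for all $\varphi\in K$. In each case $\mathcal{A}^\infty_{f,D}:=\max_{(x,y)\in\overline\Omega}|u_{f,D}(x,y)|$. *)

theory Defs
  imports "HOL-Analysis.Analysis"
begin

type_synonym R2 = "real \<times> real"

definition Omega :: "real \<Rightarrow> R2 set" where
  "Omega l = {0<..<pi} \<times> {-l<..<l}"

definition pdiff :: "bool \<Rightarrow> (R2 \<Rightarrow> real) \<Rightarrow> R2 \<Rightarrow> real" where
  "pdiff b \<phi> z = (if b then deriv (\<lambda>t. \<phi> (t, snd z)) (fst z)
                    else deriv (\<lambda>t. \<phi> (fst z, t)) (snd z))"

fun iter_pdiff :: "bool list \<Rightarrow> (R2 \<Rightarrow> real) \<Rightarrow> R2 \<Rightarrow> real" where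
  "iter_pdiff [] \<phi> = \<phi>"
| "iter_pdiff (b # bs) \<phi> = pdiff b (iter_pdiff bs \<phi>)"

definition test_fun :: "R2 set \<Rightarrow> (R2 \<Rightarrow> real) \<Rightarrow> bool" where
  "test_fun U \<phi> \<longleftrightarrow>
     (\<forall>bs. continuous_on UNIV (iter_pdiff bs \<phi>) \<and>
        (\<forall>z. (\<lambda>t. iter_pdiff bs \<phi> (t, snd z)) differentiable (at (fst z)) \<and>
             (\<lambda>t. iter_pdiff bs \<phi> (fst z, t)) differentiable (at (snd z)))) \<and>
     (\<exists>K. compact K \<and> K \<subseteq> U \<and> (\<forall>z. z \<notin> K \<longrightarrow> \<phi> z = 0))"

definition L2_on :: "R2 set \<Rightarrow> (R2 \<Rightarrow> real) \<Rightarrow> bool" where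
  "L2_on U g \<longleftrightarrow> set_borel_measurable lebesgue U g \<and>
                   set_integrable lebesgue U (\<lambda>z. (g z)\<^sup>2)"

definition is_weak_deriv :: "R2 set \<Rightarrow> bool list \<Rightarrow> (R2 \<Rightarrow> real) \<Rightarrow> (R2 \<Rightarrow> real) \<Rightarrow> bool" where
  "is_weak_deriv U bs u g \<longleftrightarrow>
     (\<forall>\<phi>. test_fun U \<phi> \<longrightarrow>
        set_integrable lebesgue U (\<lambda>z. u z * iter_pdiff bs \<phi> z) \<and>
        set_integrable lebesgue U (\<lambda>z. g z * \<phi> z) \<and>
        (LINT z:U|lebesgue. u z * iter_pdiff bs \<phi> z)
          = (-1) ^ length bs * (LINT z:U|lebesgue. g z * \<phi> z))"

text \<open>A chosen L2 weak derivative (any two choices agree a.e.).\<close>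
definition wd :: "R2 set \<Rightarrow> bool list \<Rightarrow> (R2 \<Rightarrow> real) \<Rightarrow> R2 \<Rightarrow> real" where
  "wd U bs u = (SOME g. L2_on U g \<and> is_weak_deriv U bs u g)"

text \<open>H^2_*(Omega), identified with continuous functions on the closure of Omega
  (normalized to vanish outside the closure), in H^2(Omega), vanishing on the
  vertical sides {0,pi} x (-l,l).\<close>
definition H2star :: "real \<Rightarrow> (R2 \<Rightarrow> real) \<Rightarrow> bool" where
  "H2star l u \<longleftrightarrow>
     continuous_on (closure (Omega l)) u \<and>
     (\<forall>z. z \<notin> closure (Omega l) \<longrightarrow> u z = 0) \<and>
     L2_on (Omega l) u \<and>
     (\<forall>bs. length bs \<le> 2 \<longrightarrow> (\<exists>g. L2_on (Omega l) g \<and> is_weak_deriv (Omega l) bs u g)) \<and>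
     (\<forall>y\<in>{-l<..<l}. u (0, y) = 0 \<and> u (pi, y) = 0)"

definition bform :: "real \<Rightarrow> real \<Rightarrow> R2 set \<Rightarrow> (R2 \<Rightarrow> real) \<Rightarrow> (R2 \<Rightarrow> real) \<Rightarrow> real" where
  "bform l \<sigma> E u v =
     (let uxx = wd (Omega l) [True, True] u; uyy = wd (Omega l) [False, False] u;
          uxy = wd (Omega l) [True, False] u;
          vxx = wd (Omega l) [True, True] v; vyy = wd (Omega l) [False, False] v;
          vxy = wd (Omega l) [True, False] v
      in LINT z:E|lebesgue. (uxx z + uyy z) * (vxx z + vyy z)
           + (1 - \<sigma>) * (2 * uxy z * vxy z - uxx z * vyy z - uyy z * vxx z))"

definition Kset :: "real \<Rightarrow> (R2 \<Rightarrow> real) \<Rightarrow> (R2 \<Rightarrow> real) \<Rightarrow> (R2 \<Rightarrow> real) set" where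
  "Kset l \<psi>m \<psi>p = {v. H2star l v \<and> (\<forall>z\<in>closure (Omega l). \<psi>m z \<le> v z \<and> v z \<le> \<psi>p z)}"

text \<open>u_{f,D} for energy E_1, with the pairing v |-> <f,v> given as a functional P.\<close>
definition u1 :: "real \<Rightarrow> real \<Rightarrow> (R2 \<Rightarrow> real) \<Rightarrow> (R2 \<Rightarrow> real) \<Rightarrow> real \<Rightarrow> real \<Rightarrow> R2 set
                   \<Rightarrow> ((R2 \<Rightarrow> real) \<Rightarrow> real) \<Rightarrow> R2 \<Rightarrow> real" where
  "u1 l \<sigma> \<psi>m \<psi>p \<alpha> \<beta> D P = (THE u. u \<in> Kset l \<psi>m \<psi>p \<and>
     (\<forall>\<phi>\<in>Kset l \<psi>m \<psi>p.
        \<alpha> * bform l \<sigma> (Omega l) u (\<lambda>z. \<phi> z - u z) + (\<beta> - \<alpha>) * bform l \<sigma> D u (\<lambda>z. \<phi> z - u z)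
          \<ge> P (\<lambda>z. \<phi> z - u z)))"

definition u2 :: "real \<Rightarrow> real \<Rightarrow> (R2 \<Rightarrow> real) \<Rightarrow> (R2 \<Rightarrow> real) \<Rightarrow> real \<Rightarrow> real \<Rightarrow> R2 set
                   \<Rightarrow> (R2 \<Rightarrow> real) \<Rightarrow> R2 \<Rightarrow> real" where
  "u2 l \<sigma> \<psi>m \<psi>p \<alpha> \<beta> D f = (THE u. u \<in> Kset l \<psi>m \<psi>p \<and>
     (\<forall>\<phi>\<in>Kset l \<psi>m \<psi>p.
        bform l \<sigma> (Omega l) u (\<lambda>z. \<phi> z - u z)
          \<ge> (LINT z:Omega l|lebesgue. (if z \<in> D then \<beta> else \<alpha>) * f z * (\<phi> z - u z))))"

definition Ainf :: "real \<Rightarrow> (R2 \<Rightarrow> real) \<Rightarrow> real" where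
  "Ainf l u = (SUP z\<in>closure (Omega l). \<bar>u z\<bar>)"

text \<open>Unit ball of (C^0(closure Omega))': bounded linear functionals on
  C^0(closure Omega) of dual norm at most 1 (represented as functionals depending
  only on the restriction to the closure).\<close>
definition dual_ball :: "real \<Rightarrow> ((R2 \<Rightarrow> real) \<Rightarrow> real) set" where
  "dual_ball l = {f.
     (\<forall>u v. (\<forall>z\<in>closure (Omega l). u z = v z) \<longrightarrow> f u = f v) \<and>
     (\<forall>u v a b. continuous_on (closure (Omega l)) u \<longrightarrow> continuous_on (closure (Omega l)) v \<longrightarrow>
         f (\<lambda>z. a * u z + b * v z) = a * f u + b * f v) \<and>
     (\<forall>u. continuous_on (closure (Omega l)) u \<longrightarrow>
         \<bar>f u\<bar> \<le> (SUP z\<in>closure (Omega l). \<bar>u z\<bar>))}"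

definition Lp_ball :: "real \<Rightarrow> ereal \<Rightarrow> (R2 \<Rightarrow> real) set" where
  "Lp_ball l p = {f. set_borel_measurable lebesgue (Omega l) f \<and>
     (if p = \<infinity> then (AE z in lebesgue. z \<in> Omega l \<longrightarrow> \<bar>f z\<bar> \<le> 1)
      else set_integrable lebesgue (Omega l) (\<lambda>z. \<bar>f z\<bar> powr real_of_ereal p) \<and>
           (LINT z:Omega l|lebesgue. \<bar>f z\<bar> powr real_of_ereal p) \<le> 1)}"

definition is_maximizer :: "'f set \<Rightarrow> ('f \<Rightarrow> real) \<Rightarrow> 'f \<Rightarrow> bool" where
  "is_maximizer F A f \<longleftrightarrow> f \<in> F \<and> (\<forall>g\<in>F. A g \<le> A f)"

end

theory Submission
  imports Defs "HOL-Complex_Analysis.Great_Picard"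
begin

text \<open>
  The argument is a direct-method one. The second-order seminorm controls everything: testing the weak
  derivatives of a function \<open>u\<close> that vanishes at \<open>x = 0\<close> and \<open>x = \<pi>\<close> with products of one-dimensional
  mollified steps and ramps turns them into identities on rectangles (for instance, the mixed second
  difference of \<open>u\<close> over a rectangle is the integral of \<open>u\<^sub>x\<^sub>y\<close>). These give
  Hoelder-1/2 bounds for \<open>u\<close> and \<open>L\<^sup>2\<close> bounds for its gradient in terms of the Hessian,
  hence compactness in \<open>C\<^sup>0\<close> and completeness of the energy norm.

  Along a maximizing sequence \<open>f\<^sub>n\<close> the solutions \<open>u\<^sub>n\<close> are bounded in energy, so a subsequence converges
  uniformly. Adding two of the variational inequalities gives
  \<open>a(u\<^sub>n - u\<^sub>m, u\<^sub>n - u\<^sub>m) \<le> \<langle>f\<^sub>n - f\<^sub>m, u\<^sub>n - u\<^sub>m\<rangle> \<le> 2 M \<parallel>u\<^sub>n - u\<^sub>m\<parallel>\<^sub>\<infinity>\<close>,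
  so uniform convergence already forces strong convergence in energy, and the inequality passes to the
  limit together with a weak-* cluster point of \<open>f\<^sub>n\<close>. If the obstacles are symmetric, the solution for
  \<open>-f\<close> is minus the solution for \<open>f\<close>.
\<close>

section \<open>Smooth test functions\<close>

text \<open>The boundary condition holds on the two vertical sides only, while every test function
  vanishes near the whole boundary. Boundary values are therefore reached through the continuity of
  \<open>u\<close> up to the closure: identities are proved on interior rectangles, and then one
  side is pushed to \<open>x = 0\<close> or, for \<open>u_xx\<close>, a cut-off width
  \<open>e\<close> is sent to 0. This also makes the two directions unequal. In \<open>x\<close> the
  vanishing values recover \<open>u_x\<close> from \<open>u_xx\<close> and \<open>u_y\<close> from
  \<open>u_xy\<close>; in \<open>y\<close> nothing is prescribed, so increments of \<open>u\<close>
  in \<open>x\<close> are bounded by their mean over a middle strip plus their oscillation.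

  Since \<open>wd\<close>, \<open>u1\<close> and \<open>u2\<close> are choice and description
  operators, uniqueness must be available before anything can be computed: weak derivatives agree
  almost everywhere because they have the same integrals over rectangles, and solutions agree
  because the form is coercive.

  Loads enter only through a bound against the sup norm. Measures, densities and weighted densities
  thus become instances of one abstract obstacle problem, and their cluster point may be taken along
  a filter.\<close>

definition smooth :: "(real \<Rightarrow> real) \<Rightarrow> bool" where
  "smooth f \<longleftrightarrow> (\<forall>n x. (deriv ^^ n) f differentiable at x)"

text \<open>Smoothness is shown by exhibiting a family that is stable under differentiation, so no
  formula for an n-th derivative is ever needed.\<close>

lemma smooth_coinduct:
  assumes "f \<in> S" and S: "\<And>g. g \<in> S \<Longrightarrow> \<exists>h\<in>S. \<forall>x. (g has_real_derivative h x) (at x)"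
  shows "smooth f"
proof -
  have d: "deriv g \<in> S \<and> (\<forall>x. g differentiable at x)" if "g \<in> S" for g
  proof -
    obtain h where h: "h \<in> S" "\<forall>x. (g has_real_derivative h x) (at x)" using S[OF \<open>g \<in> S\<close>] by blast
    have "deriv g = h" using h(2) by (auto intro!: ext DERIV_imp_deriv)
    with h show ?thesis using real_differentiable_def by blast
  qed
  have "(deriv ^^ n) f \<in> S" for n by (induction n) (use assms(1) d in auto)
  then show ?thesis unfolding smooth_def using d by blast
qed

lemma smooth_DERIV: "smooth f \<Longrightarrow> (f has_real_derivative deriv f x) (at x)"
  unfolding smooth_def by (metis DERIV_deriv_iff_real_differentiable funpow_0)

lemma smooth_deriv: "smooth f \<Longrightarrow> smooth (deriv f)"
  unfolding smooth_def by (metis comp_apply funpow_Suc_right)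

lemma smooth_deriv_iter: "smooth f \<Longrightarrow> smooth ((deriv ^^ n) f)"
  by (induction n) (auto intro: smooth_deriv)

lemma smooth_continuous: "smooth f \<Longrightarrow> continuous_on A f"
  by (meson DERIV_isCont continuous_at_imp_continuous_on smooth_DERIV)

lemma smooth_borel: "smooth f \<Longrightarrow> f \<in> borel_measurable borel"
  by (intro borel_measurable_continuous_onI smooth_continuous)

lemma smooth_antideriv:
  assumes "\<And>x. (F has_real_derivative f x) (at x)" "smooth f" shows "smooth F"
proof (rule smooth_coinduct[of F "insert F (Collect smooth)"])
  fix g assume "g \<in> insert F (Collect smooth)"
  then show "\<exists>h\<in>insert F (Collect smooth). \<forall>x. (g has_real_derivative h x) (at x)"
    using assms smooth_DERIV smooth_deriv by blast
qed auto

lemma smooth_affine: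
  assumes "smooth f" shows "smooth (\<lambda>x. c * f (a * x + b))"
proof (rule smooth_coinduct[of _ "{\<lambda>x. c * f (a * x + b) |c f. smooth f}"])
  show "(\<lambda>x. c * f (a * x + b)) \<in> {\<lambda>x. c * f (a * x + b) |c f. smooth f}" using assms by blast
  fix g assume "g \<in> {\<lambda>x. c * f (a * x + b) |c f. smooth f}"
  then obtain c f where g: "g = (\<lambda>x. c * f (a * x + b))" and f: "smooth f" by blast
  have "(g has_real_derivative (c * a) * deriv f (a * x + b)) (at x)" for x
    unfolding g by (rule derivative_eq_intros DERIV_chain2[OF smooth_DERIV[OF f]] refl | simp)+
  then show "\<exists>h\<in>{\<lambda>x. c * f (a * x + b) |c f. smooth f}. \<forall>x. (g has_real_derivative h x) (at x)"
    using smooth_deriv[OF f] by (intro bexI[of _ "\<lambda>x. (c * a) * deriv f (a * x + b)"]) blast+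
qed

text \<open>The derivative of a product is a sum of products. The sums and products have to be
  generated together to obtain a family to which \<open>smooth_coinduct\<close> applies.\<close>

inductive_set smooth_alg :: "(real \<Rightarrow> real) set" where
  base: "smooth f \<Longrightarrow> f \<in> smooth_alg"
| add: "f \<in> smooth_alg \<Longrightarrow> g \<in> smooth_alg \<Longrightarrow> (\<lambda>x. f x + g x) \<in> smooth_alg"
| mult: "f \<in> smooth_alg \<Longrightarrow> g \<in> smooth_alg \<Longrightarrow> (\<lambda>x. f x * g x) \<in> smooth_alg"

lemma smooth_alg_smooth: "f \<in> smooth_alg \<Longrightarrow> smooth f"
proof (rule smooth_coinduct, assumption)
  fix g assume "g \<in> smooth_alg"
  then show "\<exists>h\<in>smooth_alg. \<forall>x. (g has_real_derivative h x) (at x)"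
  proof induction
    case (base f) then show ?case using smooth_DERIV smooth_deriv smooth_alg.base by blast
  next
    case (add f g)
    then obtain f' g' where h: "f' \<in> smooth_alg" "g' \<in> smooth_alg"
      "\<And>x. (f has_real_derivative f' x) (at x)" "\<And>x. (g has_real_derivative g' x) (at x)" by blast
    show ?case by (rule bexI[of _ "\<lambda>x. f' x + g' x"]) (auto intro: DERIV_add h smooth_alg.add)
  next
    case (mult f g)
    then obtain f' g' where h: "f' \<in> smooth_alg" "g' \<in> smooth_alg"
      "\<And>x. (f has_real_derivative f' x) (at x)" "\<And>x. (g has_real_derivative g' x) (at x)" by blast
    have "(\<lambda>x. f' x * g x + g' x * f x) \<in> smooth_alg"
      by (rule smooth_alg.add[OF smooth_alg.mult[OF h(1) mult.hyps(2)] smooth_alg.mult[OF h(2) mult.hyps(1)]])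
    then show ?case by (rule bexI[rotated]) (blast intro: DERIV_mult h)
  qed
qed

lemma smooth_add: "smooth f \<Longrightarrow> smooth g \<Longrightarrow> smooth (\<lambda>x. f x + g x)"
  by (rule smooth_alg_smooth[OF smooth_alg.add[OF smooth_alg.base smooth_alg.base]])

lemma smooth_mult: "smooth f \<Longrightarrow> smooth g \<Longrightarrow> smooth (\<lambda>x. f x * g x)"
  by (rule smooth_alg_smooth[OF smooth_alg.mult[OF smooth_alg.base smooth_alg.base]])

lemma smooth_cmult: "smooth f \<Longrightarrow> smooth (\<lambda>x. c * f x)"
  using smooth_affine[of f c 1 0] by simp

lemma smooth_shift: "smooth f \<Longrightarrow> smooth (\<lambda>x. f (a * (x - b)))"
  using smooth_affine[of f 1 a "- a * b"] by (simp add: algebra_simps)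

lemma smooth_diff: "smooth f \<Longrightarrow> smooth g \<Longrightarrow> smooth (\<lambda>x. f x - g x)"
  using smooth_add[OF _ smooth_cmult[of g "-1"]] by simp

text \<open>All derivatives of \<open>exp (-1/x)\<close> on the positive half-line have this form.\<close>

definition flat :: "real poly \<Rightarrow> real \<Rightarrow> real" where
  "flat p x = (if x > 0 then poly p (1 / x) * exp (- (1 / x)) else 0)"

lemma poly_exp_tendsto_0: "((\<lambda>t::real. poly p t * exp (- t)) \<longlongrightarrow> 0) at_top"
proof (induction p)
  case (pCons a p)
  have *: "((\<lambda>t::real. poly q t * exp (- t)) \<longlongrightarrow> 0) at_top" if "\<And>k. ((\<lambda>t::real. coeff q k * (t ^ k / exp t)) \<longlongrightarrow> 0) at_top" for q
  proof -
    have "poly q t * exp (- t) = (\<Sum>k\<le>degree q. coeff q k * (t ^ k / exp t))" for t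
      by (simp add: poly_altdef sum_distrib_right exp_minus divide_inverse mult.assoc)
    then show ?thesis using tendsto_sum[of "{..degree q}", OF that] by simp
  qed
  show ?case by (rule *) (intro tendsto_mult_right_zero tendsto_power_div_exp_0)
qed simp

text \<open>With \<open>t = 1 / x\<close> the chain rule contributes the factor \<open>t^2\<close>,
  which is the polynomial \<open>[:0, 0, 1:]\<close>. At the origin the right difference quotient is
  \<open>t * p(t) * exp (-t)\<close> with \<open>t\<close> tending to infinity, so it tends to 0 and
  matches the zero branch on the left.\<close>

lemma flat_DERIV: "(flat p has_real_derivative flat ([:0, 0, 1:] * (p - pderiv p)) x) (at x)"
proof (cases x "0 :: real" rule: linorder_cases)
  case less
  have "((\<lambda>_. 0) has_real_derivative 0) (at x)" by simp
  moreover have "\<forall>\<^sub>F y in nhds x. flat p y = 0"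
    using eventually_nhds_in_open[of "{..<0}" x] less by (auto elim!: eventually_mono simp: flat_def)
  ultimately show ?thesis using less by (subst DERIV_cong_ev) (auto simp: flat_def)
next
  case greater
  have "((\<lambda>x. poly p (1 / x) * exp (- (1 / x))) has_real_derivative flat ([:0, 0, 1:] * (p - pderiv p)) x) (at x)"
    using greater by (auto intro!: derivative_eq_intros DERIV_chain2[OF poly_DERIV] simp: flat_def field_simps power2_eq_square)
  moreover have "\<forall>\<^sub>F y in nhds x. flat p y = poly p (1 / y) * exp (- (1 / y))"
    using eventually_nhds_in_open[of "{0<..}" x] greater by (auto elim!: eventually_mono simp: flat_def)
  ultimately show ?thesis by (subst DERIV_cong_ev) auto
next
  case equal
  have "((\<lambda>h. (flat p (0 + h) - flat p 0) / h) \<longlongrightarrow> 0) (at_left 0)"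
    by (rule tendsto_eventually) (auto simp: flat_def eventually_at_filter)
  moreover have "((\<lambda>h. (flat p (0 + h) - flat p 0) / h) \<longlongrightarrow> 0) (at_right 0)"
  proof -
    have "((\<lambda>h. poly ([:0, 1:] * p) (inverse h) * exp (- inverse h)) \<longlongrightarrow> 0) (at_right 0)"
      using filterlim_compose[OF poly_exp_tendsto_0 filterlim_inverse_at_top_right] .
    then show ?thesis
      by (rule Lim_transform_eventually) (auto simp: flat_def eventually_at_filter field_simps)
  qed
  ultimately have "((\<lambda>h. (flat p (0 + h) - flat p 0) / h) \<longlongrightarrow> 0) (at 0)"
    by (simp add: filterlim_at_split)
  then show ?thesis using equal by (simp add: DERIV_def flat_def)
qed

lemma smooth_flat: "smooth (flat p)"
  by (rule smooth_coinduct[of _ "range flat"]) (use flat_DERIV in auto)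

definition bump0 :: "real \<Rightarrow> real" where
  "bump0 x = flat 1 x * flat 1 (1 - x)"

lemma smooth_bump0: "smooth bump0"
  unfolding bump0_def using smooth_mult[OF smooth_flat smooth_affine[OF smooth_flat, of 1 _ "-1" 1]]
  by (simp add: add.commute)

lemma bump0_pos: "0 < x \<Longrightarrow> x < 1 \<Longrightarrow> bump0 x > 0"
  by (simp add: bump0_def flat_def)

lemma bump0_nonneg: "bump0 x \<ge> 0"
  by (simp add: bump0_def flat_def)

lemma bump0_zero: "x \<le> 0 \<or> 1 \<le> x \<Longrightarrow> bump0 x = 0"
  by (auto simp: bump0_def flat_def)

lemma primitive:
  fixes f :: "real \<Rightarrow> real"
  assumes "continuous_on UNIV f" "\<And>x. x \<le> 0 \<Longrightarrow> f x = 0"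
  obtains F where "\<And>x. (F has_real_derivative f x) (at x)" "\<And>x. x \<le> 0 \<Longrightarrow> F x = 0"
proof
  \<comment> \<open>The lower limit lies strictly left of 0, so each \<open>x\<close> that is not
    negative is interior to \<open>{-1..x+1}\<close> and has a two-sided derivative there. Near a
    negative \<open>x\<close> the function vanishes identically.\<close>
  let ?F = "\<lambda>x. integral {-1..x} f"
  have z: "?F x = 0" if "x \<le> 0" for x
    using integral_cong[of "{-1..x}" f "\<lambda>_. 0"] assms(2) that by auto
  show "\<And>x. x \<le> 0 \<Longrightarrow> ?F x = 0" by (rule z)
  show "(?F has_real_derivative f x) (at x)" for x
  proof (cases "x < 0")
    case True
    have "\<forall>\<^sub>F y in nhds x. ?F y = 0"
      using eventually_nhds_in_open[of "{..<0}" x] True by (auto elim!: eventually_mono intro!: z)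
    then show ?thesis using True assms(2)[of x] by (subst DERIV_cong_ev[of x x ?F "\<lambda>_. 0" "f x" 0]) auto
  next
    case False
    have "(?F has_real_derivative f x) (at x within {-1..x+1})"
      by (rule integral_has_real_derivative) (use False assms(1) continuous_on_subset in auto)
    then show ?thesis using False by (subst (asm) at_within_interior) auto
  qed
qed

text \<open>\<open>S\<close> is the primitive of the bump, normalised to rise from 0 to 1 across the
  unit interval, and \<open>Q\<close> is a smooth stand-in for the positive part. A fixed bound on
  their distance is enough: rescaling by a factor \<open>N\<close> shrinks it to
  \<open>1 / N\<close>.\<close>

lemma smoothing_kernels:
  obtains \<rho> S Q :: "real \<Rightarrow> real"
  where "smooth \<rho>" "smooth S" "smooth Q"
    "\<And>x. (S has_real_derivative \<rho> x) (at x)" "\<And>x. (Q has_real_derivative S x) (at x)"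
    "\<And>x. \<rho> x \<ge> 0" "\<And>x. x \<le> 0 \<or> 1 \<le> x \<Longrightarrow> \<rho> x = 0"
    "\<And>x. x \<le> 0 \<Longrightarrow> S x = 0" "\<And>x. 1 \<le> x \<Longrightarrow> S x = 1" "\<And>x. 0 \<le> S x \<and> S x \<le> 1"
    "\<And>x. x \<le> 0 \<Longrightarrow> Q x = 0" "\<And>x. 1 \<le> x \<Longrightarrow> Q x = x - 1 + Q 1" "\<And>x. \<bar>Q x - max x 0\<bar> \<le> 1"
proof -
  obtain B where B: "\<And>x. (B has_real_derivative bump0 x) (at x)" "\<And>x. x \<le> 0 \<Longrightarrow> B x = 0"
    using primitive[of bump0] smooth_continuous[OF smooth_bump0] bump0_zero by blast
  have Bmono: "B x \<le> B y" if "x \<le> y" for x y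
    using that by (rule DERIV_nonneg_imp_nondecreasing) (use B bump0_nonneg in blast)
  have "B 0 < B 1"
  proof (rule DERIV_pos_imp_increasing_open[of 0 1 B])
    show "continuous_on {0..1} B" by (rule continuous_at_imp_continuous_on) (use DERIV_isCont[OF B(1)] in blast)
    show "\<exists>y. (B has_real_derivative y) (at x) \<and> 0 < y" if "0 < x" "x < 1" for x
      using B(1) bump0_pos[OF that] by blast
  qed simp
  then have c: "B 1 > 0" using B(2) by simp
  have Bconst: "B x = B 1" if "1 \<le> x" for x
  proof (cases "x = 1")
    case False
    then have "1 < x" using that by simp
    moreover have "continuous_on {1..x} B"
      by (meson DERIV_isCont continuous_at_imp_continuous_on B(1))
    moreover have "(B has_real_derivative 0) (at y)" if "1 < y" for y
      using B(1)[of y] bump0_zero[of y] that by simp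
    ultimately show ?thesis by (intro DERIV_isconst_end) auto
  qed simp
  define S where "S x = B x / B 1" for x
  define \<rho> where "\<rho> x = bump0 x / B 1" for x
  have S': "(S has_real_derivative \<rho> x) (at x)" for x
    unfolding S_def \<rho>_def by (rule DERIV_cdivide[OF B(1)])
  have s\<rho>: "smooth \<rho>" unfolding \<rho>_def using smooth_cmult[OF smooth_bump0, of "1 / B 1"] by simp
  have sS: "smooth S" by (rule smooth_antideriv[OF S' s\<rho>])
  have S0: "S x = 0" if "x \<le> 0" for x
    using B(2)[OF that] by (simp add: S_def)
  have S1: "S x = 1" if "1 \<le> x" for x
    using Bconst[OF that] c by (simp add: S_def)
  have Sb: "0 \<le> S x \<and> S x \<le> 1" for x
    using Bmono[of "min x 0" x] Bmono[of x "max x 1"] B(2)[of "min x 0"] Bconst[of "max x 1"] c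
    by (auto simp: S_def divide_simps)
  obtain Q where Q: "\<And>x. (Q has_real_derivative S x) (at x)" "\<And>x. x \<le> 0 \<Longrightarrow> Q x = 0"
    using primitive[of S] smooth_continuous[OF sS] S0 by blast
  have Q1: "Q x = x - 1 + Q 1" if "1 \<le> x" for x
  proof (cases "x = 1")
    case False
    then have "1 < x" using that by simp
    moreover have "continuous_on {1..x} (\<lambda>x. Q x - x)"
      by (intro continuous_intros) (meson DERIV_isCont continuous_at_imp_continuous_on Q(1))
    moreover have "((\<lambda>x. Q x - x) has_real_derivative 0) (at y)" if "1 < y" for y
      using Q(1)[of y] S1[of y] that by (auto intro!: derivative_eq_intros)
    ultimately have "Q x - x = Q 1 - 1" by (intro DERIV_isconst_end) auto
    then show ?thesis by simp
  qed simp
  \<comment> \<open>Both \<open>Q x\<close> and \<open>x - Q x\<close> are nondecreasing, as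
    \<open>S\<close> takes values between 0 and 1. This confines \<open>Q\<close> to
    \<open>[0, 1]\<close> on the unit interval; beyond it the gap to \<open>x\<close> stays at
    \<open>1 - Q 1\<close>.\<close>
  have Qm: "Q x \<le> Q y" if "x \<le> y" for x y
    using that by (rule DERIV_nonneg_imp_nondecreasing) (use Q Sb in blast)
  have Qm': "x - Q x \<le> y - Q y" if "x \<le> y" for x y
    using that by (rule DERIV_nonneg_imp_nondecreasing)
      (use Sb in \<open>auto intro!: exI derivative_eq_intros Q(1)\<close>)
  have "\<bar>Q x - max x 0\<bar> \<le> 1" for x
  proof -
    consider "x \<le> 0" | "0 \<le> x" "x \<le> 1" | "1 \<le> x" by linarith
    then show ?thesis
      using Q(2)[of x] Q(2)[of 0] Qm[of 0 x] Qm[of 0 1] Qm'[of 0 x] Qm'[of 0 1] Q1[of x] by cases auto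
  qed
  note Qb = this
  have "\<rho> x \<ge> 0" for x using c bump0_nonneg[of x] by (simp add: \<rho>_def)
  moreover have "\<rho> x = 0" if "x \<le> 0 \<or> 1 \<le> x" for x using bump0_zero[OF that] by (simp add: \<rho>_def)
  ultimately show thesis
    by (rule that[OF s\<rho> sS smooth_antideriv[OF Q(1) sS] S' Q(1) _ _ S0 S1 Sb Q(2) Q1 Qb])
qed

lemma closure_Omega: "l > 0 \<Longrightarrow> closure (Omega l) = {0..pi} \<times> {-l..l}"
  by (simp add: Omega_def closure_Times)

lemma open_Omega: "open (Omega l)"
  by (simp add: Omega_def open_Times)

section \<open>Tensor products as test functions\<close>

abbreviation ptens :: "(real \<Rightarrow> real) \<Rightarrow> (real \<Rightarrow> real) \<Rightarrow> R2 \<Rightarrow> real" where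
  "ptens a b \<equiv> \<lambda>z. a (fst z) * b (snd z)"

lemma pdiff_ptens:
  assumes "smooth a" "smooth b"
  shows "pdiff c (ptens a b) = (if c then ptens (deriv a) b else ptens a (deriv b))"
proof (intro ext)
  fix z
  have "deriv (\<lambda>t. a t * b y) x = deriv a x * b y" "deriv (\<lambda>t. a x * b t) y = a x * deriv b y" for x y
    using smooth_DERIV assms by (auto intro!: DERIV_imp_deriv derivative_eq_intros simp: mult.commute)
  then show "pdiff c (ptens a b) z = (if c then ptens (deriv a) b else ptens a (deriv b)) z"
    by (simp add: pdiff_def)
qed

text \<open>The two kinds of partial derivative act on separate factors, so the order of the entries
  of \<open>bs\<close> disappears and their numbers remain. This is what later identifies the two
  mixed derivatives.\<close>

lemma iter_pdiff_ptens:
  assumes "smooth a" "smooth b"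
  shows "iter_pdiff bs (ptens a b) = ptens ((deriv ^^ count_list bs True) a) ((deriv ^^ count_list bs False) b)"
  by (induction bs) (use assms in \<open>auto simp: pdiff_ptens smooth_deriv_iter\<close>)

lemma test_fun_ptens:
  assumes ab: "smooth a" "smooth b" and "0 < p" "q < pi" "-l < r" "s < l"
    and a0: "\<And>x. x \<notin> {p..q} \<Longrightarrow> a x = 0" and b0: "\<And>y. y \<notin> {r..s} \<Longrightarrow> b y = 0"
  shows "test_fun (Omega l) (ptens a b)"
  unfolding test_fun_def iter_pdiff_ptens[OF ab]
proof (intro conjI allI)
  fix bs :: "bool list" and z :: R2
  let ?a = "(deriv ^^ count_list bs True) a" and ?b = "(deriv ^^ count_list bs False) b"
  have s: "smooth ?a" "smooth ?b" using ab smooth_deriv_iter by auto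
  show "continuous_on UNIV (ptens ?a ?b)"
    by (intro continuous_intros continuous_on_compose2[OF smooth_continuous[OF s(1)]]
        continuous_on_compose2[OF smooth_continuous[OF s(2)]]) auto
  show "(\<lambda>t. ?a (fst (t, snd z)) * ?b (snd (t, snd z))) differentiable at (fst z)"
       "(\<lambda>t. ?a (fst (fst z, t)) * ?b (snd (fst z, t))) differentiable at (snd z)"
    using DERIV_mult[OF smooth_DERIV[OF s(1)] DERIV_const] DERIV_mult[OF DERIV_const smooth_DERIV[OF s(2)]]
    unfolding real_differentiable_def fst_conv snd_conv by blast+
next
  show "\<exists>K. compact K \<and> K \<subseteq> Omega l \<and> (\<forall>z. z \<notin> K \<longrightarrow> a (fst z) * b (snd z) = 0)"
    by (rule exI[of _ "{p..q} \<times> {r..s}"]) (use assms in \<open>auto simp: Omega_def compact_Times\<close>)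
qed

section \<open>Weak compactness over a finite measure space\<close>

text \<open>For uncountably many coordinates no subsequence need converge; a finer filter than
  \<^term>\<open>sequentially\<close> takes its place.\<close>

lemma tychonoff_seq:
  fixes x :: "nat \<Rightarrow> 'i \<Rightarrow> real"
  assumes "\<And>i. \<exists>B. \<forall>n. \<bar>x n i\<bar> \<le> B"
  obtains G where "G \<le> sequentially" "G \<noteq> bot" "\<And>i. \<exists>L. ((\<lambda>n. x n i) \<longlongrightarrow> L) G"
proof -
  obtain B where B: "\<And>i n. \<bar>x n i\<bar> \<le> B i" using assms by metis
  have "compactin (product_topology (\<lambda>_. euclidean) UNIV) (PiE UNIV (\<lambda>i. {- B i..B i}))"
    unfolding compactin_PiE by (auto simp: compactin_euclidean_iff)
  then have "compact (PiE UNIV (\<lambda>i. {- B i..B i}))"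
    by (simp add: euclidean_product_topology)
  moreover have "eventually (\<lambda>y. y \<in> PiE UNIV (\<lambda>i. {- B i..B i})) (filtermap x sequentially)"
    using B by (auto simp: eventually_filtermap abs_le_iff minus_le_iff intro!: always_eventually)
  moreover have "filtermap x sequentially \<noteq> bot" by (simp add: filtermap_bot_iff)
  ultimately obtain L where L: "inf (nhds L) (filtermap x sequentially) \<noteq> bot"
    unfolding compact_filter by blast
  \<comment> \<open>Adding to \<open>sequentially\<close> the preimages of the neighbourhoods of a
    cluster point \<open>L\<close> forces convergence to \<open>L\<close>; the filter is proper
    exactly because \<open>L\<close> is a cluster point.\<close>
  let ?G = "inf sequentially (filtercomap x (nhds L))"
  show thesis
  proof
    show "?G \<le> sequentially" by simp
    show "?G \<noteq> bot"
    proof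
      assume "?G = bot"
      then have "eventually (\<lambda>_. False) ?G" by simp
      then obtain P Q where P: "eventually P sequentially" and Q: "eventually Q (nhds L)"
        and PQ: "\<And>n. P n \<Longrightarrow> Q (x n) \<Longrightarrow> False"
        unfolding eventually_inf eventually_filtercomap by blast
      have "eventually (\<lambda>y. \<not> Q y) (filtermap x sequentially)"
        unfolding eventually_filtermap by (rule eventually_mono[OF P]) (use PQ in blast)
      with Q have "eventually (\<lambda>_. False) (inf (nhds L) (filtermap x sequentially))"
        unfolding eventually_inf by blast
      with L show False by (simp add: trivial_limit_def)
    qed
    fix i
    have lim: "filterlim x (nhds L) ?G"
      using filterlim_filtercomap filterlim_mono inf_le2 by blast
    have "((\<lambda>n. x n i) \<longlongrightarrow> L i) ?G"
    proof (rule topological_tendstoI)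
      fix S assume S: "open S" "L i \<in> S"
      have "open ((\<lambda>y :: 'i \<Rightarrow> real. y i) -` S)"
        using S(1) continuous_on_product_coordinates by (rule open_vimage)
      then show "\<forall>\<^sub>F n in ?G. x n i \<in> S"
        using topological_tendstoD[OF lim, of "(\<lambda>y. y i) -` S"] S(2) by simp
    qed
    then show "\<exists>l. ((\<lambda>n. x n i) \<longlongrightarrow> l) ?G" by blast
  qed
qed

section \<open>Weak limits in Lebesgue spaces\<close>

text \<open>Convexity in its tangent form. The left-hand side is affine in \<open>s\<close>, so it
  passes to weak limits; this is the source of the lower semicontinuity below. The tangent is first
  taken for absolute values, where \<open>powr\<close> is differentiable and convex on the positive
  half-line.\<close>

lemma powr_tangent:
  fixes p r s :: real
  assumes "p > 1"
  shows "\<bar>r\<bar> powr p + p * \<bar>r\<bar> powr (p - 1) * sgn r * (s - r) \<le> \<bar>s\<bar> powr p"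
proof (cases "r = 0")
  case False
  have "p * \<bar>r\<bar> powr (p - 1) * (\<bar>s\<bar> - \<bar>r\<bar>) \<le> \<bar>s\<bar> powr p - \<bar>r\<bar> powr p"
  proof (cases "s = 0")
    case True
    have "\<bar>r\<bar> powr p = \<bar>r\<bar> powr (p - 1) * \<bar>r\<bar>" using False by (simp add: powr_diff)
    moreover have "\<bar>r\<bar> powr (p - 1) * \<bar>r\<bar> \<le> p * (\<bar>r\<bar> powr (p - 1) * \<bar>r\<bar>)"
      using mult_right_mono[of 1 p "\<bar>r\<bar> powr (p - 1) * \<bar>r\<bar>"] assms by simp
    ultimately show ?thesis using True by simp
  next
    case s: False
    have "((\<lambda>x. x powr p) has_real_derivative p * \<bar>r\<bar> powr (p - 1)) (at \<bar>r\<bar> within {0<..})"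
      by (rule has_field_derivative_at_within[OF has_real_derivative_powr]) (use False in simp)
    moreover have "\<bar>r\<bar> \<in> interior {0<..}" using False by (simp add: interior_open)
    ultimately show ?thesis
      using convex_on_imp_above_tangent[OF powr_convex[of p] connected_Ioi, of "\<bar>r\<bar>" "\<bar>s\<bar>" "p * \<bar>r\<bar> powr (p - 1)"] assms s
      by simp
  qed
  moreover have "p * \<bar>r\<bar> powr (p - 1) * (sgn r * (s - r)) \<le> p * \<bar>r\<bar> powr (p - 1) * (\<bar>s\<bar> - \<bar>r\<bar>)"
    using assms False by (intro mult_left_mono) (auto simp: sgn_if)
  ultimately show ?thesis by (simp add: mult.assoc)
qed simp

lemma integrable_bounded_mult:
  fixes u g :: "'a \<Rightarrow> real"
  assumes "integrable M u" "g \<in> borel_measurable M" "\<And>x. \<bar>g x\<bar> \<le> c"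
  shows "integrable M (\<lambda>x. g x * u x)"
proof (rule Bochner_Integration.integrable_bound[of M "\<lambda>x. c * u x"])
  show "AE x in M. norm (g x * u x) \<le> norm (c * u x)"
    using assms(3) by (intro AE_I2) (auto simp: abs_mult intro!: mult_right_mono order_trans[OF assms(3) abs_ge_self])
qed (use assms in auto)

lemma integrable_indicator_mult:
  fixes u :: "'a \<Rightarrow> real"
  assumes "integrable M u" "A \<in> sets M"
  shows "integrable M (\<lambda>x. indicator A x * u x)"
  by (rule integrable_bounded_mult[where c = 1]) (use assms in \<open>auto simp: indicator_def\<close>)

text \<open>A bounded \<open>g\<close> is uniformly close to a simple function, and the common bound
  on the L1 norms makes the resulting error independent of \<open>n\<close>. Convergence on sets
  thus extends to bounded test functions, also along a filter without countable base.\<close>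

lemma weak_conv_bounded:
  fixes f :: "'a \<Rightarrow> real"
  assumes G: "G \<noteq> bot" and f: "integrable M f" and fn: "\<And>n. integrable M (F n)"
    and B: "\<And>n :: nat. (LINT x|M. \<bar>F n x\<bar>) \<le> B"
    and A: "\<And>A. A \<in> sets M \<Longrightarrow> ((\<lambda>n. LINT x|M. indicator A x * F n x) \<longlongrightarrow> (LINT x|M. indicator A x * f x)) G"
    and g[measurable]: "g \<in> borel_measurable M" and gc: "\<And>x. \<bar>g x\<bar> \<le> (c::real)"
  shows "((\<lambda>n. LINT x|M. g x * F n x) \<longlongrightarrow> (LINT x|M. g x * f x)) G"
proof (rule tendstoI)
  fix e :: real assume e: "e > 0"
  define B' where "B' = max B (LINT x|M. \<bar>f x\<bar>) + 1"
  have B'0: "B' > 0"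
  proof -
    have "0 \<le> (LINT x|M. \<bar>f x\<bar>)" by simp
    then show ?thesis unfolding B'_def by linarith
  qed
  obtain m :: nat where m: "m > 0" "B' / real m < e / 3"
  proof -
    obtain m :: nat where "real m > 3 * B' / e" using reals_Archimedean2 by blast
    then show ?thesis using that[of m] e B'0 by (cases "m = 0") (auto simp: field_simps)
  qed
  \<comment> \<open>The sets \<open>E k\<close> on which \<open>floor (m * g) = k\<close> partition
    the space. Since \<open>g\<close> is bounded by \<open>c\<close>, all nonempty ones have index
    in \<open>{-K..K}\<close>, so \<open>h\<close> is a finite sum.\<close>
  define K where "K = \<lceil>real m * c\<rceil> + 1"
  define E where "E k = {x \<in> space M. \<lfloor>real m * g x\<rfloor> = k}" for k
  have E[measurable]: "E k \<in> sets M" for k unfolding E_def by measurable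
  define h where "h x = (\<Sum>k\<in>{-K..K}. (real_of_int k / real m) * indicator (E k) x)" for x
  have hx: "h x = \<lfloor>real m * g x\<rfloor> / real m" if "x \<in> space M" for x
  proof -
    have "real m * \<bar>g x\<bar> \<le> real m * c" using gc m by (intro mult_left_mono) auto
    then have "\<bar>real m * g x\<bar> \<le> real m * c" by (simp add: abs_mult)
    then have "\<lfloor>real m * g x\<rfloor> \<in> {-K..K}" unfolding K_def atLeastAtMost_iff by linarith
    moreover have "h x = (\<Sum>k\<in>{-K..K}. if k = \<lfloor>real m * g x\<rfloor> then real_of_int k / real m else 0)"
      unfolding h_def by (rule sum.cong) (use that in \<open>auto simp: E_def indicator_def\<close>)
    ultimately show ?thesis by simp
  qed
  have gh: "\<bar>g x - h x\<bar> \<le> 1 / real m" if "x \<in> space M" for x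
  proof -
    have "\<bar>real m * g x - \<lfloor>real m * g x\<rfloor>\<bar> \<le> 1" by linarith
    then have "\<bar>real m * g x - \<lfloor>real m * g x\<rfloor>\<bar> / real m \<le> 1 / real m" using m by (simp add: divide_right_mono)
    moreover have "g x - h x = (real m * g x - \<lfloor>real m * g x\<rfloor>) / real m"
      using m hx[OF that] by (simp add: field_simps)
    ultimately show ?thesis by (simp add: abs_divide)
  qed
  have intg: "integrable M (\<lambda>x. g x * u x)" if "integrable M u" for u
    by (rule integrable_bounded_mult[OF that g gc])
  have inth: "integrable M (\<lambda>x. indicator (E k) x * u x)" if "integrable M u" for u :: "'a \<Rightarrow> real" and k
    by (rule integrable_indicator_mult[OF that E])
  have hsum: "integrable M (\<lambda>x. h x * u x)"
    "(LINT x|M. h x * u x) = (\<Sum>k\<in>{-K..K}. (real_of_int k / real m) * (LINT x|M. indicator (E k) x * u x))"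
    if "integrable M u" for u
  proof -
    have eq: "h x * u x = (\<Sum>k\<in>{-K..K}. (real_of_int k / real m) * (indicator (E k) x * u x))" for x
      unfolding h_def by (simp add: sum_distrib_right mult.assoc)
    show "integrable M (\<lambda>x. h x * u x)"
      unfolding eq by (intro Bochner_Integration.integrable_sum integrable_mult_right inth that)
    show "(LINT x|M. h x * u x) = (\<Sum>k\<in>{-K..K}. (real_of_int k / real m) * (LINT x|M. indicator (E k) x * u x))"
      unfolding eq by (subst Bochner_Integration.integral_sum) (auto intro!: inth that)
  qed
  have err: "\<bar>(LINT x|M. g x * u x) - (LINT x|M. h x * u x)\<bar> \<le> B' / real m"
    if u: "integrable M u" and uB: "(LINT x|M. \<bar>u x\<bar>) \<le> B'" for u
  proof -
    have "\<bar>(LINT x|M. g x * u x) - (LINT x|M. h x * u x)\<bar> = \<bar>LINT x|M. g x * u x - h x * u x\<bar>"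
      using intg[OF u] hsum(1)[OF u] by simp
    also have "\<dots> \<le> (LINT x|M. \<bar>u x\<bar> / real m)"
    proof (rule order_trans[OF integral_abs_bound integral_mono])
      fix x assume "x \<in> space M"
      then show "\<bar>g x * u x - h x * u x\<bar> \<le> \<bar>u x\<bar> / real m"
        using mult_right_mono[OF gh, of x "\<bar>u x\<bar>"] by (simp add: abs_mult[symmetric] left_diff_distrib[symmetric])
    qed (use intg[OF u] hsum(1)[OF u] u in auto)
    also have "\<dots> \<le> B' / real m" using uB m by (simp add: divide_right_mono)
    finally show ?thesis .
  qed
  have "((\<lambda>n. LINT x|M. h x * F n x) \<longlongrightarrow> (LINT x|M. h x * f x)) G"
    unfolding hsum(2)[OF fn] hsum(2)[OF f] by (intro tendsto_sum tendsto_mult_left A E)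
  then have "\<forall>\<^sub>F n in G. dist (LINT x|M. h x * F n x) (LINT x|M. h x * f x) < e / 3"
    using e by (intro tendstoD) auto
  then show "\<forall>\<^sub>F n in G. dist (LINT x|M. g x * F n x) (LINT x|M. g x * f x) < e"
  proof eventually_elim
    case (elim n)
    have "\<bar>(LINT x|M. g x * F n x) - (LINT x|M. h x * F n x)\<bar> \<le> B' / real m"
      by (rule err[OF fn]) (use B[of n] in \<open>auto simp: B'_def\<close>)
    moreover have "\<bar>(LINT x|M. g x * f x) - (LINT x|M. h x * f x)\<bar> \<le> B' / real m"
      by (rule err[OF f]) (auto simp: B'_def)
    ultimately show ?case using elim m unfolding dist_real_def by linarith
  qed
qed

text \<open>Above the level \<open>t\<close>, the factor \<open>h powr (1 - p)\<close> is at most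
  \<open>t powr (1 - p)\<close>. This is uniform integrability in quantitative form: the coefficient
  of the second term tends to 0 as \<open>t\<close> grows, because \<open>p\<close> exceeds
  1.\<close>

lemma powr_split:
  fixes h t p :: real assumes "0 \<le> h" "0 < t" "p > 1"
  shows "h \<le> t + t powr (1 - p) * h powr p"
proof (cases "h \<le> t")
  case False
  then have "h = h powr (1 - p) * h powr p" using assms by (simp add: powr_add[symmetric])
  also have "\<dots> \<le> t powr (1 - p) * h powr p"
    using False assms by (intro mult_right_mono powr_mono2') auto
  finally show ?thesis using assms by linarith
qed (use assms in \<open>simp add: add_increasing2\<close>)

lemma powr_integrable:
  fixes h :: "'a \<Rightarrow> real"
  assumes "finite_measure M" "h \<in> borel_measurable M" "integrable M (\<lambda>x. \<bar>h x\<bar> powr p)" "p > 1"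
  shows "integrable M h" "(LINT x|M. \<bar>h x\<bar>) \<le> measure M (space M) + (LINT x|M. \<bar>h x\<bar> powr p)"
proof -
  interpret finite_measure M by fact
  have b: "\<bar>h x\<bar> \<le> 1 + \<bar>h x\<bar> powr p" for x using powr_split[of "\<bar>h x\<bar>" 1 p] assms by simp
  show i: "integrable M h"
    by (rule Bochner_Integration.integrable_bound[of M "\<lambda>x. 1 + \<bar>h x\<bar> powr p"]) (use assms b in auto)
  have "(LINT x|M. \<bar>h x\<bar>) \<le> (LINT x|M. 1 + \<bar>h x\<bar> powr p)"
    by (rule integral_mono) (use i assms b in auto)
  also have "\<dots> = measure M (space M) + (LINT x|M. \<bar>h x\<bar> powr p)" using assms by simp
  finally show "(LINT x|M. \<bar>h x\<bar>) \<le> measure M (space M) + (LINT x|M. \<bar>h x\<bar> powr p)" .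
qed

text \<open>The limits of \<open>\<integral>\<^sub>A h\<^sub>n\<close> form a finitely additive set function of \<open>A\<close>. Integrating
  \<open>powr_split\<close> over \<open>A\<close> with \<open>t\<close> large makes it countably additive and absolutely
  continuous, and Radon-Nikodym supplies the limit function.\<close>

lemma weak_limit_nonneg:
  fixes h :: "nat \<Rightarrow> 'a \<Rightarrow> real"
  assumes "finite_measure M" and hm[measurable]: "\<And>n. h n \<in> borel_measurable M" and h0: "\<And>n x. h n x \<ge> 0"
    and p: "p > 1" and hi: "\<And>n. integrable M (\<lambda>x. h n x powr p)" and hC: "\<And>n. (LINT x|M. h n x powr p) \<le> C"
    and G: "G \<noteq> bot"
    and conv: "\<And>A. A \<in> sets M \<Longrightarrow> \<exists>L. ((\<lambda>n. LINT x|M. indicator A x * h n x) \<longlongrightarrow> L) G"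
  obtains f where "integrable M f"
    "\<And>A. A \<in> sets M \<Longrightarrow> ((\<lambda>n. LINT x|M. indicator A x * h n x) \<longlongrightarrow> (LINT x|M. indicator A x * f x)) G"
proof -
  interpret finite_measure M by fact
  have h_int: "integrable M (h n)" for n
    using powr_integrable(1)[of M "h n" p] assms by simp
  have ind_int: "integrable M (\<lambda>x. indicator A x * h n x)" if "A \<in> sets M" for A n
    by (rule integrable_indicator_mult[OF h_int that])
  define L where "L A = Lim G (\<lambda>n. LINT x|M. indicator A x * h n x)" for A
  have L: "((\<lambda>n. LINT x|M. indicator A x * h n x) \<longlongrightarrow> L A) G" if "A \<in> sets M" for A
    using conv[OF that] tendsto_Lim[OF G] unfolding L_def by metis
  have L0: "L A \<ge> 0" if "A \<in> sets M" for A
    by (rule tendsto_lowerbound[OF L[OF that] always_eventually G]) (simp add: h0 integral_nonneg)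
  have Lb: "L A \<le> t * measure M A + t powr (1 - p) * C" if A: "A \<in> sets M" and t: "t > 0" for A t
  proof (rule tendsto_upperbound[OF L[OF A] _ G], intro always_eventually allI)
    fix n
    have "(LINT x|M. indicator A x * h n x) \<le> (LINT x|M. t * indicator A x + t powr (1 - p) * h n x powr p)"
    proof (rule integral_mono[OF ind_int[OF A]])
      show "integrable M (\<lambda>x. t * indicator A x + t powr (1 - p) * h n x powr p)"
        using A hi by (intro Bochner_Integration.integrable_add integrable_mult_right integrable_real_indicator) (auto simp: less_top[symmetric])
      show "indicator A x * h n x \<le> t * indicator A x + t powr (1 - p) * h n x powr p" for x
        using powr_split[OF h0 t p, of n x] by (auto simp: indicator_def)
    qed
    also have "\<dots> = t * measure M A + t powr (1 - p) * (LINT x|M. h n x powr p)"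
    proof -
      have "integrable M (indicator A :: 'a \<Rightarrow> real)"
        using A by (intro integrable_real_indicator) (auto simp: less_top[symmetric])
      then show ?thesis using hi[of n] A by (subst Bochner_Integration.integral_add) auto
    qed
    also have "\<dots> \<le> t * measure M A + t powr (1 - p) * C" using hC[of n] by (simp add: mult_left_mono)
    finally show "(LINT x|M. indicator A x * h n x) \<le> t * measure M A + t powr (1 - p) * C" .
  qed
  have small: "\<exists>t>0. t powr (1 - p) * C < e" if "e > 0" for e
  proof -
    have "((\<lambda>t. t powr (1 - p) * C) \<longlongrightarrow> 0 * C) at_top"
      using p by (intro tendsto_mult tendsto_neg_powr filterlim_ident) auto
    then have "\<forall>\<^sub>F t in at_top. t powr (1 - p) * C < e"
      using that by (auto dest: order_tendstoD(2))
    then have "\<forall>\<^sub>F t in at_top. t > 0 \<and> t powr (1 - p) * C < e"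
      using eventually_gt_at_top[of 0] by eventually_elim simp
    then show ?thesis by (rule eventually_happens'[rotated]) simp
  qed
  have Ladd: "L (A \<union> B) = L A + L B" if "A \<in> sets M" "B \<in> sets M" "A \<inter> B = {}" for A B
  proof -
    have "(LINT x|M. indicator (A \<union> B) x * h n x) = (LINT x|M. indicator A x * h n x) + (LINT x|M. indicator B x * h n x)" for n
    proof -
      have "indicator (A \<union> B) x * h n x = indicator A x * h n x + indicator B x * h n x" for x
        using that(3) by (auto simp: indicator_def)
      then show ?thesis using ind_int that by simp
    qed
    then have "((\<lambda>n. LINT x|M. indicator (A \<union> B) x * h n x) \<longlongrightarrow> L A + L B) G"
      using tendsto_add[OF L L] that by simp
    then show ?thesis using L[of "A \<union> B"] that tendsto_unique[OF G] by blast
  qed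
  define \<nu> where "\<nu> A = ennreal (L A)" for A
  have L_empty: "L {} = 0" using Ladd[of "{}" "{}"] by simp
  have pos: "positive (sets M) \<nu>" by (simp add: positive_def \<nu>_def L_empty)
  have add: "additive (sets M) \<nu>"
    unfolding additive_def \<nu>_def using Ladd L0 by (auto simp: ennreal_plus)
  have ca: "countably_additive (sets M) \<nu>"
  proof (rule sets.empty_continuous_imp_countably_additive[OF pos add])
    show "\<forall>A\<in>sets M. \<nu> A \<noteq> \<infinity>" by (simp add: \<nu>_def)
    fix A :: "nat \<Rightarrow> 'a set" assume A: "range A \<subseteq> sets M" "decseq A" "(\<Inter>i. A i) = {}"
    have mA: "(\<lambda>i. measure M (A i)) \<longlonglongrightarrow> 0" using finite_Lim_measure_decseq[OF A(1,2)] A(3) by simp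
    have "(\<lambda>i. L (A i)) \<longlonglongrightarrow> 0"
    proof (rule LIMSEQ_I)
      fix e :: real assume e: "e > 0"
      obtain t where t: "t > 0" "t powr (1 - p) * C < e / 2" using small[of "e/2"] e by auto
      have "(\<lambda>i. t * measure M (A i)) \<longlonglongrightarrow> t * 0" by (intro tendsto_mult_left mA)
      then have "\<forall>\<^sub>F i in sequentially. t * measure M (A i) < e / 2" using e by (auto dest!: order_tendstoD(2)[of _ _ _ "e/2"])
      then obtain N where N: "\<And>i. i \<ge> N \<Longrightarrow> t * measure M (A i) < e / 2" by (auto simp: eventually_sequentially)
      show "\<exists>no. \<forall>n\<ge>no. norm (L (A n) - 0) < e"
      proof (intro exI allI impI)
        fix n assume "n \<ge> N"
        then show "norm (L (A n) - 0) < e" using Lb[of "A n" t] L0[of "A n"] A(1) t N[of n] by force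
      qed
    qed
    then show "(\<lambda>i. \<nu> (A i)) \<longlonglongrightarrow> 0" unfolding \<nu>_def by (simp flip: ennreal_0 add: tendsto_ennrealI)
  qed
  define N where "N = measure_of (space M) (sets M) \<nu>"
  have sN[simp, measurable_cong]: "sets N = sets M" by (simp add: N_def sets.sigma_sets_eq)
  have spN: "space N = space M" by (simp add: N_def)
  have eN: "emeasure N A = \<nu> A" if "A \<in> sets M" for A
    unfolding N_def by (rule emeasure_measure_of[OF refl]) (use that pos ca sets.space_closed in \<open>auto simp: sets.sigma_sets_eq countably_additive_def positive_def\<close>)
  have fN: "finite_measure N" by (rule finite_measureI) (simp add: spN eN \<nu>_def)
  have "absolutely_continuous M N"
  proof (unfold absolutely_continuous_def, intro subsetI)
    fix A assume A: "A \<in> null_sets M"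
    then have As: "A \<in> sets M" and m0: "measure M A = 0" by (auto simp: measure_def)
    have "L A \<le> 0"
    proof (rule field_le_epsilon)
      fix e :: real assume "e > 0"
      then obtain t where "t > 0" "t powr (1 - p) * C < e" using small by blast
      then show "L A \<le> 0 + e" using Lb[OF As, of t] m0 by simp
    qed
    then show "A \<in> null_sets N" using L0[OF As] As by (auto simp: null_sets_def eN \<nu>_def)
  qed
  then obtain D where D: "D \<in> borel_measurable M" "AE x in M. RN_deriv M N x = ennreal (D x)" "\<And>x. 0 \<le> D x"
    and "absolutely_continuous M N"
    using real_RN_deriv[OF fN] sN by metis
  then have dN: "density M (\<lambda>x. ennreal (D x)) = N"
    using density_RN_deriv[of N] sN density_cong[of "RN_deriv M N" M "\<lambda>x. ennreal (D x)"] by auto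
  have nnD: "(\<integral>\<^sup>+x. ennreal (indicator A x * D x) \<partial>M) = ennreal (L A)" if A: "A \<in> sets M" for A
  proof -
    have "ennreal (L A) = emeasure (density M (\<lambda>x. ennreal (D x))) A" using eN[OF A] dN by (simp add: \<nu>_def)
    also have "\<dots> = (\<integral>\<^sup>+x. ennreal (D x) * indicator A x \<partial>M)" by (rule emeasure_density) (use D A in auto)
    also have "\<dots> = (\<integral>\<^sup>+x. ennreal (indicator A x * D x) \<partial>M)"
      by (rule nn_integral_cong) (auto simp: indicator_def)
    finally show ?thesis by simp
  qed
  have Deq: "(LINT x|M. indicator A x * D x) = L A" if A: "A \<in> sets M" for A
    using D A L0[OF A] nnD[OF A] by (subst integral_eq_nn_integral) auto
  have "integrable M D"
  proof (rule integrableI_bounded)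
    have "(\<integral>\<^sup>+x. ennreal (norm (D x)) \<partial>M) = (\<integral>\<^sup>+x. ennreal (indicator (space M) x * D x) \<partial>M)"
      by (rule nn_integral_cong) (simp add: D(3))
    then show "(\<integral>\<^sup>+x. ennreal (norm (D x)) \<partial>M) < \<infinity>" using nnD[of "space M"] by simp
  qed fact
  then show thesis using that[of D] L Deq by simp
qed

text \<open>Positive and negative parts are treated separately, since only for nonnegative functions
  do the limits of the integrals over sets form a measure. Sign and set are put into one index, so
  that both parts converge along the same filter.\<close>

lemma weak_compact:
  fixes F :: "nat \<Rightarrow> 'a \<Rightarrow> real"
  assumes fin: "finite_measure M" and Fm[measurable]: "\<And>n. F n \<in> borel_measurable M"
    and p: "p > 1" and Fi: "\<And>n. integrable M (\<lambda>x. \<bar>F n x\<bar> powr p)" and FC: "\<And>n. (LINT x|M. \<bar>F n x\<bar> powr p) \<le> C"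
  obtains G f where "G \<le> sequentially" "G \<noteq> bot" "integrable M f"
    "\<And>g (c::real). g \<in> borel_measurable M \<Longrightarrow> (\<And>x. \<bar>g x\<bar> \<le> c) \<Longrightarrow>
       ((\<lambda>n. LINT x|M. g x * F n x) \<longlongrightarrow> (LINT x|M. g x * f x)) G"
proof -
  define H where "H b n x = max 0 (if b then F n x else - F n x)" for b n x
  have Hm[measurable]: "H b n \<in> borel_measurable M" for b n unfolding H_def by (cases b) simp_all
  have H0: "H b n x \<ge> 0" and HF: "H b n x \<le> \<bar>F n x\<bar>" for b n x by (auto simp: H_def)
  have Hp: "H b n x powr p \<le> \<bar>F n x\<bar> powr p" for b n x using H0 HF p by (intro powr_mono2) auto
  have Hi: "integrable M (\<lambda>x. H b n x powr p)" for b n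
    by (rule Bochner_Integration.integrable_bound[OF Fi[of n]]) (use Hp in auto)
  have HC: "(LINT x|M. H b n x powr p) \<le> C" for b n
    using integral_mono[OF Hi[of b n] Fi[of n] Hp] FC[of n] by linarith
  have Hint: "integrable M (H b n)" for b n
    using powr_integrable(1)[OF fin Hm, of b n p] Hi H0 p by simp
  have FI: "integrable M (F n)" for n using powr_integrable(1)[OF fin Fm Fi p] .
  have FB: "(LINT x|M. \<bar>F n x\<bar>) \<le> measure M (space M) + C" for n
    using powr_integrable(2)[OF fin Fm Fi p, of n] FC[of n] by linarith
  have indH: "integrable M (\<lambda>x. indicator A x * H b n x)" if "A \<in> sets M" for A b n
    by (rule integrable_indicator_mult[OF Hint that])
  \<comment> \<open>The index runs through all sets, measurable or not. An integrand that fails to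
    be integrable has integral 0 by convention, so every coordinate stays bounded.\<close>
  define X where "X n i = (LINT x|M. indicator (snd i \<inter> space M) x * H (fst i) n x)" for n and i :: "bool \<times> 'a set"
  have "\<exists>B. \<forall>n. \<bar>X n i\<bar> \<le> B" for i
  proof (intro exI allI)
    fix n
    have "\<bar>X n i\<bar> \<le> (LINT x|M. \<bar>F n x\<bar>)"
    proof (cases "integrable M (\<lambda>x. indicator (snd i \<inter> space M) x * H (fst i) n x)")
      case True
      then show ?thesis unfolding X_def
        using FI[of n] H0 HF by (intro order_trans[OF integral_abs_bound] integral_mono) (auto simp: indicator_def)
    qed (simp add: X_def not_integrable_integral_eq)
    then show "\<bar>X n i\<bar> \<le> measure M (space M) + C"
      using FB[of n] by simp
  qed
  then obtain G where G: "G \<le> sequentially" "G \<noteq> bot" and conv: "\<And>i. \<exists>L. ((\<lambda>n. X n i) \<longlongrightarrow> L) G"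
    using tychonoff_seq[of X] by blast
  have conv': "\<exists>L. ((\<lambda>n. LINT x|M. indicator A x * H b n x) \<longlongrightarrow> L) G" if "A \<in> sets M" for A b
    using conv[of "(b, A)"] sets.sets_into_space[OF that] by (simp add: X_def Int_absorb2)
  obtain f1 where f1: "integrable M f1" "\<And>A. A \<in> sets M \<Longrightarrow> ((\<lambda>n. LINT x|M. indicator A x * H True n x) \<longlongrightarrow> (LINT x|M. indicator A x * f1 x)) G"
    using weak_limit_nonneg[OF fin Hm H0 p Hi HC G(2) conv'] by metis
  obtain f2 where f2: "integrable M f2" "\<And>A. A \<in> sets M \<Longrightarrow> ((\<lambda>n. LINT x|M. indicator A x * H False n x) \<longlongrightarrow> (LINT x|M. indicator A x * f2 x)) G"
    using weak_limit_nonneg[OF fin Hm H0 p Hi HC G(2) conv'] by metis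
  have fi: "integrable M (\<lambda>x. f1 x - f2 x)" using f1 f2 by simp
  show thesis
  proof (rule that[OF G fi])
    fix g :: "'a \<Rightarrow> real" and c assume g: "g \<in> borel_measurable M" "\<And>x. \<bar>g x\<bar> \<le> c"
    show "((\<lambda>n. LINT x|M. g x * F n x) \<longlongrightarrow> (LINT x|M. g x * (f1 x - f2 x))) G"
    proof (rule weak_conv_bounded[OF G(2) fi FI FB _ g])
      fix A assume A: "A \<in> sets M"
      have ind: "integrable M (\<lambda>x. indicator A x * u x)" if "integrable M u" for u :: "'a \<Rightarrow> real"
        by (rule integrable_indicator_mult[OF that A])
      have "(LINT x|M. indicator A x * F n x) = (LINT x|M. indicator A x * H True n x) - (LINT x|M. indicator A x * H False n x)" for n
      proof -
        have "indicator A x * F n x = indicator A x * H True n x - indicator A x * H False n x" for x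
          by (auto simp: H_def indicator_def)
        then show ?thesis using indH[OF A] by simp
      qed
      moreover have "(LINT x|M. indicator A x * (f1 x - f2 x)) = (LINT x|M. indicator A x * f1 x) - (LINT x|M. indicator A x * f2 x)"
        using ind f1(1) f2(1) by (simp add: right_diff_distrib)
      ultimately show "((\<lambda>n. LINT x|M. indicator A x * F n x) \<longlongrightarrow> (LINT x|M. indicator A x * (f1 x - f2 x))) G"
        using tendsto_diff[OF f1(2)[OF A] f2(2)[OF A]] by simp
    qed
  qed
qed

text \<open>The tangent inequality at \<open>f\<close> is integrated and passed to the limit. The
  slope is a legitimate test function only after truncation, because \<open>f\<close> is merely
  known to be integrable; Fatou's lemma then removes the truncation.\<close>

lemma weak_lsc:
  fixes F :: "nat \<Rightarrow> 'a \<Rightarrow> real"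
  assumes p: "p > 1" and G: "G \<noteq> bot" and f: "integrable M f"
    and Fint: "\<And>n. integrable M (F n)" and Fi: "\<And>n. integrable M (\<lambda>x. \<bar>F n x\<bar> powr p)"
    and FC: "\<forall>\<^sub>F n in G. (LINT x|M. \<bar>F n x\<bar> powr p) \<le> C"
    and weak: "\<And>g (c::real). g \<in> borel_measurable M \<Longrightarrow> (\<And>x. \<bar>g x\<bar> \<le> c) \<Longrightarrow>
       ((\<lambda>n. LINT x|M. g x * F n x) \<longlongrightarrow> (LINT x|M. g x * f x)) G"
  shows "integrable M (\<lambda>x. \<bar>f x\<bar> powr p)" "(LINT x|M. \<bar>f x\<bar> powr p) \<le> C"
proof -
  have fm[measurable]: "f \<in> borel_measurable M" using f by auto
  obtain n0 where n0: "(LINT x|M. \<bar>F n0 x\<bar> powr p) \<le> C" using FC eventually_happens'[OF G] by blast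
  have "0 \<le> (LINT x|M. \<bar>F n0 x\<bar> powr p)" by simp
  then have C0: "C \<ge> 0" using n0 by linarith
  define h where "h m x = (if \<bar>f x\<bar> \<le> real m then \<bar>f x\<bar> powr p else 0)" for m x
  have hm[measurable]: "h m \<in> borel_measurable M" for m unfolding h_def by measurable
  have key: "integrable M (h m) \<and> (LINT x|M. h m x) \<le> C" for m
  proof -
    \<comment> \<open>The derivative of the p-th power at \<open>f\<close>, cut off where
      \<open>\<bar>f\<bar>\<close> exceeds \<open>m\<close> so that it is bounded. As
      \<open>h m = g * f / p\<close>, integrability of \<open>h m\<close> follows from that of
      \<open>f\<close>.\<close>
    define g where "g x = (if \<bar>f x\<bar> \<le> real m then p * \<bar>f x\<bar> powr (p - 1) * sgn (f x) else 0)" for x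
    have gm: "g \<in> borel_measurable M" unfolding g_def by measurable
    have gb: "\<bar>g x\<bar> \<le> p * real m powr (p - 1)" for x
      using p by (auto simp: g_def abs_mult sgn_if intro!: powr_mono2)
    have gi: "integrable M (\<lambda>x. g x * u x)" if "integrable M u" for u :: "'a \<Rightarrow> real"
      by (rule integrable_bounded_mult[OF that gm gb])
    have hp: "h m x = g x * f x / p" for x
    proof (cases "f x = 0")
      case False
      then have "\<bar>f x\<bar> powr p = \<bar>f x\<bar> powr (p - 1) * \<bar>f x\<bar>" by (simp add: powr_diff)
      then show ?thesis using p by (auto simp: h_def g_def sgn_if)
    qed (simp add: h_def)
    have hi: "integrable M (h m)"
      unfolding hp using gi[OF f] by simp
    have ineq: "h m x + g x * F n x - g x * f x \<le> \<bar>F n x\<bar> powr p" for n x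
      using powr_tangent[OF p, of "f x" "F n x"] by (auto simp: h_def g_def right_diff_distrib)
    have "\<forall>\<^sub>F n in G. (LINT x|M. h m x) + (LINT x|M. g x * F n x) - (LINT x|M. g x * f x) \<le> C"
      using FC
    proof eventually_elim
      case (elim n)
      have "(LINT x|M. h m x) + (LINT x|M. g x * F n x) - (LINT x|M. g x * f x) = (LINT x|M. h m x + g x * F n x - g x * f x)"
        using hi gi[OF f] gi[OF Fint[of n]] by simp
      also have "\<dots> \<le> (LINT x|M. \<bar>F n x\<bar> powr p)"
        by (rule integral_mono[OF _ Fi ineq]) (use hi gi[OF f] gi[OF Fint[of n]] in auto)
      finally show ?case using elim by linarith
    qed
    moreover have "((\<lambda>n. (LINT x|M. h m x) + (LINT x|M. g x * F n x) - (LINT x|M. g x * f x)) \<longlongrightarrow>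
        (LINT x|M. h m x) + (LINT x|M. g x * f x) - (LINT x|M. g x * f x)) G"
      by (intro tendsto_intros weak[OF gm gb])
    ultimately have "(LINT x|M. h m x) + (LINT x|M. g x * f x) - (LINT x|M. g x * f x) \<le> C"
      using tendsto_upperbound G by blast
    then have "(LINT x|M. h m x) \<le> C" by linarith
    then show ?thesis using hi by blast
  qed
  have lim: "(\<lambda>m. h m x) \<longlonglongrightarrow> \<bar>f x\<bar> powr p" for x
  proof (rule tendsto_eventually)
    obtain k where "\<bar>f x\<bar> \<le> real k" using real_arch_simple by blast
    then show "\<forall>\<^sub>F m in sequentially. h m x = \<bar>f x\<bar> powr p"
      by (intro eventually_sequentiallyI[of k]) (auto simp: h_def)
  qed
  have nn: "(\<integral>\<^sup>+x. ennreal (\<bar>f x\<bar> powr p) \<partial>M) \<le> ennreal C"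
  proof -
    have "(\<integral>\<^sup>+x. ennreal (\<bar>f x\<bar> powr p) \<partial>M) = (\<integral>\<^sup>+x. liminf (\<lambda>m. ennreal (h m x)) \<partial>M)"
      using lim by (intro nn_integral_cong lim_imp_Liminf[symmetric]) (auto intro!: tendsto_ennrealI)
    also have "\<dots> \<le> liminf (\<lambda>m. \<integral>\<^sup>+x. ennreal (h m x) \<partial>M)" by (rule nn_integral_liminf) simp
    also have "\<dots> \<le> liminf (\<lambda>m. ennreal C)"
    proof (rule Liminf_mono, intro always_eventually allI)
      fix m
      show "(\<integral>\<^sup>+x. ennreal (h m x) \<partial>M) \<le> ennreal C"
        using conjunct1[OF key[of m]] conjunct2[OF key[of m]]
        by (subst nn_integral_eq_integral) (auto intro!: ennreal_leI, simp add: h_def)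
    qed
    also have "\<dots> = ennreal C" by (simp add: Liminf_const)
    finally show ?thesis .
  qed
  show fi: "integrable M (\<lambda>x. \<bar>f x\<bar> powr p)"
    using nn by (intro integrableI_bounded) (auto intro: le_less_trans)
  show "(LINT x|M. \<bar>f x\<bar> powr p) \<le> C"
    using nn C0 by (subst (asm) nn_integral_eq_integral[OF fi]) auto
qed

section \<open>Completeness of the square integrable functions\<close>

text \<open>The candidate is a weak limit. Lower semicontinuity applied to
  \<open>F n - F (N + m)\<close>, as \<open>m\<close> runs along the filter, bounds the distance of
  \<open>F n\<close> to the candidate by the Cauchy tail, which upgrades weak convergence along a
  filter to strong convergence of the whole sequence.\<close>

lemma L2_complete:
  fixes F :: "nat \<Rightarrow> 'a \<Rightarrow> real"
  assumes fin: "finite_measure M" and Fm[measurable]: "\<And>n. F n \<in> borel_measurable M"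
    and F2: "\<And>n. integrable M (\<lambda>x. (F n x)\<^sup>2)"
    and cauchy: "\<And>e. e > 0 \<Longrightarrow> \<exists>N. \<forall>m\<ge>N. \<forall>n\<ge>N. (LINT x|M. (F n x - F m x)\<^sup>2) \<le> e"
  obtains f where "f \<in> borel_measurable M" "integrable M (\<lambda>x. (f x)\<^sup>2)" "(\<lambda>n. LINT x|M. (F n x - f x)\<^sup>2) \<longlonglongrightarrow> 0"
proof -
  interpret finite_measure M by fact
  have sq: "\<bar>x\<bar> powr 2 = x\<^sup>2" for x :: real by (simp add: powr_numeral)
  have diff2: "integrable M (\<lambda>x. (u x - v x)\<^sup>2)"
    if "integrable M (\<lambda>x. (u x)\<^sup>2)" "integrable M (\<lambda>x. (v x)\<^sup>2)" "u \<in> borel_measurable M" "v \<in> borel_measurable M" for u v :: "'a \<Rightarrow> real"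
  proof (rule Bochner_Integration.integrable_bound[of M "\<lambda>x. 2 * (u x)\<^sup>2 + 2 * (v x)\<^sup>2"])
    show "AE x in M. norm ((u x - v x)\<^sup>2) \<le> norm (2 * (u x)\<^sup>2 + 2 * (v x)\<^sup>2)"
    proof (rule AE_I2)
      fix x
      have "(u x - v x)\<^sup>2 \<le> 2 * (u x)\<^sup>2 + 2 * (v x)\<^sup>2"
        using zero_le_power2[of "u x + v x"] by (simp add: power2_eq_square algebra_simps)
      then show "norm ((u x - v x)\<^sup>2) \<le> norm (2 * (u x)\<^sup>2 + 2 * (v x)\<^sup>2)" by simp
    qed
  qed (use that in auto)
  obtain N where N: "\<And>m n. m \<ge> N \<Longrightarrow> n \<ge> N \<Longrightarrow> (LINT x|M. (F n x - F m x)\<^sup>2) \<le> 1" using cauchy[of 1] by auto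
  define C where "C = 2 * (LINT x|M. (F N x)\<^sup>2) + 2"
  have bound: "(LINT x|M. (F (N + n) x)\<^sup>2) \<le> C" for n
  proof -
    have "(LINT x|M. (F (N + n) x)\<^sup>2) \<le> (LINT x|M. 2 * (F N x)\<^sup>2 + 2 * (F (N + n) x - F N x)\<^sup>2)"
    proof (rule integral_mono)
      fix x
      have "0 \<le> (F (N + n) x - 2 * F N x)\<^sup>2" by simp
      then show "(F (N + n) x)\<^sup>2 \<le> 2 * (F N x)\<^sup>2 + 2 * (F (N + n) x - F N x)\<^sup>2"
        by (simp add: power2_eq_square algebra_simps)
    qed (use F2 diff2 in auto)
    also have "\<dots> = 2 * (LINT x|M. (F N x)\<^sup>2) + 2 * (LINT x|M. (F (N + n) x - F N x)\<^sup>2)"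
      using F2 diff2 by simp
    also have "\<dots> \<le> C" using N[of N "N + n"] by (simp add: C_def)
    finally show ?thesis .
  qed
  obtain G f where G: "G \<le> sequentially" "G \<noteq> bot" and f: "integrable M f" and
    weak: "\<And>g (c::real). g \<in> borel_measurable M \<Longrightarrow> (\<And>x. \<bar>g x\<bar> \<le> c) \<Longrightarrow>
       ((\<lambda>n. LINT x|M. g x * F (N + n) x) \<longlongrightarrow> (LINT x|M. g x * f x)) G"
    using weak_compact[of M "\<lambda>n. F (N + n)" 2 C] fin F2 bound unfolding sq by auto
  have Fint: "integrable M (F n)" for n
    using powr_integrable(1)[OF fin Fm, of n 2] F2 by (simp add: sq)
  have fm[measurable]: "f \<in> borel_measurable M" using f by auto
  note mulg = integrable_bounded_mult
  have close: "integrable M (\<lambda>x. (F n x - f x)\<^sup>2) \<and> (LINT x|M. (F n x - f x)\<^sup>2) \<le> e"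
    if e: "\<And>m. m \<ge> K \<Longrightarrow> (LINT x|M. (F n x - F m x)\<^sup>2) \<le> e" for n K e
  proof -
    have ev: "\<forall>\<^sub>F m in G. (LINT x|M. \<bar>F n x - F (N + m) x\<bar> powr 2) \<le> e"
    proof (rule filter_leD[OF G(1)])
      show "\<forall>\<^sub>F m in sequentially. (LINT x|M. \<bar>F n x - F (N + m) x\<bar> powr 2) \<le> e"
        unfolding sq using eventually_ge_at_top[of K] by eventually_elim (use e in auto)
    qed
    have w: "((\<lambda>m. LINT x|M. g x * (F n x - F (N + m) x)) \<longlongrightarrow> (LINT x|M. g x * (F n x - f x))) G"
      if g: "g \<in> borel_measurable M" "\<And>x. \<bar>g x\<bar> \<le> (c::real)" for g c
      unfolding right_diff_distrib
      using tendsto_diff[OF tendsto_const[of "LINT x|M. g x * F n x" G] weak[OF g]] mulg[OF Fint g] mulg[OF f g] by simp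
    have fi: "integrable M (\<lambda>x. F n x - f x)" "\<And>m. integrable M (\<lambda>x. F n x - F (N + m) x)"
      "\<And>m. integrable M (\<lambda>x. (F n x - F (N + m) x)\<^sup>2)"
      using f Fint diff2[OF F2 F2 Fm Fm] by auto
    show ?thesis
    proof
      show "integrable M (\<lambda>x. (F n x - f x)\<^sup>2)"
        by (rule weak_lsc(1)[of 2, unfolded sq, OF _ G(2) fi ev[unfolded sq]]) (simp, rule w)
      show "(LINT x|M. (F n x - f x)\<^sup>2) \<le> e"
        by (rule weak_lsc(2)[of 2, unfolded sq, OF _ G(2) fi ev[unfolded sq]]) (simp, rule w)
    qed
  qed
  have i: "integrable M (\<lambda>x. (F n x - f x)\<^sup>2)" if "n \<ge> N" for n
    using close[of N n 1] N that by auto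
  \<comment> \<open>Writing \<open>f\<close> as \<open>F N - (F N - f)\<close> shows that it is
    square integrable.\<close>
  have "integrable M (\<lambda>x. (F N x - (F N x - f x))\<^sup>2)"
    by (rule diff2) (use F2 i in auto)
  then have f2: "integrable M (\<lambda>x. (f x)\<^sup>2)" by simp
  have "(\<lambda>n. LINT x|M. (F n x - f x)\<^sup>2) \<longlonglongrightarrow> 0"
  proof (rule LIMSEQ_I)
    fix e :: real assume e: "e > 0"
    then obtain K where K: "\<And>m n. m \<ge> K \<Longrightarrow> n \<ge> K \<Longrightarrow> (LINT x|M. (F n x - F m x)\<^sup>2) \<le> e / 2" using cauchy[of "e/2"] by auto
    show "\<exists>no. \<forall>n\<ge>no. norm ((LINT x|M. (F n x - f x)\<^sup>2) - 0) < e"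
    proof (intro exI allI impI)
      fix n assume "n \<ge> K"
      then have "(LINT x|M. (F n x - f x)\<^sup>2) \<le> e / 2" using close[of K n "e / 2"] K by blast
      then show "norm ((LINT x|M. (F n x - f x)\<^sup>2) - 0) < e" using e by simp
    qed
  qed
  then show thesis using that f2 fm by blast
qed

section \<open>Weak derivatives on the rectangle\<close>

lemma fst_borel[measurable]: "(fst :: R2 \<Rightarrow> real) \<in> borel_measurable borel"
  by (intro borel_measurable_continuous_onI continuous_intros)
lemma snd_borel[measurable]: "(snd :: R2 \<Rightarrow> real) \<in> borel_measurable borel"
  by (intro borel_measurable_continuous_onI continuous_intros)

lemma Omega_borel[measurable]: "Omega l \<in> sets borel"
  by (rule borel_open[OF open_Omega])

lemma borel_lebesgue: "f \<in> borel_measurable borel \<Longrightarrow> f \<in> borel_measurable lebesgue"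
  by (rule measurable_completion) simp

lemma Omega_finite: "emeasure lborel (Omega l) < \<infinity>"
  by (rule emeasure_bounded_finite) (simp add: Omega_def bounded_Times)

lemma integrable_ind_Omega: "integrable lborel (indicator (Omega l) :: R2 \<Rightarrow> real)"
  using Omega_finite by (intro integrable_real_indicator) auto

lemma integrable_sq_imp:
  fixes g :: "R2 \<Rightarrow> real"
  assumes [measurable]: "g \<in> borel_measurable borel" and g0: "\<And>z. z \<notin> Omega l \<Longrightarrow> g z = 0" and "integrable lborel (\<lambda>z. (g z)\<^sup>2)"
  shows "integrable lborel g"
proof (rule Bochner_Integration.integrable_bound[of _ "\<lambda>z. indicator (Omega l) z + (g z)\<^sup>2"])
  show "AE z in lborel. norm (g z) \<le> norm (indicator (Omega l) z + (g z)\<^sup>2)"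
  proof (rule AE_I2)
    fix z
    have "2 * \<bar>g z\<bar> \<le> 1 + (g z)\<^sup>2" using zero_le_power2[of "\<bar>g z\<bar> - 1"] by (simp add: power2_diff)
    then show "norm (g z) \<le> norm (indicator (Omega l) z + (g z)\<^sup>2)"
      using g0[of z] by (cases "z \<in> Omega l") auto
  qed
qed (use assms integrable_ind_Omega in auto)

text \<open>A weak derivative that is Borel and vanishes off the rectangle, so that Fubini's theorem for
  \<^term>\<open>lborel\<close> applies; \<^const>\<open>wd\<close> itself is only Lebesgue measurable.\<close>

definition wrep :: "real \<Rightarrow> bool list \<Rightarrow> (R2 \<Rightarrow> real) \<Rightarrow> (R2 \<Rightarrow> real) \<Rightarrow> bool" where
  "wrep l bs u g \<longleftrightarrow> g \<in> borel_measurable borel \<and> (\<forall>z. z \<notin> Omega l \<longrightarrow> g z = 0) \<and>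
     integrable lborel (\<lambda>z. (g z)\<^sup>2) \<and> is_weak_deriv (Omega l) bs u g"

lemma wrep_integrable: "wrep l bs u g \<Longrightarrow> integrable lborel g"
  unfolding wrep_def using integrable_sq_imp by blast

lemma test_fun_borel: "test_fun U \<phi> \<Longrightarrow> \<phi> \<in> borel_measurable borel"
  unfolding test_fun_def by (metis borel_measurable_continuous_onI iter_pdiff.simps(1))

lemma is_weak_deriv_cong_AE:
  assumes "is_weak_deriv U bs u g" and U: "U \<in> sets lebesgue" and ae: "AE z in lebesgue. z \<in> U \<longrightarrow> g z = h z"
    and h: "set_borel_measurable lebesgue U h"
  shows "is_weak_deriv U bs u h"
  unfolding is_weak_deriv_def
proof (intro allI impI)
  fix \<phi> assume \<phi>: "test_fun U \<phi>"
  have \<phi>m: "\<phi> \<in> borel_measurable lebesgue" using test_fun_borel[OF \<phi>] by (rule borel_lebesgue)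
  have m: "(\<lambda>z. indicator U z *\<^sub>R (h z * \<phi> z)) \<in> borel_measurable lebesgue"
    using borel_measurable_times[OF h[unfolded set_borel_measurable_def] \<phi>m] by (simp add: mult.assoc)
  have i: "set_integrable lebesgue U (\<lambda>z. g z * \<phi> z)"
    using assms(1) \<phi> unfolding is_weak_deriv_def by blast
  have ae': "AE z in lebesgue. indicator U z *\<^sub>R (g z * \<phi> z) = indicator U z *\<^sub>R (h z * \<phi> z)"
    using ae by eventually_elim (auto simp: indicator_def)
  have "set_integrable lebesgue U (\<lambda>z. h z * \<phi> z)"
    using i unfolding set_integrable_def by (subst integrable_cong_AE[OF m _ AE_symmetric[OF ae']]) auto
  moreover have "(LINT z:U|lebesgue. h z * \<phi> z) = (LINT z:U|lebesgue. g z * \<phi> z)"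
    using i unfolding set_lebesgue_integral_def set_integrable_def
    by (intro integral_cong_AE m AE_symmetric[OF ae']) auto
  ultimately show "set_integrable lebesgue U (\<lambda>z. u z * iter_pdiff bs \<phi> z) \<and> set_integrable lebesgue U (\<lambda>z. h z * \<phi> z) \<and>
      (LINT z:U|lebesgue. u z * iter_pdiff bs \<phi> z) = (- 1) ^ length bs * (LINT z:U|lebesgue. h z * \<phi> z)"
    using assms(1) \<phi> unfolding is_weak_deriv_def by simp
qed

lemma borel_version:
  fixes g :: "R2 \<Rightarrow> real"
  assumes "set_borel_measurable lebesgue (Omega l) g"
  obtains h where "h \<in> borel_measurable borel" "\<And>z. z \<notin> Omega l \<Longrightarrow> h z = 0" "AE z in lebesgue. z \<in> Omega l \<longrightarrow> g z = h z"
proof -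
  obtain h where h: "h \<in> borel_measurable lborel" "AE z in lborel. indicator (Omega l) z *\<^sub>R g z = h z"
    using completion_ex_borel_measurable_real[OF assms[unfolded set_borel_measurable_def]] by blast
  show thesis
  proof
    show "(\<lambda>z. indicator (Omega l) z * h z) \<in> borel_measurable borel" using h(1) by simp
    show "AE z in lebesgue. z \<in> Omega l \<longrightarrow> g z = indicator (Omega l) z * h z"
      using AE_completion[OF h(2)] by eventually_elim auto
  qed simp
qed

lemma wrep_exists:
  assumes "L2_on (Omega l) g" "is_weak_deriv (Omega l) bs u g"
  obtains h where "wrep l bs u h" "AE z in lebesgue. z \<in> Omega l \<longrightarrow> g z = h z"
proof -
  obtain h where h: "h \<in> borel_measurable borel" "\<And>z. z \<notin> Omega l \<Longrightarrow> h z = 0" "AE z in lebesgue. z \<in> Omega l \<longrightarrow> g z = h z"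
    using borel_version assms(1) unfolding L2_on_def by blast
  have hl: "h \<in> borel_measurable lebesgue" using h(1) by (rule borel_lebesgue)
  have "set_borel_measurable lebesgue (Omega l) h"
    unfolding set_borel_measurable_def using h(1) by (intro borel_lebesgue borel_measurable_scaleR) auto
  then have w: "is_weak_deriv (Omega l) bs u h"
    using is_weak_deriv_cong_AE[OF assms(2) _ h(3)] by simp
  have "integrable lebesgue (\<lambda>z. (h z)\<^sup>2)"
  proof (subst integrable_cong_AE[of _ _ "\<lambda>z. indicator (Omega l) z *\<^sub>R (g z)\<^sup>2"])
    show "integrable lebesgue (\<lambda>z. indicator (Omega l) z *\<^sub>R (g z)\<^sup>2)"
      using assms(1) by (simp add: L2_on_def set_integrable_def)
    then show "(\<lambda>z. indicator (Omega l) z *\<^sub>R (g z)\<^sup>2) \<in> borel_measurable lebesgue" by (rule borel_measurable_integrable)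
    show "AE z in lebesgue. (h z)\<^sup>2 = indicator (Omega l) z *\<^sub>R (g z)\<^sup>2"
      using h(3) by eventually_elim (use h(2) in \<open>auto simp: indicator_def\<close>)
  qed (use hl in simp)
  then have "integrable lborel (\<lambda>z. (h z)\<^sup>2)" using h(1) by (simp add: integrable_completion)
  then show thesis using that[of h] h w unfolding wrep_def by auto
qed

section \<open>Testing weak derivatives with products\<close>

definition supp_in :: "(real \<Rightarrow> real) \<Rightarrow> real \<Rightarrow> real \<Rightarrow> bool" where
  "supp_in f lo hi \<longleftrightarrow> (\<exists>p q. lo < p \<and> q < hi \<and> (\<forall>x. x \<notin> {p..q} \<longrightarrow> f x = 0))"

text \<open>The rectangle identities draw on the weak derivative through this equation alone. It is
  phrased over \<open>lborel\<close>, with \<open>u\<close> cut off to the open rectangle, so that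
  Fubini's theorem is at hand.\<close>

lemma wrep_test:
  assumes w: "wrep l bs u g" and u: "continuous_on (closure (Omega l)) u"
    and ab: "smooth a" "smooth b" "supp_in a 0 pi" "supp_in b (-l) l"
  shows "(LINT z|lborel. (indicator (Omega l) z * u z) * ((deriv ^^ count_list bs True) a (fst z) * (deriv ^^ count_list bs False) b (snd z)))
     = (-1) ^ length bs * (LINT z|lborel. g z * (a (fst z) * b (snd z)))"
proof -
  have t: "test_fun (Omega l) (ptens a b)"
    using ab unfolding supp_in_def by (elim exE conjE) (rule test_fun_ptens, auto)
  have m[measurable]: "f \<in> borel_measurable borel" if "f \<in> {a, b, (deriv ^^ count_list bs True) a, (deriv ^^ count_list bs False) b}" for f
    using that ab smooth_borel smooth_deriv_iter by auto
  have um: "(\<lambda>z. indicator (Omega l) z * u z) \<in> borel_measurable borel"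
    using borel_measurable_continuous_on_indicator[OF Omega_borel continuous_on_subset[OF u closure_subset]] by simp
  have g: "g \<in> borel_measurable borel" "\<And>z. z \<notin> Omega l \<Longrightarrow> g z = 0" using w by (auto simp: wrep_def)
  have "(LINT z:Omega l|lebesgue. u z * iter_pdiff bs (ptens a b) z) = (-1) ^ length bs * (LINT z:Omega l|lebesgue. g z * ptens a b z)"
    using w t unfolding wrep_def is_weak_deriv_def by blast
  moreover have "(LINT z:Omega l|lebesgue. g z * ptens a b z) = (LINT z|lborel. g z * (a (fst z) * b (snd z)))"
  proof -
    have "(LINT z:Omega l|lebesgue. g z * ptens a b z) = (LINT z|lebesgue. g z * (a (fst z) * b (snd z)))"
      unfolding set_lebesgue_integral_def using g(2) by (intro Bochner_Integration.integral_cong refl) (auto simp: indicator_def)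
    also have "\<dots> = (LINT z|lborel. g z * (a (fst z) * b (snd z)))"
      using g(1) m by (intro integral_completion) (simp_all, measurable)
    finally show ?thesis .
  qed
  moreover have "(LINT z:Omega l|lebesgue. u z * iter_pdiff bs (ptens a b) z) =
     (LINT z|lborel. (indicator (Omega l) z * u z) * ((deriv ^^ count_list bs True) a (fst z) * (deriv ^^ count_list bs False) b (snd z)))"
  proof -
    have "(LINT z:Omega l|lebesgue. u z * iter_pdiff bs (ptens a b) z) =
     (LINT z|lebesgue. (indicator (Omega l) z * u z) * ((deriv ^^ count_list bs True) a (fst z) * (deriv ^^ count_list bs False) b (snd z)))"
      unfolding set_lebesgue_integral_def iter_pdiff_ptens[OF ab(1,2)] by (simp add: mult.assoc)
    also have "\<dots> = (LINT z|lborel. (indicator (Omega l) z * u z) * ((deriv ^^ count_list bs True) a (fst z) * (deriv ^^ count_list bs False) b (snd z)))"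
      using um m by (intro integral_completion) (simp, measurable)
    finally show ?thesis .
  qed
  ultimately show ?thesis by simp
qed

section \<open>Functions determined by their integrals over rectangles\<close>

abbreviation rect :: "real \<Rightarrow> real \<Rightarrow> real \<Rightarrow> real \<Rightarrow> R2 \<Rightarrow> real" where
  "rect p q r s \<equiv> \<lambda>z. indicator {p<..q} (fst z) * indicator {r<..s} (snd z)"

lemma eventually_inverse_less: "(e::real) > 0 \<Longrightarrow> \<forall>\<^sub>F n in sequentially. 1 / real (Suc n) < e"
  using order_tendstoD(2)[OF LIMSEQ_inverse_real_of_nat, of e] by (simp add: inverse_eq_divide)

text \<open>The rectangle hypotheses concern half-open intervals whose ends lie strictly inside
  \<open>{c<..<d}\<close>. The \<open>max\<close> and \<open>min\<close> enforce this, and moving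
  the right end \<open>b\<close> inwards turns the closed end into an open one in the limit.\<close>

lemma indicator_Ioc_approx:
  fixes a b c d x :: real
  assumes "x \<in> {c<..<d}"
  shows "(\<lambda>n. indicator {max a (c + 1 / real (Suc n))<..min (b - 1 / real (Suc n)) (d - 1 / real (Suc n))} x :: real)
     \<longlonglongrightarrow> indicator {a<..<b} x"
proof (rule tendsto_eventually)
  show "\<forall>\<^sub>F n in sequentially. indicator {max a (c + 1 / real (Suc n))<..min (b - 1 / real (Suc n)) (d - 1 / real (Suc n))} x
     = (indicator {a<..<b} x :: real)"
  proof (cases "a < x \<and> x < b")
    case True
    have "\<forall>\<^sub>F n in sequentially. 1 / real (Suc n) < min (min (x - c) (d - x)) (b - x)"
      by (rule eventually_inverse_less) (use assms True in auto)
    then show ?thesis by eventually_elim (use True in \<open>auto simp: indicator_def\<close>)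
  next
    case False
    show ?thesis
    proof (rule always_eventually, rule allI)
      fix n
      have "1 / real (Suc n) > 0" by simp
      then show "indicator {max a (c + 1 / real (Suc n))<..min (b - 1 / real (Suc n)) (d - 1 / real (Suc n))} x
         = (indicator {a<..<b} x :: real)"
        using False unfolding indicator_def by (simp only: greaterThanAtMost_iff greaterThanLessThan_iff) (smt (verit))
    qed
  qed
qed

text \<open>Open boxes form an intersection-stable generator of the Borel sets, so the positive and
  the negative part of \<open>d\<close>, read as densities, define the same measure and must
  coincide almost everywhere.\<close>

lemma rect_AE_zero:
  fixes d :: "R2 \<Rightarrow> real"
  assumes d: "integrable lborel d" and d0: "\<And>z. z \<notin> Omega l \<Longrightarrow> d z = 0"
    and rect: "\<And>p q r s. 0 < p \<Longrightarrow> p \<le> q \<Longrightarrow> q < pi \<Longrightarrow> -l < r \<Longrightarrow> r \<le> s \<Longrightarrow> s < l \<Longrightarrow> (LINT z|lborel. d z * rect p q r s z) = 0"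
  shows "AE z in lborel. d z = 0"
proof -
  have dm[measurable]: "d \<in> borel_measurable borel" using d by auto
  have box: "(LINT z|lborel. d z * (indicator {a1<..<b1} (fst z) * indicator {a2<..<b2} (snd z))) = 0" for a1 a2 b1 b2 :: real
  proof (rule LIMSEQ_unique)
    define P where "P n = max a1 (0 + 1 / real (Suc n))" for n
    define Q where "Q n = min (b1 - 1 / real (Suc n)) (pi - 1 / real (Suc n))" for n
    define R where "R n = max a2 (-l + 1 / real (Suc n))" for n
    define S where "S n = min (b2 - 1 / real (Suc n)) (l - 1 / real (Suc n))" for n
    show "(\<lambda>n. LINT z|lborel. d z * rect (P n) (Q n) (R n) (S n) z) \<longlonglongrightarrow>
      (LINT z|lborel. d z * (indicator {a1<..<b1} (fst z) * indicator {a2<..<b2} (snd z)))"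
    proof (rule integral_dominated_convergence[where w = "\<lambda>z. \<bar>d z\<bar>"])
      show "AE z in lborel. (\<lambda>n. d z * rect (P n) (Q n) (R n) (S n) z) \<longlonglongrightarrow> d z * (indicator {a1<..<b1} (fst z) * indicator {a2<..<b2} (snd z))"
      proof (rule AE_I2)
        fix z
        show "(\<lambda>n. d z * rect (P n) (Q n) (R n) (S n) z) \<longlonglongrightarrow> d z * (indicator {a1<..<b1} (fst z) * indicator {a2<..<b2} (snd z))"
        proof (cases "z \<in> Omega l")
          case True
          then have "fst z \<in> {0<..<pi}" "snd z \<in> {-l<..<l}" by (auto simp: Omega_def)
          then show ?thesis unfolding P_def Q_def R_def S_def
            by (intro tendsto_mult tendsto_const indicator_Ioc_approx)
        qed (simp add: d0)
      qed
    qed (use d in \<open>auto simp: indicator_def\<close>)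
    have "(LINT z|lborel. d z * rect (P n) (Q n) (R n) (S n) z) = 0" for n
    proof (cases "P n \<le> Q n \<and> R n \<le> S n")
      case True
      have "1 / real (Suc n) > 0" by simp
      then show ?thesis using True by (intro rect) (auto simp: P_def Q_def R_def S_def less_max_iff_disj min_less_iff_disj)
    next
      case False
      then have "rect (P n) (Q n) (R n) (S n) = (\<lambda>z. 0)" by (intro ext) auto
      then show ?thesis by (simp only: fun_eq_iff) simp
    qed
    then show "(\<lambda>n. LINT z|lborel. d z * rect (P n) (Q n) (R n) (S n) z) \<longlonglongrightarrow> 0" by simp
  qed
  \<comment> \<open>\<open>ennreal\<close> sends negative numbers to 0, so these are the positive
    and the negative part of \<open>d\<close>. Integrability keeps both measures finite on boxes,
    which lets an equality of real integrals be read as an equality of measures.\<close>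
  let ?f = "\<lambda>z. ennreal (d z)" and ?g = "\<lambda>z. ennreal (- d z)"
  have fin: "(\<integral>\<^sup>+z. ennreal (c * d z) * indicator A z \<partial>lborel) < \<infinity>" if "A \<in> sets borel" "\<bar>c\<bar> = 1" for c and A :: "R2 set"
  proof -
    have "(\<integral>\<^sup>+z. ennreal (c * d z) * indicator A z \<partial>lborel) \<le> (\<integral>\<^sup>+z. ennreal (norm (d z)) \<partial>lborel)"
    proof (rule nn_integral_mono)
      fix z
      have "c * d z \<le> \<bar>c * d z\<bar>" by simp
      then show "ennreal (c * d z) * indicator A z \<le> ennreal (norm (d z))"
        using that(2) by (auto simp: indicator_def abs_mult intro!: ennreal_leI)
    qed
    also have "\<dots> < \<infinity>" using d by (simp add: integrable_iff_bounded)
    finally show ?thesis .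
  qed
  have "density lborel ?f = density lborel ?g"
  proof (rule measure_eqI_generator_eq)
    let ?E = "range (\<lambda>(a, b). box a b::R2 set)"
    show "Int_stable ?E" by (auto simp: Int_stable_def box_Int_box)
    show "?E \<subseteq> Pow UNIV" "sets (density lborel ?f) = sigma_sets UNIV ?E" "sets (density lborel ?g) = sigma_sets UNIV ?E"
      by (simp_all add: borel_eq_box)
    let ?A = "\<lambda>n::nat. box (- (real n *\<^sub>R One)) (real n *\<^sub>R One) :: R2 set"
    show "range ?A \<subseteq> ?E" "(\<Union>i. ?A i) = UNIV"
      unfolding UN_box_eq_UNIV by auto
    show "emeasure (density lborel ?f) (?A i) \<noteq> \<infinity>" for i
      using fin[of "?A i" 1] by (subst emeasure_density) auto
    fix X assume "X \<in> ?E"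
    then obtain a b where X: "X = box a b" by auto
    have [measurable]: "X \<in> sets borel" using X by simp
    have "indicator X z = (indicator {fst a<..<fst b} (fst z) * indicator {snd a<..<snd b} (snd z) :: real)" for z
      unfolding X by (cases z; cases a; cases b) (auto simp: box_def Basis_prod_def indicator_def)
    then have "(LINT z|lborel. indicator X z * d z) = 0" using box by (simp add: mult.commute)
    moreover have i: "integrable lborel (\<lambda>z. indicator X z * d z)" using integrable_indicator_mult[OF d, of X] by simp
    ultimately have "enn2real (\<integral>\<^sup>+z. ennreal (indicator X z * d z) \<partial>lborel) = enn2real (\<integral>\<^sup>+z. ennreal (- (indicator X z * d z)) \<partial>lborel)"
      by (simp add: real_lebesgue_integral_def)
    moreover have "(\<integral>\<^sup>+z. ennreal (indicator X z * d z) \<partial>lborel) = (\<integral>\<^sup>+z. ennreal (1 * d z) * indicator X z \<partial>lborel)"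
      "(\<integral>\<^sup>+z. ennreal (- (indicator X z * d z)) \<partial>lborel) = (\<integral>\<^sup>+z. ennreal (-1 * d z) * indicator X z \<partial>lborel)"
      by (auto intro!: nn_integral_cong simp: indicator_def)
    ultimately have e: "enn2real (\<integral>\<^sup>+z. ennreal (1 * d z) * indicator X z \<partial>lborel) = enn2real (\<integral>\<^sup>+z. ennreal (-1 * d z) * indicator X z \<partial>lborel)"
      by simp
    have "A = B" if "enn2real A = enn2real B" "A < \<infinity>" "B < \<infinity>" for A B :: ennreal
      using that by (metis ennreal_enn2real infinity_ennreal_def)
    from this[OF e] have "(\<integral>\<^sup>+z. ennreal (1 * d z) * indicator X z \<partial>lborel) = (\<integral>\<^sup>+z. ennreal (-1 * d z) * indicator X z \<partial>lborel)"
      using fin[of X 1] fin[of X "-1"] by simp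
    then show "emeasure (density lborel ?f) X = emeasure (density lborel ?g) X"
      by (subst (1 2) emeasure_density) auto
  qed
  then have "AE z in lborel. ?f z = ?g z"
    using sigma_finite_measure.density_unique_iff[OF sigma_finite_lborel, of ?f ?g] by simp
  then show ?thesis
  proof eventually_elim
    case (elim z)
    show ?case
    proof (cases "d z \<ge> 0")
      case True
      then have "ennreal (d z) = 0" using elim ennreal_neg[of "- d z"] by (simp add: ennreal_neg)
      then show ?thesis using True by simp
    next
      case False
      then have "ennreal (- d z) = 0" using elim ennreal_neg[of "d z"] by simp
      then show ?thesis using False by simp
    qed
  qed
qed

text \<open>The second derivative of the ramp is \<open>\<delta>\<^sub>p - \<delta>\<^sub>q - m (\<delta>\<^sub>e - \<delta>\<^bsub>\<pi>-e\<^esub>)\<close>; the slope \<open>m\<close> is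
  the one that makes the function vanish to the right of \<open>\<pi> - e\<close>.\<close>

definition ramp :: "real \<Rightarrow> real \<Rightarrow> real \<Rightarrow> real \<Rightarrow> real" where
  "ramp e p q x = max (x - p) 0 - max (x - q) 0 - (q - p) / (pi - 2 * e) * (max (x - e) 0 - max (x - (pi - e)) 0)"

text \<open>A mollifier \<open>\<rho>\<close>, its primitive \<open>S\<close> and the primitive \<open>Q\<close> of \<open>S\<close>. After rescaling at \<open>p\<close> they tend
  to the Dirac mass at \<open>p\<close>, to the indicator of \<open>{p<..}\<close> and to the positive part of \<open>x - p\<close>.\<close>

locale kernels =
  fixes l :: real and \<rho> S Q :: "real \<Rightarrow> real"
  assumes l: "l > 0" and smooth_rho: "smooth \<rho>" and smooth_S: "smooth S" and smooth_Q: "smooth Q"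
    and DS: "\<And>x. (S has_real_derivative \<rho> x) (at x)" and DQ: "\<And>x. (Q has_real_derivative S x) (at x)"
    and rho0: "\<And>x. \<rho> x \<ge> 0" and rho_out: "\<And>x. x \<le> 0 \<or> 1 \<le> x \<Longrightarrow> \<rho> x = 0"
    and S_le: "\<And>x. x \<le> 0 \<Longrightarrow> S x = 0" and S_ge: "\<And>x. 1 \<le> x \<Longrightarrow> S x = 1" and S_bd: "\<And>x. 0 \<le> S x \<and> S x \<le> 1"
    and Q_le: "\<And>x. x \<le> 0 \<Longrightarrow> Q x = 0" and Q_ge: "\<And>x. 1 \<le> x \<Longrightarrow> Q x = x - 1 + Q 1" and Q_bd: "\<And>x. \<bar>Q x - max x 0\<bar> \<le> 1"
begin

abbreviation (input) N :: "nat \<Rightarrow> real" where "N n \<equiv> real (Suc n)"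
definition rn where "rn n p x = N n * \<rho> (N n * (x - p))"
definition sn where "sn n p x = S (N n * (x - p))"
definition qn where "qn n p x = Q (N n * (x - p)) / N n"

lemma D_sn: "(sn n p has_real_derivative rn n p x) (at x)"
proof -
  have "((\<lambda>x. S (N n * (x - p))) has_real_derivative \<rho> (N n * (x - p)) * (N n * (1 - 0))) (at x)"
    by (rule DERIV_chain2[OF DS]) (intro DERIV_cmult DERIV_diff DERIV_ident DERIV_const)
  then show ?thesis by (simp add: sn_def[abs_def] rn_def mult.commute)
qed

lemma D_qn: "(qn n p has_real_derivative sn n p x) (at x)"
proof -
  have "((\<lambda>x. Q (N n * (x - p)) / N n) has_real_derivative (S (N n * (x - p)) * (N n * (1 - 0))) / N n) (at x)"
    by (intro DERIV_cdivide DERIV_chain2[OF DQ] DERIV_cmult DERIV_diff DERIV_ident DERIV_const)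
  then show ?thesis by (simp add: qn_def[abs_def] sn_def)
qed

lemma smooth_rn: "smooth (rn n p)" unfolding rn_def[abs_def] by (intro smooth_cmult smooth_shift smooth_rho)
lemma smooth_sn: "smooth (sn n p)" unfolding sn_def[abs_def] by (intro smooth_shift smooth_S)
lemma smooth_qn: "smooth (qn n p)" by (rule smooth_antideriv[OF D_qn smooth_sn])

lemma kernels_borel[measurable]:
  "\<rho> \<in> borel_measurable borel" "rn n p \<in> borel_measurable borel" "sn n p \<in> borel_measurable borel" "qn n p \<in> borel_measurable borel"
  using smooth_rho smooth_rn smooth_sn smooth_qn smooth_borel by auto

lemma rho_integral: "has_bochner_integral lborel \<rho> 1"
proof -
  have "has_bochner_integral lborel (\<lambda>x. \<rho> x * indicator {0 .. 1} x) (S 1 - S 0)"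
    using DS smooth_continuous[OF smooth_rho, of UNIV]
    by (intro has_bochner_integral_FTC_Icc_real) (auto simp: continuous_on_eq_continuous_at)
  moreover have "\<rho> x * indicator {0 .. 1} x = \<rho> x" for x using rho_out[of x] by (cases "x \<in> {0..1}") auto
  ultimately show ?thesis using S_le[of 0] S_ge[of 1] by simp
qed

lemma rn_nonneg: "rn n p x \<ge> 0" by (simp add: rn_def rho0)

lemma rn_integral_eq: "(LINT x|lborel. rn n p x * h x) = (LINT x|lborel. \<rho> x * h (p + x / N n))" for h :: "real \<Rightarrow> real"
proof -
  have "(LINT x|lborel. rn n p x * h x) = (1 / N n) * (LINT x|lborel. rn n p (p + 1 / N n * x) * h (p + 1 / N n * x))"
    by (subst lborel_integral_real_affine[of "1 / N n" _ p]) auto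
  also have "(LINT x|lborel. rn n p (p + 1 / N n * x) * h (p + 1 / N n * x)) = (LINT x|lborel. N n * (\<rho> x * h (p + x / N n)))"
    by (rule Bochner_Integration.integral_cong) (auto simp: rn_def)
  finally show ?thesis by simp
qed

lemma rn_has_integral: "integrable lborel (rn n p)" "(LINT x|lborel. rn n p x) = 1"
proof -
  show i: "(LINT x|lborel. rn n p x) = 1"
    using rn_integral_eq[of n p "\<lambda>_. 1"] rho_integral by (simp add: has_bochner_integral_iff)
  show "integrable lborel (rn n p)" using i not_integrable_integral_eq by fastforce
qed

lemma rn_bound:
  assumes h: "\<And>x. \<bar>h x\<bar> \<le> B" and [measurable]: "h \<in> borel_measurable borel"
  shows "integrable lborel (\<lambda>x. h x * rn n p x)" "\<bar>LINT x|lborel. h x * rn n p x\<bar> \<le> B"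
proof -
  show i: "integrable lborel (\<lambda>x. h x * rn n p x)"
    by (rule integrable_bounded_mult[OF rn_has_integral(1) _ h]) simp
  have "\<bar>LINT x|lborel. h x * rn n p x\<bar> \<le> (LINT x|lborel. B * rn n p x)"
  proof (rule order_trans[OF integral_abs_bound integral_mono])
    show "integrable lborel (\<lambda>x. \<bar>h x * rn n p x\<bar>)" using i by simp
    show "\<bar>h x * rn n p x\<bar> \<le> B * rn n p x" for x
      using mult_right_mono[OF h rn_nonneg] rn_nonneg by (simp add: abs_mult)
  qed (use rn_has_integral(1) in simp)
  then show "\<bar>LINT x|lborel. h x * rn n p x\<bar> \<le> B" using rn_has_integral(2) by simp
qed

text \<open>After the substitution the kernel is fixed and only the argument of \<open>h\<close>
  moves. Continuity at the single point \<open>p\<close> then suffices, which matters because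
  \<open>h\<close> will be a section of a function cut off at the boundary.\<close>

lemma delta_limit:
  assumes [measurable]: "h \<in> borel_measurable borel" and hB: "\<And>x. \<bar>h x\<bar> \<le> B" and c: "isCont h p"
  shows "(\<lambda>n. LINT x|lborel. h x * rn n p x) \<longlonglongrightarrow> h p"
proof -
  have "(\<lambda>n. LINT x|lborel. \<rho> x * h (p + x / N n)) \<longlonglongrightarrow> (LINT x|lborel. \<rho> x * h p)"
  proof (rule integral_dominated_convergence[where w = "\<lambda>x. B * \<rho> x"])
    show "AE x in lborel. (\<lambda>n. \<rho> x * h (p + x / N n)) \<longlonglongrightarrow> \<rho> x * h p"
    proof (intro AE_I2 tendsto_mult tendsto_const)
      fix x
      have "(\<lambda>n. p + x * inverse (N n)) \<longlonglongrightarrow> p + x * 0"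
        by (intro tendsto_intros LIMSEQ_inverse_real_of_nat)
      then have "(\<lambda>n. p + x / N n) \<longlonglongrightarrow> p" by (simp add: divide_inverse)
      then show "(\<lambda>n. h (p + x / N n)) \<longlonglongrightarrow> h p" by (rule isCont_tendsto_compose[OF c])
    qed
    show "AE x in lborel. norm (\<rho> x * h (p + x / N n)) \<le> B * \<rho> x" for n
      using mult_right_mono[OF hB rho0] rho0 by (intro AE_I2) (simp add: abs_mult mult.commute)
  qed (use rho_integral in \<open>auto simp: has_bochner_integral_iff\<close>)
  then show ?thesis using rho_integral rn_integral_eq[of _ p h] by (simp add: has_bochner_integral_iff mult.commute)
qed

lemma sn_limit: "(\<lambda>n. sn n p x) \<longlonglongrightarrow> indicator {p<..} x"
proof (rule tendsto_eventually)
  show "\<forall>\<^sub>F n in sequentially. sn n p x = indicator {p<..} x"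
  proof (cases "p < x")
    case True
    then have "\<forall>\<^sub>F n in sequentially. 1 / N n < x - p" by (intro eventually_inverse_less) auto
    then show ?thesis
    proof eventually_elim
      case (elim n)
      have "1 \<le> N n * (x - p)" using elim by (simp add: field_simps)
      then show ?case using True S_ge by (simp add: sn_def)
    qed
  next
    case False
    then have "N n * (x - p) \<le> 0" for n by (simp add: mult_le_0_iff)
    then show ?thesis using False S_le by (simp add: sn_def)
  qed
qed

lemma sn_bound: "0 \<le> sn n p x" "sn n p x \<le> 1" using S_bd by (auto simp: sn_def)

lemma qn_err: "\<bar>qn n p x - max (x - p) 0\<bar> \<le> 1 / N n"
proof -
  have "max (x - p) 0 = max (N n * (x - p)) 0 / N n"
  proof (cases "x \<le> p")
    case True
    then have "N n * (x - p) \<le> 0" by (simp add: mult_le_0_iff)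
    then show ?thesis using True by simp
  next
    case False
    then have "N n * (x - p) \<ge> 0" by simp
    then have "max (N n * (x - p)) 0 = N n * (x - p)" by (rule max_absorb1)
    then show ?thesis using False by simp
  qed
  then have "qn n p x - max (x - p) 0 = (Q (N n * (x - p)) - max (N n * (x - p)) 0) / N n"
    by (simp only: qn_def diff_divide_distrib)
  then show ?thesis using Q_bd[of "N n * (x - p)"] by (simp add: abs_divide divide_right_mono)
qed

lemma qn_limit: "(\<lambda>n. qn n p x) \<longlonglongrightarrow> max (x - p) 0"
proof -
  have "(\<lambda>n. 1 / N n) \<longlonglongrightarrow> 0" using LIMSEQ_inverse_real_of_nat by (simp add: inverse_eq_divide)
  then have "(\<lambda>n. qn n p x - max (x - p) 0) \<longlonglongrightarrow> 0"
    by (rule Lim_null_comparison[rotated]) (use qn_err in auto)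
  then show ?thesis by (simp add: LIM_zero_iff)
qed

lemma qn_out: "x \<le> p \<Longrightarrow> qn n p x = 0" "p + 1 / N n \<le> x \<Longrightarrow> qn n p x = x - p + (Q 1 - 1) / N n"
proof -
  show "x \<le> p \<Longrightarrow> qn n p x = 0" using Q_le[of "N n * (x - p)"] by (simp add: qn_def mult_le_0_iff)
  assume "p + 1 / N n \<le> x"
  then have "1 \<le> N n * (x - p)" by (simp add: field_simps)
  from Q_ge[OF this] show "qn n p x = x - p + (Q 1 - 1) / N n" by (simp add: qn_def field_simps)
qed

lemma sn_out: "x \<le> p \<Longrightarrow> sn n p x = 0" "p + 1 / N n \<le> x \<Longrightarrow> sn n p x = 1"
proof -
  show "x \<le> p \<Longrightarrow> sn n p x = 0" using S_le[of "N n * (x - p)"] by (simp add: sn_def mult_le_0_iff)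
  assume "p + 1 / N n \<le> x"
  then have "1 \<le> N n * (x - p)" by (simp add: field_simps)
  from S_ge[OF this] show "sn n p x = 1" by (simp add: sn_def)
qed

definition step where "step n p q x = sn n p x - sn n q x"

lemma smooth_step: "smooth (step n p q)" unfolding step_def[abs_def] by (intro smooth_diff smooth_sn)
lemma step_borel[measurable]: "step n p q \<in> borel_measurable borel" using smooth_step smooth_borel by blast
lemma deriv_step: "deriv (step n p q) = (\<lambda>x. rn n p x - rn n q x)"
  unfolding step_def[abs_def] by (intro ext DERIV_imp_deriv DERIV_diff D_sn)
lemma step_bound: "\<bar>step n p q x\<bar> \<le> 1" using sn_bound[of n p x] sn_bound[of n q x] by (auto simp: step_def)
lemma step_limit: assumes "p \<le> q" shows "(\<lambda>n. step n p q x) \<longlonglongrightarrow> indicator {p<..q} x"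
proof -
  have "(\<lambda>n. step n p q x) \<longlonglongrightarrow> indicator {p<..} x - indicator {q<..} x"
    unfolding step_def by (intro tendsto_diff sn_limit)
  moreover have "indicator {p<..} x - indicator {q<..} x = (indicator {p<..q} x :: real)" using assms by (auto simp: indicator_def)
  ultimately show ?thesis by simp
qed
text \<open>The transition layer at \<open>q\<close> reaches \<open>1 / N n\<close> to the right of
  \<open>q\<close>, so the support fits into the open interval only from some \<open>n\<close>
  on.\<close>

lemma step_supp: assumes "lo < p" "p \<le> q" "q < hi" shows "\<forall>\<^sub>F n in sequentially. supp_in (step n p q) lo hi"
proof -
  have "\<forall>\<^sub>F n in sequentially. 1 / N n < hi - q" using assms by (intro eventually_inverse_less) auto
  then show ?thesis
  proof eventually_elim
    case (elim n)
    have "step n p q x = 0" if "x \<notin> {p..q + 1 / N n}" for x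
    proof -
      show ?thesis
      proof (cases "x < p")
        case True
        then show ?thesis using assms by (simp add: step_def sn_out(1))
      next
        case False
        then have "q + 1 / N n \<le> x" using that by simp
        moreover from this have "p + 1 / N n \<le> x" using assms by linarith
        ultimately show ?thesis by (simp add: step_def sn_out(2))
      qed
    qed
    then show ?case unfolding supp_in_def using elim assms by (intro exI[of _ p] exI[of _ "q + 1 / N n"]) auto
  qed
qed

definition rampn where "rampn n e p q x = qn n p x - qn n q x - (q - p) / (pi - 2 * e) * (qn n e x - qn n (pi - e) x)"

lemma smooth_rampn: "smooth (rampn n e p q)"
  unfolding rampn_def[abs_def] by (intro smooth_diff smooth_cmult smooth_qn)
lemma rampn_borel[measurable]: "rampn n e p q \<in> borel_measurable borel" using smooth_rampn smooth_borel by blast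
lemma deriv2_rampn: "deriv (deriv (rampn n e p q)) = (\<lambda>x. rn n p x - rn n q x - (q - p) / (pi - 2 * e) * (rn n e x - rn n (pi - e) x))"
proof -
  have "deriv (rampn n e p q) = (\<lambda>x. sn n p x - sn n q x - (q - p) / (pi - 2 * e) * (sn n e x - sn n (pi - e) x))"
    unfolding rampn_def[abs_def] by (intro ext DERIV_imp_deriv DERIV_diff DERIV_cmult D_qn)
  then show ?thesis by (simp only:) (intro ext DERIV_imp_deriv DERIV_diff DERIV_cmult D_sn)
qed
lemma rampn_limit: "(\<lambda>n. rampn n e p q x) \<longlonglongrightarrow> ramp e p q x"
  unfolding rampn_def ramp_def by (intro tendsto_intros qn_limit)
lemma max_diff_bound: "p \<le> q \<Longrightarrow> 0 \<le> max (x - p) 0 - max (x - q) 0 \<and> max (x - p) 0 - max (x - q) 0 \<le> (q - p :: real)"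
  by (auto simp: max_def)
text \<open>Each difference of two \<open>qn\<close> is within 2 of a number between 0 and
  \<open>pi\<close>, and the slope is at most 1. Two such terms give \<open>2 * pi + 4\<close>; what
  counts is that the bound does not depend on \<open>n\<close>.\<close>

lemma rampn_bound: assumes "0 < e" "e \<le> p" "p \<le> q" "q \<le> pi - e" "e < pi / 2"
  shows "\<bar>rampn n e p q x\<bar> \<le> 2 * pi + 4"
proof -
  have m: "0 \<le> (q - p) / (pi - 2 * e)" "(q - p) / (pi - 2 * e) \<le> 1" using assms by (auto simp: field_simps)
  have E: "1 / N n \<le> 1" by simp
  define A where "A = qn n p x - qn n q x"
  define B where "B = qn n e x - qn n (pi - e) x"
  have "\<bar>A\<bar> \<le> pi + 2" "\<bar>B\<bar> \<le> pi + 2"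
  proof -
    have *: "\<bar>qn n a x - qn n b x\<bar> \<le> pi + 2" if "a \<le> b" "b - a \<le> pi" for a b
    proof -
      define M where "M c = max (x - c) 0" for c
      have "\<bar>qn n a x - M a\<bar> \<le> 1" "\<bar>qn n b x - M b\<bar> \<le> 1" "0 \<le> M a - M b" "M a - M b \<le> b - a"
        using qn_err[of n a x] qn_err[of n b x] E max_diff_bound[OF that(1), of x] unfolding M_def by linarith+
      then show ?thesis using that by linarith
    qed
    show "\<bar>A\<bar> \<le> pi + 2" "\<bar>B\<bar> \<le> pi + 2" unfolding A_def B_def using assms by (intro *, simp_all)+
  qed
  moreover have "\<bar>(q - p) / (pi - 2 * e) * B\<bar> \<le> 1 * \<bar>B\<bar>"
    unfolding abs_mult using m by (intro mult_right_mono) (simp_all only: abs_of_nonneg abs_ge_zero)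
  ultimately have "\<bar>A - (q - p) / (pi - 2 * e) * B\<bar> \<le> (pi + 2) + (pi + 2)"
    by (intro order_trans[OF abs_triangle_ineq4 add_mono]) simp_all
  then have "\<bar>A - (q - p) / (pi - 2 * e) * B\<bar> \<le> 2 * pi + 4" by simp
  then show ?thesis unfolding rampn_def A_def B_def .
qed
text \<open>To the right of all transition layers every \<open>qn\<close> is affine with the same
  offset \<open>(Q 1 - 1) / N n\<close>. The offsets cancel in pairs, and the slope is chosen so
  that the remaining constants cancel as well.\<close>

lemma rampn_supp: assumes "0 < e" "e \<le> p" "p \<le> q" "q \<le> pi - e" "e < pi / 2"
  shows "\<forall>\<^sub>F n in sequentially. supp_in (rampn n e p q) 0 pi"
proof -
  have "\<forall>\<^sub>F n in sequentially. 1 / N n < e" using assms by (intro eventually_inverse_less) auto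
  then show ?thesis
  proof eventually_elim
    case (elim n)
    have "rampn n e p q x = 0" if "x \<notin> {e..pi - e + 1 / N n}" for x
    proof (cases "x < e")
      case True then show ?thesis using assms by (simp add: rampn_def qn_out(1))
    next
      case False
      then have x: "pi - e + 1 / N n \<le> x" using that by simp
      then have "p + 1 / N n \<le> x" "q + 1 / N n \<le> x" "e + 1 / N n \<le> x" using assms by linarith+
      then have "rampn n e p q x = q - p - (q - p) / (pi - 2 * e) * (pi - 2 * e)"
        using x by (simp add: rampn_def qn_out(2))
      then show ?thesis using assms by simp
    qed
    then show ?case unfolding supp_in_def using elim assms by (intro exI[of _ e] exI[of _ "pi - e + 1 / N n"]) auto
  qed
qed

end

section \<open>Supports, sections and extension by zero\<close>

lemma compact_abs_bound:
  fixes f :: "'a::topological_space \<Rightarrow> real"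
  assumes "compact K" "continuous_on K f" obtains c where "\<And>x. x \<in> K \<Longrightarrow> \<bar>f x\<bar> \<le> c"
proof -
  have "bounded (f ` K)" using compact_imp_bounded compact_continuous_image assms by blast
  then obtain c where "\<forall>x\<in>f ` K. norm x \<le> c" unfolding bounded_iff by blast
  then show thesis by (intro that[of c]) auto
qed

lemma supp_in_deriv:
  assumes "smooth b" "supp_in b lo hi" shows "supp_in (deriv b) lo hi"
proof -
  obtain p q where pq: "lo < p" "q < hi" "\<And>x. x \<notin> {p..q} \<Longrightarrow> b x = 0" using assms(2) unfolding supp_in_def by blast
  have "deriv b x = 0" if "x \<notin> {p..q}" for x
  proof -
    have "open (- {p..q})" by (simp add: open_Compl)
    then have "\<forall>\<^sub>F y in nhds x. b y = 0"
      using eventually_nhds_in_open[of "- {p..q}" x] that pq(3) by (auto elim!: eventually_mono)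
    then have "(b has_real_derivative 0) (at x)" using DERIV_cong_ev[of x x b "\<lambda>_. 0" 0 0] by simp
    then show ?thesis by (rule DERIV_imp_deriv)
  qed
  then show ?thesis unfolding supp_in_def using pq by blast
qed

lemma supp_in_deriv_iter: "smooth b \<Longrightarrow> supp_in b lo hi \<Longrightarrow> supp_in ((deriv ^^ n) b) lo hi"
  by (induction n) (auto intro: supp_in_deriv smooth_deriv_iter)

lemma supp_in_bounded:
  assumes "smooth b" "supp_in b lo hi" obtains c where "\<And>x. \<bar>b x\<bar> \<le> c"
proof -
  obtain p q where pq: "lo < p" "q < hi" "\<And>x. x \<notin> {p..q} \<Longrightarrow> b x = 0" using assms(2) unfolding supp_in_def by blast
  obtain c where c: "\<And>x. x \<in> {p..q} \<Longrightarrow> \<bar>b x\<bar> \<le> c"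
    using compact_abs_bound[OF compact_Icc smooth_continuous[OF assms(1)]] by blast
  have "\<bar>b x\<bar> \<le> max c 0" for x using c[of x] pq(3)[of x] by (cases "x \<in> {p..q}") auto
  then show thesis by (rule that)
qed

lemma supp_in_zero: "supp_in b lo hi \<Longrightarrow> x \<notin> {lo<..<hi} \<Longrightarrow> b x = 0"
  unfolding supp_in_def by force

lemma bounded_Omega_integrable:
  fixes f :: "R2 \<Rightarrow> real"
  assumes "f \<in> borel_measurable borel" "\<And>z. z \<notin> Omega l \<Longrightarrow> f z = 0" "\<And>z. z \<in> Omega l \<Longrightarrow> \<bar>f z\<bar> \<le> B"
  shows "integrable lborel f"
  by (rule integrableI_bounded_set[where A = "Omega l" and B = B]) (use assms Omega_finite in auto)

lemma section_borel:
  fixes w :: "R2 \<Rightarrow> real"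
  assumes "w \<in> borel_measurable borel"
  shows "(\<lambda>y. w (p, y)) \<in> borel_measurable borel" "(\<lambda>x. w (x, y)) \<in> borel_measurable borel"
  by (rule measurable_compose[OF _ assms] borel_measurable_continuous_onI continuous_intros)+

lemma LINT_iterated:
  fixes f :: "R2 \<Rightarrow> real"
  assumes "integrable lborel f"
  shows "(LINT z|lborel. f z) = (LINT y|lborel. LINT x|lborel. f (x, y))"
    "(LINT z|lborel. f z) = (LINT x|lborel. LINT y|lborel. f (x, y))"
proof -
  have i: "integrable (lborel \<Otimes>\<^sub>M lborel) f" using assms by (simp add: lborel_prod)
  show "(LINT z|lborel. f z) = (LINT x|lborel. LINT y|lborel. f (x, y))"
    using lborel_pair.integral_fst'[OF i] by (simp add: lborel_prod)
  then show "(LINT z|lborel. f z) = (LINT y|lborel. LINT x|lborel. f (x, y))"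
    using lborel_pair.Fubini_integral[of "\<lambda>x y. f (x, y)"] i by simp
qed

definition ext0 :: "real \<Rightarrow> (R2 \<Rightarrow> real) \<Rightarrow> R2 \<Rightarrow> real" where
  "ext0 l u z = indicator (Omega l) z * u z"

lemma ext0_facts:
  assumes u: "continuous_on (closure (Omega l)) u"
  shows "ext0 l u \<in> borel_measurable borel" "z \<notin> Omega l \<Longrightarrow> ext0 l u z = 0"
    "z \<in> Omega l \<Longrightarrow> ext0 l u z = u z" "z \<in> Omega l \<Longrightarrow> isCont (ext0 l u) z"
proof -
  show "ext0 l u \<in> borel_measurable borel"
    using borel_measurable_continuous_on_indicator[OF Omega_borel continuous_on_subset[OF u closure_subset]]
    by (simp add: ext0_def[abs_def])
  show "z \<notin> Omega l \<Longrightarrow> ext0 l u z = 0" "z \<in> Omega l \<Longrightarrow> ext0 l u z = u z" by (auto simp: ext0_def)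
  assume z: "z \<in> Omega l"
  have "continuous_on (Omega l) (ext0 l u)"
    using continuous_on_subset[OF u closure_subset] by (rule continuous_on_eq) (simp add: ext0_def)
  then show "isCont (ext0 l u) z" using z by (simp add: continuous_on_eq_continuous_at[OF open_Omega])
qed

lemma compact_closure_Omega: "compact (closure (Omega l))"
  by (rule compact_closure[THEN iffD2]) (simp add: Omega_def bounded_Times)

lemma ext0_bound:
  assumes "continuous_on (closure (Omega l)) u" obtains B where "\<And>z. \<bar>ext0 l u z\<bar> \<le> B" "B \<ge> 0"
proof -
  obtain B where B: "\<And>z. z \<in> closure (Omega l) \<Longrightarrow> \<bar>u z\<bar> \<le> B"
    using compact_abs_bound[OF compact_closure_Omega assms] by blast
  show thesis
    by (rule that[of "max B 0"]) (use B closure_subset in \<open>fastforce simp: ext0_def indicator_def\<close>)+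
qed

section \<open>Limits of the mollified identities\<close>

context kernels begin

text \<open>Fubini puts the integral over \<open>x\<close> inside, where \<open>delta_limit\<close>
  applies because \<open>(p, y)\<close> is an interior point, hence a point of continuity, for each
  \<open>y\<close> that matters; for the remaining \<open>y\<close> the factor \<open>b\<close>
  vanishes. Domination by a constant on \<open>{-l..l}\<close> handles the outer integral.\<close>

lemma slice_limit:
  fixes b :: "real \<Rightarrow> real" and w :: "R2 \<Rightarrow> real"
  assumes wm[measurable]: "w \<in> borel_measurable borel" and wB: "\<And>z. \<bar>w z\<bar> \<le> B" and w0: "\<And>z. z \<notin> Omega l \<Longrightarrow> w z = 0"
    and wc: "\<And>z. z \<in> Omega l \<Longrightarrow> isCont w z" and p: "0 < p" "p < pi"
    and bm[measurable]: "b \<in> borel_measurable borel" and bc: "\<And>y. \<bar>b y\<bar> \<le> c" and b0: "\<And>y. y \<notin> {-l<..<l} \<Longrightarrow> b y = 0"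
  shows "integrable lborel (\<lambda>z. w z * (rn n p (fst z) * b (snd z)))"
    "(\<lambda>n. LINT z|lborel. w z * (rn n p (fst z) * b (snd z))) \<longlonglongrightarrow> (LINT y|lborel. w (p, y) * b y)"
proof -
  have B0: "B \<ge> 0" "c \<ge> 0" using wB[of undefined] bc[of undefined] by linarith+
  show i: "integrable lborel (\<lambda>z. w z * (rn n p (fst z) * b (snd z)))" for n
  proof -
    obtain M where M: "\<And>x. x \<in> {0..pi} \<Longrightarrow> \<bar>rn n p x\<bar> \<le> M"
      using compact_abs_bound[OF compact_Icc smooth_continuous[OF smooth_rn]] by blast
    show ?thesis
    proof (rule bounded_Omega_integrable[where B = "B * (M * c)"])
      fix z assume "z \<in> Omega l"
      then have "fst z \<in> {0..pi}" by (auto simp: Omega_def)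
      then show "\<bar>w z * (rn n p (fst z) * b (snd z))\<bar> \<le> B * (M * c)"
        unfolding abs_mult using wB bc M[of "fst z"] B0 by (intro mult_mono) (auto intro: order_trans[OF abs_ge_zero])
    qed (use w0 in auto)
  qed
  have sec[measurable]: "(\<lambda>x. w (x, y)) \<in> borel_measurable borel" "(\<lambda>y. w (p, y)) \<in> borel_measurable borel" for y
    using section_borel[OF wm] by auto
  have eq: "(LINT z|lborel. w z * (rn n p (fst z) * b (snd z))) = (LINT y|lborel. (LINT x|lborel. w (x, y) * rn n p x) * b y)" for n
    by (subst LINT_iterated(1)[OF i]) (simp add: mult.assoc[symmetric])
  have meas: "(\<lambda>y. (LINT x|lborel. w (x, y) * rn n p x) * b y) \<in> borel_measurable lborel" for n
  proof -
    have "(\<lambda>y. LINT x|lborel. w (x, y) * (rn n p x * b y)) \<in> borel_measurable lborel"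
    proof (rule borel_measurable_integrable, rule lborel_pair.integrable_snd)
      have "(\<lambda>(x, y). w (x, y) * (rn n p x * b y)) = (\<lambda>z. w z * (rn n p (fst z) * b (snd z)))" by auto
      then show "integrable (lborel \<Otimes>\<^sub>M lborel) (\<lambda>(x, y). w (x, y) * (rn n p x * b y))"
        using i[of n] by (simp add: lborel_prod)
    qed
    then show ?thesis by (simp add: mult.assoc[symmetric])
  qed
  show "(\<lambda>n. LINT z|lborel. w z * (rn n p (fst z) * b (snd z))) \<longlonglongrightarrow> (LINT y|lborel. w (p, y) * b y)"
    unfolding eq
  proof (rule integral_dominated_convergence[where w = "\<lambda>y. B * (c * indicator {-l..l} y)"])
    show "AE y in lborel. (\<lambda>n. (LINT x|lborel. w (x, y) * rn n p x) * b y) \<longlonglongrightarrow> w (p, y) * b y"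
    proof (rule AE_I2)
      fix y
      show "(\<lambda>n. (LINT x|lborel. w (x, y) * rn n p x) * b y) \<longlonglongrightarrow> w (p, y) * b y"
      proof (cases "y \<in> {-l<..<l}")
        case True
        then have "(p, y) \<in> Omega l" using p by (simp add: Omega_def)
        then have "isCont (\<lambda>x. w (x, y)) p"
          by (intro isCont_o2[OF _ wc]) (auto intro: continuous_intros)
        then show ?thesis by (intro tendsto_mult tendsto_const delta_limit[OF sec(1) wB])
      qed (simp add: b0)
    qed
    show "AE y in lborel. norm ((LINT x|lborel. w (x, y) * rn n p x) * b y) \<le> B * (c * indicator {-l..l} y)" for n
    proof (rule AE_I2)
      fix y
      show "norm ((LINT x|lborel. w (x, y) * rn n p x) * b y) \<le> B * (c * indicator {-l..l} y)"
        using rn_bound(2)[of "\<lambda>x. w (x, y)" B n p] wB bc[of y] b0[of y] B0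
        by (cases "y \<in> {-l<..<l}") (auto simp: abs_mult intro!: mult_mono)
    qed
    show "integrable lborel (\<lambda>y. B * (c * indicator {-l..l} y))"
      by (intro integrable_mult_right integrable_real_indicator) (auto simp: emeasure_lborel_Icc_eq)
  qed (use meas in auto)
qed

lemma weighted_limit:
  fixes g :: "R2 \<Rightarrow> real" and a :: "nat \<Rightarrow> real \<Rightarrow> real"
  assumes g: "integrable lborel g" and am: "\<And>n. a n \<in> borel_measurable borel" and Am: "A \<in> borel_measurable borel"
    and ab: "\<And>n x. \<bar>a n x\<bar> \<le> C" and lim: "\<And>x. (\<lambda>n. a n x) \<longlonglongrightarrow> (A x :: real)"
    and bm: "b \<in> borel_measurable borel" and bc: "\<And>y. \<bar>b y\<bar> \<le> c"
  shows "(\<lambda>n. LINT z|lborel. g z * (a n (fst z) * b (snd z))) \<longlonglongrightarrow> (LINT z|lborel. (g z :: real) * (A (fst z) * b (snd z)))"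
proof (rule integral_dominated_convergence[where w = "\<lambda>z. \<bar>g z\<bar> * (C * c)"])
  have gm[measurable]: "g \<in> borel_measurable borel" using g by auto
  show "(\<lambda>z. g z * (A (fst z) * b (snd z))) \<in> borel_measurable lborel" "(\<lambda>z. g z * (a n (fst z) * b (snd z))) \<in> borel_measurable lborel" for n
    using gm by (simp_all, intro borel_measurable_times measurable_compose[OF fst_borel am]
      measurable_compose[OF fst_borel Am] measurable_compose[OF snd_borel bm])+
  show "integrable lborel (\<lambda>z. \<bar>g z\<bar> * (C * c))" using g by simp
  show "AE z in lborel. (\<lambda>n. g z * (a n (fst z) * b (snd z))) \<longlonglongrightarrow> g z * (A (fst z) * b (snd z))"
    by (intro AE_I2 tendsto_intros lim)
  have C0: "C \<ge> 0" using ab[of undefined undefined] by linarith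
  show "AE z in lborel. norm (g z * (a n (fst z) * b (snd z))) \<le> \<bar>g z\<bar> * (C * c)" for n
    using ab bc C0 by (intro AE_I2) (auto simp: abs_mult intro!: mult_left_mono mult_mono)
qed

text \<open>The derivative of a step in \<open>x\<close> is a difference of two approximate Dirac
  masses, so exactly one derivative in \<open>x\<close> becomes an increment of \<open>u\<close>.
  The list \<open>bs\<close> stays general to cover \<open>u_x\<close> and both orders of the mixed
  derivative at once; derivatives in \<open>y\<close> remain on \<open>b\<close>.\<close>

lemma xstep1:
  assumes w: "wrep l bs u g" and u: "continuous_on (closure (Omega l)) u" and bs: "count_list bs True = 1"
    and pq: "0 < p" "p \<le> q" "q < pi" and b: "smooth b" "supp_in b (-l) l"
  shows "(LINT y|lborel. (ext0 l u (p, y) - ext0 l u (q, y)) * (deriv ^^ count_list bs False) b y)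
    = (-1) ^ length bs * (LINT z|lborel. g z * (indicator {p<..q} (fst z) * b (snd z)))"
proof (rule LIMSEQ_unique)
  let ?w = "ext0 l u" let ?b = "(deriv ^^ count_list bs False) b"
  obtain B where B: "\<And>z. \<bar>?w z\<bar> \<le> B" using ext0_bound[OF u] by blast
  have sb: "smooth ?b" "supp_in ?b (-l) l" using b smooth_deriv_iter supp_in_deriv_iter by auto
  obtain c where c: "\<And>y. \<bar>?b y\<bar> \<le> c" using supp_in_bounded[OF sb] by blast
  obtain c' where c': "\<And>y. \<bar>b y\<bar> \<le> c'" using supp_in_bounded[OF b] by blast
  note sl = slice_limit[OF ext0_facts(1)[OF u] B ext0_facts(2)[OF u] ext0_facts(4)[OF u] _ _ smooth_borel[OF sb(1)] c supp_in_zero[OF sb(2)]]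
  have bmi: "integrable lborel (\<lambda>y. ?w (p, y) * ?b y)" if "p \<in> {0<..<pi}" for p
    by (rule integrableI_bounded_set[where A = "{-l<..<l}" and B = "B * c"])
      (use l section_borel[OF ext0_facts(1)[OF u]] smooth_borel[OF sb(1)] B c supp_in_zero[OF sb(2)] in
        \<open>auto simp: abs_mult intro!: mult_mono order_trans[OF abs_ge_zero B]\<close>)
  have "(\<lambda>n. (LINT z|lborel. ?w z * (rn n p (fst z) * ?b (snd z))) - (LINT z|lborel. ?w z * (rn n q (fst z) * ?b (snd z))))
     \<longlonglongrightarrow> (LINT y|lborel. ?w (p, y) * ?b y) - (LINT y|lborel. ?w (q, y) * ?b y)"
    using pq by (intro tendsto_diff sl(2)) auto
  moreover have "(LINT y|lborel. ?w (p, y) * ?b y) - (LINT y|lborel. ?w (q, y) * ?b y) = (LINT y|lborel. (?w (p, y) - ?w (q, y)) * ?b y)"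
    using bmi pq by (simp add: left_diff_distrib)
  moreover have ev: "\<forall>\<^sub>F n in sequentially. (LINT z|lborel. ?w z * (rn n p (fst z) * ?b (snd z))) - (LINT z|lborel. ?w z * (rn n q (fst z) * ?b (snd z)))
     = (-1) ^ length bs * (LINT z|lborel. g z * (step n p q (fst z) * b (snd z)))"
    using step_supp[OF pq]
  proof eventually_elim
    case (elim n)
    have "(-1) ^ length bs * (LINT z|lborel. g z * (step n p q (fst z) * b (snd z)))
      = (LINT z|lborel. ?w z * ((deriv ^^ count_list bs True) (step n p q) (fst z) * ?b (snd z)))"
      using wrep_test[OF w u smooth_step b(1) elim b(2)] by (simp add: ext0_def)
    also have "\<dots> = (LINT z|lborel. ?w z * (rn n p (fst z) * ?b (snd z)) - ?w z * (rn n q (fst z) * ?b (snd z)))"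
      by (simp add: bs deriv_step algebra_simps)
    also have "\<dots> = (LINT z|lborel. ?w z * (rn n p (fst z) * ?b (snd z))) - (LINT z|lborel. ?w z * (rn n q (fst z) * ?b (snd z)))"
      using sl(1) pq by (intro Bochner_Integration.integral_diff) auto
    finally show ?case by simp
  qed
  ultimately show "(\<lambda>n. (-1) ^ length bs * (LINT z|lborel. g z * (step n p q (fst z) * b (snd z))))
      \<longlonglongrightarrow> (LINT y|lborel. (?w (p, y) - ?w (q, y)) * ?b y)"
    by (intro Lim_transform_eventually[OF _ ev]) simp
  show "(\<lambda>n. (-1) ^ length bs * (LINT z|lborel. g z * (step n p q (fst z) * b (snd z))))
      \<longlonglongrightarrow> (-1) ^ length bs * (LINT z|lborel. g z * (indicator {p<..q} (fst z) * b (snd z)))"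
    by (intro tendsto_mult tendsto_const weighted_limit[OF wrep_integrable[OF w] step_borel _ step_bound step_limit[OF pq(2)] smooth_borel[OF b(1)] c']) simp
qed

text \<open>Two derivatives in \<open>x\<close> fall on a ramp and leave four Dirac masses. Those at
  \<open>e\<close> and \<open>pi - e\<close> are the price for a test function that vanishes near
  the vertical sides; the boundary condition removes them as \<open>e\<close> tends to 0.\<close>

lemma xstep2:
  assumes w: "wrep l [True, True] u g" and u: "continuous_on (closure (Omega l)) u"
    and pq: "0 < e" "e \<le> p" "p \<le> q" "q \<le> pi - e" "e < pi / 2" and b: "smooth b" "supp_in b (-l) l"
  shows "(LINT y|lborel. (ext0 l u (p, y) - ext0 l u (q, y) - (q - p) / (pi - 2 * e) * (ext0 l u (e, y) - ext0 l u (pi - e, y))) * b y)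
    = (LINT z|lborel. g z * (ramp e p q (fst z) * b (snd z)))"
proof -
  define m where "m = (q - p) / (pi - 2 * e)"
  let ?w = "ext0 l u"
  obtain B where B: "\<And>z. \<bar>?w z\<bar> \<le> B" using ext0_bound[OF u] by blast
  obtain c where c: "\<And>y. \<bar>b y\<bar> \<le> c" using supp_in_bounded[OF b] by blast
  note sl = slice_limit[OF ext0_facts(1)[OF u] B ext0_facts(2)[OF u] ext0_facts(4)[OF u] _ _ smooth_borel[OF b(1)] c supp_in_zero[OF b(2)]]
  have bmi: "integrable lborel (\<lambda>y. ?w (p, y) * b y)" for p
    by (rule integrableI_bounded_set[where A = "{-l<..<l}" and B = "B * c"])
      (use l section_borel[OF ext0_facts(1)[OF u]] smooth_borel[OF b(1)] B c supp_in_zero[OF b(2)] in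
        \<open>auto simp: abs_mult intro!: mult_mono order_trans[OF abs_ge_zero B]\<close>)
  let ?J = "\<lambda>n p. LINT z|lborel. ?w z * (rn n p (fst z) * b (snd z))"
  let ?I = "\<lambda>p. LINT y|lborel. ?w (p, y) * b y"
  have "(\<lambda>n. ?J n p - ?J n q - m * (?J n e - ?J n (pi - e))) \<longlonglongrightarrow> ?I p - ?I q - m * (?I e - ?I (pi - e))"
    using pq by (intro tendsto_diff tendsto_mult tendsto_const sl(2)) auto
  moreover have "?I p - ?I q - m * (?I e - ?I (pi - e)) = (LINT y|lborel. (?w (p, y) - ?w (q, y) - m * (?w (e, y) - ?w (pi - e, y))) * b y)"
  proof -
    have "(LINT y|lborel. (?w (p, y) - ?w (q, y) - m * (?w (e, y) - ?w (pi - e, y))) * b y)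
      = (LINT y|lborel. ?w (p, y) * b y - ?w (q, y) * b y - m * (?w (e, y) * b y - ?w (pi - e, y) * b y))"
      by (rule Bochner_Integration.integral_cong) (simp_all only: left_diff_distrib mult.assoc)
    moreover have "(LINT y|lborel. m * (?w (e, y) * b y - ?w (pi - e, y) * b y)) = m * (?I e - ?I (pi - e))"
      using bmi by simp
    ultimately show ?thesis
      using bmi by (simp only: Bochner_Integration.integral_diff Bochner_Integration.integrable_diff integrable_mult_right)
  qed
  moreover have ev: "\<forall>\<^sub>F n in sequentially. ?J n p - ?J n q - m * (?J n e - ?J n (pi - e))
     = (LINT z|lborel. g z * (rampn n e p q (fst z) * b (snd z)))"
    using rampn_supp[OF pq]
  proof eventually_elim
    case (elim n)
    have "(LINT z|lborel. g z * (rampn n e p q (fst z) * b (snd z)))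
      = (LINT z|lborel. ?w z * (deriv (deriv (rampn n e p q)) (fst z) * b (snd z)))"
      using wrep_test[OF w u smooth_rampn b(1) elim b(2)] by (simp add: ext0_def)
    also have "\<dots> = (LINT z|lborel. ?w z * (rn n p (fst z) * b (snd z)) - ?w z * (rn n q (fst z) * b (snd z))
        - m * (?w z * (rn n e (fst z) * b (snd z)) - ?w z * (rn n (pi - e) (fst z) * b (snd z))))"
      unfolding deriv2_rampn m_def[symmetric] by (rule Bochner_Integration.integral_cong) (simp_all only: algebra_simps)
    also have "\<dots> = ?J n p - ?J n q - m * (?J n e - ?J n (pi - e))"
      using sl(1)[of p n] sl(1)[of q n] sl(1)[of e n] sl(1)[of "pi - e" n] pq
      by (simp only: Bochner_Integration.integral_diff Bochner_Integration.integrable_diff integrable_mult_right integral_mult_right) simp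
    finally show ?case by simp
  qed
  ultimately have lim: "(\<lambda>n. LINT z|lborel. g z * (rampn n e p q (fst z) * b (snd z)))
      \<longlonglongrightarrow> (LINT y|lborel. (?w (p, y) - ?w (q, y) - m * (?w (e, y) - ?w (pi - e, y))) * b y)"
    by (intro Lim_transform_eventually[OF _ ev]) simp
  have "ramp e p q \<in> borel_measurable borel" unfolding ramp_def[abs_def] by measurable
  then have "(\<lambda>n. LINT z|lborel. g z * (rampn n e p q (fst z) * b (snd z)))
      \<longlonglongrightarrow> (LINT z|lborel. g z * (ramp e p q (fst z) * b (snd z)))"
    by (intro weighted_limit[OF wrep_integrable[OF w] rampn_borel _ rampn_bound[OF pq] rampn_limit smooth_borel[OF b(1)] c])
  from LIMSEQ_unique[OF lim this] show ?thesis unfolding m_def .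
qed

text \<open>Here no derivative falls on the factor in \<open>x\<close>, so the section of
  \<open>u\<close> is replaced by its integral over \<open>{p<..q}\<close>.\<close>

lemma xstep0:
  assumes w: "wrep l [False] u g" and u: "continuous_on (closure (Omega l)) u"
    and pq: "0 < p" "p \<le> q" "q < pi" and b: "smooth b" "supp_in b (-l) l"
  shows "(LINT y|lborel. (LINT x|lborel. ext0 l u (x, y) * indicator {p<..q} x) * deriv b y)
    = - (LINT z|lborel. g z * (indicator {p<..q} (fst z) * b (snd z)))"
proof (rule LIMSEQ_unique)
  let ?w = "ext0 l u"
  obtain B where B: "\<And>z. \<bar>?w z\<bar> \<le> B" "B \<ge> 0" using ext0_bound[OF u] by blast
  obtain c' where c': "\<And>y. \<bar>b y\<bar> \<le> c'" using supp_in_bounded[OF b] by blast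
  have sb: "smooth (deriv b)" "supp_in (deriv b) (-l) l" using b smooth_deriv supp_in_deriv by auto
  obtain c where c: "\<And>y. \<bar>deriv b y\<bar> \<le> c" using supp_in_bounded[OF sb] by blast
  have wi: "integrable lborel ?w"
    by (rule bounded_Omega_integrable[OF ext0_facts(1,2)[OF u] B(1)])
  have [measurable]: "deriv b \<in> borel_measurable borel" "?w \<in> borel_measurable borel" using sb(1) smooth_borel ext0_facts(1)[OF u] by auto
  have "(\<lambda>n. LINT z|lborel. ?w z * (step n p q (fst z) * deriv b (snd z))) \<longlonglongrightarrow> (LINT z|lborel. ?w z * (indicator {p<..q} (fst z) * deriv b (snd z)))"
    by (intro weighted_limit[OF wi step_borel _ step_bound step_limit[OF pq(2)] smooth_borel[OF sb(1)] c]) simp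
  moreover have "(LINT z|lborel. ?w z * (indicator {p<..q} (fst z) * deriv b (snd z))) = (LINT y|lborel. (LINT x|lborel. ext0 l u (x, y) * indicator {p<..q} x) * deriv b y)"
  proof (subst LINT_iterated(1))
    show "integrable lborel (\<lambda>z. ?w z * (indicator {p<..q} (fst z) * deriv b (snd z)))"
    proof (rule bounded_Omega_integrable[where B = "B * c"])
      fix z
      have "\<bar>indicator {p<..q} (fst z) * deriv b (snd z)\<bar> \<le> c"
        using c[of "snd z"] by (auto simp: indicator_def)
      then show "\<bar>?w z * (indicator {p<..q} (fst z) * deriv b (snd z))\<bar> \<le> B * c"
        using B by (simp only: abs_mult) (intro mult_mono, auto)
    qed (use ext0_facts(2)[OF u] in auto)
  qed (simp add: mult.assoc[symmetric])
  moreover have ev: "\<forall>\<^sub>F n in sequentially. (LINT z|lborel. ?w z * (step n p q (fst z) * deriv b (snd z)))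
     = - (LINT z|lborel. g z * (step n p q (fst z) * b (snd z)))"
    using step_supp[OF pq]
    by eventually_elim (use wrep_test[OF w u smooth_step b(1) _ b(2)] in \<open>simp add: ext0_def\<close>)
  ultimately show "(\<lambda>n. - (LINT z|lborel. g z * (step n p q (fst z) * b (snd z))))
      \<longlonglongrightarrow> (LINT y|lborel. (LINT x|lborel. ext0 l u (x, y) * indicator {p<..q} x) * deriv b y)"
    by (intro Lim_transform_eventually[OF _ ev]) simp
  show "(\<lambda>n. - (LINT z|lborel. g z * (step n p q (fst z) * b (snd z))))
      \<longlonglongrightarrow> - (LINT z|lborel. g z * (indicator {p<..q} (fst z) * b (snd z)))"
    by (intro tendsto_minus weighted_limit[OF wrep_integrable[OF w] step_borel _ step_bound step_limit[OF pq(2)] smooth_borel[OF b(1)] c']) simp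
qed

lemma ystep_rhs:
  assumes G: "integrable lborel (G :: R2 \<Rightarrow> real)" and "r \<le> s"
  shows "(\<lambda>n. LINT z|lborel. G z * step n r s (snd z)) \<longlonglongrightarrow> (LINT z|lborel. G z * indicator {r<..s} (snd z))"
proof (rule integral_dominated_convergence[where w = "\<lambda>z. \<bar>G z\<bar>"])
  have [measurable]: "G \<in> borel_measurable borel" using G by auto
  show "(\<lambda>z. G z * indicator {r<..s} (snd z)) \<in> borel_measurable lborel" "(\<lambda>z. G z * step n r s (snd z)) \<in> borel_measurable lborel" for n
    by simp_all
  show "AE z in lborel. (\<lambda>n. G z * step n r s (snd z)) \<longlonglongrightarrow> G z * indicator {r<..s} (snd z)"
    by (intro AE_I2 tendsto_intros step_limit[OF assms(2)])
  show "AE z in lborel. norm (G z * step n r s (snd z)) \<le> \<bar>G z\<bar>" for n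
    using mult_left_mono[OF step_bound] by (intro AE_I2) (auto simp: abs_mult)
qed (use G in simp)

text \<open>Second stage of the rectangle identities: an identity valid for all smooth
  \<open>b\<close> is specialised to steps. Here \<open>b\<close> carries no derivative, so an
  integral over \<open>{r<..s}\<close> results.\<close>

lemma ystep0:
  assumes G: "integrable lborel (G :: R2 \<Rightarrow> real)" and Hm[measurable]: "H \<in> borel_measurable borel" and HB: "\<And>y. \<bar>H y\<bar> \<le> B"
    and id: "\<And>b. smooth b \<Longrightarrow> supp_in b (-l) l \<Longrightarrow> (LINT y|lborel. H y * b y) = (LINT z|lborel. G z * b (snd z))"
    and rs: "-l < r" "r \<le> s" "s < l"
  shows "(LINT y|lborel. H y * indicator {r<..s} y) = (LINT z|lborel. G z * indicator {r<..s} (snd z))"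
proof (rule LIMSEQ_unique)
  have B0: "B \<ge> 0" using HB[of undefined] by linarith
  have "(\<lambda>n. LINT y|lborel. H y * step n r s y) \<longlonglongrightarrow> (LINT y|lborel. H y * indicator {r<..s} y)"
  \<comment> \<open>All the steps live on \<open>{r..s + 1}\<close>, because the layer to the right
    of \<open>s\<close> has width at most 1.\<close>
  proof (rule integral_dominated_convergence[where w = "\<lambda>y. B * indicator {r..s + 1} y"])
    show "AE y in lborel. (\<lambda>n. H y * step n r s y) \<longlonglongrightarrow> H y * indicator {r<..s} y"
      by (intro AE_I2 tendsto_intros step_limit[OF rs(2)])
    show "AE y in lborel. norm (H y * step n r s y) \<le> B * indicator {r..s + 1} y" for n
    proof (rule AE_I2)
      fix y
      have n1: "1 / N n \<le> 1" by simp
      show "norm (H y * step n r s y) \<le> B * indicator {r..s + 1} y"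
      proof (cases "y \<in> {r..s + 1}")
        case True
        then show ?thesis using mult_mono[OF HB[of y] step_bound[of n r s y] B0] by (simp add: abs_mult)
      next
        case False
        then have "y \<le> r \<or> s + 1 \<le> y" by auto
        then have "y \<le> r \<or> s + 1 / N n \<le> y" using n1 by linarith
        then have "step n r s y = 0"
        proof
          assume "y \<le> r" then show ?thesis using rs(2) by (simp add: step_def sn_out(1))
        next
          assume "s + 1 / N n \<le> y"
          moreover from this have "r + 1 / N n \<le> y" using rs(2) by linarith
          ultimately show ?thesis by (simp add: step_def sn_out(2))
        qed
        then show ?thesis using False by simp
      qed
    qed
    show "integrable lborel (\<lambda>y. B * indicator {r..s + 1} y)"
      by (intro integrable_mult_right integrable_real_indicator) (auto simp: emeasure_lborel_Icc_eq)
  qed auto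
  then show "(\<lambda>n. LINT z|lborel. G z * step n r s (snd z)) \<longlonglongrightarrow> (LINT y|lborel. H y * indicator {r<..s} y)"
    by (rule Lim_transform_eventually) (use step_supp[OF rs] in eventually_elim, use id smooth_step in auto)
  show "(\<lambda>n. LINT z|lborel. G z * step n r s (snd z)) \<longlonglongrightarrow> (LINT z|lborel. G z * indicator {r<..s} (snd z))"
    by (rule ystep_rhs[OF G rs(2)])
qed

text \<open>The same second stage with one derivative on \<open>b\<close>: the step produces Dirac
  masses at \<open>r\<close> and \<open>s\<close>, hence point values of \<open>H\<close>, for which
  continuity at these two points is required.\<close>

lemma ystep1:
  assumes G: "integrable lborel (G :: R2 \<Rightarrow> real)" and Hm[measurable]: "H \<in> borel_measurable borel" and HB: "\<And>y. \<bar>H y\<bar> \<le> B"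
    and id: "\<And>b. smooth b \<Longrightarrow> supp_in b (-l) l \<Longrightarrow> (LINT y|lborel. H y * deriv b y) = - (LINT z|lborel. G z * b (snd z))"
    and rs: "-l < r" "r \<le> s" "s < l" and c: "isCont H r" "isCont H s"
  shows "H s - H r = (LINT z|lborel. G z * indicator {r<..s} (snd z))"
proof -
  have "H r - H s = - (LINT z|lborel. G z * indicator {r<..s} (snd z))"
  proof (rule LIMSEQ_unique)
    have "(\<lambda>n. (LINT y|lborel. H y * rn n r y) - (LINT y|lborel. H y * rn n s y)) \<longlonglongrightarrow> H r - H s"
      by (intro tendsto_diff delta_limit[OF Hm HB] c)
    moreover have "(LINT y|lborel. H y * rn n r y) - (LINT y|lborel. H y * rn n s y) = (LINT y|lborel. H y * deriv (step n r s) y)" for n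
      using rn_bound(1)[OF HB Hm] by (simp add: deriv_step right_diff_distrib)
    ultimately have "(\<lambda>n. LINT y|lborel. H y * deriv (step n r s) y) \<longlonglongrightarrow> H r - H s" by simp
    then show "(\<lambda>n. - (LINT z|lborel. G z * step n r s (snd z))) \<longlonglongrightarrow> H r - H s"
      by (rule Lim_transform_eventually) (use step_supp[OF rs] in eventually_elim, use id smooth_step in auto)
    show "(\<lambda>n. - (LINT z|lborel. G z * step n r s (snd z))) \<longlonglongrightarrow> - (LINT z|lborel. G z * indicator {r<..s} (snd z))"
      by (intro tendsto_minus ystep_rhs[OF G rs(2)])
  qed
  then show ?thesis by simp
qed

end

lemma kernels_exist: "l > 0 \<Longrightarrow> \<exists>\<rho> S Q. kernels l \<rho> S Q"
  by (rule smoothing_kernels, intro exI kernels.intro, assumption+)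

section \<open>Rectangle identities\<close>

text \<open>Equal integrals against products of bumps give equal integrals over rectangles, and
  these determine the function. The lists may differ in order, so the lemma also identifies
  \<open>u_xy\<close> with \<open>u_yx\<close>.\<close>

lemma wrep_unique:
  assumes l: "l > 0" and g: "wrep l bs u g" and h: "wrep l bs' u h" and u: "continuous_on (closure (Omega l)) u"
    and c: "count_list bs True = count_list bs' True" "count_list bs False = count_list bs' False" "length bs = length bs'"
  shows "AE z in lborel. g z = h z"
proof -
  obtain \<rho> S Q where "kernels l \<rho> S Q" using kernels_exist[OF l] by blast
  then interpret kernels l \<rho> S Q .
  have gi: "integrable lborel g" and hi: "integrable lborel h" using wrep_integrable g h by auto
  then have gm[measurable]: "g \<in> borel_measurable borel" and hm[measurable]: "h \<in> borel_measurable borel" by auto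
  have eq: "(LINT z|lborel. g z * (a (fst z) * b (snd z))) = (LINT z|lborel. h z * (a (fst z) * b (snd z)))"
    if "smooth a" "smooth b" "supp_in a 0 pi" "supp_in b (-l) l" for a b
    using wrep_test[OF g u that] wrep_test[OF h u that] c by simp
  have "AE z in lborel. g z - h z = 0"
  proof (rule rect_AE_zero)
    show "integrable lborel (\<lambda>z. g z - h z)" using gi hi by simp
    show "g z - h z = 0" if "z \<notin> Omega l" for z 
    proof -
      have "g z = 0" "h z = 0" using that g h unfolding wrep_def by blast+
      then show ?thesis by simp
    qed
    fix p q r s assume pq: "0 < p" "p \<le> q" "q < pi" and rs: "-l < r" "r \<le> s" "s < l"
    have x: "(LINT z|lborel. g z * (indicator {p<..q} (fst z) * b (snd z))) = (LINT z|lborel. h z * (indicator {p<..q} (fst z) * b (snd z)))"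
      if b: "smooth b" "supp_in b (-l) l" for b
    proof (rule LIMSEQ_unique)
      obtain k where k: "\<And>y. \<bar>b y\<bar> \<le> k" using supp_in_bounded[OF b] by blast
      show "(\<lambda>n. LINT z|lborel. h z * (step n p q (fst z) * b (snd z))) \<longlonglongrightarrow> (LINT z|lborel. h z * (indicator {p<..q} (fst z) * b (snd z)))"
        by (intro weighted_limit[OF hi step_borel _ step_bound step_limit[OF pq(2)] smooth_borel[OF b(1)] k]) simp
      have "(\<lambda>n. LINT z|lborel. g z * (step n p q (fst z) * b (snd z))) \<longlonglongrightarrow> (LINT z|lborel. g z * (indicator {p<..q} (fst z) * b (snd z)))"
        by (intro weighted_limit[OF gi step_borel _ step_bound step_limit[OF pq(2)] smooth_borel[OF b(1)] k]) simp
      then show "(\<lambda>n. LINT z|lborel. h z * (step n p q (fst z) * b (snd z))) \<longlonglongrightarrow> (LINT z|lborel. g z * (indicator {p<..q} (fst z) * b (snd z)))"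
        by (rule Lim_transform_eventually) (use step_supp[OF pq] in eventually_elim, use eq smooth_step b in auto)
    qed
    have gI: "integrable lborel (\<lambda>z. indicator {p<..q} (fst z) * g z)" and hI: "integrable lborel (\<lambda>z. indicator {p<..q} (fst z) * h z)"
      by (rule integrable_bounded_mult[OF gi, where c = 1] integrable_bounded_mult[OF hi, where c = 1]; simp add: indicator_def)+
    have "(LINT z|lborel. (indicator {p<..q} (fst z) * g z) * indicator {r<..s} (snd z)) = (LINT z|lborel. (indicator {p<..q} (fst z) * h z) * indicator {r<..s} (snd z))"
    proof (rule LIMSEQ_unique)
      show "(\<lambda>n. LINT z|lborel. (indicator {p<..q} (fst z) * h z) * step n r s (snd z)) \<longlonglongrightarrow> (LINT z|lborel. (indicator {p<..q} (fst z) * h z) * indicator {r<..s} (snd z))"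
        by (rule ystep_rhs[OF hI rs(2)])
      show "(\<lambda>n. LINT z|lborel. (indicator {p<..q} (fst z) * h z) * step n r s (snd z)) \<longlonglongrightarrow> (LINT z|lborel. (indicator {p<..q} (fst z) * g z) * indicator {r<..s} (snd z))"
        by (rule Lim_transform_eventually[OF ystep_rhs[OF gI rs(2)]])
          (use step_supp[OF rs] in eventually_elim, use x[OF smooth_step] in \<open>auto simp: ac_simps\<close>)
    qed
    moreover have "integrable lborel (\<lambda>z. g z * rect p q r s z)" "integrable lborel (\<lambda>z. h z * rect p q r s z)"
      using integrable_bounded_mult[OF gi, of "rect p q r s" 1] integrable_bounded_mult[OF hi, of "rect p q r s" 1]
      by (simp_all add: indicator_def mult.commute)
    ultimately show "(LINT z|lborel. (g z - h z) * rect p q r s z) = 0"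
      by (simp add: left_diff_distrib ac_simps)
  qed
  then show ?thesis by simp
qed

lemma Omega_mem: "(x, y) \<in> Omega l \<longleftrightarrow> 0 < x \<and> x < pi \<and> -l < y \<and> y < l"
  by (auto simp: Omega_def)

text \<open>\<open>xstep1\<close> consumes the derivative in \<open>x\<close> and leaves one in
  \<open>y\<close>, which \<open>ystep1\<close> turns into point values. No further integration
  remains on the left, which is why the mixed derivative controls \<open>u\<close>
  pointwise.\<close>

lemma rect_mixed:
  assumes l: "l > 0" and w: "wrep l bs u g" and bs: "bs = [True, False] \<or> bs = [False, True]" and u: "continuous_on (closure (Omega l)) u"
    and pq: "0 < p" "p \<le> q" "q < pi" and rs: "-l < r" "r \<le> s" "s < l"
  shows "u (q, s) - u (p, s) - (u (q, r) - u (p, r)) = (LINT z|lborel. g z * rect p q r s z)"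
proof -
  obtain \<rho> S Q where "kernels l \<rho> S Q" using kernels_exist[OF l] by blast
  then interpret kernels l \<rho> S Q .
  have gi: "integrable lborel g" using wrep_integrable w by auto
  let ?w = "ext0 l u"
  obtain B where B: "\<And>z. \<bar>?w z\<bar> \<le> B" using ext0_bound[OF u] by blast
  let ?H = "\<lambda>y. ?w (q, y) - ?w (p, y)" let ?G = "\<lambda>z. indicator {p<..q} (fst z) * g z"
  have c: "isCont ?H y" if "-l < y" "y < l" for y
    by (intro continuous_intros isCont_o2[OF _ ext0_facts(4)[OF u]]) (use that pq in \<open>auto simp: Omega_mem\<close>)
  have "?H s - ?H r = (LINT z|lborel. ?G z * indicator {r<..s} (snd z))"
  proof (rule ystep1)
    show "integrable lborel ?G" by (rule integrable_bounded_mult[OF gi, where c = 1]) (auto simp: indicator_def)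
    show "?H \<in> borel_measurable borel" using section_borel(1)[OF ext0_facts(1)[OF u]] by auto
    show "\<bar>?H y\<bar> \<le> 2 * B" for y using B[of "(p, y)"] B[of "(q, y)"] by linarith
    fix b assume b: "smooth b" "supp_in b (-l) l"
    have "(LINT y|lborel. (?w (p, y) - ?w (q, y)) * deriv b y) = (LINT z|lborel. g z * (indicator {p<..q} (fst z) * b (snd z)))"
      using xstep1[OF w u _ pq b] bs by auto
    moreover have "(LINT y|lborel. ?H y * deriv b y) = - (LINT y|lborel. (?w (p, y) - ?w (q, y)) * deriv b y)"
      by (subst integral_minus[symmetric]) (simp add: left_diff_distrib)
    ultimately show "(LINT y|lborel. ?H y * deriv b y) = - (LINT z|lborel. ?G z * b (snd z))"
      by (simp add: ac_simps)
  qed (use rs c in auto)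
  then show ?thesis
    using pq rs by (simp add: ext0_facts(3)[OF u] Omega_mem ac_simps)
qed

lemma rect_x:
  assumes l: "l > 0" and w: "wrep l [True] u g" and u: "continuous_on (closure (Omega l)) u"
    and pq: "0 < p" "p \<le> q" "q < pi" and rs: "-l < r" "r \<le> s" "s < l"
  shows "(LINT y|lborel. (u (q, y) - u (p, y)) * indicator {r<..s} y) = (LINT z|lborel. g z * rect p q r s z)"
proof -
  obtain \<rho> S Q where "kernels l \<rho> S Q" using kernels_exist[OF l] by blast
  then interpret kernels l \<rho> S Q .
  have gi: "integrable lborel g" using wrep_integrable w by auto
  let ?w = "ext0 l u"
  obtain B where B: "\<And>z. \<bar>?w z\<bar> \<le> B" using ext0_bound[OF u] by blast
  let ?H = "\<lambda>y. ?w (q, y) - ?w (p, y)" let ?G = "\<lambda>z. indicator {p<..q} (fst z) * g z"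
  have "(LINT y|lborel. ?H y * indicator {r<..s} y) = (LINT z|lborel. ?G z * indicator {r<..s} (snd z))"
  proof (rule ystep0)
    show "integrable lborel ?G" by (rule integrable_bounded_mult[OF gi, where c = 1]) (auto simp: indicator_def)
    show "?H \<in> borel_measurable borel" using section_borel(1)[OF ext0_facts(1)[OF u]] by auto
    show "\<bar>?H y\<bar> \<le> 2 * B" for y using B[of "(p, y)"] B[of "(q, y)"] by linarith
    fix b assume b: "smooth b" "supp_in b (-l) l"
    have "(LINT y|lborel. (?w (p, y) - ?w (q, y)) * b y) = - (LINT z|lborel. g z * (indicator {p<..q} (fst z) * b (snd z)))"
      using xstep1[OF w u _ pq b] by simp
    moreover have "(LINT y|lborel. ?H y * b y) = - (LINT y|lborel. (?w (p, y) - ?w (q, y)) * b y)"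
      by (subst integral_minus[symmetric]) (simp add: left_diff_distrib)
    ultimately show "(LINT y|lborel. ?H y * b y) = (LINT z|lborel. ?G z * b (snd z))"
      by (simp add: ac_simps)
  qed (use rs in auto)
  moreover have "(LINT y|lborel. (u (q, y) - u (p, y)) * indicator {r<..s} y) = (LINT y|lborel. ?H y * indicator {r<..s} y)"
    by (rule Bochner_Integration.integral_cong) (use pq rs in \<open>auto simp: ext0_facts(3)[OF u] Omega_mem indicator_def\<close>)
  ultimately show ?thesis by (simp add: ac_simps)
qed

text \<open>In \<open>xstep2\<close> the values of \<open>u\<close> at \<open>e\<close> and
  \<open>pi - e\<close> converge to those on the vertical sides by continuity up to the closure, and
  these vanish. The slope \<open>m\<close> stays bounded meanwhile, so the correction term
  disappears.\<close>

lemma rect_xx: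
  assumes l: "l > 0" and w: "wrep l [True, True] u g" and u: "continuous_on (closure (Omega l)) u"
    and u0: "\<And>y. y \<in> {-l<..<l} \<Longrightarrow> u (0, y) = 0 \<and> u (pi, y) = 0"
    and pq: "0 < p" "p \<le> q" "q < pi" and rs: "-l < r" "r \<le> s" "s < l"
  shows "(LINT y|lborel. (u (p, y) - u (q, y)) * indicator {r<..s} y) = (LINT z|lborel. g z * (ramp 0 p q (fst z) * indicator {r<..s} (snd z)))"
proof -
  obtain \<rho> S Q where "kernels l \<rho> S Q" using kernels_exist[OF l] by blast
  then interpret kernels l \<rho> S Q .
  have gi: "integrable lborel g" using wrep_integrable w by auto
  have gm[measurable]: "g \<in> borel_measurable borel" using gi by auto
  let ?w = "ext0 l u"
  obtain B where B: "\<And>z. \<bar>?w z\<bar> \<le> B" "B \<ge> 0" using ext0_bound[OF u] by blast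
  have rm[measurable]: "ramp e p q \<in> borel_measurable borel" for e unfolding ramp_def[abs_def] by measurable
  \<comment> \<open>The minimum keeps \<open>e n\<close> to the left of \<open>p\<close> and
    \<open>pi - e n\<close> to the right of \<open>q\<close>; it is at most \<open>pi / 2\<close>,
    and the extra factor 2 in \<open>e n\<close> makes that inequality strict.\<close>
  define e0 where "e0 = min p (pi - q)"
  have e0: "e0 > 0" "e0 \<le> pi / 2" using pq by (auto simp: e0_def min_def)
  define e where "e n = e0 / (2 * N n)" for n
  have e: "0 < e n" "e n \<le> p" "e n \<le> pi - q" "e n < pi / 2" for n
  proof -
    have "e n \<le> e0 / 2" unfolding e_def using e0 by (intro divide_left_mono) auto
    moreover have "e n > 0" using e0 by (simp add: e_def)
    moreover have "e0 \<le> p" "e0 \<le> pi - q" by (auto simp: e0_def)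
    ultimately show "0 < e n" "e n \<le> p" "e n \<le> pi - q" "e n < pi / 2" using e0 by linarith+
  qed
  have elim: "e \<longlonglongrightarrow> 0"
  proof -
    have "(\<lambda>n. e0 / 2 * inverse (N n)) \<longlonglongrightarrow> e0 / 2 * 0" by (intro tendsto_intros LIMSEQ_inverse_real_of_nat)
    moreover have "e = (\<lambda>n. e0 / 2 * inverse (N n))" by (intro ext) (simp only: e_def inverse_eq_divide times_divide_times_eq mult_1_right)
    ultimately show ?thesis by simp
  qed
  define m where "m n = (q - p) / (pi - 2 * e n)" for n
  have mlim: "m \<longlonglongrightarrow> (q - p) / (pi - 2 * 0)" unfolding m_def[abs_def] by (intro tendsto_intros elim) simp
  have mb: "0 \<le> m n \<and> m n \<le> 1" for n
  proof -
    have "pi - 2 * e n > 0" "q - p \<le> pi - 2 * e n" using e[of n] pq by linarith+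
    then show ?thesis using pq by (simp add: m_def)
  qed
  define H where "H n y = ?w (p, y) - ?w (q, y) - m n * (?w (e n, y) - ?w (pi - e n, y))" for n y
  have Hm[measurable]: "H n \<in> borel_measurable borel" for n
    unfolding H_def[abs_def] using section_borel(1)[OF ext0_facts(1)[OF u]] by auto
  have HB: "\<bar>H n y\<bar> \<le> 4 * B" for n y
  proof -
    have "\<bar>m n * (?w (e n, y) - ?w (pi - e n, y))\<bar> \<le> 1 * (2 * B)"
      unfolding abs_mult using mb[of n] B(1)[of "(e n, y)"] B(1)[of "(pi - e n, y)"] by (intro mult_mono) auto
    then show ?thesis unfolding H_def using B(1)[of "(p, y)"] B(1)[of "(q, y)"] by linarith
  qed
  have rb: "\<bar>ramp (e n) p q x\<bar> \<le> 2 * pi" for n x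
  proof -
    define X where "X = max (x - p) 0 - max (x - q) 0"
    define Y where "Y = max (x - e n) 0 - max (x - (pi - e n)) 0"
    have X: "0 \<le> X \<and> X \<le> pi" using max_diff_bound[of p q x] pq unfolding X_def by linarith
    have Y: "0 \<le> Y \<and> Y \<le> pi" using max_diff_bound[of "e n" "pi - e n" x] e[of n] unfolding Y_def by linarith
    have "0 \<le> m n * Y \<and> m n * Y \<le> 1 * pi" using mb[of n] Y by (intro conjI mult_mono mult_nonneg_nonneg) auto
    then have "\<bar>X - m n * Y\<bar> \<le> 2 * pi" using X by linarith
    then show ?thesis unfolding ramp_def X_def Y_def m_def .
  qed
  have step: "(LINT y|lborel. H n y * indicator {r<..s} y) = (LINT z|lborel. (ramp (e n) p q (fst z) * g z) * indicator {r<..s} (snd z))" for n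
  proof (rule ystep0[OF _ Hm HB _ rs])
    show "integrable lborel (\<lambda>z. ramp (e n) p q (fst z) * g z)"
      by (rule integrable_bounded_mult[OF gi _ rb]) measurable
    fix b assume "smooth b" "supp_in b (-l) l"
    then show "(LINT y|lborel. H n y * b y) = (LINT z|lborel. (ramp (e n) p q (fst z) * g z) * b (snd z))"
      using xstep2[OF w u, of "e n" p q b] e[of n] pq(2) unfolding H_def m_def by (simp add: ac_simps)
  qed
  have L: "(\<lambda>n. LINT y|lborel. H n y * indicator {r<..s} y) \<longlonglongrightarrow> (LINT y|lborel. (?w (p, y) - ?w (q, y)) * indicator {r<..s} y)"
  proof (rule integral_dominated_convergence[where w = "\<lambda>y. 4 * B * indicator {r<..s} y"])
    show "AE y in lborel. (\<lambda>n. H n y * indicator {r<..s} y) \<longlonglongrightarrow> (?w (p, y) - ?w (q, y)) * indicator {r<..s} y"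
    proof (rule AE_I2)
      fix y
      show "(\<lambda>n. H n y * indicator {r<..s} y) \<longlonglongrightarrow> (?w (p, y) - ?w (q, y)) * indicator {r<..s} y"
      proof (cases "y \<in> {r<..s}")
        case True
        then have y: "-l < y" "y < l" using rs by auto
        have cl: "continuous_on {0..pi} (\<lambda>x. u (x, y))"
          by (rule continuous_on_compose2[OF u]) (use y l in \<open>auto simp: closure_Omega intro!: continuous_intros\<close>)
        have ein: "e n \<in> {0..pi}" "pi - e n \<in> {0..pi}" for n using e[of n] by auto
        have "(\<lambda>n. u (e n, y)) \<longlonglongrightarrow> u (0, y)"
          by (rule continuous_on_tendsto_compose[OF cl elim]) (use ein in auto)
        moreover have "(\<lambda>n. pi - e n) \<longlonglongrightarrow> pi - 0" by (intro tendsto_intros elim)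
        then have "(\<lambda>n. u (pi - e n, y)) \<longlonglongrightarrow> u (pi, y)"
          by (intro continuous_on_tendsto_compose[OF cl]) (use ein in auto)
        moreover have "?w (e n, y) = u (e n, y)" "?w (pi - e n, y) = u (pi - e n, y)" for n
          using e[of n] y by (auto intro!: ext0_facts(3)[OF u] simp: Omega_mem)
        ultimately have "(\<lambda>n. H n y) \<longlonglongrightarrow> ?w (p, y) - ?w (q, y) - (q - p) / (pi - 2 * 0) * (u (0, y) - u (pi, y))"
          unfolding H_def by (simp only:) (intro tendsto_diff tendsto_mult tendsto_const mlim)
        then show ?thesis using u0[of y] y True by simp
      qed simp
    qed
    show "integrable lborel (\<lambda>y. 4 * B * indicator {r<..s} y)"
      using rs by (intro integrable_mult_right integrable_real_indicator) auto
    show "AE y in lborel. norm (H n y * indicator {r<..s} y) \<le> 4 * B * indicator {r<..s} y" for n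
      using HB by (intro AE_I2) (auto simp: indicator_def)
  qed (use section_borel(1)[OF ext0_facts(1)[OF u]] in auto)
  have R: "(\<lambda>n. LINT z|lborel. (ramp (e n) p q (fst z) * g z) * indicator {r<..s} (snd z)) \<longlonglongrightarrow> (LINT z|lborel. (ramp 0 p q (fst z) * g z) * indicator {r<..s} (snd z))"
  proof (rule integral_dominated_convergence[where w = "\<lambda>z. 2 * pi * \<bar>g z\<bar>"])
    have "(\<lambda>n. ramp (e n) p q x) \<longlonglongrightarrow> ramp 0 p q x" for x
      unfolding ramp_def by (intro tendsto_intros elim mlim[unfolded m_def]) simp
    then show "AE z in lborel. (\<lambda>n. (ramp (e n) p q (fst z) * g z) * indicator {r<..s} (snd z)) \<longlonglongrightarrow> (ramp 0 p q (fst z) * g z) * indicator {r<..s} (snd z)"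
      by (intro AE_I2 tendsto_intros)
    show "AE z in lborel. norm ((ramp (e n) p q (fst z) * g z) * indicator {r<..s} (snd z)) \<le> 2 * pi * \<bar>g z\<bar>" for n
      using rb[of n] by (intro AE_I2) (auto simp: indicator_def abs_mult intro!: mult_right_mono)
  qed (use gi in auto)
  have "(LINT y|lborel. (u (p, y) - u (q, y)) * indicator {r<..s} y) = (LINT y|lborel. (?w (p, y) - ?w (q, y)) * indicator {r<..s} y)"
    by (rule Bochner_Integration.integral_cong) (use pq rs in \<open>auto simp: ext0_facts(3)[OF u] Omega_mem indicator_def\<close>)
  then show ?thesis using LIMSEQ_unique[OF L[unfolded step] R] by (simp add: ac_simps)
qed

text \<open>The point values needed in \<open>y\<close> are those of the integral of
  \<open>u\<close> over \<open>{p<..q}\<close> in \<open>x\<close>. That integral is continuous in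
  \<open>y\<close> by dominated convergence, so \<open>ystep1\<close> applies to it.\<close>

lemma rect_y:
  assumes l: "l > 0" and w: "wrep l [False] u g" and u: "continuous_on (closure (Omega l)) u"
    and pq: "0 < p" "p \<le> q" "q < pi" and rs: "-l < r" "r \<le> s" "s < l"
  shows "(LINT x|lborel. (u (x, s) - u (x, r)) * indicator {p<..q} x) = (LINT z|lborel. g z * rect p q r s z)"
proof -
  obtain \<rho> S Q where "kernels l \<rho> S Q" using kernels_exist[OF l] by blast
  then interpret kernels l \<rho> S Q .
  have gi: "integrable lborel g" using wrep_integrable w by auto
  let ?w = "ext0 l u"
  have wm[measurable]: "?w \<in> borel_measurable borel" using ext0_facts(1)[OF u] .
  have sec[measurable]: "(\<lambda>x. ?w (x, y)) \<in> borel_measurable borel" for y using section_borel(2)[OF wm] .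
  obtain B where B: "\<And>z. \<bar>?w z\<bar> \<le> B" "B \<ge> 0" using ext0_bound[OF u] by blast
  define H where "H y = (LINT x|lborel. ?w (x, y) * indicator {p<..q} x)" for y
  have Bi: "integrable lborel (\<lambda>x. B * indicator {p<..q} x)" using pq by simp
  have b1: "norm (?w (x, y) * indicator {p<..q} x) \<le> B * indicator {p<..q} x" for x y
    using B by (auto simp: indicator_def)
  have Hi: "integrable lborel (\<lambda>x. ?w (x, y) * indicator {p<..q} x)" for y
    by (rule Bochner_Integration.integrable_bound[OF Bi]) (use order_trans[OF b1 abs_ge_self] in auto)
  have Hc: "isCont H y" if y: "-l < y" "y < l" for y
    unfolding H_def[abs_def]
  proof (rule continuous_at_sequentiallyI)
    fix v assume v: "v \<longlonglongrightarrow> y"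
    show "(\<lambda>n. LINT x|lborel. ?w (x, v n) * indicator {p<..q} x) \<longlonglongrightarrow> (LINT x|lborel. ?w (x, y) * indicator {p<..q} x)"
    proof (rule integral_dominated_convergence[OF _ _ Bi])
      show "AE x in lborel. (\<lambda>n. ?w (x, v n) * indicator {p<..q} x) \<longlonglongrightarrow> ?w (x, y) * indicator {p<..q} x"
      proof (rule AE_I2)
        fix x
        show "(\<lambda>n. ?w (x, v n) * indicator {p<..q} x) \<longlonglongrightarrow> ?w (x, y) * indicator {p<..q} x"
        proof (cases "x \<in> {p<..q}")
          case True
          have "isCont (\<lambda>y. ?w (x, y)) y"
            by (intro isCont_o2[OF _ ext0_facts(4)[OF u]]) (use True y pq in \<open>auto simp: Omega_mem intro: continuous_intros\<close>)
          then show ?thesis by (intro tendsto_intros isCont_tendsto_compose[OF _ v])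
        qed simp
      qed
    qed (use b1 in auto)
  qed
  let ?G = "\<lambda>z. indicator {p<..q} (fst z) * g z"
  have "H s - H r = (LINT z|lborel. ?G z * indicator {r<..s} (snd z))"
  proof (rule ystep1)
    show "integrable lborel ?G" by (rule integrable_bounded_mult[OF gi, where c = 1]) (auto simp: indicator_def)
    have "integrable lborel (\<lambda>z. ?w z * indicator {p<..q} (fst z))"
      by (rule bounded_Omega_integrable[where B = B]) (use B ext0_facts(2)[OF u] in \<open>auto simp: indicator_def\<close>)
    then have "integrable (lborel \<Otimes>\<^sub>M lborel) (\<lambda>(x, y). ?w (x, y) * indicator {p<..q} x)"
      by (simp add: lborel_prod case_prod_unfold)
    then show "H \<in> borel_measurable borel"
      unfolding H_def[abs_def] using lborel_pair.integrable_snd[of "\<lambda>x y. ?w (x, y) * indicator {p<..q} x"] by auto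
    show "\<bar>H y\<bar> \<le> B * (q - p)" for y
    proof -
      have "\<bar>H y\<bar> \<le> (LINT x|lborel. B * indicator {p<..q} x)"
        unfolding H_def by (rule order_trans[OF integral_abs_bound integral_mono]) (use Hi Bi b1 in auto)
      then show ?thesis using pq by simp
    qed
    show "(LINT y|lborel. H y * deriv b y) = - (LINT z|lborel. ?G z * b (snd z))" if "smooth b" "supp_in b (-l) l" for b
      unfolding H_def using xstep0[OF w u pq that] by (simp add: ac_simps)
  qed (use rs Hc in auto)
  moreover have "H s - H r = (LINT x|lborel. (u (x, s) - u (x, r)) * indicator {p<..q} x)"
  proof -
    have "H s - H r = (LINT x|lborel. ?w (x, s) * indicator {p<..q} x - ?w (x, r) * indicator {p<..q} x)"
      unfolding H_def using Hi by simp
    also have "\<dots> = (LINT x|lborel. (u (x, s) - u (x, r)) * indicator {p<..q} x)"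
      by (rule Bochner_Integration.integral_cong) (use pq rs in \<open>auto simp: ext0_facts(3)[OF u] Omega_mem indicator_def\<close>)
    finally show ?thesis .
  qed
  ultimately show ?thesis by (simp add: ac_simps)
qed

section \<open>Bounds by the Hessian\<close>

text \<open>The discriminant inequality, stated so as to serve both integrals and the abstract form
  \<open>A\<close>. For \<open>C = 0\<close> the polynomial is affine, and a nonzero slope would
  make it negative somewhere.\<close>

lemma quad_nonneg_imp:
  fixes A B C :: real
  assumes q: "\<And>t. 0 \<le> A + 2 * B * t + C * t\<^sup>2" and C: "C \<ge> 0"
  shows "B\<^sup>2 \<le> A * C"
proof (cases "C = 0")
  case True
  have "B = 0"
  proof (rule ccontr)
    assume B: "B \<noteq> 0"
    have "0 \<le> A + 2 * B * (- (A + 1) / (2 * B))" using q[of "- (A + 1) / (2 * B)"] True by simp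
    also have "\<dots> = -1" using B by simp
    finally show False by simp
  qed
  then show ?thesis using True by simp
next
  case False
  then have C0: "C > 0" using C by simp
  have "0 \<le> A + 2 * B * (- B / C) + C * (- B / C)\<^sup>2" by (rule q)
  also have "\<dots> = A - B\<^sup>2 / C" using C0 by (simp add: power2_eq_square)
  finally show ?thesis using C0 by (simp add: field_simps)
qed

lemma Cauchy_Schwarz_LINT:
  fixes f g :: "'a \<Rightarrow> real"
  assumes [measurable]: "f \<in> borel_measurable M" "g \<in> borel_measurable M"
    and f2: "integrable M (\<lambda>x. (f x)\<^sup>2)" and g2: "integrable M (\<lambda>x. (g x)\<^sup>2)"
  shows "integrable M (\<lambda>x. f x * g x)" "(LINT x|M. f x * g x)\<^sup>2 \<le> (LINT x|M. (f x)\<^sup>2) * (LINT x|M. (g x)\<^sup>2)"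
proof -
  show fg: "integrable M (\<lambda>x. f x * g x)"
  proof (rule Bochner_Integration.integrable_bound[of M "\<lambda>x. (f x)\<^sup>2 + (g x)\<^sup>2"])
    show "AE x in M. norm (f x * g x) \<le> norm ((f x)\<^sup>2 + (g x)\<^sup>2)"
    proof (rule AE_I2)
      fix x
      have "2 * \<bar>f x * g x\<bar> \<le> (f x)\<^sup>2 + (g x)\<^sup>2"
        using zero_le_power2[of "\<bar>f x\<bar> - \<bar>g x\<bar>"] by (simp add: power2_diff abs_mult)
      moreover have "0 \<le> \<bar>f x * g x\<bar>" by simp
      ultimately show "norm (f x * g x) \<le> norm ((f x)\<^sup>2 + (g x)\<^sup>2)" unfolding real_norm_def by linarith
    qed
  qed (use f2 g2 in auto)
  show "(LINT x|M. f x * g x)\<^sup>2 \<le> (LINT x|M. (f x)\<^sup>2) * (LINT x|M. (g x)\<^sup>2)"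
  proof (rule quad_nonneg_imp)
    fix t
    have "0 \<le> (LINT x|M. (f x + t * g x)\<^sup>2)" by simp
    also have "\<dots> = (LINT x|M. (f x)\<^sup>2 + (2 * t) * (f x * g x) + t\<^sup>2 * (g x)\<^sup>2)"
      by (rule Bochner_Integration.integral_cong) (simp_all add: power2_eq_square algebra_simps)
    also have "\<dots> = (LINT x|M. (f x)\<^sup>2) + 2 * (LINT x|M. f x * g x) * t + (LINT x|M. (g x)\<^sup>2) * t\<^sup>2"
      using f2 g2 fg by simp
    finally show "0 \<le> (LINT x|M. (f x)\<^sup>2) + 2 * (LINT x|M. f x * g x) * t + (LINT x|M. (g x)\<^sup>2) * t\<^sup>2" .
  qed simp
qed

section \<open>Integral operators in the first variable\<close>

text \<open>A partial integral operator: the kernel acts on the sections in \<open>x\<close>, with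
  \<open>y\<close> as a parameter. First derivatives will be recognised as images of second
  derivatives under such operators.\<close>

definition kop :: "real \<Rightarrow> (R2 \<Rightarrow> real) \<Rightarrow> (R2 \<Rightarrow> real) \<Rightarrow> R2 \<Rightarrow> real" where
  "kop l k w z = indicator (Omega l) z * (LINT s|lborel. k (fst z, s) * w (s, snd z))"

text \<open>Sections of \<open>w\<close> live on an interval of length \<open>pi\<close> and the
  kernel is bounded by 1. Cauchy-Schwarz in the inner variable gives one factor \<open>pi\<close>,
  and the integration over \<open>x\<close> gives the other.\<close>

lemma kop_L2:
  assumes km[measurable]: "k \<in> borel_measurable borel" and kb: "\<And>z. \<bar>k z\<bar> \<le> 1"
    and wm[measurable]: "w \<in> borel_measurable borel" and w0: "\<And>z. z \<notin> Omega l \<Longrightarrow> w z = 0" and w2: "integrable lborel (\<lambda>z. (w z)\<^sup>2)"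
  shows "kop l k w \<in> borel_measurable borel" "integrable lborel (\<lambda>z. (kop l k w z)\<^sup>2)"
    "(LINT z|lborel. (kop l k w z)\<^sup>2) \<le> pi\<^sup>2 * (LINT z|lborel. (w z)\<^sup>2)"
proof -
  have "(\<lambda>t :: R2 \<times> real. k (fst (fst t), snd t) * w (snd t, snd (fst t))) \<in> borel_measurable borel"
    by (intro borel_measurable_times measurable_compose[OF _ km] measurable_compose[OF _ wm]
        borel_measurable_continuous_onI continuous_intros)
  then have "(\<lambda>t. k (fst (fst t), snd t) * w (snd t, snd (fst t))) \<in> borel_measurable (borel \<Otimes>\<^sub>M lborel)"
    by (simp add: borel_prod cong: measurable_cong_sets)
  then have "(\<lambda>z. LINT s|lborel. k (fst z, s) * w (s, snd z)) \<in> borel_measurable borel"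
    by (intro lborel.borel_measurable_lebesgue_integral) (simp add: case_prod_unfold)
  then show Tm[measurable]: "kop l k w \<in> borel_measurable borel" unfolding kop_def[abs_def] by measurable
  have secw[measurable]: "(\<lambda>s. w (s, y)) \<in> borel_measurable borel" for y using section_borel(2)[OF wm] .
  have seck[measurable]: "(\<lambda>s. k (x, s)) \<in> borel_measurable borel" for x using section_borel(1)[OF km] .
  \<comment> \<open>For \<open>y\<close> whose section is not square integrable the right-hand side
    is infinite, so the estimate holds at every point and no exceptional set has to be
    tracked.\<close>
  have pt: "ennreal ((kop l k w (x, y))\<^sup>2) \<le> ennreal pi * (indicator {0<..<pi} x * (\<integral>\<^sup>+s. ennreal ((w (s, y))\<^sup>2) \<partial>lborel))" for x y
  proof (cases "(x, y) \<in> Omega l")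
    case True
    then have x: "x \<in> {0<..<pi}" by (simp add: Omega_mem)
    show ?thesis
    proof (cases "integrable lborel (\<lambda>s. (w (s, y))\<^sup>2)")
      case i: True
      have eq: "k (x, s) * w (s, y) = (indicator {0..pi} s * k (x, s)) * w (s, y)" for s
        using w0[of "(s, y)"] by (cases "s \<in> {0..pi}") (auto simp: Omega_mem)
      have i1: "integrable lborel (\<lambda>s. (indicator {0..pi} s * k (x, s))\<^sup>2)"
      proof (rule Bochner_Integration.integrable_bound[of lborel "\<lambda>s. indicator {0..pi} s :: real"])
        show "AE s in lborel. norm ((indicator {0..pi} s * k (x, s))\<^sup>2) \<le> norm (indicator {0..pi} s :: real)"
          using kb by (intro AE_I2) (auto simp: indicator_def abs_square_le_1)
        show "integrable lborel (\<lambda>s. indicator {0..pi} s :: real)"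
          by (intro integrable_real_indicator) (auto simp: emeasure_lborel_Icc_eq)
      qed measurable
      have i1b: "(LINT s|lborel. (indicator {0..pi} s * k (x, s))\<^sup>2) \<le> pi"
      proof -
        have "(LINT s|lborel. (indicator {0..pi} s * k (x, s))\<^sup>2) \<le> (LINT s|lborel. indicator {0..pi} s)"
          using i1 kb by (intro integral_mono integrable_real_indicator) (auto simp: indicator_def abs_square_le_1 emeasure_lborel_Icc_eq)
        then show ?thesis by simp
      qed
      have "(kop l k w (x, y))\<^sup>2 = (LINT s|lborel. (indicator {0..pi} s * k (x, s)) * w (s, y))\<^sup>2"
        unfolding kop_def fst_conv snd_conv Bochner_Integration.integral_cong[OF refl eq] using True by simp
      also have "\<dots> \<le> (LINT s|lborel. (indicator {0..pi} s * k (x, s))\<^sup>2) * (LINT s|lborel. (w (s, y))\<^sup>2)"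
        by (rule Cauchy_Schwarz_LINT(2)[OF _ _ i1 i]) measurable
      also have "\<dots> \<le> pi * (LINT s|lborel. (w (s, y))\<^sup>2)" using i1b by (intro mult_right_mono) auto
      finally have "ennreal ((kop l k w (x, y))\<^sup>2) \<le> ennreal pi * ennreal (LINT s|lborel. (w (s, y))\<^sup>2)"
        by (subst ennreal_mult[symmetric]) (auto intro: ennreal_leI)
      then show ?thesis using i x by (simp add: nn_integral_eq_integral)
    next
      case False
      then have "(\<integral>\<^sup>+s. ennreal ((w (s, y))\<^sup>2) \<partial>lborel) = \<infinity>"
        by (simp add: integrable_iff_bounded) (metis top.not_eq_extremum)
      then show ?thesis using x by (simp add: ennreal_mult_top)
    qed
  qed (simp add: kop_def)
  have nnT: "(\<integral>\<^sup>+z. ennreal ((kop l k w z)\<^sup>2) \<partial>lborel) \<le> ennreal (pi\<^sup>2 * (LINT z|lborel. (w z)\<^sup>2))"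
  proof -
    have wm2: "(\<lambda>z. ennreal ((w z)\<^sup>2)) \<in> borel_measurable (lborel \<Otimes>\<^sub>M lborel)" "(\<lambda>z. ennreal ((kop l k w z)\<^sup>2)) \<in> borel_measurable (lborel \<Otimes>\<^sub>M lborel)"
      unfolding lborel_prod by simp_all
    have Wm[measurable]: "(\<lambda>y. \<integral>\<^sup>+s. ennreal ((w (s, y))\<^sup>2) \<partial>lborel) \<in> borel_measurable borel"
    proof -
      have "(\<lambda>t :: R2. w (snd t, fst t)) \<in> borel_measurable borel"
        by (intro measurable_compose[OF _ wm] borel_measurable_continuous_onI continuous_intros)
      then have "(\<lambda>t :: R2. w (snd t, fst t)) \<in> borel_measurable (borel \<Otimes>\<^sub>M lborel)"
        by (simp add: borel_prod cong: measurable_cong_sets)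
      then show ?thesis
        by (intro lborel.borel_measurable_nn_integral) (simp add: case_prod_unfold)
    qed
    have "(\<integral>\<^sup>+z. ennreal ((kop l k w z)\<^sup>2) \<partial>lborel) = (\<integral>\<^sup>+y. \<integral>\<^sup>+x. ennreal ((kop l k w (x, y))\<^sup>2) \<partial>lborel \<partial>lborel)"
      using lborel_pair.nn_integral_snd[OF wm2(2)] by (simp add: lborel_prod)
    also have "\<dots> \<le> (\<integral>\<^sup>+y. \<integral>\<^sup>+x. ennreal pi * (indicator {0<..<pi} x * (\<integral>\<^sup>+s. ennreal ((w (s, y))\<^sup>2) \<partial>lborel)) \<partial>lborel \<partial>lborel)"
      by (intro nn_integral_mono pt)
    also have "\<dots> = (\<integral>\<^sup>+y. ennreal pi * (ennreal pi * (\<integral>\<^sup>+s. ennreal ((w (s, y))\<^sup>2) \<partial>lborel)) \<partial>lborel)"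
      by (simp add: nn_integral_cmult nn_integral_multc)
    also have "\<dots> = ennreal pi * (ennreal pi * (\<integral>\<^sup>+y. \<integral>\<^sup>+s. ennreal ((w (s, y))\<^sup>2) \<partial>lborel \<partial>lborel))"
      by (simp add: nn_integral_cmult)
    also have "(\<integral>\<^sup>+y. \<integral>\<^sup>+s. ennreal ((w (s, y))\<^sup>2) \<partial>lborel \<partial>lborel) = (\<integral>\<^sup>+z. ennreal ((w z)\<^sup>2) \<partial>lborel)"
      using lborel_pair.nn_integral_snd[OF wm2(1)] by (simp add: lborel_prod)
    also have "\<dots> = ennreal (LINT z|lborel. (w z)\<^sup>2)" by (rule nn_integral_eq_integral[OF w2]) simp
    also have "ennreal pi * (ennreal pi * ennreal (LINT z|lborel. (w z)\<^sup>2)) = ennreal (pi\<^sup>2 * (LINT z|lborel. (w z)\<^sup>2))"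
      by (simp add: ennreal_mult[symmetric] power2_eq_square mult.assoc)
    finally show ?thesis .
  qed
  show i: "integrable lborel (\<lambda>z. (kop l k w z)\<^sup>2)"
    using nnT by (intro integrableI_bounded) (auto intro: le_less_trans)
  show "(LINT z|lborel. (kop l k w z)\<^sup>2) \<le> pi\<^sup>2 * (LINT z|lborel. (w z)\<^sup>2)"
    using nnT by (subst (asm) nn_integral_eq_integral[OF i]) auto
qed

lemma indicator_Ioc_measurable:
  fixes f :: "'a \<Rightarrow> real"
  shows "f \<in> borel_measurable M \<Longrightarrow> (\<lambda>t. indicator {a<..b} (f t) :: real) \<in> borel_measurable M"
  by measurable

text \<open>Two ways of rearranging the integral over a rectangle. With the integral over
  \<open>x\<close> outside, the inner one is itself a rectangle integral, which suits
  \<open>ky\<close>; with it moved onto the kernel, the kernel becomes a test function, which suits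
  \<open>kx\<close>.\<close>

lemma kop_rect:
  assumes km[measurable]: "k \<in> borel_measurable borel" and kb: "\<And>z. \<bar>k z\<bar> \<le> 1"
    and wm[measurable]: "w \<in> borel_measurable borel" and w0: "\<And>z. z \<notin> Omega l \<Longrightarrow> w z = 0" and w2: "integrable lborel (\<lambda>z. (w z)\<^sup>2)"
    and pq: "0 < p" "p \<le> q" "q < pi" and rs: "-l < r" "r \<le> s" "s < l"
  shows "(LINT z|lborel. kop l k w z * rect p q r s z)
     = (LINT x|lborel. indicator {p<..q} x * (LINT z|lborel. k (x, fst z) * indicator {r<..s} (snd z) * w z))"
    "(LINT x|lborel. indicator {p<..q} x * (LINT z|lborel. k (x, fst z) * indicator {r<..s} (snd z) * w z))
     = (LINT z|lborel. w z * ((LINT x|lborel. indicator {p<..q} x * k (x, fst z)) * indicator {r<..s} (snd z)))"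
proof -
  have wi: "integrable lborel w" by (rule integrable_sq_imp[OF wm w0 w2])
  have inner: "integrable lborel (\<lambda>z. k (x, fst z) * indicator {r<..s} (snd z) * w z)" for x
  proof (rule integrable_bounded_mult[OF wi, where c = 1])
    have "(\<lambda>z :: R2. k (x, fst z)) \<in> borel_measurable borel"
      by (intro measurable_compose[OF _ km] borel_measurable_continuous_onI continuous_intros)
    then show "(\<lambda>z :: R2. k (x, fst z) * indicator {r<..s} (snd z)) \<in> borel_measurable lborel" by simp
    show "\<bar>k (x, fst z) * indicator {r<..s} (snd z)\<bar> \<le> 1" for z :: R2 using kb by (auto simp: indicator_def)
  qed
  have Ti: "integrable lborel (kop l k w)"
    by (rule integrable_sq_imp[where l = l]) (use kop_L2[OF km kb wm w0 w2] in \<open>auto simp: kop_def\<close>)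
  have Tr: "integrable lborel (\<lambda>z. kop l k w z * rect p q r s z)"
    using integrable_bounded_mult[OF Ti, of "rect p q r s" 1] by (simp add: indicator_def mult.commute)
  show "(LINT z|lborel. kop l k w z * rect p q r s z)
     = (LINT x|lborel. indicator {p<..q} x * (LINT z|lborel. k (x, fst z) * indicator {r<..s} (snd z) * w z))"
  proof (subst LINT_iterated(2)[OF Tr], rule Bochner_Integration.integral_cong[OF refl])
    fix x
    have "(LINT z|lborel. k (x, fst z) * indicator {r<..s} (snd z) * w z) = (LINT y|lborel. indicator {r<..s} y * (LINT s|lborel. k (x, s) * w (s, y)))"
    proof (subst LINT_iterated(1)[OF inner], rule Bochner_Integration.integral_cong[OF refl])
      fix y
      have "(LINT xa|lborel. k (x, fst (xa, y)) * indicator {r<..s} (snd (xa, y)) * w (xa, y)) = (LINT xa|lborel. indicator {r<..s} y * (k (x, xa) * w (xa, y)))"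
        by (rule Bochner_Integration.integral_cong) auto
      then show "(LINT xa|lborel. k (x, fst (xa, y)) * indicator {r<..s} (snd (xa, y)) * w (xa, y)) = indicator {r<..s} y * (LINT s|lborel. k (x, s) * w (s, y))"
        by simp
    qed
    moreover have "(LINT y|lborel. kop l k w (x, y) * rect p q r s (x, y)) = (LINT y|lborel. indicator {p<..q} x * (indicator {r<..s} y * (LINT s|lborel. k (x, s) * w (s, y))))"
      by (rule Bochner_Integration.integral_cong) (use pq rs in \<open>auto simp: kop_def Omega_mem indicator_def\<close>)
    ultimately show "(LINT y|lborel. kop l k w (x, y) * rect p q r s (x, y)) = indicator {p<..q} x * (LINT z|lborel. k (x, fst z) * indicator {r<..s} (snd z) * w z)"
      by simp
  qed
  let ?F = "\<lambda>t :: real \<times> R2. indicator {p<..q} (fst t) * (k (fst t, fst (snd t)) * indicator {r<..s} (snd (snd t)) * w (snd t))"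
  have Fm: "?F \<in> borel_measurable borel"
    by (intro borel_measurable_times measurable_compose[OF _ km] measurable_compose[OF _ wm] indicator_Ioc_measurable
        borel_measurable_continuous_onI continuous_intros)
  have "integrable (lborel \<Otimes>\<^sub>M lborel) (\<lambda>(x, z). ?F (x, z))"
  proof (rule Bochner_Integration.integrable_bound)
    show "integrable (lborel \<Otimes>\<^sub>M lborel) (\<lambda>(x :: real, z). indicator {p<..q} x * w z)"
    proof (rule integrableI_bounded)
      have wm': "(\<lambda>t :: real \<times> R2. w (snd t)) \<in> borel_measurable borel" "(\<lambda>t :: real \<times> R2. indicator {p<..q} (fst t) :: real) \<in> borel_measurable borel"
        by (intro measurable_compose[OF _ wm] indicator_Ioc_measurable borel_measurable_continuous_onI continuous_intros)+
      then show m: "(\<lambda>(x :: real, z). indicator {p<..q} x * w z) \<in> borel_measurable (lborel \<Otimes>\<^sub>M lborel)"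
        by (simp add: lborel_prod case_prod_unfold)
      have "(\<integral>\<^sup>+ t. ennreal (norm (case t of (x :: real, z) \<Rightarrow> indicator {p<..q} x * w z)) \<partial>(lborel \<Otimes>\<^sub>M lborel))
         = (\<integral>\<^sup>+ x. \<integral>\<^sup>+ z. ennreal (norm (indicator {p<..q} x * w z)) \<partial>lborel \<partial>lborel)"
        using m by (subst lborel.nn_integral_fst[symmetric]) auto
      also have "\<dots> = (\<integral>\<^sup>+ x. indicator {p<..q} x * (\<integral>\<^sup>+ z. ennreal (norm (w z)) \<partial>lborel) \<partial>lborel)"
        by (rule nn_integral_cong) (auto simp: indicator_def)
      also have "\<dots> = ennreal (q - p) * (\<integral>\<^sup>+ z. ennreal (norm (w z)) \<partial>lborel)"
        using pq by (simp add: nn_integral_multc)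
      also have "\<dots> < \<infinity>" using wi by (auto simp: integrable_iff_bounded ennreal_mult_less_top)
      finally show "(\<integral>\<^sup>+ t. ennreal (norm (case t of (x :: real, z) \<Rightarrow> indicator {p<..q} x * w z)) \<partial>(lborel \<Otimes>\<^sub>M lborel)) < \<infinity>" .
    qed
    show "(\<lambda>(x, z). ?F (x, z)) \<in> borel_measurable (lborel \<Otimes>\<^sub>M lborel)"
      using Fm by (simp add: lborel_prod case_prod_unfold)
    show "AE t in lborel \<Otimes>\<^sub>M lborel. norm (case t of (x, z) \<Rightarrow> ?F (x, z)) \<le> norm (case t of (x :: real, z) \<Rightarrow> indicator {p<..q} x * w z)"
      using mult_right_mono[OF kb] by (intro AE_I2) (auto simp: indicator_def abs_mult split: prod.splits)
  qed
  then have "(LINT z|lborel. LINT x|lborel. ?F (x, z)) = (LINT x|lborel. LINT z|lborel. ?F (x, z))"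
    by (rule lborel_pair.Fubini_integral)
  moreover have "(LINT x|lborel. ?F (x, z)) = w z * ((LINT x|lborel. indicator {p<..q} x * k (x, fst z)) * indicator {r<..s} (snd z))" for z
  proof -
    have "(LINT x|lborel. ?F (x, z)) = (LINT x|lborel. (w z * indicator {r<..s} (snd z)) * (indicator {p<..q} x * k (x, fst z)))"
      by (rule Bochner_Integration.integral_cong) auto
    then show ?thesis by simp
  qed
  moreover have "(LINT z|lborel. ?F (x, z)) = indicator {p<..q} x * (LINT z|lborel. k (x, fst z) * indicator {r<..s} (snd z) * w z)" for x
    by simp
  ultimately show "(LINT x|lborel. indicator {p<..q} x * (LINT z|lborel. k (x, fst z) * indicator {r<..s} (snd z) * w z))
     = (LINT z|lborel. w z * ((LINT x|lborel. indicator {p<..q} x * k (x, fst z)) * indicator {r<..s} (snd z)))"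
    by simp
qed

lemma LINT_rect:
  assumes "p \<le> q" "r \<le> s"
  shows "integrable lborel (rect p q r s)" "(LINT z|lborel. rect p q r s z) = (q - p) * (s - r)"
proof -
  show i: "integrable lborel (rect p q r s)"
  proof (rule integrableI_bounded_set[where A = "cbox (p, r) (q, s)" and B = 1])
    show "emeasure lborel (cbox (p, r) (q, s)) < \<infinity>" by (rule emeasure_bounded_finite) simp
    show "AE z in lborel. z \<notin> cbox (p, r) (q, s) \<longrightarrow> rect p q r s z = 0"
      by (intro AE_I2) (auto simp: cbox_Pair_eq indicator_def)
  qed (auto simp: indicator_def)
  show "(LINT z|lborel. rect p q r s z) = (q - p) * (s - r)"
    by (subst LINT_iterated(1)[OF i]) (use assms in simp)
qed

lemma rect_CS:
  assumes g: "g \<in> borel_measurable borel" "integrable lborel (\<lambda>z. (g z)\<^sup>2)" and "p \<le> q" "r \<le> s"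
  shows "(LINT z|lborel. g z * rect p q r s z)\<^sup>2 \<le> (LINT z|lborel. (g z)\<^sup>2) * ((q - p) * (s - r))"
proof -
  have sq: "(rect p q r s z)\<^sup>2 = rect p q r s z" for z by (auto simp: indicator_def)
  show ?thesis
    using Cauchy_Schwarz_LINT(2)[of g lborel "rect p q r s"] g LINT_rect[OF assms(3,4)] unfolding sq by simp
qed

text \<open>Minus the \<open>x\<close>-derivative of the Dirichlet Green function of \<open>-d\<^sup>2/dx\<^sup>2\<close> on \<open>(0, \<pi>)\<close>: it
  recovers \<open>u\<^sub>x\<close> from \<open>u\<^sub>x\<^sub>x\<close>, as the kernel \<open>ky\<close> recovers \<open>u\<^sub>y\<close> from
  \<open>u\<^sub>x\<^sub>y\<close>.\<close>

definition kx :: "R2 \<Rightarrow> real" where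
  "kx z = indicator {0..pi} (snd z) * (snd z / pi - indicator {z. fst z < snd z} z)"

definition ky :: "R2 \<Rightarrow> real" where
  "ky z = indicator {z. snd z \<le> fst z \<and> 0 < snd z} z"

lemma kx_facts: "kx \<in> borel_measurable borel" "\<bar>kx z\<bar> \<le> 1"
proof -
  show "kx \<in> borel_measurable borel" unfolding kx_def[abs_def] by measurable
  show "\<bar>kx z\<bar> \<le> 1"
  proof (cases "snd z \<in> {0..pi}")
    case True
    then have "0 \<le> snd z / pi" "snd z / pi \<le> 1" by auto
    moreover have "indicator {z. fst z < snd z} z = (0::real) \<or> indicator {z. fst z < snd z} z = (1::real)" by (auto simp: indicator_def)
    ultimately show ?thesis using True unfolding kx_def by auto
  qed (simp add: kx_def)
qed

lemma ky_facts: "ky \<in> borel_measurable borel" "\<bar>ky z\<bar> \<le> 1"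
proof -
  show "ky \<in> borel_measurable borel" unfolding ky_def[abs_def] by measurable
qed (simp add: ky_def indicator_def)

text \<open>This computation is the reason for the choice of \<open>kx\<close>: integrated over an
  interval it yields, up to sign, the test function of \<open>rect_xx\<close>.\<close>

lemma kx_integral:
  assumes "0 < s" "s < pi" "p \<le> q"
  shows "(LINT x|lborel. indicator {p<..q} x * kx (x, s)) = - ramp 0 p q s"
proof -
  have ind: "integrable lborel (indicator {p<..q} :: real \<Rightarrow> real)" "integrable lborel (indicator {p<..<min q s} :: real \<Rightarrow> real)"
    by (intro integrable_real_indicator; cases "p \<le> q"; cases "p \<le> min q s"; simp)+
  have "(LINT x|lborel. indicator {p<..q} x * kx (x, s)) = (LINT x|lborel. s / pi * indicator {p<..q} x - indicator {p<..<min q s} x)"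
  proof (rule integral_cong_AE)
    \<comment> \<open>For \<open>q < s\<close> the two integrands differ at the point
      \<open>q\<close>, which the open interval omits.\<close>
    have "AE x in lborel. x \<noteq> q" by (rule AE_lborel_singleton)
    then show "AE x in lborel. indicator {p<..q} x * kx (x, s) = s / pi * indicator {p<..q} x - indicator {p<..<min q s} x"
      by eventually_elim (use assms in \<open>auto simp: kx_def indicator_def\<close>)
    have "(\<lambda>x. kx (x, s)) \<in> borel_measurable borel" by (rule section_borel(2)[OF kx_facts(1)])
    then show "(\<lambda>x. indicator {p<..q} x * kx (x, s)) \<in> borel_measurable lborel" by measurable
  qed measurable
  also have "\<dots> = s / pi * (q - p) - measure lborel {p<..<min q s}"
    using ind assms by simp
  also have "measure lborel {p<..<min q s} = max (s - p) 0 - max (s - q) 0"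
    using assms by (cases "p \<le> min q s") (auto simp: min_def max_def measure_def emeasure_lborel_Ioo split: if_splits)
  finally show ?thesis using assms by (simp add: ramp_def field_simps)
qed

section \<open>Square integral bounds for the first derivatives\<close>

text \<open>By \<open>rect_xx\<close> and \<open>rect_x\<close> the functions \<open>gx\<close> and
  \<open>kop l kx gxx\<close> have the same integrals over all interior rectangles, so they agree
  almost everywhere and the operator bound applies.\<close>

lemma first_x_bound:
  assumes l: "l > 0" and wx: "wrep l [True] u gx" and wxx: "wrep l [True, True] u gxx" and u: "continuous_on (closure (Omega l)) u"
    and u0: "\<And>y. y \<in> {-l<..<l} \<Longrightarrow> u (0, y) = 0 \<and> u (pi, y) = 0"
  shows "(LINT z|lborel. (gx z)\<^sup>2) \<le> pi\<^sup>2 * (LINT z|lborel. (gxx z)\<^sup>2)"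
proof -
  have g: "gxx \<in> borel_measurable borel" "\<And>z. z \<notin> Omega l \<Longrightarrow> gxx z = 0" "integrable lborel (\<lambda>z. (gxx z)\<^sup>2)"
    using wxx by (auto simp: wrep_def)
  have gxm: "gx \<in> borel_measurable borel" "\<And>z. z \<notin> Omega l \<Longrightarrow> gx z = 0" using wx by (auto simp: wrep_def)
  note T = kop_L2[OF kx_facts g]
  have Ti: "integrable lborel (kop l kx gxx)"
    by (rule integrable_sq_imp[where l = l]) (use T in \<open>auto simp: kop_def\<close>)
  have gi: "integrable lborel gx" using wrep_integrable[OF wx] .
  have "AE z in lborel. gx z - kop l kx gxx z = 0"
  proof (rule rect_AE_zero)
    show "integrable lborel (\<lambda>z. gx z - kop l kx gxx z)" using Ti gi by simp
    show "gx z - kop l kx gxx z = 0" if "z \<notin> Omega l" for z using that gxm by (simp add: kop_def)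
    fix p q r s assume pq: "0 < p" "p \<le> q" "q < pi" and rs: "-l < r" "r \<le> s" "s < l"
    have "(LINT z|lborel. kop l kx gxx z * rect p q r s z)
        = (LINT z|lborel. gxx z * ((LINT x|lborel. indicator {p<..q} x * kx (x, fst z)) * indicator {r<..s} (snd z)))"
      using kop_rect[OF kx_facts g pq rs] by simp
    also have "\<dots> = (LINT z|lborel. - (gxx z * (ramp 0 p q (fst z) * indicator {r<..s} (snd z))))"
    proof (rule Bochner_Integration.integral_cong[OF refl])
      fix z :: R2
      show "gxx z * ((LINT x|lborel. indicator {p<..q} x * kx (x, fst z)) * indicator {r<..s} (snd z)) = - (gxx z * (ramp 0 p q (fst z) * indicator {r<..s} (snd z)))"
        using kx_integral[of "fst z" p q] g(2)[of z] pq by (cases "z \<in> Omega l") (auto simp: Omega_def)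
    qed
    also have "\<dots> = - (LINT y|lborel. (u (p, y) - u (q, y)) * indicator {r<..s} y)"
      using rect_xx[OF l wxx u u0 pq rs] by simp
    also have "\<dots> = (LINT y|lborel. (u (q, y) - u (p, y)) * indicator {r<..s} y)"
      by (subst integral_minus[symmetric]) (simp add: left_diff_distrib)
    also have "\<dots> = (LINT z|lborel. gx z * rect p q r s z)"
      by (rule rect_x[OF l wx u pq rs])
    finally have "(LINT z|lborel. kop l kx gxx z * rect p q r s z) = (LINT z|lborel. gx z * rect p q r s z)" .
    moreover have "integrable lborel (\<lambda>z. gx z * rect p q r s z)" "integrable lborel (\<lambda>z. kop l kx gxx z * rect p q r s z)"
      using integrable_bounded_mult[OF gi, of "rect p q r s" 1] integrable_bounded_mult[OF Ti, of "rect p q r s" 1]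
      by (simp_all add: indicator_def mult.commute)
    ultimately show "(LINT z|lborel. (gx z - kop l kx gxx z) * rect p q r s z) = 0"
      by (simp add: left_diff_distrib)
  qed
  then have "(LINT z|lborel. (gx z)\<^sup>2) = (LINT z|lborel. (kop l kx gxx z)\<^sup>2)"
    using gxm(1) T(1) by (intro integral_cong_AE) auto
  then show ?thesis using T(3) by simp
qed

text \<open>The left side of the rectangle is moved to \<open>x = 0\<close>, where \<open>u\<close>
  vanishes for all \<open>y\<close> in question; half of the mixed difference drops out.\<close>

lemma rect_mixed0:
  assumes l: "l > 0" and w: "wrep l bs u g" and bs: "bs = [True, False] \<or> bs = [False, True]" and u: "continuous_on (closure (Omega l)) u"
    and u0: "\<And>y. y \<in> {-l<..<l} \<Longrightarrow> u (0, y) = 0 \<and> u (pi, y) = 0"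
    and q: "0 < q" "q < pi" and rs: "-l < r" "r \<le> s" "s < l"
  shows "u (q, s) - u (q, r) = (LINT z|lborel. g z * rect 0 q r s z)"
proof (rule LIMSEQ_unique)
  have gi: "integrable lborel g" using wrep_integrable w by auto
  then have gm[measurable]: "g \<in> borel_measurable borel" by auto
  define e where "e n = q * inverse (real (Suc n))" for n
  have "(\<lambda>n. q * inverse (real (Suc n))) \<longlonglongrightarrow> q * 0" by (intro tendsto_intros LIMSEQ_inverse_real_of_nat)
  then have elim: "e \<longlonglongrightarrow> 0" by (simp add: e_def[abs_def])
  have e: "0 < e n" "e n \<le> q" for n
  proof -
    show "0 < e n" using q by (simp add: e_def)
    have "inverse (real (Suc n)) \<le> 1" by (simp add: inverse_eq_divide)
    then have "q * inverse (real (Suc n)) \<le> q * 1" using q by (intro mult_left_mono) auto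
    then show "e n \<le> q" by (simp add: e_def)
  qed
  have cl: "continuous_on {0..pi} (\<lambda>x. u (x, y))" if "y \<in> {-l<..<l}" for y
    by (rule continuous_on_compose2[OF u]) (use that l in \<open>auto simp: closure_Omega intro!: continuous_intros\<close>)
  have ue: "(\<lambda>n. u (e n, y)) \<longlonglongrightarrow> 0" if y: "y \<in> {-l<..<l}" for y
  proof -
    have "e n \<in> {0..pi}" for n using e[of n] q by auto
    then have "(\<lambda>n. u (e n, y)) \<longlonglongrightarrow> u (0, y)"
      by (intro continuous_on_tendsto_compose[OF cl[OF y] elim]) auto
    then show ?thesis using u0[OF y] by simp
  qed
  have "(\<lambda>n. u (q, s) - u (e n, s) - (u (q, r) - u (e n, r))) \<longlonglongrightarrow> u (q, s) - 0 - (u (q, r) - 0)"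
    using rs by (intro tendsto_intros ue) auto
  then show "(\<lambda>n. LINT z|lborel. g z * rect (e n) q r s z) \<longlonglongrightarrow> u (q, s) - u (q, r)"
    using rect_mixed[OF l w bs u e(1) e(2) q(2) rs] by simp
  show "(\<lambda>n. LINT z|lborel. g z * rect (e n) q r s z) \<longlonglongrightarrow> (LINT z|lborel. g z * rect 0 q r s z)"
  proof (rule integral_dominated_convergence[where w = "\<lambda>z. \<bar>g z\<bar>"])
    have "(\<lambda>n. indicator {e n<..q} x) \<longlonglongrightarrow> (indicator {0<..q} x :: real)" for x
    proof (rule tendsto_eventually, cases "x > 0")
      case True
      then show "\<forall>\<^sub>F n in sequentially. indicator {e n<..q} x = (indicator {0<..q} x :: real)"
        using order_tendstoD(2)[OF elim, of x] by (auto elim!: eventually_mono simp: indicator_def)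
    next
      case False
      then have "indicator {e n<..q} x = (indicator {0<..q} x :: real)" for n using e(1)[of n] by (auto simp: indicator_def)
      then show "\<forall>\<^sub>F n in sequentially. indicator {e n<..q} x = (indicator {0<..q} x :: real)" by simp
    qed
    then show "AE z in lborel. (\<lambda>n. g z * rect (e n) q r s z) \<longlonglongrightarrow> g z * rect 0 q r s z"
      by (intro AE_I2 tendsto_intros)
  qed (use gi in \<open>auto simp: indicator_def\<close>)
qed

text \<open>As \<open>u\<close> vanishes on the side \<open>x = 0\<close>, so does its increment in
  \<open>y\<close>; integrating \<open>u_xy\<close> in \<open>x\<close> from that side therefore
  gives \<open>u_y\<close>. This is how the condition on the vertical sides controls a derivative
  along them.\<close>

lemma first_y_bound:
  assumes l: "l > 0" and wy: "wrep l [False] u gy" and wxy: "wrep l [True, False] u gxy" and u: "continuous_on (closure (Omega l)) u"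
    and u0: "\<And>y. y \<in> {-l<..<l} \<Longrightarrow> u (0, y) = 0 \<and> u (pi, y) = 0"
  shows "(LINT z|lborel. (gy z)\<^sup>2) \<le> pi\<^sup>2 * (LINT z|lborel. (gxy z)\<^sup>2)"
proof -
  have g: "gxy \<in> borel_measurable borel" "\<And>z. z \<notin> Omega l \<Longrightarrow> gxy z = 0" "integrable lborel (\<lambda>z. (gxy z)\<^sup>2)"
    using wxy by (auto simp: wrep_def)
  have gym: "gy \<in> borel_measurable borel" "\<And>z. z \<notin> Omega l \<Longrightarrow> gy z = 0" using wy by (auto simp: wrep_def)
  note T = kop_L2[OF ky_facts g]
  have Ti: "integrable lborel (kop l ky gxy)"
    by (rule integrable_sq_imp[where l = l]) (use T in \<open>auto simp: kop_def\<close>)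
  have gi: "integrable lborel gy" using wrep_integrable[OF wy] .
  have "AE z in lborel. gy z - kop l ky gxy z = 0"
  proof (rule rect_AE_zero)
    show "integrable lborel (\<lambda>z. gy z - kop l ky gxy z)" using Ti gi by simp
    show "gy z - kop l ky gxy z = 0" if "z \<notin> Omega l" for z using that gym by (simp add: kop_def)
    fix p q r s assume pq: "0 < p" "p \<le> q" "q < pi" and rs: "-l < r" "r \<le> s" "s < l"
    have "(LINT z|lborel. kop l ky gxy z * rect p q r s z)
        = (LINT x|lborel. indicator {p<..q} x * (LINT z|lborel. ky (x, fst z) * indicator {r<..s} (snd z) * gxy z))"
      by (rule kop_rect(1)[OF ky_facts g pq rs])
    also have "\<dots> = (LINT x|lborel. (u (x, s) - u (x, r)) * indicator {p<..q} x)"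
    proof (rule Bochner_Integration.integral_cong[OF refl])
      fix x
      have "(LINT z|lborel. ky (x, fst z) * indicator {r<..s} (snd z) * gxy z) = u (x, s) - u (x, r)" if "0 < x" "x < pi"
      proof -
        have "(LINT z|lborel. ky (x, fst z) * indicator {r<..s} (snd z) * gxy z) = (LINT z|lborel. gxy z * rect 0 x r s z)"
          by (rule Bochner_Integration.integral_cong) (auto simp: ky_def indicator_def)
        then show ?thesis using rect_mixed0[OF l wxy _ u u0 that rs] by simp
      qed
      then show "indicator {p<..q} x * (LINT z|lborel. ky (x, fst z) * indicator {r<..s} (snd z) * gxy z) = (u (x, s) - u (x, r)) * indicator {p<..q} x"
        using pq by (cases "x \<in> {p<..q}") auto
    qed
    also have "\<dots> = (LINT z|lborel. gy z * rect p q r s z)"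
      by (rule rect_y[OF l wy u pq rs])
    finally have "(LINT z|lborel. kop l ky gxy z * rect p q r s z) = (LINT z|lborel. gy z * rect p q r s z)" .
    moreover have "integrable lborel (\<lambda>z. gy z * rect p q r s z)" "integrable lborel (\<lambda>z. kop l ky gxy z * rect p q r s z)"
      using integrable_bounded_mult[OF gi, of "rect p q r s" 1] integrable_bounded_mult[OF Ti, of "rect p q r s" 1]
      by (simp_all add: indicator_def mult.commute)
    ultimately show "(LINT z|lborel. (gy z - kop l ky gxy z) * rect p q r s z) = 0"
      by (simp add: left_diff_distrib)
  qed
  then have "(LINT z|lborel. (gy z)\<^sup>2) = (LINT z|lborel. (kop l ky gxy z)\<^sup>2)"
    using gym(1) T(1) by (intro integral_cong_AE) auto
  then show ?thesis using T(3) by simp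
qed

section \<open>Hoelder continuity with exponent one half\<close>

text \<open>Cauchy-Schwarz on the rectangle between the side \<open>x = 0\<close> and the two
  points, whose area is at most \<open>pi\<close> times their distance.\<close>

lemma holder_y:
  assumes l: "l > 0" and wxy: "wrep l [True, False] u gxy" and u: "continuous_on (closure (Omega l)) u"
    and u0: "\<And>y. y \<in> {-l<..<l} \<Longrightarrow> u (0, y) = 0 \<and> u (pi, y) = 0"
    and x: "0 < x" "x < pi" and r: "-l < r" "r < l" and s: "-l < s" "s < l"
  shows "(u (x, s) - u (x, r))\<^sup>2 \<le> pi * \<bar>s - r\<bar> * (LINT z|lborel. (gxy z)\<^sup>2)"
proof -
  have main: "(u (x, s) - u (x, r))\<^sup>2 \<le> pi * (s - r) * (LINT z|lborel. (gxy z)\<^sup>2)" if rs: "-l < r" "r \<le> s" "s < l" for r s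
  proof -
    have "(u (x, s) - u (x, r))\<^sup>2 = (LINT z|lborel. gxy z * rect 0 x r s z)\<^sup>2"
      using rect_mixed0[OF l wxy _ u u0 x rs] by simp
    also have "\<dots> \<le> (LINT z|lborel. (gxy z)\<^sup>2) * ((x - 0) * (s - r))"
      using wxy x rs by (intro rect_CS) (auto simp: wrep_def)
    also have "\<dots> \<le> (LINT z|lborel. (gxy z)\<^sup>2) * (pi * (s - r))"
      using x rs by (intro mult_left_mono mult_right_mono) auto
    finally show ?thesis by (simp add: ac_simps)
  qed
  show ?thesis
    using main[of r s] main[of s r] r s by (cases "r \<le> s") (auto simp: power2_commute)
qed

text \<open>No condition is available at \<open>y = l\<close> or \<open>y = -l\<close>, so the
  increment \<open>H\<close> is compared with its mean. The mixed identity bounds the oscillation of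
  \<open>H\<close> and contributes \<open>sqrt (2 * l)\<close>; the identity for \<open>u_x\<close>
  bounds the mean and contributes \<open>pi / sqrt l\<close>.\<close>

lemma holder_x:
  assumes l: "l > 0" and wx: "wrep l [True] u gx" and wxx: "wrep l [True, True] u gxx" and wxy: "wrep l [True, False] u gxy"
    and u: "continuous_on (closure (Omega l)) u"
    and u0: "\<And>y. y \<in> {-l<..<l} \<Longrightarrow> u (0, y) = 0 \<and> u (pi, y) = 0"
    and p: "0 < p" "p < pi" and q: "0 < q" "q < pi" and y: "-l < y" "y < l"
    and N: "(LINT z|lborel. (gxx z)\<^sup>2) \<le> N" "(LINT z|lborel. (gxy z)\<^sup>2) \<le> N"
  shows "\<bar>u (q, y) - u (p, y)\<bar> \<le> (sqrt (2 * l) + pi / sqrt l) * sqrt N * sqrt \<bar>q - p\<bar>"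
proof -
  have main: "\<bar>u (q, y) - u (p, y)\<bar> \<le> (sqrt (2 * l) + pi / sqrt l) * sqrt N * sqrt (q - p)" if pq: "0 < p" "p \<le> q" "q < pi" for p q
  proof -
    define H where "H y = u (q, y) - u (p, y)" for y
    define \<delta> where "\<delta> = sqrt (2 * l * (q - p) * N)"
    have "0 \<le> (LINT z|lborel. (gxx z)\<^sup>2)" by simp
    then have N0: "N \<ge> 0" using N(1) by linarith
    have gxx0: "(LINT z|lborel. (gx z)\<^sup>2) \<le> pi\<^sup>2 * N"
      by (rule order_trans[OF first_x_bound[OF l wx wxx u u0] mult_left_mono[OF N(1)]]) simp_all
    have osc: "\<bar>H s - H r\<bar> \<le> \<delta>" if rs: "-l < r" "r \<le> s" "s < l" for r s
    proof -
      have "(H s - H r)\<^sup>2 = (LINT z|lborel. gxy z * rect p q r s z)\<^sup>2"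
        using rect_mixed[OF l wxy _ u pq rs] by (simp add: H_def)
      also have "\<dots> \<le> (LINT z|lborel. (gxy z)\<^sup>2) * ((q - p) * (s - r))"
        using wxy pq rs by (intro rect_CS) (auto simp: wrep_def)
      also have "\<dots> \<le> N * ((q - p) * (2 * l))"
        using N pq rs N0 by (intro mult_mono) auto
      finally show ?thesis unfolding \<delta>_def by (intro real_le_rsqrt) (simp add: ac_simps)
    qed
    have osc': "\<bar>H s - H r\<bar> \<le> \<delta>" if "-l < r" "r < l" "-l < s" "s < l" for r s
      using osc[of r s] osc[of s r] that by (cases "r \<le> s") (auto simp: abs_minus_commute)
    \<comment> \<open>The middle half of the height has length \<open>l\<close> and stays away from
      the ends, as \<open>rect_x\<close> requires an interior rectangle.\<close>
    let ?r = "- l / 2" let ?s = "l / 2"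
    have rs: "-l < ?r" "?r \<le> ?s" "?s < l" using l by auto
    define A where "A = (LINT t|lborel. H t * indicator {?r<..?s} t)"
    have A2: "A\<^sup>2 \<le> pi\<^sup>2 * N * ((q - p) * l)"
    proof -
      have "A\<^sup>2 = (LINT z|lborel. gx z * rect p q ?r ?s z)\<^sup>2"
        using rect_x[OF l wx u pq rs] by (simp add: A_def H_def)
      also have "\<dots> \<le> (LINT z|lborel. (gx z)\<^sup>2) * ((q - p) * (?s - ?r))"
        using wx pq rs by (intro rect_CS) (auto simp: wrep_def)
      also have "\<dots> \<le> (pi\<^sup>2 * N) * ((q - p) * l)"
        using gxx0 pq l N0 by (intro mult_mono) auto
      finally show ?thesis .
    qed
    then have "\<bar>A\<bar> \<le> sqrt (pi\<^sup>2 * N * ((q - p) * l))" by (intro real_le_rsqrt) (simp only: power2_abs)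
    also have "\<dots> = pi * sqrt N * sqrt (q - p) * sqrt l" by (simp add: real_sqrt_mult)
    finally have A: "\<bar>A\<bar> \<le> pi * sqrt N * sqrt (q - p) * sqrt l" .
    have Hi: "integrable lborel (\<lambda>t. H t * indicator {?r<..?s} t)"
    proof -
      have "continuous_on {?r..?s} H"
        unfolding H_def[abs_def]
        by (intro continuous_intros continuous_on_compose2[OF u]) (use pq l in \<open>auto simp: closure_Omega intro!: continuous_intros\<close>)
      then have "integrable lborel (\<lambda>t. indicator {?r..?s} t *\<^sub>R H t)"
        by (intro borel_integrable_compact) auto
      then have "integrable lborel (\<lambda>t. indicator {?r<..?s} t * (indicator {?r..?s} t *\<^sub>R H t))"
        by (rule integrable_indicator_mult) simp
      moreover have "(\<lambda>t. indicator {?r<..?s} t * (indicator {?r..?s} t *\<^sub>R H t)) = (\<lambda>t. H t * indicator {?r<..?s} t)"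
        by (auto simp: indicator_def)
      ultimately show ?thesis by metis
    qed
    have ci: "integrable lborel (\<lambda>t. c * indicator {?r<..?s} t)" "(LINT t|lborel. c * indicator {?r<..?s} t) = c * l" for c :: real
      using l by (auto simp: field_simps)
    have oy: "H y - \<delta> \<le> H t" "H t \<le> H y + \<delta>" if "t \<in> {?r<..?s}" for t
    proof -
      have "-l < t" "t < l" using that l by (auto simp: field_simps)
      from osc'[OF y this] show "H y - \<delta> \<le> H t" "H t \<le> H y + \<delta>" by linarith+
    qed
    have up: "A \<le> (H y + \<delta>) * l"
      unfolding A_def ci(2)[symmetric]
      by (rule integral_mono[OF Hi ci(1)]) (use oy in \<open>auto simp: indicator_def\<close>)
    have lo: "(H y - \<delta>) * l \<le> A"
      unfolding A_def ci(2)[symmetric]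
      by (rule integral_mono[OF ci(1) Hi]) (use oy in \<open>auto simp: indicator_def\<close>)
    have "\<bar>H y\<bar> * l \<le> \<delta> * l + \<bar>A\<bar>"
      using up lo l by (cases "H y \<ge> 0") (auto simp: algebra_simps)
    then have "\<bar>H y\<bar> \<le> \<delta> + \<bar>A\<bar> / l" using l by (simp add: field_simps)
    also have "\<bar>A\<bar> / l \<le> pi * sqrt N * sqrt (q - p) * sqrt l / l" using A l by (simp add: divide_right_mono)
    also have "\<delta> + pi * sqrt N * sqrt (q - p) * sqrt l / l = (sqrt (2 * l) + pi / sqrt l) * sqrt N * sqrt (q - p)"
    proof -
      have "sqrt l / l = 1 / sqrt l" using l by (simp add: field_simps)
      then have "pi * sqrt N * sqrt (q - p) * sqrt l / l = pi / sqrt l * sqrt N * sqrt (q - p)"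
        by (metis (no_types, opaque_lifting) mult.commute mult.left_commute mult.right_neutral times_divide_eq_right)
      moreover have "\<delta> = sqrt (2 * l) * sqrt N * sqrt (q - p)" unfolding \<delta>_def
        by (simp only: real_sqrt_mult mult.assoc) (simp only: ac_simps)
      ultimately show ?thesis by (simp add: distrib_right)
    qed
    finally show ?thesis by (simp add: H_def)
  qed
  show ?thesis
    using main[of p q] main[of q p] p q by (cases "p \<le> q") (auto simp: abs_minus_commute)
qed

text \<open>Two interior points are joined through the corner \<open>(x', y)\<close>, one leg in
  each direction; both coordinate distances are at most \<open>dist z z'\<close>. The estimate
  reaches the closure by approximation, because \<open>u\<close> is continuous there.\<close>

lemma holder:
  assumes l: "l > 0" and wx: "wrep l [True] u gx" and wxx: "wrep l [True, True] u gxx" and wxy: "wrep l [True, False] u gxy"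
    and u: "continuous_on (closure (Omega l)) u"
    and u0: "\<And>y. y \<in> {-l<..<l} \<Longrightarrow> u (0, y) = 0 \<and> u (pi, y) = 0"
    and N: "(LINT z|lborel. (gxx z)\<^sup>2) \<le> N" "(LINT z|lborel. (gxy z)\<^sup>2) \<le> N"
    and z: "z \<in> closure (Omega l)" "z' \<in> closure (Omega l)"
  shows "\<bar>u z - u z'\<bar> \<le> (sqrt (2 * l) + pi / sqrt l + sqrt pi) * sqrt N * sqrt (dist z z')"
proof -
  let ?C = "sqrt (2 * l) + pi / sqrt l + sqrt pi"
  have "0 \<le> (LINT z|lborel. (gxx z)\<^sup>2)" by simp
  then have N0: "N \<ge> 0" using N(1) by linarith
  have inner: "\<bar>u z - u z'\<bar> \<le> ?C * sqrt N * sqrt (dist z z')" if "z \<in> Omega l" "z' \<in> Omega l" for z z'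
  proof -
    obtain x y x' y' where zz: "z = (x, y)" "z' = (x', y')" by (cases z, cases z')
    have b: "0 < x" "x < pi" "-l < y" "y < l" "0 < x'" "x' < pi" "-l < y'" "y' < l" using that zz by (auto simp: Omega_mem)
    have d: "\<bar>x - x'\<bar> \<le> dist z z'" "\<bar>y - y'\<bar> \<le> dist z z'"
      using dist_fst_le[of z z'] dist_snd_le[of z z'] zz by (auto simp: dist_real_def)
    have "\<bar>u (x, y) - u (x', y)\<bar> \<le> (sqrt (2 * l) + pi / sqrt l) * sqrt N * sqrt \<bar>x - x'\<bar>"
      by (rule holder_x[OF l wx wxx wxy u u0]) (use b N in auto)
    also have "\<dots> \<le> (sqrt (2 * l) + pi / sqrt l) * sqrt N * sqrt (dist z z')"
      using d l N0 by (intro mult_left_mono) auto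
    finally have 1: "\<bar>u (x, y) - u (x', y)\<bar> \<le> (sqrt (2 * l) + pi / sqrt l) * sqrt N * sqrt (dist z z')" .
    have "(u (x', y) - u (x', y'))\<^sup>2 \<le> pi * \<bar>y - y'\<bar> * (LINT z|lborel. (gxy z)\<^sup>2)"
      by (rule holder_y[OF l wxy u u0]) (use b in auto)
    also have "\<dots> \<le> pi * dist z z' * N" using d N by (intro mult_mono) auto
    finally have "\<bar>u (x', y) - u (x', y')\<bar> \<le> sqrt (pi * dist z z' * N)"
      by (intro real_le_rsqrt) (simp only: power2_abs)
    then have 2: "\<bar>u (x', y) - u (x', y')\<bar> \<le> sqrt pi * sqrt N * sqrt (dist z z')" by (simp add: real_sqrt_mult ac_simps)
    have "\<bar>u z - u z'\<bar> \<le> \<bar>u (x, y) - u (x', y)\<bar> + \<bar>u (x', y) - u (x', y')\<bar>" unfolding zz by simp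
    also have "\<dots> \<le> ?C * sqrt N * sqrt (dist z z')" using 1 2 by (simp add: distrib_right)
    finally show ?thesis .
  qed
  obtain a where a: "\<And>n. a n \<in> Omega l" "a \<longlonglongrightarrow> z" using z(1) closure_sequential by blast
  obtain b where b: "\<And>n. b n \<in> Omega l" "b \<longlonglongrightarrow> z'" using z(2) closure_sequential by blast
  have au: "(\<lambda>n. u (a n)) \<longlonglongrightarrow> u z"
    by (rule continuous_on_tendsto_compose[OF u a(2) z(1)]) (intro always_eventually allI subsetD[OF closure_subset a(1)])
  have bu: "(\<lambda>n. u (b n)) \<longlonglongrightarrow> u z'"
    by (rule continuous_on_tendsto_compose[OF u b(2) z(2)]) (intro always_eventually allI subsetD[OF closure_subset b(1)])
  show ?thesis
  proof (rule LIMSEQ_le)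
    show "(\<lambda>n. \<bar>u (a n) - u (b n)\<bar>) \<longlonglongrightarrow> \<bar>u z - u z'\<bar>" by (intro tendsto_intros au bu)
    show "(\<lambda>n. ?C * sqrt N * sqrt (dist (a n) (b n))) \<longlonglongrightarrow> ?C * sqrt N * sqrt (dist z z')" by (intro tendsto_intros a b)
    show "\<exists>n0. \<forall>n\<ge>n0. \<bar>u (a n) - u (b n)\<bar> \<le> ?C * sqrt N * sqrt (dist (a n) (b n))"
      using inner[OF a(1) b(1)] by blast
  qed
qed

section \<open>Abstract obstacle problems\<close>

text \<open>Common form of a load: functionals from the dual ball and densities both qualify. The
  bound is phrased with an arbitrary pointwise bound \<open>b\<close> instead of a supremum, which
  makes it directly usable with uniform error bounds.\<close>

definition admissible :: "'a::euclidean_space set \<Rightarrow> real \<Rightarrow> (('a \<Rightarrow> real) \<Rightarrow> real) \<Rightarrow> bool" where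
  "admissible S M P \<longleftrightarrow>
     (\<forall>u v a b. continuous_on S u \<longrightarrow> continuous_on S v \<longrightarrow> P (\<lambda>z. a * u z + b * v z) = a * P u + b * P v) \<and>
     (\<forall>v b. continuous_on S v \<longrightarrow> (\<forall>z\<in>S. \<bar>v z\<bar> \<le> b) \<longrightarrow> \<bar>P v\<bar> \<le> M * b)"

text \<open>The assumptions distil what the direct method uses: energy controls the sup norm and the
  modulus of continuity, the energy norm is complete, and \<open>K\<close> is convex, closed and
  uniformly bounded. \<open>H_ext\<close> makes an element depend on its values on \<open>S\<close>
  only, so that a solution is unique as a function and can be named by \<open>THE\<close>.\<close>

locale obstacle =
  fixes H :: "('a::euclidean_space \<Rightarrow> real) set" and A :: "('a \<Rightarrow> real) \<Rightarrow> ('a \<Rightarrow> real) \<Rightarrow> real"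
    and S :: "'a set" and K :: "('a \<Rightarrow> real) set" and C B :: real
  assumes H_lin: "\<And>u v a b. u \<in> H \<Longrightarrow> v \<in> H \<Longrightarrow> (\<lambda>z. a * u z + b * v z) \<in> H"
    and A_sym: "\<And>u v. u \<in> H \<Longrightarrow> v \<in> H \<Longrightarrow> A u v = A v u"
    and A_lin: "\<And>u v w a b. u \<in> H \<Longrightarrow> v \<in> H \<Longrightarrow> w \<in> H \<Longrightarrow> A (\<lambda>z. a * u z + b * v z) w = a * A u w + b * A v w"
    and A_nonneg: "\<And>u. u \<in> H \<Longrightarrow> A u u \<ge> 0"
    and S: "compact S" "S \<noteq> {}"
    and H_cont: "\<And>u. u \<in> H \<Longrightarrow> continuous_on S u"
    and C0: "C \<ge> 0"
    and holder: "\<And>u z z'. u \<in> H \<Longrightarrow> z \<in> S \<Longrightarrow> z' \<in> S \<Longrightarrow> \<bar>u z - u z'\<bar> \<le> C * sqrt (A u u) * sqrt (dist z z')"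
    and sup: "\<And>u z. u \<in> H \<Longrightarrow> z \<in> S \<Longrightarrow> \<bar>u z\<bar> \<le> C * sqrt (A u u)"
    and H_ext: "\<And>u v. u \<in> H \<Longrightarrow> v \<in> H \<Longrightarrow> (\<And>z. z \<in> S \<Longrightarrow> u z = v z) \<Longrightarrow> u = v"
    and complete: "\<And>X. (\<And>n. X n \<in> H) \<Longrightarrow>
        (\<And>e. e > 0 \<Longrightarrow> \<exists>N. \<forall>m\<ge>N. \<forall>n\<ge>N. A (\<lambda>z. X n z - X m z) (\<lambda>z. X n z - X m z) \<le> e) \<Longrightarrow>
        \<exists>u\<in>H. (\<lambda>n. A (\<lambda>z. X n z - u z) (\<lambda>z. X n z - u z)) \<longlonglongrightarrow> 0"
    and KH: "K \<subseteq> H" and K_zero: "(\<lambda>_. 0) \<in> K"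
    and K_convex: "\<And>u v t. u \<in> K \<Longrightarrow> v \<in> K \<Longrightarrow> 0 \<le> t \<Longrightarrow> t \<le> 1 \<Longrightarrow> (\<lambda>z. (1 - t) * u z + t * v z) \<in> K"
    and K_closed: "\<And>X u. u \<in> H \<Longrightarrow> (\<And>n :: nat. X n \<in> K) \<Longrightarrow> (\<And>z. z \<in> S \<Longrightarrow> (\<lambda>n. X n z) \<longlonglongrightarrow> u z) \<Longrightarrow> u \<in> K"
    and K_bdd: "\<And>u z. u \<in> K \<Longrightarrow> z \<in> S \<Longrightarrow> \<bar>u z\<bar> \<le> B"
begin

abbreviation q where "q u \<equiv> A u u"

lemma H_diff: "u \<in> H \<Longrightarrow> v \<in> H \<Longrightarrow> (\<lambda>z. u z - v z) \<in> H"
  using H_lin[of u v 1 "-1"] by simp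

lemma A_diff: "u \<in> H \<Longrightarrow> v \<in> H \<Longrightarrow> w \<in> H \<Longrightarrow> A (\<lambda>z. u z - v z) w = A u w - A v w"
  using A_lin[of u v w 1 "-1"] by simp

lemma A_lin2: "u \<in> H \<Longrightarrow> v \<in> H \<Longrightarrow> w \<in> H \<Longrightarrow> A w (\<lambda>z. a * u z + b * v z) = a * A w u + b * A w v"
  using A_lin[of u v w a b] A_sym H_lin by simp

lemma A_diff2: "u \<in> H \<Longrightarrow> v \<in> H \<Longrightarrow> w \<in> H \<Longrightarrow> A w (\<lambda>z. u z - v z) = A w u - A w v"
  using A_lin2[of u v w 1 "-1"] by simp

lemma A_CS: assumes "u \<in> H" "v \<in> H" shows "(A u v)\<^sup>2 \<le> q u * q v"
proof (rule quad_nonneg_imp)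
  fix t
  have "0 \<le> q (\<lambda>z. 1 * u z + t * v z)" by (intro A_nonneg H_lin assms)
  also have "\<dots> = q u + 2 * A u v * t + q v * t\<^sup>2"
    using assms by (simp only: A_lin A_lin2 H_lin) (simp add: A_sym[of v u] power2_eq_square algebra_simps)
  finally show "0 \<le> q u + 2 * A u v * t + q v * t\<^sup>2" .
qed (use assms A_nonneg in simp)

lemma A_tendsto_0:
  assumes X: "\<And>n. X n \<in> H" and "w \<in> H" and "(\<lambda>n. q (X n)) \<longlonglongrightarrow> 0"
  shows "(\<lambda>n. A w (X n)) \<longlonglongrightarrow> 0"
proof (rule Lim_null_comparison)
  have "(\<lambda>n. sqrt (q w * q (X n))) \<longlonglongrightarrow> sqrt (q w * 0)" by (intro tendsto_intros assms)
  then show "(\<lambda>n. sqrt (q w * q (X n))) \<longlonglongrightarrow> 0" by simp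
  show "\<forall>\<^sub>F n in sequentially. norm (A w (X n)) \<le> sqrt (q w * q (X n))"
  proof (rule always_eventually, rule allI)
    fix n
    have "\<bar>A w (X n)\<bar>\<^sup>2 \<le> q w * q (X n)" using A_CS[OF assms(2) X] by simp
    then show "norm (A w (X n)) \<le> sqrt (q w * q (X n))" unfolding real_norm_def by (rule real_le_rsqrt)
  qed
qed

text \<open>The variational inequality contains the term \<open>q (X n)\<close>, which weak
  convergence would control from one side only. Convergence in energy gives its limit, and uniform
  convergence on \<open>S\<close> comes along by \<open>sup\<close>.\<close>

lemma strong_limit:
  assumes X: "\<And>n. X n \<in> H" and u: "u \<in> H" and lim: "(\<lambda>n. q (\<lambda>z. X n z - u z)) \<longlonglongrightarrow> 0"
  shows "\<exists>b. b \<longlonglongrightarrow> 0 \<and> (\<forall>n. \<forall>z\<in>S. \<bar>X n z - u z\<bar> \<le> b n)"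
    "\<phi> \<in> H \<Longrightarrow> (\<lambda>n. A (X n) (\<lambda>z. \<phi> z - X n z)) \<longlonglongrightarrow> A u (\<lambda>z. \<phi> z - u z)"
    "(\<lambda>n. q (X n)) \<longlonglongrightarrow> q u"
proof -
  note XH = X u H_diff[OF X u]
  have "(\<lambda>n. C * sqrt (q (\<lambda>z. X n z - u z))) \<longlonglongrightarrow> C * sqrt 0" by (intro tendsto_intros lim)
  then show "\<exists>b. b \<longlonglongrightarrow> 0 \<and> (\<forall>n. \<forall>z\<in>S. \<bar>X n z - u z\<bar> \<le> b n)"
    using sup[OF XH(3)] by (intro exI[of _ "\<lambda>n. C * sqrt (q (\<lambda>z. X n z - u z))"]) auto
  have d0: "(\<lambda>n. A w (\<lambda>z. X n z - u z)) \<longlonglongrightarrow> 0" if "w \<in> H" for w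
    by (rule A_tendsto_0[OF XH(3) that lim])
  have c: "(\<lambda>n. A w (X n)) \<longlonglongrightarrow> A w u" if "w \<in> H" for w
    using d0[OF that] by (simp add: A_diff2[OF X u that] LIM_zero_iff)
  have qe: "q (X n) = q (\<lambda>z. X n z - u z) + 2 * A u (X n) - q u" for n
    by (simp add: A_diff[OF X u XH(3)] A_diff2[OF X u X] A_diff2[OF X u u] A_sym[OF X u])
  have "(\<lambda>n. q (\<lambda>z. X n z - u z) + 2 * A u (X n) - q u) \<longlonglongrightarrow> 0 + 2 * q u - q u"
    by (intro tendsto_intros lim c u)
  then show qq: "(\<lambda>n. q (X n)) \<longlonglongrightarrow> q u" unfolding qe by simp
  assume \<phi>: "\<phi> \<in> H"
  have "(\<lambda>n. A \<phi> (X n) - q (X n)) \<longlonglongrightarrow> A \<phi> u - q u" by (intro tendsto_intros c qq \<phi>)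
  then show "(\<lambda>n. A (X n) (\<lambda>z. \<phi> z - X n z)) \<longlonglongrightarrow> A u (\<lambda>z. \<phi> z - u z)"
    by (simp add: A_diff2[OF \<phi> X X] A_diff2[OF \<phi> u u] A_sym[OF _ \<phi>] X u)
qed

lemma strong_limit_K:
  assumes X: "\<And>n. X n \<in> K" and u: "u \<in> H" and lim: "(\<lambda>n. q (\<lambda>z. X n z - u z)) \<longlonglongrightarrow> 0"
  shows "u \<in> K"
proof (rule K_closed[OF u X])
  fix z assume z: "z \<in> S"
  obtain b where b: "b \<longlonglongrightarrow> 0" "\<And>n z. z \<in> S \<Longrightarrow> \<bar>X n z - u z\<bar> \<le> b n"
    using strong_limit(1)[of X u] X KH u lim by blast
  have "(\<lambda>n. X n z - u z) \<longlonglongrightarrow> 0"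
    by (rule Lim_null_comparison[OF _ b(1)]) (use b(2)[OF z] in simp)
  then show "(\<lambda>n. X n z) \<longlonglongrightarrow> u z" by (simp add: LIM_zero_iff)
qed

section \<open>Existence and uniqueness of solutions\<close>

definition sol :: "(('a \<Rightarrow> real) \<Rightarrow> real) \<Rightarrow> ('a \<Rightarrow> real) \<Rightarrow> bool" where
  "sol P u \<longleftrightarrow> u \<in> K \<and> (\<forall>\<phi>\<in>K. A u (\<lambda>z. \<phi> z - u z) \<ge> P (\<lambda>z. \<phi> z - u z))"

lemma sol_ineq: "sol P u \<Longrightarrow> \<phi> \<in> K \<Longrightarrow> P (\<lambda>z. \<phi> z - u z) \<le> A u (\<lambda>z. \<phi> z - u z)"
  unfolding sol_def by blast

lemma admissible_diff:
  assumes "admissible S M P" "u \<in> H" "v \<in> H"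
  shows "P (\<lambda>z. u z - v z) = P u - P v"
proof -
  have "P (\<lambda>z. 1 * u z + (-1) * v z) = 1 * P u + (-1) * P v"
    using assms H_cont unfolding admissible_def by blast
  then show ?thesis by simp
qed

lemma admissible_bound:
  assumes "admissible S M P" "u \<in> H" "\<And>z. z \<in> S \<Longrightarrow> \<bar>u z\<bar> \<le> b" shows "\<bar>P u\<bar> \<le> M * b"
  using assms H_cont unfolding admissible_def by blast

lemma sol_diff:
  assumes P: "admissible S M P" "admissible S M P'" and s: "sol P u" "sol P' u'" and b: "\<And>z. z \<in> S \<Longrightarrow> \<bar>u z - u' z\<bar> \<le> b"
  shows "q (\<lambda>z. u z - u' z) \<le> P (\<lambda>z. u z - u' z) - P' (\<lambda>z. u z - u' z)"
    "q (\<lambda>z. u z - u' z) \<le> 2 * M * b"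
proof -
  have u: "u \<in> H" "u' \<in> H" "u \<in> K" "u' \<in> K" using s KH by (auto simp: sol_def)
  have 1: "A u (\<lambda>z. u' z - u z) \<ge> P (\<lambda>z. u' z - u z)" "A u' (\<lambda>z. u z - u' z) \<ge> P' (\<lambda>z. u z - u' z)"
    using s u by (auto simp: sol_def)
  have 2: "q (\<lambda>z. u z - u' z) = - A u (\<lambda>z. u' z - u z) - A u' (\<lambda>z. u z - u' z)"
    using u by (simp add: A_diff A_diff2 H_diff)
  show 3: "q (\<lambda>z. u z - u' z) \<le> P (\<lambda>z. u z - u' z) - P' (\<lambda>z. u z - u' z)"
    using 1 2 admissible_diff[OF P(1) u(2,1)] admissible_diff[OF P(1) u(1,2)] by linarith
  have "\<bar>P (\<lambda>z. u z - u' z)\<bar> \<le> M * b" "\<bar>P' (\<lambda>z. u z - u' z)\<bar> \<le> M * b"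
    using admissible_bound[OF _ H_diff[OF u(1,2)] b] P by auto
  then show "q (\<lambda>z. u z - u' z) \<le> 2 * M * b" using 3 by linarith
qed

lemma sol_unique:
  assumes P: "admissible S M P" and s: "sol P u" "sol P u'"
  shows "u = u'"
proof -
  have u: "u \<in> H" "u' \<in> H" using s KH by (auto simp: sol_def)
  have "\<bar>u z - u' z\<bar> \<le> 2 * B" if "z \<in> S" for z
    using K_bdd[of u z] K_bdd[of u' z] s that by (auto simp: sol_def)
  from sol_diff(1)[OF P P s this] have "q (\<lambda>z. u z - u' z) \<le> 0" by simp
  then have "q (\<lambda>z. u z - u' z) = 0" using A_nonneg[OF H_diff[OF u]] by linarith
  then show ?thesis using sup[OF H_diff[OF u]] by (intro H_ext u) simp
qed

text \<open>The solution minimises \<open>J\<close> over \<open>K\<close>. By the parallelogram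
  identity every minimising sequence is Cauchy in energy, so completeness provides the minimiser
  without a weak compactness argument.\<close>

lemma sol_exists:
  assumes P: "admissible S M P"
  shows "\<exists>u. sol P u"
proof -
  define J where "J u = q u / 2 - P u" for u
  have J_lb: "J u \<ge> - (M * B)" if "u \<in> K" for u
  proof -
    have "\<bar>P u\<bar> \<le> M * B" using admissible_bound[OF P] K_bdd that KH by blast
    moreover have "q u \<ge> 0" using A_nonneg that KH by blast
    ultimately show ?thesis unfolding J_def by linarith
  qed
  define I where "I = Inf (J ` K)"
  have bb: "bdd_below (J ` K)" using J_lb by (intro bdd_belowI) auto
  have I_le: "I \<le> J u" if "u \<in> K" for u unfolding I_def using that bb by (intro cInf_lower) auto
  have "\<exists>u\<in>K. J u < I + 1 / real (Suc n)" for n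
  proof -
    have "Inf (J ` K) < I + 1 / real (Suc n)" unfolding I_def by simp
    then show ?thesis using cInf_lessD[of "J ` K"] K_zero by blast
  qed
  then obtain X where X: "\<And>n. X n \<in> K" "\<And>n. J (X n) < I + 1 / real (Suc n)" by metis
  have XH: "X n \<in> H" for n using X(1) KH by blast
  \<comment> \<open>The midpoint of \<open>u\<close> and \<open>v\<close> lies in \<open>K\<close>,
    so its energy is at least \<open>I\<close>. In \<open>J u + J v - 2 * J m\<close> the linear
    parts cancel and a quarter of \<open>q (u - v)\<close> remains; hence the factor 4.\<close>
  have par: "q (\<lambda>z. u z - v z) \<le> 4 * (J u + J v - 2 * I)" if "u \<in> K" "v \<in> K" for u v
  proof -
    have H: "u \<in> H" "v \<in> H" using that KH by auto
    have m: "(\<lambda>z. (1 - 1/2) * u z + (1/2) * v z) \<in> K" by (rule K_convex) (use that in auto)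
    have Pm: "P (\<lambda>z. (1 - 1/2) * u z + (1/2) * v z) = (1 - 1/2) * P u + (1/2) * P v"
      using P H H_cont unfolding admissible_def by blast
    have "q (\<lambda>z. (1 - 1/2) * u z + (1/2) * v z) = (q u + 2 * A u v + q v) / 4"
      using H by (simp only: A_lin A_lin2 H_lin) (simp add: A_sym[of v u] field_simps)
    moreover have "q (\<lambda>z. u z - v z) = q u - 2 * A u v + q v"
      using H by (simp add: A_diff A_diff2 H_diff A_sym[of v u])
    ultimately show ?thesis
      using I_le[OF m] Pm unfolding J_def by (simp add: field_simps)
  qed
  have "\<exists>u\<in>H. (\<lambda>n. q (\<lambda>z. X n z - u z)) \<longlonglongrightarrow> 0"
  proof (rule complete[OF XH])
    fix e :: real assume e: "e > 0"
    obtain N where N: "\<And>n. n \<ge> N \<Longrightarrow> 1 / real (Suc n) < e / 8"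
      using eventually_inverse_less[of "e/8"] e by (auto simp: eventually_sequentially)
    show "\<exists>N. \<forall>m\<ge>N. \<forall>n\<ge>N. q (\<lambda>z. X n z - X m z) \<le> e"
    proof (intro exI allI impI)
      fix m n assume mn: "N \<le> m" "N \<le> n"
      have "J (X n) + J (X m) - 2 * I \<le> e / 4"
        using X(2)[of n] X(2)[of m] N[OF mn(1)] N[OF mn(2)] by linarith
      then show "q (\<lambda>z. X n z - X m z) \<le> e"
        using par[OF X(1)[of n] X(1)[of m]] by simp
    qed
  qed
  then obtain u where u: "u \<in> H" and lim: "(\<lambda>n. q (\<lambda>z. X n z - u z)) \<longlonglongrightarrow> 0" by blast
  have uK: "u \<in> K" by (rule strong_limit_K[OF X(1) u lim])
  have Plim: "(\<lambda>n. P (X n)) \<longlonglongrightarrow> P u"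
  proof -
    obtain b where b: "b \<longlonglongrightarrow> 0" "\<And>n z. z \<in> S \<Longrightarrow> \<bar>X n z - u z\<bar> \<le> b n"
      using strong_limit(1)[OF XH u lim] by blast
    have "(\<lambda>n. M * b n) \<longlonglongrightarrow> M * 0" by (intro tendsto_intros b)
    moreover have "norm (P (X n) - P u) \<le> M * b n" for n
      unfolding real_norm_def admissible_diff[OF P XH u, symmetric] by (rule admissible_bound[OF P H_diff[OF XH u] b(2)])
    ultimately have "(\<lambda>n. P (X n) - P u) \<longlonglongrightarrow> 0"
      by (intro Lim_null_comparison[of "\<lambda>n. P (X n) - P u" "\<lambda>n. M * b n"] always_eventually allI) simp_all
    then show ?thesis by (simp add: LIM_zero_iff)
  qed
  have "J u \<le> I"
  proof (rule LIMSEQ_le)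
    show "(\<lambda>n. J (X n)) \<longlonglongrightarrow> J u" unfolding J_def by (intro tendsto_intros strong_limit(3)[OF XH u lim] Plim) simp
    have "(\<lambda>n. I + inverse (real (Suc n))) \<longlonglongrightarrow> I + 0" by (intro tendsto_intros LIMSEQ_inverse_real_of_nat)
    then show "(\<lambda>n. I + 1 / real (Suc n)) \<longlonglongrightarrow> I" by (simp add: inverse_eq_divide)
    show "\<exists>N. \<forall>n\<ge>N. J (X n) \<le> I + 1 / real (Suc n)" using X(2) less_imp_le by blast
  qed
  then have min: "J u \<le> J v" if "v \<in> K" for v using I_le[OF that] by linarith
  have "sol P u"
    unfolding sol_def
  proof (intro conjI uK ballI)
    fix \<phi> assume \<phi>: "\<phi> \<in> K"
    have H: "u \<in> H" "\<phi> \<in> H" using uK \<phi> KH by auto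
    define d where "d = (\<lambda>z. \<phi> z - u z)"
    have dH: "d \<in> H" unfolding d_def by (rule H_diff[OF H(2,1)])
    \<comment> \<open>Minimality along the segment from \<open>u\<close> to \<open>\<phi>\<close>.
      After division by \<open>t\<close> the quadratic term still carries a factor \<open>t\<close>
      and vanishes as \<open>t\<close> tends to 0.\<close>
    have ineq: "P d - A u d \<le> t / 2 * q d" if t: "0 < t" "t \<le> 1" for t
    proof -
      have "(\<lambda>z. (1 - t) * u z + t * \<phi> z) = (\<lambda>z. 1 * u z + t * d z)" by (auto simp: d_def algebra_simps)
      moreover have "(\<lambda>z. (1 - t) * u z + t * \<phi> z) \<in> K" using t uK \<phi> by (intro K_convex) auto
      ultimately have "J u \<le> J (\<lambda>z. 1 * u z + t * d z)" using min by metis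
      moreover have "P (\<lambda>z. 1 * u z + t * d z) = 1 * P u + t * P d"
        using P H dH H_cont unfolding admissible_def by blast
      moreover have "q (\<lambda>z. 1 * u z + t * d z) = q u + 2 * t * A u d + t * t * q d"
        using H dH by (simp only: A_lin A_lin2 H_lin) (simp add: A_sym[of d u] algebra_simps)
      ultimately have "0 \<le> t * (A u d + t / 2 * q d - P d)" unfolding J_def by (simp add: algebra_simps)
      then show ?thesis using t by (simp add: zero_le_mult_iff)
    qed
    have "P d - A u d \<le> 0"
    proof (rule tendsto_lowerbound)
      show "((\<lambda>t. t / 2 * q d) \<longlongrightarrow> 0) (at_right 0)"
      proof -
        have "((\<lambda>t. t / 2 * q d) \<longlongrightarrow> 0 / 2 * q d) (at_right 0)" by (intro tendsto_intros) simp
        then show ?thesis by simp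
      qed
      show "\<forall>\<^sub>F t in at_right 0. P d - A u d \<le> t / 2 * q d"
        by (rule eventually_mono[OF eventually_at_right_real[of 0 1]]) (simp, rule ineq, simp_all)
    qed simp
    then show "P (\<lambda>z. \<phi> z - u z) \<le> A u (\<lambda>z. \<phi> z - u z)" by (simp add: d_def)
  qed
  then show ?thesis by blast
qed

lemma the_sol: "admissible S M P \<Longrightarrow> sol P (THE u. sol P u)"
  using sol_exists sol_unique by (metis theI)

section \<open>Maximization over the loads\<close>

definition ampl :: "('a \<Rightarrow> real) \<Rightarrow> real" where "ampl u = (SUP z\<in>S. \<bar>u z\<bar>)"

lemma ampl_le: "(\<And>z. z \<in> S \<Longrightarrow> \<bar>u z\<bar> \<le> c) \<Longrightarrow> ampl u \<le> c"
  unfolding ampl_def using S(2) by (intro cSUP_least) auto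

lemma ampl_diff:
  assumes "u \<in> K" "v \<in> K" "\<And>z. z \<in> S \<Longrightarrow> \<bar>u z - v z\<bar> \<le> b"
  shows "ampl u \<le> ampl v + b"
proof (rule ampl_le)
  fix z assume z: "z \<in> S"
  have "\<bar>v z\<bar> \<le> ampl v" unfolding ampl_def
    by (rule cSUP_upper[OF z]) (use K_bdd[OF assms(2)] in \<open>auto intro!: bdd_aboveI2\<close>)
  then show "\<bar>u z\<bar> \<le> ampl v + b" using assms(3)[OF z] by linarith
qed

text \<open>The order of the limits matters. Equicontinuity first gives an honest subsequence of
  states that converges strongly; the loads then only need a cluster point along a finer filter,
  under which the strong limits persist.\<close>

theorem maximizer_exists:
  assumes F: "F \<noteq> {}" and adm: "\<And>f. f \<in> F \<Longrightarrow> admissible S M (P f)"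
    and cpt: "\<And>f :: nat \<Rightarrow> 'f. (\<And>n. f n \<in> F) \<Longrightarrow>
      \<exists>G g. G \<le> sequentially \<and> G \<noteq> bot \<and> g \<in> F \<and> (\<forall>v. continuous_on S v \<longrightarrow> ((\<lambda>n. P (f n) v) \<longlongrightarrow> P g v) G)"
  shows "\<exists>g\<in>F. \<forall>f\<in>F. ampl (THE u. sol (P f) u) \<le> ampl (THE u. sol (P g) u)"
proof -
  define U where "U f = (THE u. sol (P f) u)" for f
  have U: "sol (P f) (U f)" if "f \<in> F" for f unfolding U_def by (rule the_sol[OF adm[OF that]])
  have UK: "U f \<in> K" if "f \<in> F" for f using U[OF that] by (simp add: sol_def)
  define s where "s = (SUP f\<in>F. ampl (U f))"
  have bd: "bdd_above ((\<lambda>f. ampl (U f)) ` F)"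
    by (rule bdd_aboveI2[of _ _ B]) (use UK K_bdd in \<open>auto intro!: ampl_le\<close>)
  have s_ub: "ampl (U f) \<le> s" if "f \<in> F" for f unfolding s_def by (rule cSUP_upper[OF that bd])
  have "\<exists>f\<in>F. s - 1 / real (Suc n) < ampl (U f)" for n
  proof -
    have "s - 1 / real (Suc n) < (SUP f\<in>F. ampl (U f))" unfolding s_def by simp
    then show ?thesis using less_cSUP_iff[OF F bd] by blast
  qed
  then obtain f where f: "\<And>n. f n \<in> F" "\<And>n. s - 1 / real (Suc n) < ampl (U (f n))" by metis
  have XK: "U (f n) \<in> K" for n using UK f by blast
  then have XH: "U (f n) \<in> H" for n using KH by blast
  \<comment> \<open>Testing with the zero function, which belongs to \<open>K\<close>, bounds the
    energy by the pairing of the load with the state; the obstacles bound the state and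
    \<open>M\<close> bounds the load.\<close>
  have qb: "q (U (f n)) \<le> M * B" for n
  proof -
    have "A (U (f n)) (\<lambda>z. (\<lambda>_. 0) z - U (f n) z) \<ge> P (f n) (\<lambda>z. (\<lambda>_. 0) z - U (f n) z)"
      by (rule sol_ineq[OF U[OF f(1)] K_zero])
    moreover have z: "(\<lambda>_. 0) \<in> H" using K_zero KH by blast
    moreover have "A (U (f n)) (\<lambda>_. 0) = 0" using A_lin2[of "\<lambda>_. 0" "\<lambda>_. 0" "U (f n)" 0 0] z XH by simp
    moreover have "P (f n) (\<lambda>_. 0) = 0"
      using admissible_diff[OF adm[OF f(1)] z z, of n] by simp
    ultimately have "q (U (f n)) \<le> P (f n) (U (f n))"
      using A_diff2[OF z XH XH, of n n] admissible_diff[OF adm[OF f(1)] z XH, of n n] by linarith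
    also have "\<dots> \<le> \<bar>P (f n) (U (f n))\<bar>" by simp
    also have "\<dots> \<le> M * B" by (rule admissible_bound[OF adm[OF f(1)] XH]) (use K_bdd XK in blast)
    finally show ?thesis .
  qed
  obtain g0 k where k: "strict_mono (k :: nat \<Rightarrow> nat)"
    "\<And>e. 0 < e \<Longrightarrow> \<exists>N. \<forall>n x. n \<ge> N \<and> x \<in> S \<longrightarrow> norm (U (f (k n)) x - g0 x) < e"
  proof (rule Arzela_Ascoli[of S "\<lambda>n. U (f n)" B])
    show "compact S" by (rule S(1))
    show "norm (U (f n) x) \<le> B" if "x \<in> S" for n x using K_bdd[OF XK that] by simp
    fix x and e :: real assume x: "x \<in> S" and e: "0 < e"
    \<comment> \<open>The summand 1 keeps \<open>c\<close> positive, so that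
      \<open>(e / c)\<^sup>2\<close> is a valid radius; the square undoes the square root in the
      Hoelder bound.\<close>
    define c where "c = C * sqrt (M * B) + 1"
    have "M * B \<ge> 0" using qb[of 0] A_nonneg[OF XH[of 0]] by linarith
    then have c: "c > 0" using C0 by (simp add: c_def add_nonneg_pos)
    show "\<exists>d>0. \<forall>n y. y \<in> S \<and> norm (x - y) < d \<longrightarrow> norm (U (f n) x - U (f n) y) < e"
    proof (intro exI[of _ "(e / c)\<^sup>2"] conjI allI impI)
      show "0 < (e / c)\<^sup>2" using e c by simp
      fix n y assume y: "y \<in> S \<and> norm (x - y) < (e / c)\<^sup>2"
      have "\<bar>U (f n) x - U (f n) y\<bar> \<le> C * sqrt (q (U (f n))) * sqrt (dist x y)"
        using holder[OF XH x] y by blast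
      also have "\<dots> \<le> c * sqrt (dist x y)"
      proof (rule mult_right_mono)
        have "C * sqrt (q (U (f n))) \<le> C * sqrt (M * B)" using qb C0 by (intro mult_left_mono) auto
        then show "C * sqrt (q (U (f n))) \<le> c" by (simp add: c_def)
      qed simp
      also have "\<dots> < c * (e / c)"
      proof (rule mult_strict_left_mono[OF _ c])
        have "sqrt (dist x y) < sqrt ((e / c)\<^sup>2)" using y by (simp only: real_sqrt_less_iff dist_norm)
        then show "sqrt (dist x y) < e / c" using e c by simp
      qed
      finally show "norm (U (f n) x - U (f n) y) < e" using c by simp
    qed
  qed blast
  define X where "X n = U (f (k n))" for n
  have X: "X n \<in> K" "X n \<in> H" "sol (P (f (k n))) (X n)" for n using XK XH U f(1) by (auto simp: X_def)
  have M0: "M \<ge> 0"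
  proof -
    have "\<bar>P (f 0) (\<lambda>_. 0)\<bar> \<le> M * 1" using admissible_bound[OF adm[OF f(1)], of "\<lambda>_. 0" 1] K_zero KH by auto
    then show ?thesis by linarith
  qed
  have "\<exists>u\<in>H. (\<lambda>n. q (\<lambda>z. X n z - u z)) \<longlonglongrightarrow> 0"
  proof (rule complete[OF X(2)])
    fix e :: real assume e: "e > 0"
    \<comment> \<open>Two states within \<open>\<eta>\<close> of their common limit are within
      \<open>2 * \<eta>\<close> of each other, and \<open>sol_diff\<close> multiplies this by
      \<open>2 * M\<close>. Dividing by \<open>M + 1\<close> avoids a division by zero.\<close>
    define \<eta> where "\<eta> = e / (4 * (M + 1))"
    have \<eta>: "\<eta> > 0" "2 * M * (2 * \<eta>) \<le> e" using e M0 by (auto simp: \<eta>_def field_simps)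
    obtain N where N: "\<And>n x. n \<ge> N \<Longrightarrow> x \<in> S \<Longrightarrow> norm (U (f (k n)) x - g0 x) < \<eta>" using k(2)[OF \<eta>(1)] by blast
    show "\<exists>N. \<forall>m\<ge>N. \<forall>n\<ge>N. q (\<lambda>z. X n z - X m z) \<le> e"
    proof (intro exI allI impI)
      fix m n assume mn: "N \<le> m" "N \<le> n"
      have "\<bar>X n z - X m z\<bar> \<le> 2 * \<eta>" if "z \<in> S" for z
        using N[OF mn(1) that] N[OF mn(2) that] unfolding X_def real_norm_def by linarith
      from sol_diff(2)[OF adm[OF f(1)] adm[OF f(1)] X(3) X(3) this]
      show "q (\<lambda>z. X n z - X m z) \<le> e" using \<eta>(2) by linarith
    qed
  qed
  then obtain u where u: "u \<in> H" and lim: "(\<lambda>n. q (\<lambda>z. X n z - u z)) \<longlonglongrightarrow> 0" by blast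
  have uK: "u \<in> K" by (rule strong_limit_K[OF X(1) u lim])
  obtain b where b: "b \<longlonglongrightarrow> 0" "\<And>n z. z \<in> S \<Longrightarrow> \<bar>X n z - u z\<bar> \<le> b n"
    using strong_limit(1)[OF X(2) u lim] by blast
  \<comment> \<open>The cluster point is taken along the subsequence already extracted; since
    \<open>G\<close> is finer than \<open>sequentially\<close>, all limits obtained so far hold
    along \<open>G\<close> too.\<close>
  obtain G g where G: "G \<le> sequentially" "G \<noteq> bot" and g: "g \<in> F"
    and w: "\<And>v. continuous_on S v \<Longrightarrow> ((\<lambda>n. P (f (k n)) v) \<longlongrightarrow> P g v) G"
    using cpt[of "\<lambda>n. f (k n)"] f(1) by blast
  have "sol (P g) u"
    unfolding sol_def
  proof (intro conjI uK ballI)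
    fix \<phi> assume \<phi>: "\<phi> \<in> K"
    have \<phi>H: "\<phi> \<in> H" using \<phi> KH by blast
    show "P g (\<lambda>z. \<phi> z - u z) \<le> A u (\<lambda>z. \<phi> z - u z)"
    proof (rule tendsto_le[OF G(2)])
      show "((\<lambda>n. A (X n) (\<lambda>z. \<phi> z - X n z)) \<longlongrightarrow> A u (\<lambda>z. \<phi> z - u z)) G"
        using tendsto_mono[OF G(1) strong_limit(2)[OF X(2) u lim \<phi>H]] .
      \<comment> \<open>Loads and states vary together. All loads share the constant
        \<open>M\<close>, so uniform convergence of the states makes their pairing with
        \<open>X n - u\<close> vanish, and the remaining pairing has a fixed argument.\<close>
      have "(\<lambda>n. M * b n) \<longlonglongrightarrow> M * 0" by (intro tendsto_intros b)
      moreover have "norm (P (f (k n)) (\<lambda>z. X n z - u z)) \<le> M * b n" for n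
        unfolding real_norm_def by (rule admissible_bound[OF adm[OF f(1)] H_diff[OF X(2) u] b(2)])
      ultimately have "(\<lambda>n. P (f (k n)) (\<lambda>z. X n z - u z)) \<longlonglongrightarrow> 0"
        by (intro Lim_null_comparison[of "\<lambda>n. P (f (k n)) (\<lambda>z. X n z - u z)" "\<lambda>n. M * b n"] always_eventually allI) simp_all
      then have "((\<lambda>n. P (f (k n)) (\<lambda>z. \<phi> z - u z) - P (f (k n)) (\<lambda>z. X n z - u z)) \<longlongrightarrow> P g (\<lambda>z. \<phi> z - u z) - 0) G"
        using w[OF H_cont[OF H_diff[OF \<phi>H u]]] tendsto_mono[OF G(1)] by (intro tendsto_diff) auto
      moreover have "P (f (k n)) (\<lambda>z. \<phi> z - u z) - P (f (k n)) (\<lambda>z. X n z - u z) = P (f (k n)) (\<lambda>z. \<phi> z - X n z)" for n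
        using admissible_diff[OF adm[OF f(1)] \<phi>H u, of "k n"] admissible_diff[OF adm[OF f(1)] X(2) u, of "k n" n]
          admissible_diff[OF adm[OF f(1)] \<phi>H X(2), of "k n" n] by linarith
      ultimately show "((\<lambda>n. P (f (k n)) (\<lambda>z. \<phi> z - X n z)) \<longlongrightarrow> P g (\<lambda>z. \<phi> z - u z)) G" by simp
      show "\<forall>\<^sub>F n in G. P (f (k n)) (\<lambda>z. \<phi> z - X n z) \<le> A (X n) (\<lambda>z. \<phi> z - X n z)"
        using X(3) \<phi> by (auto simp: sol_def)
    qed
  qed
  then have Ug: "U g = u" using sol_unique[OF adm[OF g]] U[OF g] by blast
  have "s \<le> ampl u"
  proof (rule LIMSEQ_le)
    have "(\<lambda>n. s - inverse (real (Suc n))) \<longlonglongrightarrow> s - 0" by (intro tendsto_intros LIMSEQ_inverse_real_of_nat)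
    then show "(\<lambda>n. s - inverse (real (Suc n))) \<longlonglongrightarrow> s" by simp
    have "(\<lambda>n. ampl u + b n) \<longlonglongrightarrow> ampl u + 0" by (intro tendsto_intros b)
    then show "(\<lambda>n. ampl u + b n) \<longlonglongrightarrow> ampl u" by simp
    \<comment> \<open>The members \<open>k n\<close> of the subsequence are at least as close to the
      supremum as the index \<open>n\<close> demands, because \<open>n \<le> k n\<close>.\<close>
    have "s - inverse (real (Suc n)) \<le> ampl u + b n" for n
    proof -
      have "n \<le> k n" by (rule seq_suble[OF k(1)])
      then have "1 / real (Suc (k n)) \<le> 1 / real (Suc n)" by (intro divide_left_mono) auto
      then have "s - inverse (real (Suc n)) \<le> s - 1 / real (Suc (k n))" by (simp add: inverse_eq_divide)
      also have "\<dots> \<le> ampl (X n)" using f(2)[of "k n"] by (simp add: X_def)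
      also have "\<dots> \<le> ampl u + b n" by (rule ampl_diff[OF X(1) uK b(2)])
      finally show ?thesis .
    qed
    then show "\<exists>N. \<forall>n\<ge>N. s - inverse (real (Suc n)) \<le> ampl u + b n" by blast
  qed
  then show ?thesis using g s_ub Ug unfolding U_def[symmetric] by (intro bexI[of _ g]) force+
qed

theorem maximizer_neg:
  assumes adm: "\<And>f. f \<in> F \<Longrightarrow> admissible S M (P f)"
    and neg: "f \<in> F" "nf \<in> F" "\<And>v. v \<in> H \<Longrightarrow> P nf v = - P f v"
    and K_neg: "\<And>u. u \<in> K \<Longrightarrow> (\<lambda>z. - u z) \<in> K"
  shows "ampl (THE u. sol (P nf) u) = ampl (THE u. sol (P f) u)"
proof -
  define u where "u = (THE u. sol (P f) u)"
  have u: "sol (P f) u" unfolding u_def by (rule the_sol[OF adm[OF neg(1)]])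
  then have uH: "u \<in> K" "u \<in> H" using KH by (auto simp: sol_def)
  have "sol (P nf) (\<lambda>z. - u z)"
    unfolding sol_def
  proof (intro conjI K_neg uH ballI)
    fix \<phi> assume \<phi>: "\<phi> \<in> K"
    have n\<phi>: "(\<lambda>z. - \<phi> z) \<in> K" "(\<lambda>z. - \<phi> z) \<in> H" "\<phi> \<in> H" using K_neg[OF \<phi>] \<phi> KH by auto
    have d: "(\<lambda>z. - \<phi> z - u z) \<in> H" by (rule H_diff[OF n\<phi>(2) uH(2)])
    \<comment> \<open>Negation is written as a two-term combination with a zero coefficient, the
      form in which \<open>H_lin\<close>, \<open>A_lin\<close> and the linearity of loads are
      stated.\<close>
    have e: "(\<lambda>z. \<phi> z - - u z) = (\<lambda>z. (-1) * (- \<phi> z - u z) + 0 * u z)" "(\<lambda>z. - u z) = (\<lambda>z. (-1) * u z + 0 * u z)" by auto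
    have "P nf (\<lambda>z. (-1) * (- \<phi> z - u z) + 0 * u z) = P f (\<lambda>z. - \<phi> z - u z)"
    proof -
      have "P f (\<lambda>z. (-1) * (- \<phi> z - u z) + 0 * u z) = (-1) * P f (\<lambda>z. - \<phi> z - u z) + 0 * P f u"
        using adm[OF neg(1)] H_cont[OF d] H_cont[OF uH(2)] unfolding admissible_def by blast
      then show ?thesis using neg(3)[OF H_lin[OF d uH(2), of "-1" 0]] by simp
    qed
    also have "\<dots> \<le> A u (\<lambda>z. - \<phi> z - u z)" by (rule sol_ineq[OF u n\<phi>(1)])
    also have "\<dots> = A (\<lambda>z. (-1) * u z + 0 * u z) (\<lambda>z. (-1) * (- \<phi> z - u z) + 0 * u z)"
      using d uH(2) H_lin[OF d uH(2)] by (simp only: A_lin A_lin2) simp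
    finally show "P nf (\<lambda>z. \<phi> z - - u z) \<le> A (\<lambda>z. - u z) (\<lambda>z. \<phi> z - - u z)" unfolding e(1) by (subst e(2))
  qed
  then have "(THE u. sol (P nf) u) = (\<lambda>z. - u z)"
    using sol_unique[OF adm[OF neg(2)]] the_sol[OF adm[OF neg(2)]] by blast
  then show ?thesis unfolding u_def[symmetric] by (simp add: ampl_def)
qed

end

section \<open>The energy space\<close>

lemma set_lebesgue_lborel:
  assumes "f \<in> borel_measurable borel"
  shows "set_integrable lebesgue (Omega l) f \<longleftrightarrow> integrable lborel (\<lambda>z. indicator (Omega l) z * f z)"
    "(LINT z:Omega l|lebesgue. f z) = (LINT z|lborel. indicator (Omega l) z * (f z :: real))"
proof -
  have m: "(\<lambda>z. indicator (Omega l) z * f z) \<in> borel_measurable lborel" using assms by simp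
  show "set_integrable lebesgue (Omega l) f \<longleftrightarrow> integrable lborel (\<lambda>z. indicator (Omega l) z * f z)"
    unfolding set_integrable_def using integrable_completion[OF m] by simp
  show "(LINT z:Omega l|lebesgue. f z) = (LINT z|lborel. indicator (Omega l) z * f z)"
    unfolding set_lebesgue_integral_def using integral_completion[OF m] by simp
qed

lemma iter_pdiff_cont: "test_fun U \<phi> \<Longrightarrow> continuous_on UNIV (iter_pdiff bs \<phi>)"
  unfolding test_fun_def by blast

lemma test_fun_cont: "test_fun U \<phi> \<Longrightarrow> continuous_on UNIV \<phi>"
  using iter_pdiff_cont[of U \<phi> "[]"] by simp

lemma cont_Omega_bound:
  fixes D :: "R2 \<Rightarrow> real"
  assumes "continuous_on UNIV D" obtains c where "\<And>z. z \<in> Omega l \<Longrightarrow> \<bar>D z\<bar> \<le> c" "c \<ge> 0"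
proof -
  obtain c where c: "\<And>z. z \<in> closure (Omega l) \<Longrightarrow> \<bar>D z\<bar> \<le> c"
    using compact_abs_bound[OF compact_closure_Omega continuous_on_subset[OF assms]] by blast
  show thesis by (rule that[of "max c 0"]) (use c closure_subset in fastforce)+
qed

lemma weak_integrable:
  fixes D :: "R2 \<Rightarrow> real"
  assumes u: "continuous_on (closure (Omega l)) u" and D: "continuous_on UNIV D"
  shows "integrable lborel (\<lambda>z. ext0 l u z * D z)"
proof -
  obtain B where B: "\<And>z. \<bar>ext0 l u z\<bar> \<le> B" "B \<ge> 0" using ext0_bound[OF u] by blast
  obtain c where c: "\<And>z. z \<in> Omega l \<Longrightarrow> \<bar>D z\<bar> \<le> c" "c \<ge> 0" using cont_Omega_bound[OF D] by blast
  have Dm: "D \<in> borel_measurable borel" using D by (rule borel_measurable_continuous_onI)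
  show ?thesis
  proof (rule bounded_Omega_integrable[where B = "B * c"])
    show "(\<lambda>z. ext0 l u z * D z) \<in> borel_measurable borel" using ext0_facts(1)[OF u] Dm by simp
    show "\<bar>ext0 l u z * D z\<bar> \<le> B * c" if "z \<in> Omega l" for z
      unfolding abs_mult using B c that by (intro mult_mono) auto
  qed (simp add: ext0_def)
qed

text \<open>In the second part the constant depends on \<open>D\<close> only. This uniformity in
  \<open>g\<close> is what lets the pairing with a test function pass to square-mean limits in
  \<open>wrep_limit\<close>.\<close>

lemma L2_test_integrable:
  fixes D :: "R2 \<Rightarrow> real"
  assumes g: "g \<in> borel_measurable borel" "\<And>z. z \<notin> Omega l \<Longrightarrow> g z = 0" "integrable lborel (\<lambda>z. (g z)\<^sup>2)"
    and D: "continuous_on UNIV D"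
  shows "integrable lborel (\<lambda>z. g z * D z)"
    "\<exists>c. \<forall>g. g \<in> borel_measurable borel \<longrightarrow> (\<forall>z. z \<notin> Omega l \<longrightarrow> g z = 0) \<longrightarrow> integrable lborel (\<lambda>z. (g z)\<^sup>2) \<longrightarrow>
        (LINT z|lborel. g z * D z)\<^sup>2 \<le> c * (LINT z|lborel. (g z)\<^sup>2)"
proof -
  obtain c where c: "\<And>z. z \<in> Omega l \<Longrightarrow> \<bar>D z\<bar> \<le> c" "c \<ge> 0" using cont_Omega_bound[OF D] by blast
  have [measurable]: "D \<in> borel_measurable borel" using D by (rule borel_measurable_continuous_onI)
  let ?D = "\<lambda>z. indicator (Omega l) z * D z"
  have D2: "integrable lborel (\<lambda>z. (?D z)\<^sup>2)"
  proof (rule bounded_Omega_integrable[where l = l and B = "c\<^sup>2"])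
    show "\<bar>(?D z)\<^sup>2\<bar> \<le> c\<^sup>2" if "z \<in> Omega l" for z
      using c(1)[OF that] c(2) that by (simp add: abs_le_square_iff[symmetric])
  qed simp_all
  have eq: "g z * D z = g z * ?D z" if "\<forall>z. z \<notin> Omega l \<longrightarrow> g z = 0" for g :: "R2 \<Rightarrow> real" and z
  proof (cases "z \<in> Omega l")
    case False
    then have "g z = 0" using that by blast
    then show ?thesis by simp
  qed simp
  have "integrable lborel (\<lambda>z. g z * ?D z)"
    by (rule Cauchy_Schwarz_LINT(1)[OF _ _ g(3) D2]) (use g(1) in auto)
  moreover have "(\<lambda>z. g z * D z) = (\<lambda>z. g z * ?D z)" by (intro ext eq) (use g(2) in blast)
  ultimately show "integrable lborel (\<lambda>z. g z * D z)" by (simp only:)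
  show "\<exists>c. \<forall>g. g \<in> borel_measurable borel \<longrightarrow> (\<forall>z. z \<notin> Omega l \<longrightarrow> g z = 0) \<longrightarrow> integrable lborel (\<lambda>z. (g z)\<^sup>2) \<longrightarrow>
        (LINT z|lborel. g z * D z)\<^sup>2 \<le> c * (LINT z|lborel. (g z)\<^sup>2)"
  proof (intro exI allI impI)
    fix g :: "R2 \<Rightarrow> real" assume h: "g \<in> borel_measurable borel" "\<forall>z. z \<notin> Omega l \<longrightarrow> g z = 0" "integrable lborel (\<lambda>z. (g z)\<^sup>2)"
    have "(LINT z|lborel. g z * D z)\<^sup>2 = (LINT z|lborel. g z * ?D z)\<^sup>2"
      unfolding eq[OF h(2)] by simp
    also have "\<dots> \<le> (LINT z|lborel. (g z)\<^sup>2) * (LINT z|lborel. (?D z)\<^sup>2)"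
      by (rule Cauchy_Schwarz_LINT(2)[OF _ _ h(3) D2]) (use h(1) in auto)
    finally show "(LINT z|lborel. g z * D z)\<^sup>2 \<le> (LINT z|lborel. (?D z)\<^sup>2) * (LINT z|lborel. (g z)\<^sup>2)" by (simp add: mult.commute)
  qed
qed

text \<open>Continuity of \<open>u\<close> on the compact closure and square integrability of
  \<open>g\<close> supply the integrability clauses. What is left is one equation over
  \<open>lborel\<close> per test function, a form that is visibly stable under linear combinations
  and limits.\<close>

lemma wrep_iff:
  assumes u: "continuous_on (closure (Omega l)) u"
  shows "wrep l bs u g \<longleftrightarrow> g \<in> borel_measurable borel \<and> (\<forall>z. z \<notin> Omega l \<longrightarrow> g z = 0) \<and> integrable lborel (\<lambda>z. (g z)\<^sup>2) \<and>
    (\<forall>\<phi>. test_fun (Omega l) \<phi> \<longrightarrow> (LINT z|lborel. ext0 l u z * iter_pdiff bs \<phi> z) = (-1) ^ length bs * (LINT z|lborel. g z * \<phi> z))"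
proof -
  have "is_weak_deriv (Omega l) bs u g \<longleftrightarrow>
      (\<forall>\<phi>. test_fun (Omega l) \<phi> \<longrightarrow> (LINT z|lborel. ext0 l u z * iter_pdiff bs \<phi> z) = (-1) ^ length bs * (LINT z|lborel. g z * \<phi> z))"
    if g: "g \<in> borel_measurable borel" "\<And>z. z \<notin> Omega l \<Longrightarrow> g z = 0" "integrable lborel (\<lambda>z. (g z)\<^sup>2)"
  proof -
    have iff: "(set_integrable lebesgue (Omega l) (\<lambda>z. u z * iter_pdiff bs \<phi> z) \<and> set_integrable lebesgue (Omega l) (\<lambda>z. g z * \<phi> z) \<and>
      (LINT z:Omega l|lebesgue. u z * iter_pdiff bs \<phi> z) = (- 1) ^ length bs * (LINT z:Omega l|lebesgue. g z * \<phi> z)) \<longleftrightarrow>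
      (LINT z|lborel. ext0 l u z * iter_pdiff bs \<phi> z) = (-1) ^ length bs * (LINT z|lborel. g z * \<phi> z)" if \<phi>: "test_fun (Omega l) \<phi>" for \<phi>
    proof -
      let ?D = "iter_pdiff bs \<phi>"
      have D: "continuous_on UNIV ?D" "continuous_on UNIV \<phi>" using iter_pdiff_cont[OF \<phi>] test_fun_cont[OF \<phi>] by auto
      have Dm: "?D \<in> borel_measurable borel" "\<phi> \<in> borel_measurable borel" using D by (auto intro: borel_measurable_continuous_onI)
      have e1: "indicator (Omega l) z *\<^sub>R (u z * ?D z) = ext0 l u z * ?D z" for z by (simp add: ext0_def)
      have m1: "(\<lambda>z. ext0 l u z * ?D z) \<in> borel_measurable lborel" using ext0_facts(1)[OF u] Dm by simp
      have m2: "(\<lambda>z. g z * \<phi> z) \<in> borel_measurable lborel" using g Dm by simp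
      have e2: "indicator (Omega l) z *\<^sub>R (g z * \<phi> z) = g z * \<phi> z" for z using g(2) by (cases "z \<in> Omega l") auto
      have "set_integrable lebesgue (Omega l) (\<lambda>z. u z * ?D z)"
        unfolding set_integrable_def e1 integrable_completion[OF m1] by (rule weak_integrable[OF u D(1)])
      moreover have "set_integrable lebesgue (Omega l) (\<lambda>z. g z * \<phi> z)"
        unfolding set_integrable_def e2 integrable_completion[OF m2] by (rule L2_test_integrable(1)[OF g D(2)])
      ultimately show ?thesis
        unfolding set_lebesgue_integral_def e1 e2 integral_completion[OF m1] integral_completion[OF m2] by blast
    qed
    then show ?thesis unfolding is_weak_deriv_def by blast
  qed
  then show ?thesis unfolding wrep_def by blast
qed

lemma ext0_L2: "continuous_on (closure (Omega l)) u \<Longrightarrow> integrable lborel (\<lambda>z. (ext0 l u z)\<^sup>2)"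
proof -
  assume u: "continuous_on (closure (Omega l)) u"
  obtain B where B: "\<And>z. \<bar>ext0 l u z\<bar> \<le> B" "B \<ge> 0" using ext0_bound[OF u] by blast
  show ?thesis
  proof (rule bounded_Omega_integrable[where B = "B\<^sup>2"])
    show "\<bar>(ext0 l u z)\<^sup>2\<bar> \<le> B\<^sup>2" for z using B(1)[of z] B(2) by (simp add: abs_le_square_iff[symmetric])
    show "(\<lambda>z. (ext0 l u z)\<^sup>2) \<in> borel_measurable borel" using ext0_facts(1)[OF u] by simp
    show "z \<notin> Omega l \<Longrightarrow> (ext0 l u z)\<^sup>2 = 0" for z by (simp add: ext0_def)
  qed
qed

lemma wrep_Nil: "continuous_on (closure (Omega l)) u \<Longrightarrow> wrep l [] u (ext0 l u)"
  by (simp add: wrep_iff ext0_facts(1) ext0_L2) (simp add: ext0_def)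

lemma wrep_L2: "wrep l bs u g \<Longrightarrow> L2_on (Omega l) g \<and> is_weak_deriv (Omega l) bs u g"
proof
  assume w: "wrep l bs u g"
  then show "is_weak_deriv (Omega l) bs u g" by (simp add: wrep_def)
  have g: "g \<in> borel_measurable borel" "\<And>z. z \<notin> Omega l \<Longrightarrow> g z = 0" "integrable lborel (\<lambda>z. (g z)\<^sup>2)" using w by (auto simp: wrep_def)
  have e: "indicator (Omega l) z * (g z)\<^sup>2 = (g z)\<^sup>2" for z using g(2) by (cases "z \<in> Omega l") auto
  have "set_borel_measurable lebesgue (Omega l) g"
    unfolding set_borel_measurable_def using g(1) by (intro borel_lebesgue borel_measurable_scaleR) auto
  then show "L2_on (Omega l) g"
    unfolding L2_on_def using set_lebesgue_lborel(1)[of "\<lambda>z. (g z)\<^sup>2" l] g e by simp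
qed

lemma H2star_iff:
  "H2star l u \<longleftrightarrow> continuous_on (closure (Omega l)) u \<and> (\<forall>z. z \<notin> closure (Omega l) \<longrightarrow> u z = 0) \<and>
     (\<forall>bs. length bs \<le> 2 \<longrightarrow> (\<exists>g. wrep l bs u g)) \<and> (\<forall>y\<in>{-l<..<l}. u (0, y) = 0 \<and> u (pi, y) = 0)"
proof -
  have "L2_on (Omega l) u" if u: "continuous_on (closure (Omega l)) u"
  proof -
    have e: "indicator (Omega l) z *\<^sub>R u z = ext0 l u z" "indicator (Omega l) z *\<^sub>R (u z)\<^sup>2 = (ext0 l u z)\<^sup>2" for z
      by (auto simp: ext0_def indicator_def)
    have m: "(\<lambda>z. (ext0 l u z)\<^sup>2) \<in> borel_measurable lborel" using ext0_facts(1)[OF u] by simp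
    show ?thesis
      unfolding L2_on_def set_borel_measurable_def set_integrable_def e integrable_completion[OF m]
      using borel_lebesgue[OF ext0_facts(1)[OF u]] ext0_L2[OF u] by blast
  qed
  moreover have "(\<exists>g. L2_on (Omega l) g \<and> is_weak_deriv (Omega l) bs u g) \<longleftrightarrow> (\<exists>g. wrep l bs u g)" for bs
    using wrep_L2 wrep_exists by metis
  ultimately show ?thesis unfolding H2star_def by blast
qed

lemma H2star_cont: "H2star l u \<Longrightarrow> continuous_on (closure (Omega l)) u"
  by (simp add: H2star_def)

lemma H2star_sides: "H2star l u \<Longrightarrow> y \<in> {-l<..<l} \<Longrightarrow> u (0, y) = 0 \<and> u (pi, y) = 0"
  by (simp add: H2star_def)

section \<open>Representatives of the chosen weak derivatives\<close>

text \<open>\<open>wd\<close> is an arbitrary choice within its class. Its Borel representative is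
  linear in \<open>u\<close> only almost everywhere, so every algebraic property of the energy has
  to pass through an integral.\<close>

definition rep :: "real \<Rightarrow> bool list \<Rightarrow> (R2 \<Rightarrow> real) \<Rightarrow> R2 \<Rightarrow> real" where
  "rep l bs u = (SOME h. wrep l bs u h \<and> (AE z in lebesgue. z \<in> Omega l \<longrightarrow> wd (Omega l) bs u z = h z))"

lemma rep:
  assumes "H2star l u" "length bs \<le> 2"
  shows "wrep l bs u (rep l bs u)" "AE z in lebesgue. z \<in> Omega l \<longrightarrow> wd (Omega l) bs u z = rep l bs u z"
    "L2_on (Omega l) (wd (Omega l) bs u)"
proof -
  have "\<exists>g. L2_on (Omega l) g \<and> is_weak_deriv (Omega l) bs u g" using assms unfolding H2star_def by blast
  then have w: "L2_on (Omega l) (wd (Omega l) bs u)" "is_weak_deriv (Omega l) bs u (wd (Omega l) bs u)"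
    using someI_ex[of "\<lambda>g. L2_on (Omega l) g \<and> is_weak_deriv (Omega l) bs u g"] unfolding wd_def[symmetric] by blast+
  then show "L2_on (Omega l) (wd (Omega l) bs u)" by blast
  have "\<exists>h. wrep l bs u h \<and> (AE z in lebesgue. z \<in> Omega l \<longrightarrow> wd (Omega l) bs u z = h z)"
    using wrep_exists[OF w] by blast
  then show "wrep l bs u (rep l bs u)" "AE z in lebesgue. z \<in> Omega l \<longrightarrow> wd (Omega l) bs u z = rep l bs u z"
    using someI_ex[of "\<lambda>h. wrep l bs u h \<and> (AE z in lebesgue. z \<in> Omega l \<longrightarrow> wd (Omega l) bs u z = h z)"]
    unfolding rep_def[symmetric] by blast+
qed

lemma rep_props:
  assumes "H2star l u" "length bs \<le> 2"
  shows "rep l bs u \<in> borel_measurable borel" "z \<notin> Omega l \<Longrightarrow> rep l bs u z = 0" "integrable lborel (\<lambda>z. (rep l bs u z)\<^sup>2)"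
  using rep(1)[OF assms] unfolding wrep_def by blast+

lemma wrep_lin:
  assumes u: "continuous_on (closure (Omega l)) u" and v: "continuous_on (closure (Omega l)) v"
    and g: "wrep l bs u g" and h: "wrep l bs v h"
  shows "wrep l bs (\<lambda>z. a * u z + b * v z) (\<lambda>z. a * g z + b * h z)"
proof -
  have g': "g \<in> borel_measurable borel" "\<And>z. z \<notin> Omega l \<Longrightarrow> g z = 0" "integrable lborel (\<lambda>z. (g z)\<^sup>2)"
    and gw: "\<And>\<phi>. test_fun (Omega l) \<phi> \<Longrightarrow> (LINT z|lborel. ext0 l u z * iter_pdiff bs \<phi> z) = (-1) ^ length bs * (LINT z|lborel. g z * \<phi> z)"
    using g unfolding wrep_iff[OF u] by blast+
  have h': "h \<in> borel_measurable borel" "\<And>z. z \<notin> Omega l \<Longrightarrow> h z = 0" "integrable lborel (\<lambda>z. (h z)\<^sup>2)"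
    and hw: "\<And>\<phi>. test_fun (Omega l) \<phi> \<Longrightarrow> (LINT z|lborel. ext0 l v z * iter_pdiff bs \<phi> z) = (-1) ^ length bs * (LINT z|lborel. h z * \<phi> z)"
    using h unfolding wrep_iff[OF v] by blast+
  have c: "continuous_on (closure (Omega l)) (\<lambda>z. a * u z + b * v z)" by (intro continuous_intros u v)
  have gh: "integrable lborel (\<lambda>z. g z * h z)" by (rule Cauchy_Schwarz_LINT(1)[OF _ _ g'(3) h'(3)]) (use g' h' in auto)
  have "integrable lborel (\<lambda>z. (a * g z + b * h z)\<^sup>2)"
  proof -
    have "(a * g z + b * h z)\<^sup>2 = a\<^sup>2 * (g z)\<^sup>2 + 2 * a * b * (g z * h z) + b\<^sup>2 * (h z)\<^sup>2" for z
      by (simp add: power2_eq_square algebra_simps)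
    then show ?thesis using g'(3) h'(3) gh by simp
  qed
  moreover have "(LINT z|lborel. ext0 l (\<lambda>z. a * u z + b * v z) z * iter_pdiff bs \<phi> z) = (-1) ^ length bs * (LINT z|lborel. (a * g z + b * h z) * \<phi> z)"
    if \<phi>: "test_fun (Omega l) \<phi>" for \<phi>
  proof -
    note D = iter_pdiff_cont[OF \<phi>, of bs] test_fun_cont[OF \<phi>]
    have "(LINT z|lborel. ext0 l (\<lambda>z. a * u z + b * v z) z * iter_pdiff bs \<phi> z)
        = (LINT z|lborel. a * (ext0 l u z * iter_pdiff bs \<phi> z) + b * (ext0 l v z * iter_pdiff bs \<phi> z))"
      by (rule Bochner_Integration.integral_cong) (simp_all add: ext0_def algebra_simps)
    also have "\<dots> = a * (LINT z|lborel. ext0 l u z * iter_pdiff bs \<phi> z) + b * (LINT z|lborel. ext0 l v z * iter_pdiff bs \<phi> z)"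
      using weak_integrable[OF u D(1)] weak_integrable[OF v D(1)] by simp
    also have "\<dots> = (-1) ^ length bs * (a * (LINT z|lborel. g z * \<phi> z) + b * (LINT z|lborel. h z * \<phi> z))"
      using gw[OF \<phi>] hw[OF \<phi>] by (simp add: algebra_simps)
    also have "a * (LINT z|lborel. g z * \<phi> z) + b * (LINT z|lborel. h z * \<phi> z) = (LINT z|lborel. (a * g z + b * h z) * \<phi> z)"
      using L2_test_integrable(1)[OF g' D(2)] L2_test_integrable(1)[OF h' D(2)] by (simp add: distrib_right mult.assoc)
    finally show ?thesis .
  qed
  ultimately show ?thesis unfolding wrep_iff[OF c] using g'(1,2) h'(1,2) by simp
qed

lemma H2star_lin:
  assumes "H2star l u" "H2star l v" shows "H2star l (\<lambda>z. a * u z + b * v z)"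
  unfolding H2star_iff
proof (intro conjI allI impI ballI)
  note c = H2star_cont[OF assms(1)] H2star_cont[OF assms(2)]
  show "continuous_on (closure (Omega l)) (\<lambda>z. a * u z + b * v z)" by (intro continuous_intros c)
  show "a * u z + b * v z = 0" if "z \<notin> closure (Omega l)" for z
  proof -
    have "u z = 0" "v z = 0" using assms that unfolding H2star_def by blast+
    then show ?thesis by simp
  qed
  show "\<exists>g. wrep l bs (\<lambda>z. a * u z + b * v z) g" if "length bs \<le> 2" for bs
    using wrep_lin[OF c rep(1)[OF assms(1) that] rep(1)[OF assms(2) that]] by blast
  show "a * u (0, y) + b * v (0, y) = 0" "a * u (pi, y) + b * v (pi, y) = 0" if "y \<in> {-l<..<l}" for y
    using H2star_sides[OF assms(1) that] H2star_sides[OF assms(2) that] by auto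
qed

lemma H2star_zero: "H2star l (\<lambda>_. 0)"
proof -
  have c: "continuous_on (closure (Omega l)) (\<lambda>_. 0 :: real)" by simp
  show ?thesis unfolding H2star_iff wrep_iff[OF c] by (auto intro!: exI[of _ "\<lambda>_. 0"] simp: ext0_def)
qed

text \<open>Both sides represent the same weak derivative of the combination, so uniqueness
  decides.\<close>

lemma rep_lin:
  assumes l: "l > 0" and u: "H2star l u" and v: "H2star l v" and bs: "length bs \<le> 2"
  shows "AE z in lborel. rep l bs (\<lambda>z. a * u z + b * v z) z = a * rep l bs u z + b * rep l bs v z"
  by (rule wrep_unique[OF l rep(1)[OF H2star_lin[OF u v] bs] wrep_lin[OF H2star_cont[OF u] H2star_cont[OF v] rep(1)[OF u bs] rep(1)[OF v bs]]
        H2star_cont[OF H2star_lin[OF u v]] refl refl refl])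

section \<open>The plate energy\<close>

text \<open>The integrand of the bilinear form, with \<open>a\<close>, \<open>b\<close>,
  \<open>c\<close> in the roles of \<open>u_xx\<close>, \<open>u_yy\<close>, \<open>u_xy\<close> and
  the primed letters for \<open>v\<close>. Isolated from the functions, it reduces coercivity to
  real algebra.\<close>

definition Qf :: "real \<Rightarrow> real \<Rightarrow> real \<Rightarrow> real \<Rightarrow> real \<Rightarrow> real \<Rightarrow> real \<Rightarrow> real" where
  "Qf s a b c a' b' c' = (a + b) * (a' + b') + (1 - s) * (2 * c * c' - a * b' - b * a')"

abbreviation Qrep :: "real \<Rightarrow> real \<Rightarrow> (R2 \<Rightarrow> real) \<Rightarrow> (R2 \<Rightarrow> real) \<Rightarrow> R2 \<Rightarrow> real" where
  "Qrep l s u v \<equiv> \<lambda>z. Qf s (rep l [True, True] u z) (rep l [False, False] u z) (rep l [True, False] u z)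
       (rep l [True, True] v z) (rep l [False, False] v z) (rep l [True, False] v z)"

lemma Qrep_borel:
  assumes "H2star l u" "H2star l v" shows "Qrep l s u v \<in> borel_measurable borel"
proof -
  have [measurable]: "rep l [a, b] u \<in> borel_measurable borel" "rep l [a, b] v \<in> borel_measurable borel" for a b
    using rep_props(1) assms by auto
  show ?thesis unfolding Qf_def by measurable
qed

lemma Qrep_integrable:
  assumes u: "H2star l u" and v: "H2star l v" and E: "E \<in> sets borel"
  shows "integrable lborel (\<lambda>z. indicator E z * Qrep l s u v z)"
proof -
  have p: "integrable lborel (\<lambda>z. rep l [a, b] u z * rep l [c, d] v z)" for a b c d
    by (rule Cauchy_Schwarz_LINT(1)) (use rep_props[OF u] rep_props[OF v] in auto)
  have "integrable lborel (\<lambda>z. (rep l [True, True] u z * rep l [True, True] v z + rep l [True, True] u z * rep l [False, False] v z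
     + rep l [False, False] u z * rep l [True, True] v z + rep l [False, False] u z * rep l [False, False] v z)
     + (1 - s) * (2 * (rep l [True, False] u z * rep l [True, False] v z) - rep l [True, True] u z * rep l [False, False] v z
        - rep l [False, False] u z * rep l [True, True] v z))"
    by (intro Bochner_Integration.integrable_add Bochner_Integration.integrable_diff integrable_mult_right p)
  moreover have "(rep l [True, True] u z * rep l [True, True] v z + rep l [True, True] u z * rep l [False, False] v z
     + rep l [False, False] u z * rep l [True, True] v z + rep l [False, False] u z * rep l [False, False] v z)
     + (1 - s) * (2 * (rep l [True, False] u z * rep l [True, False] v z) - rep l [True, True] u z * rep l [False, False] v z
        - rep l [False, False] u z * rep l [True, True] v z) = Qrep l s u v z" for z
    unfolding Qf_def by (simp add: algebra_simps)
  ultimately have "integrable lborel (Qrep l s u v)" by simp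
  then show ?thesis by (rule integrable_indicator_mult) (use E in simp)
qed

lemma bform_rep:
  assumes u: "H2star l u" and v: "H2star l v" and E: "E \<in> sets borel" "E \<subseteq> Omega l"
  shows "bform l s E u v = (LINT z|lborel. indicator E z * Qrep l s u v z)"
proof -
  let ?w = "\<lambda>bs u z. wd (Omega l) bs u z"
  let ?W = "\<lambda>z. indicator E z *\<^sub>R Qf s (?w [True, True] u z) (?w [False, False] u z) (?w [True, False] u z)
     (?w [True, True] v z) (?w [False, False] v z) (?w [True, False] v z)"
  have m: "(\<lambda>z. indicator (Omega l) z *\<^sub>R ?w [a, b] f z) \<in> borel_measurable lebesgue" if "f \<in> {u, v}" for a b f
    using rep(3)[of l f "[a, b]"] that u v by (auto simp: L2_on_def set_borel_measurable_def)
  \<comment> \<open>\<open>wd\<close> is known to be measurable only after multiplication with the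
    indicator of the rectangle. The cut-off versions give measurability, and they produce the same
    integrand on \<open>E\<close>.\<close>
  let ?o = "\<lambda>bs f z. indicator (Omega l) z *\<^sub>R ?w bs f z"
  have "(\<lambda>z. indicator E z *\<^sub>R Qf s (?o [True, True] u z) (?o [False, False] u z) (?o [True, False] u z)
     (?o [True, True] v z) (?o [False, False] v z) (?o [True, False] v z)) \<in> borel_measurable lebesgue"
  proof -
    have [measurable]: "?o [a, b] u \<in> borel_measurable lebesgue" "?o [a, b] v \<in> borel_measurable lebesgue" for a b
      by (rule m; simp)+
    have [measurable]: "E \<in> sets lebesgue" using E(1) by simp
    show ?thesis unfolding Qf_def by measurable
  qed
  moreover have "(\<lambda>z. indicator E z *\<^sub>R Qf s (?o [True, True] u z) (?o [False, False] u z) (?o [True, False] u z)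
     (?o [True, True] v z) (?o [False, False] v z) (?o [True, False] v z)) = ?W"
    using E(2) by (intro ext) (auto simp: indicator_def)
  ultimately have Wm: "?W \<in> borel_measurable lebesgue" by simp
  have Rm: "(\<lambda>z. indicator E z * Qrep l s u v z) \<in> borel_measurable lborel" using Qrep_borel[OF u v] E by simp
  have "bform l s E u v = (LINT z|lebesgue. ?W z)"
    unfolding bform_def Let_def set_lebesgue_integral_def Qf_def by simp
  also have "\<dots> = (LINT z|lebesgue. indicator E z * Qrep l s u v z)"
  proof (rule integral_cong_AE[OF Wm measurable_completion[OF Rm]])
    show "AE z in lebesgue. ?W z = indicator E z * Qrep l s u v z"
    proof -
      have "AE z in lebesgue. z \<in> Omega l \<longrightarrow> ?w [a, b] f z = rep l [a, b] f z" if "f \<in> {u, v}" for a b f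
        using rep(2)[of l f "[a, b]"] that u v by auto
      then have "AE z in lebesgue. z \<in> Omega l \<longrightarrow> ?w [True, True] u z = rep l [True, True] u z"
        "AE z in lebesgue. z \<in> Omega l \<longrightarrow> ?w [False, False] u z = rep l [False, False] u z"
        "AE z in lebesgue. z \<in> Omega l \<longrightarrow> ?w [True, False] u z = rep l [True, False] u z"
        "AE z in lebesgue. z \<in> Omega l \<longrightarrow> ?w [True, True] v z = rep l [True, True] v z"
        "AE z in lebesgue. z \<in> Omega l \<longrightarrow> ?w [False, False] v z = rep l [False, False] v z"
        "AE z in lebesgue. z \<in> Omega l \<longrightarrow> ?w [True, False] v z = rep l [True, False] v z"
        by blast+
      then show ?thesis
    proof eventually_elim
      case (elim z)
      then show ?case using E(2) by (cases "z \<in> E") auto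
    qed
    qed
  qed
  also have "\<dots> = (LINT z|lborel. indicator E z * Qrep l s u v z)" by (rule integral_completion[OF Rm])
  finally show ?thesis .
qed

lemma bform_sym:
  assumes "H2star l u" "H2star l v" "E \<in> sets borel" "E \<subseteq> Omega l"
  shows "bform l s E u v = bform l s E v u"
  unfolding bform_rep[OF assms] bform_rep[OF assms(2,1,3,4)] Qf_def by (simp add: algebra_simps)

lemma bform_lin:
  assumes l: "l > 0" and u: "H2star l u" and v: "H2star l v" and w: "H2star l w" and E: "E \<in> sets borel" "E \<subseteq> Omega l"
  shows "bform l s E (\<lambda>z. a * u z + b * v z) w = a * bform l s E u w + b * bform l s E v w"
proof -
  let ?f = "\<lambda>z. a * u z + b * v z"
  have f: "H2star l ?f" by (rule H2star_lin[OF u v])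
  have "bform l s E ?f w = (LINT z|lborel. indicator E z * Qrep l s ?f w z)" by (rule bform_rep[OF f w E])
  also have "\<dots> = (LINT z|lborel. a * (indicator E z * Qrep l s u w z) + b * (indicator E z * Qrep l s v w z))"
  proof (rule integral_cong_AE)
    show "(\<lambda>z. indicator E z * Qrep l s ?f w z) \<in> borel_measurable lborel"
      "(\<lambda>z. a * (indicator E z * Qrep l s u w z) + b * (indicator E z * Qrep l s v w z)) \<in> borel_measurable lborel"
      using Qrep_borel[OF f w, of s] Qrep_borel[OF u w, of s] Qrep_borel[OF v w, of s] E by auto
    have "AE z in lborel. rep l [True, True] ?f z = a * rep l [True, True] u z + b * rep l [True, True] v z"
      "AE z in lborel. rep l [False, False] ?f z = a * rep l [False, False] u z + b * rep l [False, False] v z"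
      "AE z in lborel. rep l [True, False] ?f z = a * rep l [True, False] u z + b * rep l [True, False] v z"
      by (rule rep_lin[OF l u v]; simp)+
    then show "AE z in lborel. indicator E z * Qrep l s ?f w z = a * (indicator E z * Qrep l s u w z) + b * (indicator E z * Qrep l s v w z)"
    proof eventually_elim
      case (elim z)
      then show ?case unfolding elim Qf_def by (simp add: algebra_simps)
    qed
  qed
  also have "\<dots> = a * bform l s E u w + b * bform l s E v w"
    using Qrep_integrable[OF u w E(1)] Qrep_integrable[OF v w E(1)] bform_rep[OF u w E] bform_rep[OF v w E] by simp
  finally show ?thesis .
qed

text \<open>Stands in for the full norm: the boundary condition lets it dominate the lower order
  terms. The mixed derivative is counted once, which changes the norm by a bounded factor
  only.\<close>

definition hess2 :: "real \<Rightarrow> (R2 \<Rightarrow> real) \<Rightarrow> real" where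
  "hess2 l u = (LINT z|lborel. (rep l [True, True] u z)\<^sup>2) + (LINT z|lborel. (rep l [False, False] u z)\<^sup>2) + (LINT z|lborel. (rep l [True, False] u z)\<^sup>2)"

lemma hess2_nonneg: "hess2 l u \<ge> 0"
  by (simp add: hess2_def)

text \<open>Completing squares: each difference is a combination of squares whose coefficients
  \<open>s\<close>, \<open>1 - s\<close> and \<open>2 * s\<close> are nonnegative. This is where the
  range of \<open>s\<close> produces coercivity.\<close>

lemma Qf_bounds:
  assumes "0 < s" "s < 1"
  shows "(1 - s) * (a\<^sup>2 + b\<^sup>2 + c\<^sup>2) \<le> Qf s a b c a b c" "Qf s a b c a b c \<le> 2 * (a\<^sup>2 + b\<^sup>2 + c\<^sup>2)"
proof -
  have e: "Qf s a b c a b c = (1 - s) * (a\<^sup>2 + b\<^sup>2 + c\<^sup>2) + s * (a + b)\<^sup>2 + (1 - s) * c\<^sup>2"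
    by (simp add: Qf_def power2_eq_square algebra_simps)
  show "(1 - s) * (a\<^sup>2 + b\<^sup>2 + c\<^sup>2) \<le> Qf s a b c a b c" unfolding e using assms by simp
  have e': "2 * (a\<^sup>2 + b\<^sup>2 + c\<^sup>2) = Qf s a b c a b c + (1 - s) * (a\<^sup>2 + b\<^sup>2) + s * (a - b)\<^sup>2 + 2 * s * c\<^sup>2"
    by (simp add: Qf_def power2_eq_square algebra_simps)
  show "Qf s a b c a b c \<le> 2 * (a\<^sup>2 + b\<^sup>2 + c\<^sup>2)" unfolding e' using assms by simp
qed

text \<open>The integrand is nonnegative at every point, so the form over any Borel part of the
  rectangle is nonnegative and bounded by the Hessian. The form over \<open>D\<close> can thus be
  added without harming the lower bound over the whole rectangle.\<close>

lemma bform_bounds: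
  assumes u: "H2star l u" and E: "E \<in> sets borel" "E \<subseteq> Omega l" and s: "0 < s" "s < 1"
  shows "0 \<le> bform l s E u u" "bform l s E u u \<le> 2 * hess2 l u" "E = Omega l \<Longrightarrow> (1 - s) * hess2 l u \<le> bform l s E u u"
proof -
  let ?S = "\<lambda>z. (rep l [True, True] u z)\<^sup>2 + (rep l [False, False] u z)\<^sup>2 + (rep l [True, False] u z)\<^sup>2"
  have i: "integrable lborel (\<lambda>z. (rep l [a, b] u z)\<^sup>2)" for a b using rep_props(3)[OF u] by simp
  have Si: "integrable lborel ?S" using i by simp
  have S: "hess2 l u = (LINT z|lborel. ?S z)" unfolding hess2_def using i by simp
  have b: "0 \<le> (1 - s) * ?S z" "(1 - s) * ?S z \<le> Qrep l s u u z" "Qrep l s u u z \<le> 2 * ?S z" for z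
    using Qf_bounds[OF s] s by auto
  then have Q0: "0 \<le> Qrep l s u u z" for z using order_trans by blast
  show "0 \<le> bform l s E u u" unfolding bform_rep[OF u u E] using Q0 by (intro Bochner_Integration.integral_nonneg) auto
  have "bform l s E u u \<le> (LINT z|lborel. 2 * ?S z)"
    unfolding bform_rep[OF u u E]
  proof (rule integral_mono[OF Qrep_integrable[OF u u E(1)]])
    show "integrable lborel (\<lambda>z. 2 * ?S z)" by (rule integrable_mult_right[OF Si])
    show "indicator E z * Qrep l s u u z \<le> 2 * ?S z" for z
      using b(3)[of z] Q0[of z] by (cases "z \<in> E") auto
  qed
  also have "\<dots> = 2 * hess2 l u" unfolding S by (rule integral_mult_right_zero)
  finally show "bform l s E u u \<le> 2 * hess2 l u" .
  assume EO: "E = Omega l"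
  have "(1 - s) * hess2 l u = (LINT z|lborel. (1 - s) * ?S z)" using S by simp
  also have "\<dots> \<le> bform l s E u u"
    unfolding bform_rep[OF u u E]
  proof (rule integral_mono[OF _ Qrep_integrable[OF u u E(1)]])
    show "integrable lborel (\<lambda>z. (1 - s) * ?S z)" using Si by (rule integrable_mult_right)
    show "(1 - s) * ?S z \<le> indicator E z * Qrep l s u u z" for z
      using b(2)[of z] rep_props(2)[OF u] unfolding EO by (cases "z \<in> Omega l") auto
  qed
  finally show "(1 - s) * hess2 l u \<le> bform l s E u u" .
qed

text \<open>One constant for two estimates. The first factor is the Hoelder constant; the second
  makes the sup bound follow from it, since no point is farther than \<open>pi + l\<close> from a
  zero of \<open>u\<close>.\<close>

definition Cemb :: "real \<Rightarrow> real" where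
  "Cemb l = (sqrt (2 * l) + pi / sqrt l + sqrt pi) * (1 + sqrt (pi + l))"

lemma Cemb_nonneg: "l > 0 \<Longrightarrow> Cemb l \<ge> 0"
  by (simp add: Cemb_def)

lemma embedding:
  assumes l: "l > 0" and u: "H2star l u" and z: "z \<in> closure (Omega l)"
  shows "z' \<in> closure (Omega l) \<Longrightarrow> \<bar>u z - u z'\<bar> \<le> Cemb l * sqrt (hess2 l u) * sqrt (dist z z')"
    "\<bar>u z\<bar> \<le> Cemb l * sqrt (hess2 l u)"
proof -
  let ?c = "sqrt (2 * l) + pi / sqrt l + sqrt pi"
  have N: "(LINT z|lborel. (rep l [True, True] u z)\<^sup>2) \<le> hess2 l u" "(LINT z|lborel. (rep l [True, False] u z)\<^sup>2) \<le> hess2 l u"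
    by (simp_all add: hess2_def)
  have h: "\<bar>u z - u z'\<bar> \<le> ?c * sqrt (hess2 l u) * sqrt (dist z z')" if "z' \<in> closure (Omega l)" for z'
    by (rule holder[OF l rep(1)[OF u] rep(1)[OF u] rep(1)[OF u] H2star_cont[OF u] H2star_sides[OF u] N z that]) simp_all
  have c0: "?c \<ge> 0" using l by simp
  have s0: "sqrt (hess2 l u) \<ge> 0" using hess2_nonneg by simp
  show "\<bar>u z - u z'\<bar> \<le> Cemb l * sqrt (hess2 l u) * sqrt (dist z z')" if "z' \<in> closure (Omega l)"
  proof -
    have "?c * 1 \<le> Cemb l" unfolding Cemb_def using c0 l by (intro mult_left_mono) auto
    then have "?c * sqrt (hess2 l u) * sqrt (dist z z') \<le> Cemb l * sqrt (hess2 l u) * sqrt (dist z z')"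
      using s0 by (intro mult_right_mono) auto
    then show ?thesis using h[OF that] by linarith
  qed
  \<comment> \<open>The reference point for the sup bound is the midpoint of the left side, where
    \<open>u\<close> vanishes.\<close>
  have o: "(0, 0) \<in> closure (Omega l)" using l by (simp add: closure_Omega)
  have u0: "u (0, 0) = 0" using H2star_sides[OF u, of 0] l by simp
  have d: "dist z (0, 0) \<le> pi + l"
  proof -
    have "dist z (0, 0) \<le> \<bar>fst z\<bar> + \<bar>snd z\<bar>"
      by (cases z) (simp add: dist_prod_def dist_real_def sqrt_sum_squares_le_sum_abs)
    moreover have "\<bar>fst z\<bar> \<le> pi" "\<bar>snd z\<bar> \<le> l" using z l by (auto simp: closure_Omega)
    ultimately show ?thesis by linarith
  qed
  have "\<bar>u z\<bar> \<le> ?c * sqrt (hess2 l u) * sqrt (dist z (0, 0))" using h[OF o] u0 by simp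
  also have "\<dots> \<le> ?c * sqrt (hess2 l u) * (1 + sqrt (pi + l))"
  proof (rule mult_left_mono)
    have "sqrt (dist z (0, 0)) \<le> sqrt (pi + l)" using d by simp
    then show "sqrt (dist z (0, 0)) \<le> 1 + sqrt (pi + l)" by linarith
  qed (use c0 s0 in simp)
  finally show "\<bar>u z\<bar> \<le> Cemb l * sqrt (hess2 l u)" unfolding Cemb_def by (simp only: ac_simps)
qed

section \<open>Completeness of the energy space\<close>

lemma L2_Omega_complete:
  fixes F :: "nat \<Rightarrow> R2 \<Rightarrow> real"
  assumes F: "\<And>n. F n \<in> borel_measurable borel" "\<And>n z. z \<notin> Omega l \<Longrightarrow> F n z = 0" "\<And>n. integrable lborel (\<lambda>z. (F n z)\<^sup>2)"
    and cauchy: "\<And>e. e > 0 \<Longrightarrow> \<exists>N. \<forall>m\<ge>N. \<forall>n\<ge>N. (LINT z|lborel. (F n z - F m z)\<^sup>2) \<le> e"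
  obtains f where "f \<in> borel_measurable borel" "\<And>z. z \<notin> Omega l \<Longrightarrow> f z = 0" "integrable lborel (\<lambda>z. (f z)\<^sup>2)"
    "(\<lambda>n. LINT z|lborel. (F n z - f z)\<^sup>2) \<longlonglongrightarrow> 0"
proof -
  define M where "M = restrict_space lborel (Omega l)"
  have O: "Omega l \<inter> space lborel \<in> sets lborel" by simp
  have fin: "finite_measure M"
    by (rule finite_measureI) (use Omega_finite[of l] in \<open>simp add: M_def emeasure_restrict_space space_restrict_space less_top\<close>)
  have eq: "indicator (Omega l) z *\<^sub>R (F n z)\<^sup>2 = (F n z)\<^sup>2" "indicator (Omega l) z *\<^sub>R (F n z - F m z)\<^sup>2 = (F n z - F m z)\<^sup>2" for n m z
    using F(2)[of z] by (cases "z \<in> Omega l"; simp)+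
  obtain f where f: "f \<in> borel_measurable M" "integrable M (\<lambda>x. (f x)\<^sup>2)" "(\<lambda>n. LINT x|M. (F n x - f x)\<^sup>2) \<longlonglongrightarrow> 0"
  proof (rule L2_complete[OF fin])
    show "F n \<in> borel_measurable M" for n unfolding M_def using F(1) by (intro measurable_restrict_space1) simp
    show "integrable M (\<lambda>x. (F n x)\<^sup>2)" for n
      unfolding M_def integrable_restrict_space[OF O] eq by (rule F(3))
    show "\<exists>N. \<forall>m\<ge>N. \<forall>n\<ge>N. (LINT x|M. (F n x - F m x)\<^sup>2) \<le> e" if "e > 0" for e
      unfolding M_def integral_restrict_space[OF O] eq by (rule cauchy[OF that])
  qed blast
  define g where "g z = indicator (Omega l) z *\<^sub>R f z" for z
  have e2: "indicator (Omega l) z *\<^sub>R (f z)\<^sup>2 = (g z)\<^sup>2" "indicator (Omega l) z *\<^sub>R (F n z - f z)\<^sup>2 = (F n z - g z)\<^sup>2" for n z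
    using F(2)[of z] by (cases "z \<in> Omega l"; simp add: g_def)+
  show thesis
  proof (rule that[of g])
    show "g \<in> borel_measurable borel"
      using f(1) unfolding M_def borel_measurable_restrict_space_iff[OF O] g_def[abs_def] by simp
    show "g z = 0" if "z \<notin> Omega l" for z using that by (simp add: g_def)
    show "integrable lborel (\<lambda>z. (g z)\<^sup>2)" using f(2) unfolding M_def integrable_restrict_space[OF O] e2 .
    show "(\<lambda>n. LINT z|lborel. (F n z - g z)\<^sup>2) \<longlonglongrightarrow> 0" using f(3) unfolding M_def integral_restrict_space[OF O] e2 .
  qed
qed

text \<open>Closedness of weak differentiation. In the defining equation the left-hand side
  converges because \<open>X n\<close> does so uniformly, and the right-hand side because
  \<open>g n\<close> converges in square mean.\<close>

lemma wrep_limit: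
  assumes X: "\<And>n. continuous_on (closure (Omega l)) (X n)" and u: "continuous_on (closure (Omega l)) u"
    and unif: "b \<longlonglongrightarrow> 0" "\<And>n z. z \<in> closure (Omega l) \<Longrightarrow> \<bar>X n z - u z\<bar> \<le> b n"
    and w: "\<And>n. wrep l bs (X n) (g n)"
    and G: "G \<in> borel_measurable borel" "\<And>z. z \<notin> Omega l \<Longrightarrow> G z = 0" "integrable lborel (\<lambda>z. (G z)\<^sup>2)"
    and lim: "(\<lambda>n. LINT z|lborel. (g n z - G z)\<^sup>2) \<longlonglongrightarrow> 0"
  shows "wrep l bs u G"
  unfolding wrep_iff[OF u]
proof (intro conjI allI impI G)
  fix \<phi> assume \<phi>: "test_fun (Omega l) \<phi>"
  let ?D = "iter_pdiff bs \<phi>"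
  note D = iter_pdiff_cont[OF \<phi>, of bs] test_fun_cont[OF \<phi>]
  have g: "g n \<in> borel_measurable borel" "\<And>z. z \<notin> Omega l \<Longrightarrow> g n z = 0" "integrable lborel (\<lambda>z. (g n z)\<^sup>2)"
    and gw: "(LINT z|lborel. ext0 l (X n) z * ?D z) = (-1) ^ length bs * (LINT z|lborel. g n z * \<phi> z)" for n
    using w[of n] \<phi> unfolding wrep_iff[OF X] by blast+
  show "(LINT z|lborel. ext0 l u z * ?D z) = (-1) ^ length bs * (LINT z|lborel. G z * \<phi> z)"
  proof (rule LIMSEQ_unique)
    obtain c where c: "\<And>z. z \<in> Omega l \<Longrightarrow> \<bar>?D z\<bar> \<le> c" "c \<ge> 0" using cont_Omega_bound[OF D(1)] by blast
    define m where "m = (LINT z|lborel. indicator (Omega l) z :: real)"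
    have est: "norm ((LINT z|lborel. ext0 l (X n) z * ?D z) - (LINT z|lborel. ext0 l u z * ?D z)) \<le> b n * (c * m)" for n
    proof -
      have "(LINT z|lborel. ext0 l (X n) z * ?D z) - (LINT z|lborel. ext0 l u z * ?D z) = (LINT z|lborel. ext0 l (X n) z * ?D z - ext0 l u z * ?D z)"
        using weak_integrable[OF X D(1)] weak_integrable[OF u D(1)] by simp
      also have "norm \<dots> \<le> (LINT z|lborel. b n * (c * indicator (Omega l) z))"
        unfolding real_norm_def
      proof (rule order_trans[OF integral_abs_bound integral_mono])
        show "integrable lborel (\<lambda>z. \<bar>ext0 l (X n) z * ?D z - ext0 l u z * ?D z\<bar>)"
          using weak_integrable[OF X D(1)] weak_integrable[OF u D(1)] by simp
        show "integrable lborel (\<lambda>z. b n * (c * indicator (Omega l) z))"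
          by (intro integrable_mult_right integrable_ind_Omega)
        show "\<bar>ext0 l (X n) z * ?D z - ext0 l u z * ?D z\<bar> \<le> b n * (c * indicator (Omega l) z)" for z
        proof (cases "z \<in> Omega l")
          case True
          then have "\<bar>X n z - u z\<bar> * \<bar>?D z\<bar> \<le> b n * c"
            using unif(2)[of z n] c closure_subset[of "Omega l"] by (intro mult_mono) (auto intro: order_trans[OF abs_ge_zero])
          then show ?thesis using True by (simp add: ext0_def abs_mult[symmetric] left_diff_distrib)
        qed (simp add: ext0_def)
      qed
      also have "\<dots> = b n * (c * m)" unfolding m_def by (simp only: integral_mult_right_zero)
      finally show ?thesis .
    qed
    have "(\<lambda>n. b n * (c * m)) \<longlonglongrightarrow> 0 * (c * m)" by (intro tendsto_intros unif)
    then have "(\<lambda>n. (LINT z|lborel. ext0 l (X n) z * ?D z) - (LINT z|lborel. ext0 l u z * ?D z)) \<longlonglongrightarrow> 0"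
      by (intro Lim_null_comparison[OF always_eventually[OF allI[OF est]]]) simp
    then show "(\<lambda>n. LINT z|lborel. ext0 l (X n) z * ?D z) \<longlonglongrightarrow> (LINT z|lborel. ext0 l u z * ?D z)"
      by (simp add: LIM_zero_iff)
    have gG: "(\<lambda>z. g n z - G z) \<in> borel_measurable borel" "\<And>z. z \<notin> Omega l \<Longrightarrow> g n z - G z = 0" "integrable lborel (\<lambda>z. (g n z - G z)\<^sup>2)" for n
    proof -
      show "(\<lambda>z. g n z - G z) \<in> borel_measurable borel" using g(1) G(1) by simp
      show "\<And>z. z \<notin> Omega l \<Longrightarrow> g n z - G z = 0" using g(2) G(2) by simp
      have "integrable lborel (\<lambda>z. g n z * G z)" by (rule Cauchy_Schwarz_LINT(1)[OF _ _ g(3) G(3)]) (use g(1) G(1) in auto)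
      then have "integrable lborel (\<lambda>z. (g n z)\<^sup>2 + (G z)\<^sup>2 - 2 * (g n z * G z))" using g(3) G(3) by simp
      moreover have "(g n z)\<^sup>2 + (G z)\<^sup>2 - 2 * (g n z * G z) = (g n z - G z)\<^sup>2" for z by (simp add: power2_diff)
      ultimately show "integrable lborel (\<lambda>z. (g n z - G z)\<^sup>2)" by simp
    qed
    obtain k where k: "\<And>g. g \<in> borel_measurable borel \<Longrightarrow> (\<forall>z. z \<notin> Omega l \<longrightarrow> g z = 0) \<Longrightarrow> integrable lborel (\<lambda>z. (g z)\<^sup>2) \<Longrightarrow>
        (LINT z|lborel. g z * \<phi> z)\<^sup>2 \<le> k * (LINT z|lborel. (g z)\<^sup>2)"
      using L2_test_integrable(2)[OF G D(2)] by blast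
    have est2: "norm ((LINT z|lborel. g n z * \<phi> z) - (LINT z|lborel. G z * \<phi> z)) \<le> sqrt (k * (LINT z|lborel. (g n z - G z)\<^sup>2))" for n
    proof -
      have "(LINT z|lborel. g n z * \<phi> z) - (LINT z|lborel. G z * \<phi> z) = (LINT z|lborel. (g n z - G z) * \<phi> z)"
        using L2_test_integrable(1)[OF g D(2)] L2_test_integrable(1)[OF G D(2)] by (simp add: left_diff_distrib)
      moreover have "(LINT z|lborel. (g n z - G z) * \<phi> z)\<^sup>2 \<le> k * (LINT z|lborel. (g n z - G z)\<^sup>2)"
        by (rule k[OF gG(1) _ gG(3)]) (use gG(2) in blast)
      ultimately show ?thesis by (intro real_le_rsqrt) (simp only: real_norm_def power2_abs)
    qed
    have "(\<lambda>n. sqrt (k * (LINT z|lborel. (g n z - G z)\<^sup>2))) \<longlonglongrightarrow> sqrt (k * 0)" by (intro tendsto_intros lim)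
    then have "(\<lambda>n. (LINT z|lborel. g n z * \<phi> z) - (LINT z|lborel. G z * \<phi> z)) \<longlonglongrightarrow> 0"
      by (intro Lim_null_comparison[OF always_eventually[OF allI[OF est2]]]) simp
    then have "(\<lambda>n. LINT z|lborel. g n z * \<phi> z) \<longlonglongrightarrow> (LINT z|lborel. G z * \<phi> z)" by (simp add: LIM_zero_iff)
    then show "(\<lambda>n. LINT z|lborel. ext0 l (X n) z * ?D z) \<longlonglongrightarrow> (-1) ^ length bs * (LINT z|lborel. G z * \<phi> z)"
      unfolding gw by (intro tendsto_intros)
  qed
qed

text \<open>The constant \<open>1 + pi\<^sup>2\<close> covers first derivatives, which cost
  \<open>pi\<^sup>2\<close>, and second derivatives, which cost 1, so that all five can be handled
  uniformly.\<close>

lemma rep_norm_bound: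
  assumes l: "l > 0" and u: "H2star l u" and bs: "bs \<in> {[True], [False], [True, True], [False, False], [True, False]}"
  shows "(LINT z|lborel. (rep l bs u z)\<^sup>2) \<le> (1 + pi\<^sup>2) * hess2 l u"
proof -
  have r: "wrep l bs u (rep l bs u)" if "length bs \<le> 2" for bs using rep(1)[OF u that] .
  have N: "(LINT z|lborel. (rep l [True, True] u z)\<^sup>2) \<le> hess2 l u" "(LINT z|lborel. (rep l [True, False] u z)\<^sup>2) \<le> hess2 l u"
    "(LINT z|lborel. (rep l [False, False] u z)\<^sup>2) \<le> hess2 l u"
    by (simp_all add: hess2_def)
  have x: "(LINT z|lborel. (rep l [True] u z)\<^sup>2) \<le> pi\<^sup>2 * hess2 l u"
    by (rule order_trans[OF first_x_bound[OF l r r H2star_cont[OF u] H2star_sides[OF u]] mult_left_mono[OF N(1)]]) simp_all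
  have y: "(LINT z|lborel. (rep l [False] u z)\<^sup>2) \<le> pi\<^sup>2 * hess2 l u"
    by (rule order_trans[OF first_y_bound[OF l r r H2star_cont[OF u] H2star_sides[OF u]] mult_left_mono[OF N(2)]]) simp_all
  have "1 * hess2 l u \<le> (1 + pi\<^sup>2) * hess2 l u" "pi\<^sup>2 * hess2 l u \<le> (1 + pi\<^sup>2) * hess2 l u"
    using hess2_nonneg by (intro mult_right_mono; simp)+
  then show ?thesis using bs x y N by auto
qed

lemma rep_diff:
  assumes l: "l > 0" and u: "H2star l u" and v: "H2star l v" and bs: "length bs \<le> 2"
  shows "(LINT z|lborel. (rep l bs u z - rep l bs v z)\<^sup>2) = (LINT z|lborel. (rep l bs (\<lambda>z. u z - v z) z)\<^sup>2)"
proof (rule integral_cong_AE)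
  have d: "H2star l (\<lambda>z. u z - v z)" using H2star_lin[OF u v, of 1 "-1"] by simp
  show "AE z in lborel. (rep l bs u z - rep l bs v z)\<^sup>2 = (rep l bs (\<lambda>z. u z - v z) z)\<^sup>2"
    using rep_lin[OF l u v bs, of 1 "-1"] by eventually_elim simp
qed (use rep_props(1)[OF u bs] rep_props(1)[OF v bs] rep_props(1)[OF H2star_lin[OF u v, of 1 "-1"] bs] in auto)

text \<open>The embedding yields a uniform limit and the Hessian bounds yield a square-mean limit
  for each derivative; closedness identifies the latter as the weak derivatives of the
  former.\<close>

lemma H2star_complete:
  fixes X :: "nat \<Rightarrow> R2 \<Rightarrow> real"
  assumes l: "l > 0" and X: "\<And>n. H2star l (X n)"
    and cauchy: "\<And>e. e > 0 \<Longrightarrow> \<exists>N. \<forall>m\<ge>N. \<forall>n\<ge>N. hess2 l (\<lambda>z. X n z - X m z) \<le> e"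
  obtains u where "H2star l u" "(\<lambda>n. hess2 l (\<lambda>z. X n z - u z)) \<longlonglongrightarrow> 0"
proof -
  let ?S = "closure (Omega l)"
  have XX: "H2star l (\<lambda>z. X n z - X m z)" for n m using H2star_lin[OF X X, of 1 n "-1" m] by simp
  have emb: "\<bar>X n z - X m z\<bar> \<le> Cemb l * sqrt (hess2 l (\<lambda>z. X n z - X m z))" if "z \<in> ?S" for n m z
    using embedding(2)[OF l XX that] .
  have uc: "uniformly_Cauchy_on ?S X"
    unfolding uniformly_Cauchy_on_def
  proof (intro allI impI)
    fix e :: real assume e: "e > 0"
    define d where "d = (e / (Cemb l + 1))\<^sup>2"
    have C: "Cemb l + 1 > 0" using Cemb_nonneg[OF l] by simp
    then have d: "d > 0" using e by (simp add: d_def)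
    obtain N where N: "\<And>m n. m \<ge> N \<Longrightarrow> n \<ge> N \<Longrightarrow> hess2 l (\<lambda>z. X n z - X m z) \<le> d" using cauchy[OF d] by blast
    show "\<exists>M. \<forall>x\<in>?S. \<forall>m\<ge>M. \<forall>n\<ge>M. dist (X m x) (X n x) < e"
    proof (intro exI ballI allI impI)
      fix x m n assume x: "x \<in> ?S" and mn: "N \<le> m" "N \<le> n"
      have "sqrt (hess2 l (\<lambda>z. X m z - X n z)) \<le> sqrt d" using N[OF mn(2,1)] by simp
      also have "\<dots> = e / (Cemb l + 1)" using e C by (simp add: d_def)
      finally have "Cemb l * sqrt (hess2 l (\<lambda>z. X m z - X n z)) \<le> Cemb l * (e / (Cemb l + 1))"
        using Cemb_nonneg[OF l] by (rule mult_left_mono)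
      also have "\<dots> < (Cemb l + 1) * (e / (Cemb l + 1))" using e C by (intro mult_strict_right_mono) auto
      also have "\<dots> = e" using C by simp
      finally show "dist (X m x) (X n x) < e" using emb[OF x, of m n] unfolding dist_real_def by linarith
    qed
  qed
  then have "uniformly_convergent_on ?S X" by (rule Cauchy_uniformly_convergent)
  then obtain u0 where u0: "uniform_limit ?S X u0 sequentially" unfolding uniformly_convergent_on_def by blast
  \<comment> \<open>Members of the space are normalised to vanish off the closure, about which the
    uniform limit says nothing.\<close>
  define u where "u z = (if z \<in> ?S then u0 z else 0)" for z
  have ul: "uniform_limit ?S X u sequentially"
    using u0 by (rule uniform_limit_cong'[THEN iffD1, rotated 2]) (simp_all add: u_def)
  have uc: "continuous_on ?S u"
    by (rule uniform_limit_theorem[OF _ ul]) (use H2star_cont[OF X] in auto)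
  have pw: "(\<lambda>n. X n z) \<longlonglongrightarrow> u z" if "z \<in> ?S" for z by (rule tendsto_uniform_limitI[OF ul that])
  define b where "b n = (SUP z\<in>?S. \<bar>X n z - u z\<bar>)" for n
  have Sne: "?S \<noteq> {}" using l by (auto simp: closure_Omega)
  have bu: "\<bar>X n z - u z\<bar> \<le> b n" if "z \<in> ?S" for n z
  proof -
    obtain c where "\<And>z. z \<in> ?S \<Longrightarrow> \<bar>X n z - u z\<bar> \<le> c"
      using compact_abs_bound[OF compact_closure_Omega continuous_on_diff[OF H2star_cont[OF X] uc]] by blast
    then show ?thesis unfolding b_def using that by (intro cSUP_upper bdd_aboveI2)
  qed
  have b0: "b \<longlonglongrightarrow> 0"
  proof (rule LIMSEQ_I)
    fix r :: real assume r: "0 < r"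
    obtain N where N: "\<And>n z. n \<ge> N \<Longrightarrow> z \<in> ?S \<Longrightarrow> \<bar>X n z - u z\<bar> < r / 2"
      using uniform_limitD[OF ul, of "r/2"] r by (auto simp: eventually_sequentially dist_real_def)
    show "\<exists>no. \<forall>n\<ge>no. norm (b n - 0) < r"
    proof (intro exI allI impI)
      fix n assume n: "N \<le> n"
      have "b n \<le> r / 2" unfolding b_def using Sne N[OF n] by (intro cSUP_least) (auto intro: less_imp_le)
      moreover have "(0, 0) \<in> ?S" using l by (simp add: closure_Omega)
      then have "b n \<ge> 0" using bu[of "(0, 0)" n] by linarith
      ultimately show "norm (b n - 0) < r" using r by simp
    qed
  qed
  have lim: "\<exists>G. wrep l bs u G \<and> (\<lambda>n. LINT z|lborel. (rep l bs (X n) z - G z)\<^sup>2) \<longlonglongrightarrow> 0"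
    if bs: "bs \<in> {[True], [False], [True, True], [False, False], [True, False]}" for bs
  proof -
    have len: "length bs \<le> 2" using bs by auto
    note R = rep_props[OF X len]
    obtain G where G: "G \<in> borel_measurable borel" "\<And>z. z \<notin> Omega l \<Longrightarrow> G z = 0" "integrable lborel (\<lambda>z. (G z)\<^sup>2)"
      "(\<lambda>n. LINT z|lborel. (rep l bs (X n) z - G z)\<^sup>2) \<longlonglongrightarrow> 0"
    proof (rule L2_Omega_complete[where l = l, OF R(1) _ R(3)])
      fix e :: real assume e: "e > 0"
      have p: "1 + pi\<^sup>2 > 0" by (simp add: add_pos_nonneg)
      obtain N where N: "\<And>m n. m \<ge> N \<Longrightarrow> n \<ge> N \<Longrightarrow> hess2 l (\<lambda>z. X n z - X m z) \<le> e / (1 + pi\<^sup>2)"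
        using cauchy[of "e / (1 + pi\<^sup>2)"] e p by auto
      show "\<exists>N. \<forall>m\<ge>N. \<forall>n\<ge>N. (LINT z|lborel. (rep l bs (X n) z - rep l bs (X m) z)\<^sup>2) \<le> e"
      proof (intro exI allI impI)
        fix m n assume mn: "N \<le> m" "N \<le> n"
        have "(LINT z|lborel. (rep l bs (X n) z - rep l bs (X m) z)\<^sup>2) \<le> (1 + pi\<^sup>2) * hess2 l (\<lambda>z. X n z - X m z)"
          unfolding rep_diff[OF l X X len] by (rule rep_norm_bound[OF l XX bs])
        also have "\<dots> \<le> (1 + pi\<^sup>2) * (e / (1 + pi\<^sup>2))" using N[OF mn] p by (intro mult_left_mono) auto
        also have "\<dots> = e" using p by simp
        finally show "(LINT z|lborel. (rep l bs (X n) z - rep l bs (X m) z)\<^sup>2) \<le> e" .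
      qed
    qed (use R(2) that in blast)+
    have "wrep l bs u G"
      by (rule wrep_limit[OF H2star_cont[OF X] uc b0 bu rep(1)[OF X len] G])
    then show ?thesis using G(4) by blast
  qed
  have uH: "H2star l u"
    unfolding H2star_iff
  proof (intro conjI allI impI ballI uc)
    show "u z = 0" if "z \<notin> ?S" for z using that by (simp add: u_def)
    show "u (0, y) = 0" "u (pi, y) = 0" if y: "y \<in> {-l<..<l}" for y
    proof -
      have m: "(0, y) \<in> ?S" "(pi, y) \<in> ?S" using y l by (auto simp: closure_Omega)
      show "u (0, y) = 0" "u (pi, y) = 0"
        using pw[OF m(1)] pw[OF m(2)] H2star_sides[OF X y] by (auto dest: LIMSEQ_unique[OF tendsto_const])
    qed
    fix bs :: "bool list" assume "length bs \<le> 2"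
    then have "bs = [] \<or> (\<exists>a. bs = [a]) \<or> (\<exists>a b. bs = [a, b])"
      by (auto simp: numeral_2_eq_2 le_Suc_eq length_Suc_conv)
    then consider "bs = []" | "bs \<in> {[True], [False], [True, True], [False, False], [True, False]}" | "bs = [False, True]"
      by fastforce
    then show "\<exists>g. wrep l bs u g"
    proof cases
      case 1 then show ?thesis using wrep_Nil[OF uc] by blast
    next
      case 2 then show ?thesis using lim by blast
    next
      case 3
      \<comment> \<open>The Hessian controls one order of the mixed derivative. By uniqueness its
        representative serves for the other order as well, so both have the same limit.\<close>
      have "wrep l [False, True] (X n) (rep l [True, False] (X n))" for n
      proof -
        have w: "wrep l [False, True] (X n) (rep l [False, True] (X n))" "wrep l [True, False] (X n) (rep l [True, False] (X n))"
          using rep(1)[OF X] by auto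
        have ae: "AE z in lborel. rep l [False, True] (X n) z = rep l [True, False] (X n) z"
          by (rule wrep_unique[OF l w H2star_cont[OF X]]) auto
        have rb: "rep l [True, False] (X n) \<in> borel_measurable borel" using w(2) by (simp add: wrep_def)
        have "is_weak_deriv (Omega l) [False, True] (X n) (rep l [True, False] (X n))"
        proof (rule is_weak_deriv_cong_AE)
          show "is_weak_deriv (Omega l) [False, True] (X n) (rep l [False, True] (X n))" using w(1) by (simp add: wrep_def)
          show "AE z in lebesgue. z \<in> Omega l \<longrightarrow> rep l [False, True] (X n) z = rep l [True, False] (X n) z"
            using AE_completion[OF ae] by eventually_elim simp
          show "set_borel_measurable lebesgue (Omega l) (rep l [True, False] (X n))"
            unfolding set_borel_measurable_def using rb by (intro borel_lebesgue borel_measurable_scaleR) auto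
        qed simp
        then show ?thesis using w(2) unfolding wrep_def by blast
      qed
      moreover obtain G where G: "wrep l [True, False] u G" "(\<lambda>n. LINT z|lborel. (rep l [True, False] (X n) z - G z)\<^sup>2) \<longlonglongrightarrow> 0"
        using lim[of "[True, False]"] by auto
      ultimately have "wrep l [False, True] u G"
        by (intro wrep_limit[OF H2star_cont[OF X] uc b0 bu]) (auto simp: wrep_def)
      then show ?thesis using 3 by blast
    qed
  qed
  have lim2: "(\<lambda>n. LINT z|lborel. (rep l bs (\<lambda>z. X n z - u z) z)\<^sup>2) \<longlonglongrightarrow> 0"
    if bs: "bs \<in> {[True, True], [False, False], [True, False]}" for bs
  proof -
    have len: "length bs \<le> 2" using bs by auto
    obtain G where G: "wrep l bs u G" "(\<lambda>n. LINT z|lborel. (rep l bs (X n) z - G z)\<^sup>2) \<longlonglongrightarrow> 0"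
      using lim[of bs] bs by auto
    have ae: "AE z in lborel. G z = rep l bs u z"
      by (rule wrep_unique[OF l G(1) rep(1)[OF uH len] uc]) auto
    have Gm: "G \<in> borel_measurable borel" using G(1) by (simp add: wrep_def)
    have "(LINT z|lborel. (rep l bs (X n) z - G z)\<^sup>2) = (LINT z|lborel. (rep l bs (\<lambda>z. X n z - u z) z)\<^sup>2)" for n
    proof -
      have "(LINT z|lborel. (rep l bs (X n) z - G z)\<^sup>2) = (LINT z|lborel. (rep l bs (X n) z - rep l bs u z)\<^sup>2)"
        by (rule integral_cong_AE) (use ae Gm rep_props(1)[OF X len] rep_props(1)[OF uH len] in auto)
      then show ?thesis using rep_diff[OF l X uH len] by simp
    qed
    then show ?thesis using G(2) by simp
  qed
  have "(\<lambda>n. hess2 l (\<lambda>z. X n z - u z)) \<longlonglongrightarrow> 0 + 0 + 0"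
    unfolding hess2_def by (intro tendsto_add lim2) auto
  then show thesis using that[OF uH] by simp
qed

section \<open>Existence of maximizers\<close>

lemma Kset_H2star: "u \<in> Kset l \<psi>m \<psi>p \<Longrightarrow> H2star l u"
  by (simp add: Kset_def)

text \<open>The coefficients cover both energies: \<open>\<alpha>\<close> and
  \<open>\<beta> - \<alpha>\<close> for the first, 1 and 0 for the second. Coercivity bounds the
  Hessian by the form divided by \<open>c1 * (1 - s)\<close>, whence the constant
  \<open>C\<close>.\<close>

lemma plate_obstacle:
  assumes l: "l > 0" and s: "0 < s" "s < 1" and c: "c1 > 0" "c2 \<ge> 0"
    and \<psi>: "continuous_on (closure (Omega l)) \<psi>m" "continuous_on (closure (Omega l)) \<psi>p"
      "\<forall>z\<in>closure (Omega l). \<psi>m z \<le> 0 \<and> 0 \<le> \<psi>p z"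
    and D: "open D" "D \<subseteq> Omega l"
  obtains C B where "obstacle {u. H2star l u} (\<lambda>u v. c1 * bform l s (Omega l) u v + c2 * bform l s D u v) (closure (Omega l)) (Kset l \<psi>m \<psi>p) C B"
proof -
  let ?A = "\<lambda>u v. c1 * bform l s (Omega l) u v + c2 * bform l s D u v" and ?S = "closure (Omega l)"
  have Db: "D \<in> sets borel" using D(1) by (rule borel_open)
  have Om: "Omega l \<in> sets borel" "Omega l \<subseteq> Omega l" by auto
  have k: "c1 * (1 - s) > 0" using c s by simp
  have low: "c1 * (1 - s) * hess2 l u \<le> ?A u u" and up: "?A u u \<le> (2 * c1 + 2 * c2) * hess2 l u" if u: "H2star l u" for u
  proof -
    have "c1 * ((1 - s) * hess2 l u) \<le> c1 * bform l s (Omega l) u u"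
      using c bform_bounds(3)[OF u Om s refl] by (intro mult_left_mono) auto
    moreover have "0 \<le> c2 * bform l s D u u" using c bform_bounds(1)[OF u Db D(2) s] by simp
    ultimately show "c1 * (1 - s) * hess2 l u \<le> ?A u u" by (simp add: mult.assoc)
    have "c1 * bform l s (Omega l) u u \<le> c1 * (2 * hess2 l u)" "c2 * bform l s D u u \<le> c2 * (2 * hess2 l u)"
      using c bform_bounds(2)[OF u Om s] bform_bounds(2)[OF u Db D(2) s] by (intro mult_left_mono; simp)+
    then show "?A u u \<le> (2 * c1 + 2 * c2) * hess2 l u" by (simp add: algebra_simps)
  qed
  define C where "C = Cemb l / sqrt (c1 * (1 - s))"
  have C: "Cemb l * sqrt (hess2 l u) \<le> C * sqrt (?A u u)" if u: "H2star l u" for u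
  proof -
    have "sqrt (c1 * (1 - s)) * sqrt (hess2 l u) \<le> sqrt (?A u u)"
      using low[OF u] by (simp only: real_sqrt_mult[symmetric] real_sqrt_le_iff)
    then have "sqrt (hess2 l u) \<le> sqrt (?A u u) / sqrt (c1 * (1 - s))" using k by (simp add: field_simps)
    then have "Cemb l * sqrt (hess2 l u) \<le> Cemb l * (sqrt (?A u u) / sqrt (c1 * (1 - s)))"
      using Cemb_nonneg[OF l] by (rule mult_left_mono)
    then show ?thesis by (simp add: C_def)
  qed
  obtain B1 where B1: "\<And>z. z \<in> ?S \<Longrightarrow> \<bar>\<psi>m z\<bar> \<le> B1" using compact_abs_bound[OF compact_closure_Omega \<psi>(1)] by blast
  obtain B2 where B2: "\<And>z. z \<in> ?S \<Longrightarrow> \<bar>\<psi>p z\<bar> \<le> B2" using compact_abs_bound[OF compact_closure_Omega \<psi>(2)] by blast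
  have "obstacle {u. H2star l u} ?A ?S (Kset l \<psi>m \<psi>p) C (max B1 B2)"
  proof (rule obstacle.intro)
    show "compact ?S" by (rule compact_closure_Omega)
    show "?S \<noteq> {}" using l by (auto simp: closure_Omega)
    show "(\<lambda>z. a * u z + b * v z) \<in> {u. H2star l u}" if "u \<in> {u. H2star l u}" "v \<in> {u. H2star l u}" for u v a b
      using that H2star_lin by simp
    show "?A u v = ?A v u" if "u \<in> {u. H2star l u}" "v \<in> {u. H2star l u}" for u v
      using that bform_sym[OF _ _ Om, of u v s] bform_sym[OF _ _ Db D(2), of u v s] by simp
    show "?A (\<lambda>z. a * u z + b * v z) w = a * ?A u w + b * ?A v w"
      if "u \<in> {u. H2star l u}" "v \<in> {u. H2star l u}" "w \<in> {u. H2star l u}" for u v w a b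
      using that bform_lin[OF l _ _ _ Om, of u v w s a b] bform_lin[OF l _ _ _ Db D(2), of u v w s a b]
      by (simp add: algebra_simps)
    show "0 \<le> ?A u u" if "u \<in> {u. H2star l u}" for u
      using that c bform_bounds(1)[OF _ Om s, of u] bform_bounds(1)[OF _ Db D(2) s, of u] by simp
    show "continuous_on ?S u" if "u \<in> {u. H2star l u}" for u using that H2star_cont by simp
    show "C \<ge> 0" unfolding C_def using Cemb_nonneg[OF l] k by simp
    show "\<bar>u z - u z'\<bar> \<le> C * sqrt (?A u u) * sqrt (dist z z')" if "u \<in> {u. H2star l u}" "z \<in> ?S" "z' \<in> ?S" for u z z'
    proof -
      have u: "H2star l u" using that by simp
      have "\<bar>u z - u z'\<bar> \<le> Cemb l * sqrt (hess2 l u) * sqrt (dist z z')" by (rule embedding(1)[OF l u that(2,3)])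
      also have "\<dots> \<le> C * sqrt (?A u u) * sqrt (dist z z')" using C[OF u] by (intro mult_right_mono) auto
      finally show ?thesis .
    qed
    show "\<bar>u z\<bar> \<le> C * sqrt (?A u u)" if "u \<in> {u. H2star l u}" "z \<in> ?S" for u z
      using embedding(2)[OF l _ that(2), of u] C[of u] that(1) by simp
    show "u = v" if "u \<in> {u. H2star l u}" "v \<in> {u. H2star l u}" "\<And>z. z \<in> ?S \<Longrightarrow> u z = v z" for u v
    proof
      fix z
      have "u z = 0" "v z = 0" if "z \<notin> ?S" using \<open>u \<in> _\<close> \<open>v \<in> _\<close> that unfolding H2star_def by blast+
      then show "u z = v z" using that(3) by (cases "z \<in> ?S") auto
    qed
    show "\<exists>u\<in>{u. H2star l u}. (\<lambda>n. ?A (\<lambda>z. X n z - u z) (\<lambda>z. X n z - u z)) \<longlonglongrightarrow> 0"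
      if X: "\<And>n. X n \<in> {u. H2star l u}"
        and cauchy: "\<And>e. e > 0 \<Longrightarrow> \<exists>N. \<forall>m\<ge>N. \<forall>n\<ge>N. ?A (\<lambda>z. X n z - X m z) (\<lambda>z. X n z - X m z) \<le> e" for X
    proof -
      have XH: "H2star l (X n)" for n using X by simp
      have d: "H2star l (\<lambda>z. f z - g z)" if "H2star l f" "H2star l g" for f g
        using H2star_lin[OF that, of 1 "-1"] by simp
      obtain u where u: "H2star l u" "(\<lambda>n. hess2 l (\<lambda>z. X n z - u z)) \<longlonglongrightarrow> 0"
      proof (rule H2star_complete[OF l XH])
        fix e :: real assume e: "e > 0"
        then have "c1 * (1 - s) * e > 0" using k by simp
        from cauchy[OF this] obtain N where N: "\<And>m n. m \<ge> N \<Longrightarrow> n \<ge> N \<Longrightarrow> ?A (\<lambda>z. X n z - X m z) (\<lambda>z. X n z - X m z) \<le> c1 * (1 - s) * e" by blast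
        show "\<exists>N. \<forall>m\<ge>N. \<forall>n\<ge>N. hess2 l (\<lambda>z. X n z - X m z) \<le> e"
        proof (intro exI allI impI)
          fix m n assume mn: "N \<le> m" "N \<le> n"
          have "c1 * (1 - s) * hess2 l (\<lambda>z. X n z - X m z) \<le> c1 * (1 - s) * e"
            using low[OF d[OF XH XH], of n m] N[OF mn] by (rule order_trans)
          then show "hess2 l (\<lambda>z. X n z - X m z) \<le> e" using k by (rule mult_left_le_imp_le)
        qed
      qed blast
      have "(\<lambda>n. ?A (\<lambda>z. X n z - u z) (\<lambda>z. X n z - u z)) \<longlonglongrightarrow> 0"
      proof (rule tendsto_sandwich)
        have dn: "H2star l (\<lambda>z. X n z - u z)" for n by (rule d[OF XH u(1)])
        show "\<forall>\<^sub>F n in sequentially. ?A (\<lambda>z. X n z - u z) (\<lambda>z. X n z - u z) \<le> (2 * c1 + 2 * c2) * hess2 l (\<lambda>z. X n z - u z)"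
          by (rule always_eventually, rule allI, rule up[OF dn])
        have "0 \<le> ?A (\<lambda>z. X n z - u z) (\<lambda>z. X n z - u z)" for n
          using c bform_bounds(1)[OF dn Om s] bform_bounds(1)[OF dn Db D(2) s] by simp
        then show "\<forall>\<^sub>F n in sequentially. 0 \<le> ?A (\<lambda>z. X n z - u z) (\<lambda>z. X n z - u z)" by simp
        have "(\<lambda>n. (2 * c1 + 2 * c2) * hess2 l (\<lambda>z. X n z - u z)) \<longlonglongrightarrow> (2 * c1 + 2 * c2) * 0" by (intro tendsto_intros u)
        then show "(\<lambda>n. (2 * c1 + 2 * c2) * hess2 l (\<lambda>z. X n z - u z)) \<longlonglongrightarrow> 0" by simp
      qed simp
      then show ?thesis using u(1) by blast
    qed
    show "Kset l \<psi>m \<psi>p \<subseteq> {u. H2star l u}" using Kset_H2star by blast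
    show "(\<lambda>_. 0) \<in> Kset l \<psi>m \<psi>p" using H2star_zero \<psi>(3) by (simp add: Kset_def)
    show "(\<lambda>z. (1 - t) * u z + t * v z) \<in> Kset l \<psi>m \<psi>p" if u: "u \<in> Kset l \<psi>m \<psi>p" and v: "v \<in> Kset l \<psi>m \<psi>p" and t: "0 \<le> t" "t \<le> 1" for u v t
    proof -
      have "\<psi>m z \<le> (1 - t) * u z + t * v z \<and> (1 - t) * u z + t * v z \<le> \<psi>p z" if z: "z \<in> ?S" for z
      proof -
        have b: "\<psi>m z \<le> u z" "u z \<le> \<psi>p z" "\<psi>m z \<le> v z" "v z \<le> \<psi>p z" using u v z by (auto simp: Kset_def)
        have "(1 - t) * \<psi>m z + t * \<psi>m z \<le> (1 - t) * u z + t * v z" "(1 - t) * u z + t * v z \<le> (1 - t) * \<psi>p z + t * \<psi>p z"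
          using b t by (intro add_mono mult_left_mono; simp)+
        then show ?thesis by (simp add: algebra_simps)
      qed
      then show ?thesis using H2star_lin[OF Kset_H2star[OF u] Kset_H2star[OF v]] by (simp add: Kset_def)
    qed
    show "u \<in> Kset l \<psi>m \<psi>p" if uH: "u \<in> {u. H2star l u}" and X: "\<And>n :: nat. X n \<in> Kset l \<psi>m \<psi>p" and lim: "\<And>z. z \<in> ?S \<Longrightarrow> (\<lambda>n. X n z) \<longlonglongrightarrow> u z" for X u
    proof -
      have "\<psi>m z \<le> u z \<and> u z \<le> \<psi>p z" if z: "z \<in> ?S" for z
        using LIMSEQ_le_const[OF lim[OF z]] LIMSEQ_le_const2[OF lim[OF z]] X z by (auto simp: Kset_def)
      then show ?thesis using uH by (simp add: Kset_def)
    qed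
    show "\<bar>u z\<bar> \<le> max B1 B2" if "u \<in> Kset l \<psi>m \<psi>p" "z \<in> ?S" for u z
      using that B1[OF that(2)] B2[OF that(2)] by (auto simp: Kset_def abs_le_iff)
  qed
  then show thesis by (rule that)
qed

text \<open>The type of loads is left open, because a load is a functional in one case and a
  function in the others. Only its pairing \<open>P f\<close>, sequential-type compactness along a
  filter, and a negation \<open>nf\<close> are used.\<close>

lemma plate_maximizers:
  fixes P :: "'f \<Rightarrow> (R2 \<Rightarrow> real) \<Rightarrow> real"
  assumes l: "l > 0" and s: "0 < s" "s < 1" and c: "c1 > 0" "c2 \<ge> 0"
    and \<psi>: "continuous_on (closure (Omega l)) \<psi>m" "continuous_on (closure (Omega l)) \<psi>p"
      "\<forall>z\<in>closure (Omega l). \<psi>m z \<le> 0 \<and> 0 \<le> \<psi>p z"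
    and D: "open D" "D \<subseteq> Omega l"
    and U: "\<And>f. U f = (THE u. u \<in> Kset l \<psi>m \<psi>p \<and> (\<forall>\<phi>\<in>Kset l \<psi>m \<psi>p.
        c1 * bform l s (Omega l) u (\<lambda>z. \<phi> z - u z) + c2 * bform l s D u (\<lambda>z. \<phi> z - u z) \<ge> P f (\<lambda>z. \<phi> z - u z)))"
    and F: "F \<noteq> {}" and adm: "\<And>f. f \<in> F \<Longrightarrow> admissible (closure (Omega l)) M (P f)"
    and cpt: "\<And>f :: nat \<Rightarrow> 'f. (\<And>n. f n \<in> F) \<Longrightarrow>
      \<exists>G g. G \<le> sequentially \<and> G \<noteq> bot \<and> g \<in> F \<and> (\<forall>v. continuous_on (closure (Omega l)) v \<longrightarrow> ((\<lambda>n. P (f n) v) \<longlongrightarrow> P g v) G)"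
    and neg: "\<And>f. f \<in> F \<Longrightarrow> nf f \<in> F" "\<And>f v. f \<in> F \<Longrightarrow> H2star l v \<Longrightarrow> P (nf f) v = - P f v"
  shows "(\<exists>f. is_maximizer F (\<lambda>f. Ainf l (U f)) f) \<and>
    ((\<forall>z\<in>closure (Omega l). - \<psi>m z = \<psi>p z) \<longrightarrow>
      (\<forall>f. is_maximizer F (\<lambda>f. Ainf l (U f)) f \<longrightarrow> is_maximizer F (\<lambda>f. Ainf l (U f)) (nf f)))"
proof -
  let ?A = "\<lambda>u v. c1 * bform l s (Omega l) u v + c2 * bform l s D u v" and ?K = "Kset l \<psi>m \<psi>p"
  obtain C B where ob: "obstacle {u. H2star l u} ?A (closure (Omega l)) ?K C B"
    using plate_obstacle[OF l s c \<psi> D] by blast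
  interpret O: obstacle "{u. H2star l u}" ?A "closure (Omega l)" ?K C B by (rule ob)
  have UO: "U f = (THE u. O.sol (P f) u)" for f unfolding U O.sol_def ..
  have AO: "Ainf l u = O.ampl u" for u by (simp add: Ainf_def O.ampl_def)
  have "\<exists>g\<in>F. \<forall>f\<in>F. O.ampl (U f) \<le> O.ampl (U g)"
    unfolding UO by (rule O.maximizer_exists[OF F adm cpt])
  then have ex: "\<exists>f. is_maximizer F (\<lambda>f. Ainf l (U f)) f" unfolding is_maximizer_def AO by blast
  have "is_maximizer F (\<lambda>f. Ainf l (U f)) (nf f)"
    if sym: "\<forall>z\<in>closure (Omega l). - \<psi>m z = \<psi>p z" and f: "is_maximizer F (\<lambda>f. Ainf l (U f)) f" for f
  proof -
    have fF: "f \<in> F" using f by (simp add: is_maximizer_def)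
    have K: "(\<lambda>z. - u z) \<in> ?K" if u: "u \<in> ?K" for u
    proof -
      have "H2star l (\<lambda>z. (-1) * u z + 0 * u z)" by (rule H2star_lin; rule Kset_H2star[OF u])
      moreover have "\<psi>m z \<le> - u z \<and> - u z \<le> \<psi>p z" if "z \<in> closure (Omega l)" for z
        using u sym that by (auto simp: Kset_def) (smt (verit))+
      ultimately show ?thesis by (simp add: Kset_def)
    qed
    have "O.ampl (U (nf f)) = O.ampl (U f)"
      unfolding UO by (rule O.maximizer_neg[where F = F and P = P and M = M, OF adm fF neg(1)[OF fF] neg(2)[OF fF] K]) auto
    then show ?thesis using f neg(1)[OF fF] unfolding is_maximizer_def AO by simp
  qed
  with ex show ?thesis by blast
qed

section \<open>Compactness of the sets of loads\<close>

lemma dual_ball_admissible: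
  assumes "f \<in> dual_ball l" "l > 0" shows "admissible (closure (Omega l)) 1 f"
  unfolding admissible_def
proof (intro conjI allI impI)
  show "f (\<lambda>z. a * u z + b * v z) = a * f u + b * f v" if "continuous_on (closure (Omega l)) u" "continuous_on (closure (Omega l)) v" for u v a b
    using assms that unfolding dual_ball_def by blast
  fix v :: "R2 \<Rightarrow> real" and b assume v: "continuous_on (closure (Omega l)) v" "\<forall>z\<in>closure (Omega l). \<bar>v z\<bar> \<le> b"
  have "\<bar>f v\<bar> \<le> (SUP z\<in>closure (Omega l). \<bar>v z\<bar>)" using assms(1) v(1) unfolding dual_ball_def by blast
  also have "\<dots> \<le> b" using v(2) assms(2) by (intro cSUP_least) (auto simp: closure_Omega)
  finally show "\<bar>f v\<bar> \<le> 1 * b" by simp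
qed

text \<open>The Banach-Alaoglu argument: the continuous functions serve as coordinates, and
  linearity and the norm bound pass to pointwise limits.\<close>

lemma dual_ball_compact:
  assumes f: "\<And>n :: nat. f n \<in> dual_ball l"
  shows "\<exists>G g. G \<le> sequentially \<and> G \<noteq> bot \<and> g \<in> dual_ball l \<and> (\<forall>v. continuous_on (closure (Omega l)) v \<longrightarrow> ((\<lambda>n. f n v) \<longlongrightarrow> g v) G)"
proof -
  let ?S = "closure (Omega l)"
  \<comment> \<open>On functions that are not continuous on the closure the elements of the ball are
    unrestricted, so those coordinates are set to 0 to keep them bounded. The limit still depends on
    values on the closure only, as continuity there does.\<close>
  define x where "x n v = (if continuous_on ?S v then f n v else 0)" for n and v :: "R2 \<Rightarrow> real"
  have fb: "\<bar>f n v\<bar> \<le> (SUP z\<in>?S. \<bar>v z\<bar>)" if "continuous_on ?S v" for n and v :: "R2 \<Rightarrow> real"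
    using f[of n] that unfolding dual_ball_def by blast
  have "\<exists>B. \<forall>n. \<bar>x n v\<bar> \<le> B" for v
    using fb[of v] by (cases "continuous_on ?S v") (auto simp: x_def)
  then obtain G where G: "G \<le> sequentially" "G \<noteq> bot" "\<And>v. \<exists>L. ((\<lambda>n. x n v) \<longlongrightarrow> L) G"
    using tychonoff_seq[of x] by blast
  define g where "g v = Lim G (\<lambda>n. x n v)" for v
  have g: "((\<lambda>n. x n v) \<longlongrightarrow> g v) G" for v
  proof -
    obtain L where "((\<lambda>n. x n v) \<longlongrightarrow> L) G" using G(3) by blast
    then show ?thesis unfolding g_def using tendsto_Lim[OF G(2)] by metis
  qed
  have gc: "((\<lambda>n. f n v) \<longlongrightarrow> g v) G" if "continuous_on ?S v" for v :: "R2 \<Rightarrow> real" using g[of v] that by (simp add: x_def)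
  have "g \<in> dual_ball l"
    unfolding dual_ball_def
  proof (rule CollectI, intro conjI allI impI)
    show "g u = g v" if e: "\<forall>z\<in>?S. u z = v z" for u v
    proof -
      have "continuous_on ?S u \<longleftrightarrow> continuous_on ?S v" using e by (intro continuous_on_cong) auto
      moreover have "f n u = f n v" for n using f[of n] e unfolding dual_ball_def by blast
      ultimately have "x n u = x n v" for n by (simp add: x_def)
      then show ?thesis by (simp add: g_def)
    qed
    show "g (\<lambda>z. a * u z + b * v z) = a * g u + b * g v" if "continuous_on ?S u" "continuous_on ?S v" for u v a b
    proof (rule tendsto_unique[OF G(2)])
      have "continuous_on ?S (\<lambda>z. a * u z + b * v z)" by (intro continuous_intros that)
      then show "((\<lambda>n. f n (\<lambda>z. a * u z + b * v z)) \<longlongrightarrow> g (\<lambda>z. a * u z + b * v z)) G" by (rule gc)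
      have "f n (\<lambda>z. a * u z + b * v z) = a * f n u + b * f n v" for n using f[of n] that unfolding dual_ball_def by blast
      then show "((\<lambda>n. f n (\<lambda>z. a * u z + b * v z)) \<longlongrightarrow> a * g u + b * g v) G"
        by (simp only:) (intro tendsto_intros gc that)
    qed
    show "\<bar>g u\<bar> \<le> (SUP z\<in>?S. \<bar>u z\<bar>)" if "continuous_on ?S u" for u
      by (rule tendsto_upperbound[OF tendsto_rabs[OF gc[OF that]] _ G(2)]) (use fb[OF that] in \<open>auto intro: always_eventually\<close>)
  qed
  then show ?thesis using G gc by blast
qed

abbreviation MOm :: "real \<Rightarrow> R2 measure" where "MOm l \<equiv> restrict_space lebesgue (Omega l)"

lemma Omega_lebesgue: "Omega l \<inter> space lebesgue \<in> sets lebesgue"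
  by simp

lemma MOm_finite: "finite_measure (MOm l)"
  by (rule finite_measureI) (use Omega_finite[of l] in \<open>simp add: emeasure_restrict_space space_restrict_space less_top\<close>)

lemma MOm_integral: "(LINT z:Omega l|lebesgue. (h z :: real)) = (LINT z|MOm l. h z)"
  unfolding set_lebesgue_integral_def integral_restrict_space[OF Omega_lebesgue] ..

lemma Lp_ball_MOm:
  "f \<in> Lp_ball l p \<longleftrightarrow> f \<in> borel_measurable (MOm l) \<and>
    (if p = \<infinity> then (AE z in MOm l. \<bar>f z\<bar> \<le> 1)
     else integrable (MOm l) (\<lambda>z. \<bar>f z\<bar> powr real_of_ereal p) \<and> (LINT z|MOm l. \<bar>f z\<bar> powr real_of_ereal p) \<le> 1)"
  unfolding Lp_ball_def MOm_integral set_integrable_def integrable_restrict_space[OF Omega_lebesgue]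
    set_borel_measurable_def borel_measurable_restrict_space_iff[OF Omega_lebesgue] AE_restrict_space_iff[OF Omega_lebesgue]
  by simp

text \<open>The constant comes from \<open>\<bar>f\<bar> \<le> 1 + \<bar>f\<bar> powr p\<close>; it
  is uniform over the ball, as required for a common \<open>M\<close>.\<close>

lemma Lp_ball_L1:
  assumes f: "f \<in> Lp_ball l p" and p: "1 < p"
  shows "integrable (MOm l) f" "(LINT z|MOm l. \<bar>f z\<bar>) \<le> measure (MOm l) (space (MOm l)) + 1"
proof -
  interpret finite_measure "MOm l" by (rule MOm_finite)
  have fm: "f \<in> borel_measurable (MOm l)" using f by (simp add: Lp_ball_MOm)
  have "integrable (MOm l) f \<and> (LINT z|MOm l. \<bar>f z\<bar>) \<le> measure (MOm l) (space (MOm l)) + 1"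
  proof (cases "p = \<infinity>")
    case True
    then have ae: "AE z in MOm l. \<bar>f z\<bar> \<le> 1" using f by (simp add: Lp_ball_MOm)
    have i: "integrable (MOm l) f"
      by (rule integrable_const_bound[where B = 1]) (use ae fm in auto)
    have "(LINT z|MOm l. \<bar>f z\<bar>) \<le> (LINT z|MOm l. 1)"
      by (rule integral_mono_AE) (use i ae in auto)
    then show ?thesis using i by simp
  next
    case False
    then have q: "real_of_ereal p > 1" using p by (cases p) auto
    have "integrable (MOm l) (\<lambda>z. \<bar>f z\<bar> powr real_of_ereal p)" "(LINT z|MOm l. \<bar>f z\<bar> powr real_of_ereal p) \<le> 1"
      using f False by (auto simp: Lp_ball_MOm)
    then show ?thesis using powr_integrable[OF MOm_finite fm _ q] by fastforce
  qed
  then show "integrable (MOm l) f" "(LINT z|MOm l. \<bar>f z\<bar>) \<le> measure (MOm l) (space (MOm l)) + 1" by auto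
qed

text \<open>For finite \<open>p\<close> weak compactness and lower semicontinuity apply as they
  stand. For \<open>p = \<infinity>\<close> the functions are bounded in square mean on the finite
  measure space, so compactness is taken with exponent 2 and the bound by 1 is recovered for the
  limit.\<close>

lemma Lp_ball_compact:
  assumes f: "\<And>n :: nat. f n \<in> Lp_ball l p" and p: "1 < p"
  shows "\<exists>G g. G \<le> sequentially \<and> G \<noteq> bot \<and> g \<in> Lp_ball l p \<and>
    (\<forall>h (c :: real). h \<in> borel_measurable (MOm l) \<longrightarrow> (\<forall>z. \<bar>h z\<bar> \<le> c) \<longrightarrow> ((\<lambda>n. LINT z|MOm l. h z * f n z) \<longlongrightarrow> (LINT z|MOm l. h z * g z)) G)"
proof -
  interpret finite_measure "MOm l" by (rule MOm_finite)
  have fm: "f n \<in> borel_measurable (MOm l)" for n using f[of n] by (simp add: Lp_ball_MOm)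
  have fi: "integrable (MOm l) (f n)" for n by (rule Lp_ball_L1(1)[OF f p])
  show ?thesis
  proof (cases "p = \<infinity>")
    case False
    then have q: "real_of_ereal p > 1" using p by (cases p) auto
    have b: "integrable (MOm l) (\<lambda>z. \<bar>f n z\<bar> powr real_of_ereal p)" "(LINT z|MOm l. \<bar>f n z\<bar> powr real_of_ereal p) \<le> 1" for n
      using f[of n] False by (auto simp: Lp_ball_MOm)
    obtain G g where G: "G \<le> sequentially" "G \<noteq> bot" "integrable (MOm l) g"
      and w: "\<And>h (c::real). h \<in> borel_measurable (MOm l) \<Longrightarrow> (\<And>x. \<bar>h x\<bar> \<le> c) \<Longrightarrow>
       ((\<lambda>n. LINT x|MOm l. h x * f n x) \<longlongrightarrow> (LINT x|MOm l. h x * g x)) G"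
    proof (rule weak_compact[where F = f, OF MOm_finite fm q b])
      fix G g assume *: "G \<le> sequentially" "G \<noteq> bot" "integrable (MOm l) g"
        and **: "\<And>h (c::real). h \<in> borel_measurable (MOm l) \<Longrightarrow> (\<And>x. \<bar>h x\<bar> \<le> c) \<Longrightarrow>
          ((\<lambda>n. LINT x|MOm l. h x * f n x) \<longlongrightarrow> (LINT x|MOm l. h x * g x)) G"
      show thesis by (rule that[OF *]) (rule **)
    qed
    have ev: "\<forall>\<^sub>F n in G. (LINT z|MOm l. \<bar>f n z\<bar> powr real_of_ereal p) \<le> 1" using b(2) by simp
    have "integrable (MOm l) (\<lambda>z. \<bar>g z\<bar> powr real_of_ereal p)"
      by (rule weak_lsc(1)[OF q G(2,3) fi b(1) ev]) (rule w)
    moreover have "(LINT z|MOm l. \<bar>g z\<bar> powr real_of_ereal p) \<le> 1"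
      by (rule weak_lsc(2)[OF q G(2,3) fi b(1) ev]) (rule w)
    ultimately have "g \<in> Lp_ball l p" using False G(3) by (simp add: Lp_ball_MOm)
    then show ?thesis using G(1,2) w by blast
  next
    case True
    have ae: "AE z in MOm l. \<bar>f n z\<bar> \<le> 1" for n using f[of n] True by (simp add: Lp_ball_MOm)
    have ae2: "AE z in MOm l. \<bar>f n z\<bar> powr 2 \<le> 1" for n
      using ae[of n] by eventually_elim (simp add: powr_numeral abs_square_le_1)
    have b1: "integrable (MOm l) (\<lambda>z. \<bar>f n z\<bar> powr 2)" for n
      by (rule integrable_const_bound[where B = 1]) (use ae2[of n] fm[of n] in auto)
    have b2: "(LINT z|MOm l. \<bar>f n z\<bar> powr 2) \<le> measure (MOm l) (space (MOm l))" for n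
    proof -
      have "(LINT z|MOm l. \<bar>f n z\<bar> powr 2) \<le> (LINT z|MOm l. 1)"
        by (rule integral_mono_AE[OF b1 _ ae2]) simp
      then show ?thesis by simp
    qed
    obtain G g where G: "G \<le> sequentially" "G \<noteq> bot" and gi: "integrable (MOm l) g"
      and w: "\<And>h (c::real). h \<in> borel_measurable (MOm l) \<Longrightarrow> (\<And>x. \<bar>h x\<bar> \<le> c) \<Longrightarrow>
       ((\<lambda>n. LINT x|MOm l. h x * f n x) \<longlongrightarrow> (LINT x|MOm l. h x * g x)) G"
    proof (rule weak_compact[where F = f and p = 2, OF MOm_finite fm _ b1 b2])
      fix G g assume *: "G \<le> sequentially" "G \<noteq> bot" "integrable (MOm l) g"
        and **: "\<And>h (c::real). h \<in> borel_measurable (MOm l) \<Longrightarrow> (\<And>x. \<bar>h x\<bar> \<le> c) \<Longrightarrow>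
          ((\<lambda>n. LINT x|MOm l. h x * f n x) \<longlongrightarrow> (LINT x|MOm l. h x * g x)) G"
      show thesis by (rule that[OF *]) (rule **)
    qed simp
    have gm[measurable]: "g \<in> borel_measurable (MOm l)" using gi by auto
    \<comment> \<open>Testing with the sign of the limit on the set where its modulus exceeds 1. For
      each \<open>f n\<close> the pairing is at most the measure of that set; in the limit the
      integral of \<open>\<bar>g\<bar> - 1\<close> over the set is at most 0, so the set is
      null.\<close>
    define h where "h z = (if \<bar>g z\<bar> > 1 then sgn (g z) else 0)" for z
    define j where "j z = (if \<bar>g z\<bar> > 1 then 1 else 0 :: real)" for z
    have hm: "h \<in> borel_measurable (MOm l)" unfolding h_def by measurable
    have jm: "j \<in> borel_measurable (MOm l)" unfolding j_def by measurable
    have hb: "\<bar>h z\<bar> \<le> 1" for z by (auto simp: h_def sgn_if)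
    have ji: "integrable (MOm l) j" by (rule integrable_const_bound[where B = 1]) (use jm in \<open>auto simp: j_def\<close>)
    have hi: "integrable (MOm l) (\<lambda>z. h z * u z)" if "integrable (MOm l) u" for u
      by (rule integrable_bounded_mult[OF that hm hb])
    have "(LINT z|MOm l. h z * g z) \<le> (LINT z|MOm l. j z)"
    proof (rule tendsto_upperbound[OF w[OF hm hb] _ G(2)], intro always_eventually allI)
      fix n
      show "(LINT z|MOm l. h z * f n z) \<le> (LINT z|MOm l. j z)"
      proof (rule integral_mono_AE[OF hi[OF fi] ji])
        show "AE z in MOm l. h z * f n z \<le> j z"
          using ae[of n] by eventually_elim (auto simp: h_def j_def sgn_if)
      qed
    qed
    then have le: "(LINT z|MOm l. h z * g z - j z) \<le> 0" using hi[OF gi] ji by simp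
    have nn: "0 \<le> h z * g z - j z" for z by (auto simp: h_def j_def sgn_if)
    have "(LINT z|MOm l. h z * g z - j z) = 0"
      by (rule order_antisym[OF le Bochner_Integration.integral_nonneg]) (rule nn)
    then have "AE z in MOm l. h z * g z - j z = 0"
      using integral_nonneg_eq_0_iff_AE[of "MOm l" "\<lambda>z. h z * g z - j z"] hi[OF gi] ji nn by simp
    then have "AE z in MOm l. \<bar>g z\<bar> \<le> 1"
      by eventually_elim (auto simp: h_def j_def sgn_if split: if_splits)
    then have "g \<in> Lp_ball l p" using True gm by (simp add: Lp_ball_MOm)
    then show ?thesis using G w by blast
  qed
qed

text \<open>The weight \<open>m\<close> is 1 for the first energy and takes the values
  \<open>\<beta>\<close> on \<open>D\<close> and \<open>\<alpha>\<close> elsewhere for the second,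
  where the two densities act on the load.\<close>

definition Pw :: "real \<Rightarrow> (R2 \<Rightarrow> real) \<Rightarrow> (R2 \<Rightarrow> real) \<Rightarrow> (R2 \<Rightarrow> real) \<Rightarrow> real" where
  "Pw l m f v = (LINT z:Omega l|lebesgue. m z * f z * v z)"

lemma Pw_alt: "Pw l m f v = (LINT z|MOm l. (indicator (Omega l) z * (m z * v z)) * f z)"
  unfolding Pw_def MOm_integral by (rule Bochner_Integration.integral_cong) (auto simp: space_restrict_space)

lemma weight_measurable:
  fixes m v :: "R2 \<Rightarrow> real"
  assumes m: "m \<in> borel_measurable borel" and mb: "\<And>z. \<bar>m z\<bar> \<le> c" and v: "continuous_on (closure (Omega l)) v" "\<forall>z\<in>closure (Omega l). \<bar>v z\<bar> \<le> b" and b: "b \<ge> 0"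
  shows "(\<lambda>z. indicator (Omega l) z * (m z * v z)) \<in> borel_measurable (MOm l)" "\<bar>indicator (Omega l) z * (m z * v z)\<bar> \<le> c * b"
proof -
  have "(\<lambda>z. m z * ext0 l v z) \<in> borel_measurable borel" using m ext0_facts(1)[OF v(1)] by simp
  then have "(\<lambda>z. m z * ext0 l v z) \<in> borel_measurable (MOm l)" by (intro measurable_restrict_space1 borel_lebesgue)
  moreover have "(\<lambda>z. m z * ext0 l v z) = (\<lambda>z. indicator (Omega l) z * (m z * v z))" by (auto simp: ext0_def)
  ultimately show "(\<lambda>z. indicator (Omega l) z * (m z * v z)) \<in> borel_measurable (MOm l)" by simp
  have c: "c \<ge> 0" using order_trans[OF abs_ge_zero mb] .
  show "\<bar>indicator (Omega l) z * (m z * v z)\<bar> \<le> c * b"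
  proof (cases "z \<in> Omega l")
    case True
    then have "\<bar>v z\<bar> \<le> b" using v(2) closure_subset by blast
    then show ?thesis using True mb[of z] c by (auto simp: abs_mult intro!: mult_mono)
  qed (use b c in simp)
qed

lemma Pw_admissible:
  assumes l: "l > 0" and m: "m \<in> borel_measurable borel" "\<And>z. \<bar>m z\<bar> \<le> c" and f: "f \<in> Lp_ball l p" and p: "1 < p"
  shows "admissible (closure (Omega l)) (c * (measure (MOm l) (space (MOm l)) + 1)) (Pw l m f)"
  unfolding admissible_def
proof (intro conjI allI impI)
  let ?S = "closure (Omega l)"
  note fi = Lp_ball_L1[OF f p]
  have bnd: "integrable (MOm l) (\<lambda>z. (indicator (Omega l) z * (m z * v z)) * f z) \<and> \<bar>Pw l m f v\<bar> \<le> c * b * (measure (MOm l) (space (MOm l)) + 1)"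
    if v: "continuous_on ?S v" "\<forall>z\<in>?S. \<bar>v z\<bar> \<le> b" for v b
  proof -
    have "(0, 0) \<in> ?S" using l by (simp add: closure_Omega)
    then have b: "b \<ge> 0" using v(2) order_trans[OF abs_ge_zero] by blast
    note h = weight_measurable[OF m v b]
    have c: "c * b \<ge> 0" using order_trans[OF abs_ge_zero h(2)] .
    have i: "integrable (MOm l) (\<lambda>z. (indicator (Omega l) z * (m z * v z)) * f z)"
      by (rule integrable_bounded_mult[OF fi(1) h])
    have "\<bar>Pw l m f v\<bar> \<le> (LINT z|MOm l. c * b * \<bar>f z\<bar>)"
      unfolding Pw_alt
    proof (rule order_trans[OF integral_abs_bound integral_mono])
      show "integrable (MOm l) (\<lambda>z. \<bar>(indicator (Omega l) z * (m z * v z)) * f z\<bar>)" using i by (rule integrable_abs)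
      show "integrable (MOm l) (\<lambda>z. c * b * \<bar>f z\<bar>)" using fi(1) by (intro integrable_mult_right integrable_abs)
      show "\<bar>indicator (Omega l) z * (m z * v z) * f z\<bar> \<le> c * b * \<bar>f z\<bar>" for z
        unfolding abs_mult[of _ "f z"] by (rule mult_right_mono[OF h(2)]) simp
    qed
    also have "\<dots> = c * b * (LINT z|MOm l. \<bar>f z\<bar>)" by simp
    also have "\<dots> \<le> c * b * (measure (MOm l) (space (MOm l)) + 1)" using fi(2) c by (rule mult_left_mono)
    finally show ?thesis using i by blast
  qed
  show "\<bar>Pw l m f v\<bar> \<le> c * (measure (MOm l) (space (MOm l)) + 1) * b" if "continuous_on ?S v" "\<forall>z\<in>?S. \<bar>v z\<bar> \<le> b" for v b
    using bnd[OF that] by (simp only: ac_simps)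
  have i: "integrable (MOm l) (\<lambda>z. (indicator (Omega l) z * (m z * v z)) * f z)" if v: "continuous_on ?S v" for v
  proof -
    obtain b where "\<And>z. z \<in> ?S \<Longrightarrow> \<bar>v z\<bar> \<le> b" using compact_abs_bound[OF compact_closure_Omega v] by blast
    then show ?thesis using bnd[OF v, of b] by blast
  qed
  show "Pw l m f (\<lambda>z. a * u z + b * v z) = a * Pw l m f u + b * Pw l m f v" if "continuous_on ?S u" "continuous_on ?S v" for u v a b
  proof -
    have "(indicator (Omega l) z * (m z * (a * u z + b * v z))) * f z
       = a * ((indicator (Omega l) z * (m z * u z)) * f z) + b * ((indicator (Omega l) z * (m z * v z)) * f z)" for z
      by (simp add: algebra_simps)
    then show ?thesis unfolding Pw_alt using i[OF that(1)] i[OF that(2)] by simp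
  qed
qed

lemma Pw_compact:
  assumes l: "l > 0" and m: "m \<in> borel_measurable borel" "\<And>z. \<bar>m z\<bar> \<le> c" and f: "\<And>n :: nat. f n \<in> Lp_ball l p" and p: "1 < p"
  shows "\<exists>G g. G \<le> sequentially \<and> G \<noteq> bot \<and> g \<in> Lp_ball l p \<and> (\<forall>v. continuous_on (closure (Omega l)) v \<longrightarrow> ((\<lambda>n. Pw l m (f n) v) \<longlongrightarrow> Pw l m g v) G)"
proof -
  obtain G g where G: "G \<le> sequentially" "G \<noteq> bot" "g \<in> Lp_ball l p"
    and w: "\<forall>h (c :: real). h \<in> borel_measurable (MOm l) \<longrightarrow> (\<forall>z. \<bar>h z\<bar> \<le> c) \<longrightarrow> ((\<lambda>n. LINT z|MOm l. h z * f n z) \<longlongrightarrow> (LINT z|MOm l. h z * g z)) G"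
    using Lp_ball_compact[where f = f, OF f p] by (elim exE conjE) (rule that)
  have "((\<lambda>n. Pw l m (f n) v) \<longlongrightarrow> Pw l m g v) G" if v: "continuous_on (closure (Omega l)) v" for v
  proof -
    obtain b where b: "\<And>z. z \<in> closure (Omega l) \<Longrightarrow> \<bar>v z\<bar> \<le> b" using compact_abs_bound[OF compact_closure_Omega v] by blast
    have "(0, 0) \<in> closure (Omega l)" using l by (simp add: closure_Omega)
    then have b0: "b \<ge> 0" using b order_trans[OF abs_ge_zero] by blast
    note h = weight_measurable[OF m v _ b0]
    show ?thesis unfolding Pw_alt by (rule w[rule_format, where c = "c * b"]) (use h b in auto)
  qed
  then show ?thesis using G by blast
qed

lemma Lp_ball_neg: "f \<in> Lp_ball l p \<Longrightarrow> (\<lambda>z. - f z) \<in> Lp_ball l p"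
  by (simp add: Lp_ball_MOm)

lemma Lp_ball_zero: "1 < p \<Longrightarrow> (\<lambda>_. 0) \<in> Lp_ball l p"
  by (simp add: Lp_ball_MOm)

lemma Pw_neg: "Pw l m (\<lambda>z. - f z) v = - Pw l m f v"
  unfolding Pw_alt by simp

theorem theorem3p1:
  fixes l \<sigma> \<alpha> \<beta> :: real and \<psi>m \<psi>p :: "R2 \<Rightarrow> real" and D :: "R2 set" and p :: ereal
  assumes "l > 0" and "0 < \<sigma>" and "\<sigma> < 1" and "0 < \<alpha>" and "\<alpha> < 1" and "1 < \<beta>"
    and "continuous_on (closure (Omega l)) \<psi>m" and "continuous_on (closure (Omega l)) \<psi>p"
    and "\<forall>z\<in>closure (Omega l). \<psi>m z \<le> 0 \<and> 0 \<le> \<psi>p z"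
    and "\<exists>z\<in>closure (Omega l). \<psi>m z \<noteq> 0" and "\<exists>z\<in>closure (Omega l). \<psi>p z \<noteq> 0"
    and "open D" and "D \<subseteq> Omega l"
    and "1 < p"
  shows
    "\<comment> \<open>(a) E_1, measures\<close>
     ((\<exists>f. is_maximizer (dual_ball l) (\<lambda>f. Ainf l (u1 l \<sigma> \<psi>m \<psi>p \<alpha> \<beta> D f)) f) \<and>
      ((\<forall>z\<in>closure (Omega l). - \<psi>m z = \<psi>p z) \<longrightarrow>
        (\<forall>f. is_maximizer (dual_ball l) (\<lambda>f. Ainf l (u1 l \<sigma> \<psi>m \<psi>p \<alpha> \<beta> D f)) f \<longrightarrow>
             is_maximizer (dual_ball l) (\<lambda>f. Ainf l (u1 l \<sigma> \<psi>m \<psi>p \<alpha> \<beta> D f)) (\<lambda>v. - f v))))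
   \<and> \<comment> \<open>(b) E_1, L^p\<close>
     ((\<exists>f. is_maximizer (Lp_ball l p)
              (\<lambda>f. Ainf l (u1 l \<sigma> \<psi>m \<psi>p \<alpha> \<beta> D (\<lambda>v. LINT z:Omega l|lebesgue. f z * v z))) f) \<and>
      ((\<forall>z\<in>closure (Omega l). - \<psi>m z = \<psi>p z) \<longrightarrow>
        (\<forall>f. is_maximizer (Lp_ball l p)
              (\<lambda>f. Ainf l (u1 l \<sigma> \<psi>m \<psi>p \<alpha> \<beta> D (\<lambda>v. LINT z:Omega l|lebesgue. f z * v z))) f \<longrightarrow>
             is_maximizer (Lp_ball l p)
              (\<lambda>f. Ainf l (u1 l \<sigma> \<psi>m \<psi>p \<alpha> \<beta> D (\<lambda>v. LINT z:Omega l|lebesgue. f z * v z))) (\<lambda>z. - f z))))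
   \<and> \<comment> \<open>(b) E_2, L^p\<close>
     ((\<exists>f. is_maximizer (Lp_ball l p) (\<lambda>f. Ainf l (u2 l \<sigma> \<psi>m \<psi>p \<alpha> \<beta> D f)) f) \<and>
      ((\<forall>z\<in>closure (Omega l). - \<psi>m z = \<psi>p z) \<longrightarrow>
        (\<forall>f. is_maximizer (Lp_ball l p) (\<lambda>f. Ainf l (u2 l \<sigma> \<psi>m \<psi>p \<alpha> \<beta> D f)) f \<longrightarrow>
             is_maximizer (Lp_ball l p) (\<lambda>f. Ainf l (u2 l \<sigma> \<psi>m \<psi>p \<alpha> \<beta> D f)) (\<lambda>z. - f z))))"
proof -
  note l = assms(1) and s = assms(2,3) and \<psi> = assms(7-9) and D = assms(12,13) and p = assms(14)
  have c: "0 < \<alpha>" "0 \<le> \<beta> - \<alpha>" using assms(4-6) by auto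
  have dual0: "(\<lambda>_. 0) \<in> dual_ball l"
  proof -
    have "0 \<le> (SUP z\<in>closure (Omega l). \<bar>u z\<bar>)" if u: "continuous_on (closure (Omega l)) u" for u :: "R2 \<Rightarrow> real"
    proof -
      obtain k where k: "\<And>z. z \<in> closure (Omega l) \<Longrightarrow> \<bar>u z\<bar> \<le> k" using compact_abs_bound[OF compact_closure_Omega u] by blast
      have "(0, 0) \<in> closure (Omega l)" using l by (simp add: closure_Omega)
      then have "\<bar>u (0, 0)\<bar> \<le> (SUP z\<in>closure (Omega l). \<bar>u z\<bar>)" by (rule cSUP_upper) (use k in \<open>auto intro!: bdd_aboveI2\<close>)
      then show ?thesis using abs_ge_zero order_trans by blast
    qed
    then show ?thesis by (simp add: dual_ball_def)
  qed
  have dual_neg: "(\<lambda>v. - f v) \<in> dual_ball l" if "f \<in> dual_ball l" for f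
    using that unfolding dual_ball_def by (auto simp: algebra_simps)
  have A: "(\<exists>f. is_maximizer (dual_ball l) (\<lambda>f. Ainf l (u1 l \<sigma> \<psi>m \<psi>p \<alpha> \<beta> D f)) f) \<and>
      ((\<forall>z\<in>closure (Omega l). - \<psi>m z = \<psi>p z) \<longrightarrow>
        (\<forall>f. is_maximizer (dual_ball l) (\<lambda>f. Ainf l (u1 l \<sigma> \<psi>m \<psi>p \<alpha> \<beta> D f)) f \<longrightarrow>
             is_maximizer (dual_ball l) (\<lambda>f. Ainf l (u1 l \<sigma> \<psi>m \<psi>p \<alpha> \<beta> D f)) (\<lambda>v. - f v)))"
    by (rule plate_maximizers[where P = "\<lambda>f. f" and U = "\<lambda>f. u1 l \<sigma> \<psi>m \<psi>p \<alpha> \<beta> D f" and F = "dual_ball l" and nf = "\<lambda>f v. - f v" and M = 1,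
        OF l s c \<psi> D u1_def _ dual_ball_admissible[OF _ l] dual_ball_compact dual_neg]) (use dual0 in auto)
  have one: "(\<lambda>_ :: R2. 1 :: real) \<in> borel_measurable borel" "\<And>z :: R2. \<bar>1 :: real\<bar> \<le> 1" by auto
  have P1: "(\<lambda>v. LINT z:Omega l|lebesgue. f z * v z) = Pw l (\<lambda>_. 1) f" for f by (auto simp: Pw_def)
  have ne: "Lp_ball l p \<noteq> {}" using Lp_ball_zero[OF p] by blast
  have B1: "(\<exists>f. is_maximizer (Lp_ball l p) (\<lambda>f. Ainf l (u1 l \<sigma> \<psi>m \<psi>p \<alpha> \<beta> D (Pw l (\<lambda>_. 1) f))) f) \<and>
      ((\<forall>z\<in>closure (Omega l). - \<psi>m z = \<psi>p z) \<longrightarrow>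
        (\<forall>f. is_maximizer (Lp_ball l p) (\<lambda>f. Ainf l (u1 l \<sigma> \<psi>m \<psi>p \<alpha> \<beta> D (Pw l (\<lambda>_. 1) f))) f \<longrightarrow>
             is_maximizer (Lp_ball l p) (\<lambda>f. Ainf l (u1 l \<sigma> \<psi>m \<psi>p \<alpha> \<beta> D (Pw l (\<lambda>_. 1) f))) (\<lambda>z. - f z)))"
    by (rule plate_maximizers[where P = "Pw l (\<lambda>_. 1)" and U = "\<lambda>f. u1 l \<sigma> \<psi>m \<psi>p \<alpha> \<beta> D (Pw l (\<lambda>_. 1) f)" and F = "Lp_ball l p" and nf = "\<lambda>f z. - f z",
        OF l s c \<psi> D u1_def ne Pw_admissible[OF l one _ p] Pw_compact[OF l one _ p] Lp_ball_neg Pw_neg])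
  let ?m = "\<lambda>z. if z \<in> D then \<beta> else \<alpha>"
  have [measurable]: "D \<in> sets borel" using D(1) by (rule borel_open)
  have m: "?m \<in> borel_measurable borel" by measurable
  have mb: "\<bar>?m z\<bar> \<le> \<beta>" for z using assms(4-6) by auto
  \<comment> \<open>The second energy has no contrast in the form, so it is the case of coefficients
    1 and 0, with the set \<open>D\<close> entering through the weight of the load.\<close>
  have u2: "u2 l \<sigma> \<psi>m \<psi>p \<alpha> \<beta> D f = (THE u. u \<in> Kset l \<psi>m \<psi>p \<and> (\<forall>\<phi>\<in>Kset l \<psi>m \<psi>p.
        1 * bform l \<sigma> (Omega l) u (\<lambda>z. \<phi> z - u z) + 0 * bform l \<sigma> D u (\<lambda>z. \<phi> z - u z) \<ge> Pw l ?m f (\<lambda>z. \<phi> z - u z)))" for f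
    by (simp add: u2_def Pw_def)
  have one': "(0 :: real) < 1" "(0 :: real) \<le> 0" by auto
  have B2: "(\<exists>f. is_maximizer (Lp_ball l p) (\<lambda>f. Ainf l (u2 l \<sigma> \<psi>m \<psi>p \<alpha> \<beta> D f)) f) \<and>
      ((\<forall>z\<in>closure (Omega l). - \<psi>m z = \<psi>p z) \<longrightarrow>
        (\<forall>f. is_maximizer (Lp_ball l p) (\<lambda>f. Ainf l (u2 l \<sigma> \<psi>m \<psi>p \<alpha> \<beta> D f)) f \<longrightarrow>
             is_maximizer (Lp_ball l p) (\<lambda>f. Ainf l (u2 l \<sigma> \<psi>m \<psi>p \<alpha> \<beta> D f)) (\<lambda>z. - f z)))"
    by (rule plate_maximizers[where P = "Pw l ?m" and U = "\<lambda>f. u2 l \<sigma> \<psi>m \<psi>p \<alpha> \<beta> D f" and F = "Lp_ball l p" and nf = "\<lambda>f z. - f z",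
        OF l s one' \<psi> D u2 ne Pw_admissible[OF l m mb _ p] Pw_compact[OF l m mb _ p] Lp_ball_neg Pw_neg])
  show ?thesis unfolding P1 by (intro conjI[OF A] conjI[OF B1] B2)
qed

end
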